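(* Suppose that $\mathfrak g$ is of type $\mathfrak{sl}_{n+1}$. An object $M$ of $\mathcal I_{\mathrm{bdd}}$ has a $\nabla$-filtration if and only if the canonical filtration of $M$ is a $\nabla$-filtration.
   Context: $\mathfrak g$ is a finite-dimensional complex simple Lie algebra of rank $n$ with Cartan subalgebra $\mathfrak h$, Weyl group $W$ with longest element $w_0$, root lattice $Q$, nonnegative integer span $Q^+$ of the simple roots, dominant integral weights $P^+$, Chevalley generators $x_i^\pm,h_i$ ($i\in I=\{1,\dots,n\}$), and $\mathfrak n^\pm$ the subalgebra generated by the $x_i^\pm$. $\mathfrak g[t]=\mathfrak g\otimes\mathbf C[t]$ is the current algebra, graded by powers of $t$. $\operatorname{wt}M$ is the set of $\mathfrak h$-weights of $M$; $\operatorname{conv}W\lambda$ is the convex hull of $W\lambda$. $\mathcal I$ is the category of $\mathbf Z$-graded $\mathfrak g[t]$-modules $V=\bigoplus_s V[s]$ with finite-dimensional graded components, $(\mathfrak g\otimes t^r)V[s]\subset V[s+r]$, with degree-zero $\mathfrak g[t]$-maps as morphisms. $\mathcal I_{\mathrm{bdd}}$ is the full subcategory of objects $M$ such that $\operatorname{wt}M\subset\bigcup_{\ell=1}^s\operatorname{conv}W\mu_\ell$ for some finitely many $\mu_1,\dots,\mu_s\in P^+$, and there is $r\in\mathbf Z$ with $M[\ell]=0$ for $\ell\ge r$. The restricted dual of $V\in\mathcal I$ is $V^*=\bigoplus_r V^*[r]$, $V^*[r]=V[-r]^*$, with action $((xt^s)v^* )(w)=-v^*((xt^s)w)$. The global Weyl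 module $W(\lambda,r)$, $(\lambda,r)\in P^+\times\mathbf Z$, is the graded $\mathfrak g[t]$-module generated by $w_{\lambda,r}$ of degree $r$ with defining relations $\mathfrak n^+[t]w_{\lambda,r}=0$, $(x_i^-)^{\lambda(h_i)+1}w_{\lambda,r}=0$, $hw_{\lambda,r}=\lambda(h)w_{\lambda,r}$ ($i\in I$, $h\in\mathfrak h$). Set $\nabla(\lambda,r)=W(-w_0\lambda,-r)^*$. $M\in\mathcal I$ has a $\nabla$-filtration if there is an increasing family of submodules $0\subset M_1\subset M_2\subset\cdots$ with $M=\bigcup_kM_k$ and successive quotients (including the first term) of the form $\bigoplus_{(\lambda,r)\in P^+\times\mathbf Z}\nabla(\lambda,r)^{m_k(\lambda,r)}$ for some nonnegative integers $m_k(\lambda,r)$. Fix an enumeration $\lambda_0,\lambda_1,\lambda_2,\dots$ of $P^+$ such that $\lambda_r-\lambda_s\in Q^+$ implies $r\ge s$. For $M\in\mathcal I_{\mathrm{bdd}}$ let $k(M)$ be minimal such that $\operatorname{wt}M\subset\bigcup_{s=0}^{k(M)}\big(\operatorname{conv}W\lambda_s\cap(\lambda_s+Q)\big)$, and for $0\le s\le k(M)$ let $M_s$ be the maximal submodule of $M$ whose weights lie in $\bigcup_{r\le s}\big(\operatorname{conv}W\lambda_r\cap(\lambda_r+Q)\big)$. The canonical filtration of $M$ is $M_0\subset M_1\subset\cdots\subset M_{k(M)}=M$ (with $M_{-1}=0$); it is a $\nabla$-filtration if each $M_s/M_{s-1}$, $0\le s\le k(M)$, is isomorphic to a direct sum of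 modules $\nabla(\lambda,r)$. *)

theory Defs
  imports "Jordan_Normal_Form.VS_Connect" "HOL-Algebra.AbelCoset" "HOL-Library.Poly_Mapping" "HOL.Complex"
begin

section \<open>The Lie algebra of type A\<close>

definition sl :: "nat \<Rightarrow> complex mat set" where
  "sl n = {x \<in> carrier_mat (n + 1) (n + 1). (\<Sum>j<n + 1. x $$ (j, j)) = 0}"

definition bracket :: "complex mat \<Rightarrow> complex mat \<Rightarrow> complex mat" where
  "bracket x y = x * y - y * x"

definition elem_mat :: "nat \<Rightarrow> nat \<Rightarrow> nat \<Rightarrow> complex mat" where
  "elem_mat n a b = mat (n + 1) (n + 1) (\<lambda>(j, k). if j = a \<and> k = b then 1 else 0)"

text \<open>Chevalley generators. Matrix entries are indexed from 0, the index set of the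
  simple roots is \<open>{1..n}\<close>.\<close>

definition x_pos :: "nat \<Rightarrow> nat \<Rightarrow> complex mat" where
  "x_pos n i = elem_mat n (i - 1) i"

definition x_neg :: "nat \<Rightarrow> nat \<Rightarrow> complex mat" where
  "x_neg n i = elem_mat n i (i - 1)"

definition coroot :: "nat \<Rightarrow> nat \<Rightarrow> complex mat" where
  "coroot n i = elem_mat n (i - 1) (i - 1) - elem_mat n i i"

definition cartan :: "nat \<Rightarrow> complex mat set" where
  "cartan n = {x \<in> sl n. diagonal_mat x}"

definition lie_subalgebra :: "nat \<Rightarrow> complex mat set \<Rightarrow> bool" where
  "lie_subalgebra n A \<longleftrightarrow> A \<subseteq> sl n \<and> 0\<^sub>m (n + 1) (n + 1) \<in> A \<and>
     (\<forall>x\<in>A. \<forall>y\<in>A. x + y \<in> A \<and> bracket x y \<in> A) \<and> (\<forall>c. \<forall>x\<in>A. c \<cdot>\<^sub>m x \<in> A)"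

definition n_pos :: "nat \<Rightarrow> complex mat set" where
  "n_pos n = \<Inter> {A. lie_subalgebra n A \<and> x_pos n ` {1..n} \<subseteq> A}"


section \<open>Weights and the Weyl group\<close>

text \<open>Elements of the dual of the Cartan subalgebra are linear functionals on it, extended
  by 0 to all matrices, so that vector space operations are pointwise.\<close>

type_synonym weight = "complex mat \<Rightarrow> complex"

definition cartan_dual :: "nat \<Rightarrow> weight set" where
  "cartan_dual n = {\<mu>.
     (\<forall>g\<in>cartan n. \<forall>h\<in>cartan n. \<mu> (g + h) = \<mu> g + \<mu> h) \<and>
     (\<forall>c. \<forall>h\<in>cartan n. \<mu> (c \<cdot>\<^sub>m h) = c * \<mu> h) \<and>
     (\<forall>h. h \<notin> cartan n \<longrightarrow> \<mu> h = 0)}"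

definition simple_root :: "nat \<Rightarrow> nat \<Rightarrow> weight" where
  "simple_root n i = (\<lambda>h. if h \<in> cartan n then h $$ (i - 1, i - 1) - h $$ (i, i) else 0)"

definition root_lattice :: "nat \<Rightarrow> weight set" where
  "root_lattice n = {\<lambda>h. \<Sum>i=1..n. of_int (c i) * simple_root n i h | c :: nat \<Rightarrow> int. True}"

definition root_lattice_pos :: "nat \<Rightarrow> weight set" where
  "root_lattice_pos n = {\<lambda>h. \<Sum>i=1..n. of_nat (c i) * simple_root n i h | c :: nat \<Rightarrow> nat. True}"

definition dominant_weights :: "nat \<Rightarrow> weight set" where
  "dominant_weights n = {\<mu> \<in> cartan_dual n. \<forall>i\<in>{1..n}. \<mu> (coroot n i) \<in> \<nat>}"

definition simple_refl :: "nat \<Rightarrow> nat \<Rightarrow> weight \<Rightarrow> weight" where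
  "simple_refl n i \<mu> = (\<lambda>h. \<mu> h - \<mu> (coroot n i) * simple_root n i h)"

definition refl_word :: "nat \<Rightarrow> nat list \<Rightarrow> weight \<Rightarrow> weight" where
  "refl_word n is = foldr (simple_refl n) is"

definition weyl_group :: "nat \<Rightarrow> (weight \<Rightarrow> weight) set" where
  "weyl_group n = refl_word n ` lists {1..n}"

definition weyl_length :: "nat \<Rightarrow> (weight \<Rightarrow> weight) \<Rightarrow> nat" where
  "weyl_length n w = (LEAST k. \<exists>is\<in>lists {1..n}. length is = k \<and> refl_word n is = w)"

definition longest_element :: "nat \<Rightarrow> weight \<Rightarrow> weight" where
  "longest_element n =
     (THE w. w \<in> weyl_group n \<and> (\<forall>v\<in>weyl_group n. weyl_length n v \<le> weyl_length n w))"

definition weyl_orbit :: "nat \<Rightarrow> weight \<Rightarrow> weight set" where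
  "weyl_orbit n \<mu> = (\<lambda>w. w \<mu>) ` weyl_group n"

text \<open>The function type \<^typ>\<open>weight\<close> is not an instance of \<^class>\<open>real_vector\<close>, so
  convex hulls are written out as sets of finite convex combinations.\<close>

definition conv_hull :: "weight set \<Rightarrow> weight set" where
  "conv_hull A = {\<lambda>h. \<Sum>\<mu>\<in>S. complex_of_real (c \<mu>) * \<mu> h | S (c :: weight \<Rightarrow> real).
     finite S \<and> S \<subseteq> A \<and> (\<forall>\<mu>\<in>S. 0 \<le> c \<mu>) \<and> sum c S = 1}"

definition saturated_cell :: "nat \<Rightarrow> weight \<Rightarrow> weight set" where
  "saturated_cell n \<mu> =
     {\<nu> \<in> conv_hull (weyl_orbit n \<mu>). (\<lambda>h. \<nu> h - \<mu> h) \<in> root_lattice n}"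


section \<open>Graded modules for the current algebra\<close>

text \<open>\<open>act V x s v\<close> is \<open>(x \<otimes> t\<^sup>s) v\<close>. As the powers of \<open>t\<close> form a basis of the polynomial ring,
  a representation of the current algebra is a family, indexed by \<open>s\<close>, of linear maps
  \<open>x \<mapsto> act V x s\<close> compatible with \<open>[x \<otimes> t\<^sup>r, y \<otimes> t\<^sup>s] = [x, y] \<otimes> t\<^bsup>r+s\<^esup>\<close>. The fields
  \<^const>\<open>mult\<close> and \<^const>\<open>one\<close> inherited from the record type of modules play no role.\<close>

record 'v gmod = "(complex, 'v) module" +
  act :: "complex mat \<Rightarrow> nat \<Rightarrow> 'v \<Rightarrow> 'v"
  grd :: "int \<Rightarrow> 'v set"

locale current_module = vectorspace "class_ring :: complex ring" V
  for n :: nat and V :: "'v gmod" (structure) +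
  assumes act_closed: "\<lbrakk>x \<in> sl n; v \<in> carrier V\<rbrakk> \<Longrightarrow> act V x s v \<in> carrier V"
    and act_add_right: "\<lbrakk>x \<in> sl n; v \<in> carrier V; w \<in> carrier V\<rbrakk> \<Longrightarrow>
          act V x s (v \<oplus>\<^bsub>V\<^esub> w) = act V x s v \<oplus>\<^bsub>V\<^esub> act V x s w"
    and act_smult_right: "\<lbrakk>x \<in> sl n; v \<in> carrier V\<rbrakk> \<Longrightarrow>
          act V x s (c \<odot>\<^bsub>V\<^esub> v) = c \<odot>\<^bsub>V\<^esub> act V x s v"
    and act_add_left: "\<lbrakk>x \<in> sl n; y \<in> sl n; v \<in> carrier V\<rbrakk> \<Longrightarrow>
          act V (x + y) s v = act V x s v \<oplus>\<^bsub>V\<^esub> act V y s v"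
    and act_smult_left: "\<lbrakk>x \<in> sl n; v \<in> carrier V\<rbrakk> \<Longrightarrow>
          act V (c \<cdot>\<^sub>m x) s v = c \<odot>\<^bsub>V\<^esub> act V x s v"
    and act_bracket: "\<lbrakk>x \<in> sl n; y \<in> sl n; v \<in> carrier V\<rbrakk> \<Longrightarrow>
          act V (bracket x y) (r + s) v =
            act V x r (act V y s v) \<ominus>\<^bsub>V\<^esub> act V y s (act V x r v)"

locale graded_current_module = current_module +
  assumes grd_subspace: "subspace (class_ring :: complex ring) (grd V d) V"
    and grd_decomposition: "v \<in> carrier V \<Longrightarrow>
          \<exists>!f. (\<forall>d. f d \<in> grd V d) \<and> finite {d. f d \<noteq> \<zero>\<^bsub>V\<^esub>} \<and>
               v = (\<Oplus>\<^bsub>V\<^esub>d\<in>{d. f d \<noteq> \<zero>\<^bsub>V\<^esub>}. f d)"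
    and act_grd: "\<lbrakk>x \<in> sl n; v \<in> grd V d\<rbrakk> \<Longrightarrow> act V x s v \<in> grd V (d + int s)"

locale category_I = graded_current_module +
  assumes grd_fin_dim: "vectorspace.fin_dim (class_ring :: complex ring) (V\<lparr>carrier := grd V d\<rparr>)"

definition weights :: "nat \<Rightarrow> 'v gmod \<Rightarrow> weight set" where
  "weights n V = {\<mu> \<in> cartan_dual n. \<exists>v\<in>carrier V. v \<noteq> \<zero>\<^bsub>V\<^esub> \<and>
     (\<forall>h\<in>cartan n. act V h 0 v = \<mu> h \<odot>\<^bsub>V\<^esub> v)}"

definition category_I_bdd :: "nat \<Rightarrow> 'v gmod \<Rightarrow> bool" where
  "category_I_bdd n V \<longleftrightarrow> category_I n V \<and>
     (\<exists>F. finite F \<and> F \<subseteq> dominant_weights n \<and>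
        weights n V \<subseteq> (\<Union>\<mu>\<in>F. conv_hull (weyl_orbit n \<mu>))) \<and>
     (\<exists>r. \<forall>d\<ge>r. grd V d = {\<zero>\<^bsub>V\<^esub>})"

definition restrict_gmod :: "'v gmod \<Rightarrow> 'v set \<Rightarrow> 'v gmod" where
  "restrict_gmod V N = V\<lparr>carrier := N, grd := \<lambda>d. grd V d \<inter> N\<rparr>"

text \<open>Subobjects in the category, i.e. graded submodules: the decomposition axiom for the
  restricted structure says that \<open>N\<close> is the direct sum of its intersections with the
  graded components.\<close>

definition graded_submodule :: "nat \<Rightarrow> 'v set \<Rightarrow> 'v gmod \<Rightarrow> bool" where
  "graded_submodule n N V \<longleftrightarrow> N \<subseteq> carrier V \<and> category_I n (restrict_gmod V N)"

definition quotient_gmod :: "'v gmod \<Rightarrow> 'v set \<Rightarrow> 'v set gmod" where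
  "quotient_gmod V N = \<lparr>
     carrier = a_rcosets\<^bsub>V\<^esub> N, mult = undefined, one = undefined,
     zero = N, add = (<+>\<^bsub>V\<^esub>),
     smult = (\<lambda>c C. \<Union>v\<in>C. N +>\<^bsub>V\<^esub> (c \<odot>\<^bsub>V\<^esub> v)),
     act = (\<lambda>x s C. \<Union>v\<in>C. N +>\<^bsub>V\<^esub> act V x s v),
     grd = (\<lambda>d. (\<lambda>v. N +>\<^bsub>V\<^esub> v) ` grd V d)\<rparr>"

definition direct_sum_gmod :: "'j set \<Rightarrow> ('j \<Rightarrow> 'v gmod) \<Rightarrow> ('j \<Rightarrow> 'v) gmod" where
  "direct_sum_gmod J X = (let
       S = {f \<in> (\<Pi>\<^sub>E j\<in>J. carrier (X j)). finite {j \<in> J. f j \<noteq> \<zero>\<^bsub>X j\<^esub>}}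
     in \<lparr>
     carrier = S, mult = undefined, one = undefined,
     zero = (\<lambda>j\<in>J. \<zero>\<^bsub>X j\<^esub>), add = (\<lambda>f g. \<lambda>j\<in>J. f j \<oplus>\<^bsub>X j\<^esub> g j),
     smult = (\<lambda>c f. \<lambda>j\<in>J. c \<odot>\<^bsub>X j\<^esub> f j),
     act = (\<lambda>x s f. \<lambda>j\<in>J. act (X j) x s (f j)),
     grd = (\<lambda>d. {f \<in> S. \<forall>j\<in>J. f j \<in> grd (X j) d})\<rparr>)"

text \<open>The direct sum over \<open>r\<close> of the duals of the components \<open>V[-r]\<close> is realised as the space
  of linear functionals on \<open>V\<close> that vanish on all but finitely many graded components.\<close>

definition dual_gmod :: "'v gmod \<Rightarrow> ('v \<Rightarrow> complex) gmod" where
  "dual_gmod V = (let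
       S = {f \<in> extensional (carrier V).
              (\<forall>v\<in>carrier V. \<forall>w\<in>carrier V. f (v \<oplus>\<^bsub>V\<^esub> w) = f v + f w) \<and>
              (\<forall>c. \<forall>v\<in>carrier V. f (c \<odot>\<^bsub>V\<^esub> v) = c * f v) \<and>
              finite {d. \<exists>v\<in>grd V d. f v \<noteq> 0}}
     in \<lparr>
     carrier = S, mult = undefined, one = undefined,
     zero = (\<lambda>v\<in>carrier V. 0), add = (\<lambda>f g. \<lambda>v\<in>carrier V. f v + g v),
     smult = (\<lambda>c f. \<lambda>v\<in>carrier V. c * f v),
     act = (\<lambda>x s f. \<lambda>v\<in>carrier V. - f (act V x s v)),
     grd = (\<lambda>r. {f \<in> S. \<forall>d. d \<noteq> - r \<longrightarrow> (\<forall>v\<in>grd V d. f v = 0)})\<rparr>)"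

definition degree0_hom :: "nat \<Rightarrow> 'v gmod \<Rightarrow> 'w gmod \<Rightarrow> ('v \<Rightarrow> 'w) \<Rightarrow> bool" where
  "degree0_hom n V W \<phi> \<longleftrightarrow> linear_map (class_ring :: complex ring) V W \<phi> \<and>
     (\<forall>x\<in>sl n. \<forall>s. \<forall>v\<in>carrier V. \<phi> (act V x s v) = act W x s (\<phi> v)) \<and>
     (\<forall>d. \<phi> ` grd V d \<subseteq> grd W d)"

definition gmod_iso :: "nat \<Rightarrow> 'v gmod \<Rightarrow> 'w gmod \<Rightarrow> bool" where
  "gmod_iso n V W \<longleftrightarrow> (\<exists>\<phi>. degree0_hom n V W \<phi> \<and> bij_betw \<phi> (carrier V) (carrier W))"


section \<open>Global Weyl modules and their duals\<close>

text \<open>Generators and relations: the word \<open>[(x\<^sub>1, s\<^sub>1), \<dots>, (x\<^sub>k, s\<^sub>k)]\<close> stands for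
  \<open>(x\<^sub>1 \<otimes> t\<^bsup>s\<^sub>1\<^esup>) \<cdots> (x\<^sub>k \<otimes> t\<^bsup>s\<^sub>k\<^esup>) w\<close>, where \<open>w\<close> is the generator, of degree \<open>r\<close>.
  \<open>free_word_module\<close> is the vector space with the words as basis; it is not yet a module
  for the current algebra, since \<open>act\<close> only prepends letters.\<close>

type_synonym current_word = "(complex mat \<times> nat) list"

definition free_word_module :: "nat \<Rightarrow> int \<Rightarrow> (current_word \<Rightarrow>\<^sub>0 complex) gmod" where
  "free_word_module n r = \<lparr>
     carrier = {f. Poly_Mapping.keys f \<subseteq> lists (sl n \<times> UNIV)}, mult = undefined, one = undefined,
     zero = 0, add = (+), smult = (\<lambda>c. Poly_Mapping.map ((*) c)),
     act = (\<lambda>x s f. \<Sum>u\<in>Poly_Mapping.keys f.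
              Poly_Mapping.single ((x, s) # u) (Poly_Mapping.lookup f u)),
     grd = (\<lambda>d. {f. \<forall>u\<in>Poly_Mapping.keys f.
              u \<in> lists (sl n \<times> UNIV) \<and> d = r + int (sum_list (map snd u))})\<rparr>"

text \<open>The first three families, in which \<open>u\<close> is an arbitrary word, are the relations of the
  universal enveloping algebra of the current algebra; the last three are the defining
  relations of the global Weyl module.\<close>

definition weyl_relations :: "nat \<Rightarrow> weight \<Rightarrow> (current_word \<Rightarrow>\<^sub>0 complex) set" where
  "weyl_relations n \<mu> = (let e = (\<lambda>u. Poly_Mapping.single u (1 :: complex)) in
     {e ((x + y, s) # u) - e ((x, s) # u) - e ((y, s) # u) | x y s u.
        x \<in> sl n \<and> y \<in> sl n \<and> u \<in> lists (sl n \<times> UNIV)} \<union>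
     {e ((c \<cdot>\<^sub>m x, s) # u) - Poly_Mapping.single ((x, s) # u) c | c x s u.
        x \<in> sl n \<and> u \<in> lists (sl n \<times> UNIV)} \<union>
     {e ((bracket x y, r + s) # u) - e ((x, r) # (y, s) # u) + e ((y, s) # (x, r) # u) | x y r s u.
        x \<in> sl n \<and> y \<in> sl n \<and> u \<in> lists (sl n \<times> UNIV)} \<union>
     {e [(x, s)] | x s. x \<in> n_pos n} \<union>
     {e (replicate (k + 1) (x_neg n i, 0)) | i k. i \<in> {1..n} \<and> \<mu> (coroot n i) = of_nat k} \<union>
     {e [(h, 0)] - Poly_Mapping.single [] (\<mu> h) | h. h \<in> cartan n})"

definition relation_submodule :: "nat \<Rightarrow> weight \<Rightarrow> int \<Rightarrow> (current_word \<Rightarrow>\<^sub>0 complex) set" where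
  "relation_submodule n \<mu> r = \<Inter> {K.
     subspace (class_ring :: complex ring) K (free_word_module n r) \<and>
     (\<forall>x\<in>sl n. \<forall>s. \<forall>f\<in>K. act (free_word_module n r) x s f \<in> K) \<and>
     weyl_relations n \<mu> \<subseteq> K}"

definition global_weyl :: "nat \<Rightarrow> weight \<Rightarrow> int \<Rightarrow> (current_word \<Rightarrow>\<^sub>0 complex) set gmod" where
  "global_weyl n \<mu> r = quotient_gmod (free_word_module n r) (relation_submodule n \<mu> r)"

type_synonym nabla_carrier = "(current_word \<Rightarrow>\<^sub>0 complex) set \<Rightarrow> complex"

definition nabla :: "nat \<Rightarrow> weight \<Rightarrow> int \<Rightarrow> nabla_carrier gmod" where
  "nabla n \<mu> r = dual_gmod (global_weyl n (\<lambda>h. - longest_element n \<mu> h) (- r))"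


section \<open>Filtrations\<close>

text \<open>The last component of an index only counts copies of \<open>nabla n \<mu> r\<close>.\<close>

definition nabla_sum ::
  "nat \<Rightarrow> (weight \<times> int \<times> nat) set \<Rightarrow> (weight \<times> int \<times> nat \<Rightarrow> nabla_carrier) gmod" where
  "nabla_sum n J = direct_sum_gmod J (\<lambda>(\<mu>, r, j). nabla n \<mu> r)"

definition has_nabla_filtration :: "nat \<Rightarrow> 'v gmod \<Rightarrow> bool" where
  "has_nabla_filtration n M \<longleftrightarrow> (\<exists>F :: nat \<Rightarrow> 'v set.
     F 0 = {\<zero>\<^bsub>M\<^esub>} \<and> (\<forall>k. graded_submodule n (F k) M \<and> F k \<subseteq> F (Suc k)) \<and>
     (\<Union>k. F k) = carrier M \<and>
     (\<forall>k. \<exists>m :: weight \<Rightarrow> int \<Rightarrow> nat.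
        gmod_iso n (quotient_gmod (restrict_gmod M (F (Suc k))) (F k))
          (nabla_sum n {(\<mu>, r, j). \<mu> \<in> dominant_weights n \<and> j < m \<mu> r})))"

definition dominant_enumeration :: "nat \<Rightarrow> (nat \<Rightarrow> weight) \<Rightarrow> bool" where
  "dominant_enumeration n lam \<longleftrightarrow> bij_betw lam UNIV (dominant_weights n) \<and>
     (\<forall>r s. (\<lambda>h. lam r h - lam s h) \<in> root_lattice_pos n \<longrightarrow> s \<le> r)"

definition canonical_length :: "nat \<Rightarrow> (nat \<Rightarrow> weight) \<Rightarrow> 'v gmod \<Rightarrow> nat" where
  "canonical_length n lam M =
     (LEAST k. weights n M \<subseteq> (\<Union>s\<le>k. saturated_cell n (lam s)))"

definition canonical_submodule :: "nat \<Rightarrow> (nat \<Rightarrow> weight) \<Rightarrow> 'v gmod \<Rightarrow> nat \<Rightarrow> 'v set" where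
  "canonical_submodule n lam M s = (let
       P = (\<lambda>N. graded_submodule n N M \<and>
              weights n (restrict_gmod M N) \<subseteq> (\<Union>r\<le>s. saturated_cell n (lam r)))
     in THE N. P N \<and> (\<forall>N'. P N' \<longrightarrow> N' \<subseteq> N))"

text \<open>Graded components of objects are finite-dimensional, so countably many copies of each
  \<open>nabla n \<mu> r\<close> cover all direct sums that can occur.\<close>

definition canonical_is_nabla_filtration :: "nat \<Rightarrow> (nat \<Rightarrow> weight) \<Rightarrow> 'v gmod \<Rightarrow> bool" where
  "canonical_is_nabla_filtration n lam M \<longleftrightarrow>
     (\<forall>s\<le>canonical_length n lam M. \<exists>J. J \<subseteq> dominant_weights n \<times> UNIV \<times> UNIV \<and>
        gmod_iso n
          (quotient_gmod (restrict_gmod M (canonical_submodule n lam M s))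
             (if s = 0 then {\<zero>\<^bsub>M\<^esub>} else canonical_submodule n lam M (s - 1)))
          (nabla_sum n J))"

end

theory Submission
  imports Defs "HOL-Computational_Algebra.Fundamental_Theorem_Algebra" "HOL-Combinatorics.Permutations"
    "HOL-Library.Nat_Bijection"
begin

text \<open>A module is transported to a space of complex functions, and an element of \<open>nabla n \<mu> r\<close>, a
  functional on a global Weyl module, is identified with the function of its values on words.
  These modules are coinduced. Hence, if the weights of \<open>X\<close> lie in the cells up to that of \<open>\<mu>\<close>, a
  homomorphism from a submodule of \<open>X\<close> to \<open>nabla n \<mu> r\<close> extends to \<open>X\<close>: extend the functional
  ``value at the generator'' by zero on the other weight spaces; the relations of the Weyl module hold
  because the weights they involve do not occur in \<open>X\<close>. Given a filtration of \<open>X\<close>, the components of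
  weight \<open>\<mu>\<close> of all its layers therefore extend to a surjection of \<open>X\<close> onto a direct sum of modules
  \<open>nabla n \<mu> r\<close>. Its kernel is the largest submodule with weights in the smaller cells and again has a
  filtration, by the layers with the remaining weights, so induction on the index applies.

  Conversely a canonical filtration is a filtration. Multiplicities are finite because
  the graded components are finite-dimensional.\<close>

text \<open>Since \<open>nabla n \<mu> r\<close> is dual to the Weyl module of highest weight
  \<open>- w0 \<mu>\<close>, the value at the generator sees only the weight
  \<open>w0 \<mu>\<close>. Extending it by zero is harmless once \<open>w0 \<mu>\<close> minus a
  positive root, and \<open>w0 \<mu>\<close> plus a simple root just beyond its string, are not
  weights of \<open>X\<close>. This is why representations of sl2, on one graded component at a
  time, come first. Type A enters through coordinates: integral weights are integer vectors up to a
  constant, the Weyl group permutes the entries and \<open>w0\<close> reverses their order. The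
  filtration may be infinite and its layers come in no particular order of weights, so the
  components of one weight are collected from all layers at once. The combined map stays inside the
  direct sum because a graded component, being finite-dimensional, lies in a single step of the
  filtration and meets only finitely many summands of each layer below.\<close>

section \<open>Linear algebra in spaces of complex functions\<close>

text \<open>Every complex vector space embeds into a space of functions. Working there makes the
  type-based library of vector spaces available; \<open>'x \<Rightarrow> complex\<close> itself is not
  an instance of the classes it needs.\<close>
typedef 'x cvec = "UNIV :: ('x \<Rightarrow> complex) set" morphisms ev Cvec ..

setup_lifting type_definition_cvec

instantiation cvec :: (type) ab_group_add
begin
lift_definition zero_cvec :: "'a cvec" is "\<lambda>x. 0" .
lift_definition plus_cvec :: "'a cvec \<Rightarrow> 'a cvec \<Rightarrow> 'a cvec" is "\<lambda>v w x. v x + w x" .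
lift_definition minus_cvec :: "'a cvec \<Rightarrow> 'a cvec \<Rightarrow> 'a cvec" is "\<lambda>v w x. v x - w x" .
lift_definition uminus_cvec :: "'a cvec \<Rightarrow> 'a cvec" is "\<lambda>v x. - v x" .
instance by standard (transfer, simp add: algebra_simps)+
end

lift_definition sc :: "complex \<Rightarrow> 'x cvec \<Rightarrow> 'x cvec" is "\<lambda>c v x. c * v x" .

lemma ev_simps [simp]: "ev 0 x = 0" "ev (v + w) x = ev v x + ev w x" "ev (v - w) x = ev v x - ev w x"
  "ev (- v) x = - ev v x" "ev (sc c v) x = c * ev v x"
  by (transfer, simp)+

lemma cvec_eq_iff: "v = w \<longleftrightarrow> (\<forall>x. ev v x = ev w x)"
  by transfer auto

interpretation vs: vector_space "sc :: complex \<Rightarrow> 'x cvec \<Rightarrow> 'x cvec"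
  by unfold_locales (auto simp: cvec_eq_iff algebra_simps)

text \<open>Linearity is demanded on \<open>V\<close> only: the operators that arise from a module
  are defined through \<open>inv_into\<close> and take arbitrary values outside the embedded
  carrier.\<close>

definition endo :: "'x cvec set \<Rightarrow> ('x cvec \<Rightarrow> 'x cvec) \<Rightarrow> bool" where
  "endo V T \<longleftrightarrow> (\<forall>v\<in>V. T v \<in> V) \<and> (\<forall>v\<in>V. \<forall>w\<in>V. T (v + w) = T v + T w) \<and>
     (\<forall>c. \<forall>v\<in>V. T (sc c v) = sc c (T v))"

text \<open>\<open>pl T bs\<close> is the product of the operators \<open>T - b\<close> over \<open>b \<in> set bs\<close>, with multiplicity.\<close>
primrec pl :: "('x cvec \<Rightarrow> 'x cvec) \<Rightarrow> complex list \<Rightarrow> 'x cvec \<Rightarrow> 'x cvec" where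
  "pl T [] v = v"
| "pl T (b # bs) v = T (pl T bs v) - sc b (pl T bs v)"

locale sub_endo =
  fixes V :: "'x cvec set" and T
  assumes V: "vs.subspace V" and T: "endo V T"
begin

lemma V_simps [simp, intro]: "0 \<in> V" "v \<in> V \<Longrightarrow> w \<in> V \<Longrightarrow> v + w \<in> V" "v \<in> V \<Longrightarrow> w \<in> V \<Longrightarrow> v - w \<in> V"
  "v \<in> V \<Longrightarrow> sc c v \<in> V" "v \<in> V \<Longrightarrow> - v \<in> V"
  using V by (auto simp: vs.subspace_0 vs.subspace_add vs.subspace_diff vs.subspace_scale vs.subspace_neg)

lemma T_in [simp, intro]: "v \<in> V \<Longrightarrow> T v \<in> V"
  and T_add: "v \<in> V \<Longrightarrow> w \<in> V \<Longrightarrow> T (v + w) = T v + T w"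
  and T_sc: "v \<in> V \<Longrightarrow> T (sc c v) = sc c (T v)"
  using T by (auto simp: endo_def)

lemma T_0: "T 0 = 0"
  using T_sc[of 0 0] by (simp add: vs.scale_zero_left)

lemma T_diff: "v \<in> V \<Longrightarrow> w \<in> V \<Longrightarrow> T (v - w) = T v - T w"
  using T_add[of "v - w" w] by (simp add: algebra_simps)

lemma T_uminus: "v \<in> V \<Longrightarrow> T (- v) = - T v"
  using T_diff[of 0 v] by (simp add: T_0)

lemma T_sum: "(\<And>i. i \<in> I \<Longrightarrow> g i \<in> V) \<Longrightarrow> T (\<Sum>i\<in>I. g i) = (\<Sum>i\<in>I. T (g i))"
  by (induction I rule: infinite_finite_induct) (auto simp: T_0 T_add vs.subspace_sum[OF V])

lemmas T_lin = T_add T_sc T_0 T_diff T_uminus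

lemma pl_in [simp, intro]: "v \<in> V \<Longrightarrow> pl T bs v \<in> V"
  by (induction bs) auto

lemma pow_in [simp, intro]: "v \<in> V \<Longrightarrow> (T ^^ k) v \<in> V"
  by (induction k) auto

lemma pl_endo: "endo V (pl T bs)"
proof -
  have "pl T bs (v + w) = pl T bs v + pl T bs w" if "v \<in> V" "w \<in> V" for v w
    using that by (induction bs) (simp_all add: T_lin vs.scale_right_distrib algebra_simps)
  moreover have "pl T bs (sc c v) = sc c (pl T bs v)" if "v \<in> V" for v c
    using that by (induction bs)
      (simp_all add: T_lin vs.scale_right_diff_distrib vs.scale_left_commute)
  ultimately show ?thesis by (auto simp: endo_def)
qed

lemma pow_endo: "endo V (T ^^ k)"
proof -
  have "(T ^^ k) (v + w) = (T ^^ k) v + (T ^^ k) w" if "v \<in> V" "w \<in> V" for v w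
    using that by (induction k) (auto simp: T_lin)
  moreover have "(T ^^ k) (sc c v) = sc c ((T ^^ k) v)" if "v \<in> V" for v c
    using that by (induction k) (auto simp: T_lin)
  ultimately show ?thesis by (auto simp: endo_def)
qed

lemma pl_append: "pl T (as @ bs) v = pl T as (pl T bs v)"
  by (induction as) auto

lemma pl_T: "v \<in> V \<Longrightarrow> pl T bs (T v) = T (pl T bs v)"
  by (induction bs) (auto simp: T_lin)

lemma pl_Cons': "v \<in> V \<Longrightarrow> pl T (b # bs) v = pl T bs (T v - sc b v)"
proof -
  assume v: "v \<in> V"
  interpret P: sub_endo V "pl T bs" by unfold_locales (rule V pl_endo)+
  show ?thesis using v by (simp add: P.T_lin pl_T)
qed

lemma pl_comm: "v \<in> V \<Longrightarrow> pl T as (pl T bs v) = pl T bs (pl T as v)"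
proof (induction as)
  case (Cons a as)
  interpret P: sub_endo V "pl T bs" by unfold_locales (rule V pl_endo)+
  show ?case using Cons by (simp add: P.T_lin pl_T)
qed simp

lemma pl_eigen: "v \<in> V \<Longrightarrow> T v = sc a v \<Longrightarrow> pl T bs v = sc (\<Prod>b\<leftarrow>bs. a - b) v"
proof (induction bs)
  case (Cons b bs)
  then have "pl T (b # bs) v = sc (\<Prod>b\<leftarrow>bs. a - b) (sc a v) - sc b (sc (\<Prod>b\<leftarrow>bs. a - b) v)"
    by (simp add: T_sc del: vs.scale_scale)
  then show ?case by (simp add: cvec_eq_iff algebra_simps)
qed simp

text \<open>Bezout's argument, one factor at a time. Once the factors behind \<open>a\<close> have
  been applied, the remaining vector is an eigenvector for \<open>a\<close>; on it
  \<open>pl T bs\<close> multiplies by a nonzero number and yet gives zero.\<close>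

lemma pl_coprime:
  assumes "v \<in> V" "pl T as v = 0" "pl T bs v = 0" "set as \<inter> set bs = {}"
  shows "v = 0"
  using assms
proof (induction as)
  case (Cons a as)
  let ?w = "pl T as v"
  have w: "?w \<in> V" "T ?w = sc a ?w" using Cons.prems by auto
  interpret P: sub_endo V "pl T as" by unfold_locales (rule V pl_endo)+
  have "pl T bs ?w = 0" using Cons.prems by (simp add: pl_comm[of v bs as] P.T_0)
  then have "sc (\<Prod>b\<leftarrow>bs. a - b) ?w = 0" using pl_eigen[OF w] by simp
  moreover have "(\<Prod>b\<leftarrow>bs. a - b) \<noteq> 0" using Cons.prems by (auto simp: prod_list_zero_iff)
  ultimately have "?w = 0" by (simp add: vs.scale_eq_0_iff)
  then show ?case using Cons by auto
qed simp

text \<open>A root foreign to \<open>bs\<close> can be cancelled from \<open>as\<close>: a vector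
  killed by its factor and by \<open>pl T bs\<close> is zero by coprimality. The surviving roots
  keep their multiplicities in \<open>as\<close>.\<close>

lemma pl_filter:
  assumes "v \<in> V" "pl T as v = 0" "pl T bs v = 0"
  shows "pl T (filter (\<lambda>a. a \<in> set bs) as) v = 0"
proof -
  \<comment> \<open>A factor that is kept is commuted into the suffix \<open>as2\<close>, so that
    the factor examined next stands in front again.\<close>
  have "pl T (as1 @ as2) v = 0 \<Longrightarrow> pl T (filter (\<lambda>a. a \<in> set bs) as1 @ as2) v = 0" for as1 as2
  proof (induction as1 arbitrary: as2)
    case (Cons a as1)
    show ?case
    proof (cases "a \<in> set bs")
      case True
      interpret P: sub_endo V "pl T as1" by unfold_locales (rule V pl_endo)+
      have "pl T (as1 @ a # as2) v = pl T (a # as1 @ as2) v"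
        using assms(1) by (simp add: pl_append pl_T P.T_lin)
      then have "pl T (filter (\<lambda>a. a \<in> set bs) as1 @ a # as2) v = 0"
        using Cons by simp
      moreover have "pl T (filter (\<lambda>a. a \<in> set bs) as1 @ a # as2) v
          = pl T (a # filter (\<lambda>a. a \<in> set bs) as1 @ as2) v"
      proof -
        interpret P: sub_endo V "pl T (filter (\<lambda>a. a \<in> set bs) as1)" by unfold_locales (rule V pl_endo)+
        show ?thesis using assms(1) by (simp add: pl_append pl_T P.T_lin)
      qed
      ultimately show ?thesis using True by simp
    next
      case False
      interpret P: sub_endo V "pl T (as1 @ as2)" by unfold_locales (rule V pl_endo)+
      have "pl T [a] (pl T (as1 @ as2) v) = 0" using Cons.prems by simp
      moreover have "pl T bs (pl T (as1 @ as2) v) = 0"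
        using pl_comm[of v bs "as1 @ as2"] assms P.T_0 by metis
      ultimately have "pl T (as1 @ as2) v = 0"
        using pl_coprime[of "pl T (as1 @ as2) v" "[a]" bs] assms(1) False by auto
      then show ?thesis using Cons.IH False by simp
    qed
  qed simp
  from this[of as "[]"] show ?thesis using assms by simp
qed

text \<open>Lagrange interpolation, one root at a time.\<close>
lemma pl_distinct_span:
  assumes "v \<in> V" "pl T bs v = 0" "distinct bs"
  shows "v \<in> vs.span {u \<in> V. \<exists>b\<in>set bs. T u = sc b u}"
  using assms
proof (induction bs arbitrary: v)
  case (Cons b bs)
  let ?E = "\<lambda>bs. {u \<in> V. \<exists>b\<in>set bs. T u = sc b u}"
  have "T v - sc b v \<in> vs.span (?E bs)"
  proof (rule Cons.IH)
    show "pl T bs (T v - sc b v) = 0" using pl_Cons'[OF Cons.prems(1), of b bs] Cons.prems(2) by simp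
  qed (use Cons.prems in auto)
  \<comment> \<open>On eigenvectors for the other roots \<open>T - b\<close> is invertible, so
    \<open>T v - sc b v\<close> has a preimage \<open>w\<close> in their span; then
    \<open>v - w\<close> is an eigenvector for \<open>b\<close>.\<close>
  moreover have "\<exists>w\<in>vs.span (?E bs). w \<in> V \<and> T w - sc b w = x" if "x \<in> vs.span (?E bs)" for x
    using that
  proof (induction rule: vs.span_induct_alt)
    case base
    show ?case by (rule bexI[of _ 0]) (auto simp: T_0 vs.span_zero)
  next
    case (step c x y)
    then obtain w a where w: "w \<in> vs.span (?E bs)" "w \<in> V" "T w - sc b w = y"
      and a: "a \<in> set bs" "T x = sc a x" "x \<in> V" by auto
    have ab: "a \<noteq> b" using a Cons.prems by auto
    define t where "t = c / (a - b)"
    have t: "c = (a - b) * t" using ab by (simp add: t_def)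
    let ?w = "sc t x + w"
    have "x \<in> vs.span (?E bs)" using a by (intro vs.span_base) auto
    then have 1: "?w \<in> vs.span (?E bs)" using w by (intro vs.span_add vs.span_scale)
    have "T ?w - sc b ?w = sc c x + (T w - sc b w)"
      using a w by (simp add: T_lin cvec_eq_iff t algebra_simps)
    then show ?case using 1 a w by (intro bexI[of _ ?w]) auto
  qed
  ultimately obtain w where w: "w \<in> vs.span (?E bs)" "w \<in> V" "T w - sc b w = T v - sc b v"
    by blast
  have "T (v - w) = sc b (v - w)" using w Cons.prems
    by (simp add: T_lin cvec_eq_iff algebra_simps)
  then have "v - w \<in> vs.span (?E (b # bs))" using w Cons.prems by (intro vs.span_base) auto
  moreover have "w \<in> vs.span (?E (b # bs))" using w(1) vs.span_mono[of "?E bs" "?E (b # bs)"] by auto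
  ultimately have "v - w + w \<in> vs.span (?E (b # bs))" by (rule vs.span_add)
  then show ?case by simp
qed (auto simp: vs.span_zero)

subsection \<open>Annihilating polynomials\<close>

definition pT :: "complex poly \<Rightarrow> 'x cvec \<Rightarrow> 'x cvec" where
  "pT p v = (\<Sum>i\<le>degree p. sc (coeff p i) ((T ^^ i) v))"

lemma pT_bound: "degree p \<le> d \<Longrightarrow> pT p v = (\<Sum>i\<le>d. sc (coeff p i) ((T ^^ i) v))"
  unfolding pT_def by (rule sum.mono_neutral_left) (auto simp: coeff_eq_0)

lemma pT_add: "pT (p + q) v = pT p v + pT q v"
  using degree_add_le_max[of p q]
  by (simp add: pT_bound[of _ "max (degree p) (degree q)"] sum.distrib[symmetric] vs.scale_left_distrib)

lemma pT_smult: "pT (smult c p) v = sc c (pT p v)"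
  using degree_smult_le[of c p]
  by (simp add: pT_bound[of _ "degree p"] vs.scale_sum_right)

lemma pT_diff: "pT (p - q) v = pT p v - pT q v"
  using pT_add[of "p - q" q v] by simp

lemma pT_monom: "pT (monom 1 k) v = (T ^^ k) v"
proof -
  have "pT (monom 1 k) v = (\<Sum>i\<le>k. if i = k then (T ^^ k) v else 0)"
    unfolding pT_bound[OF degree_monom_le] by (rule sum.cong) (auto simp: vs.scale_zero_left)
  then show ?thesis by simp
qed

lemma pT_pCons0: "v \<in> V \<Longrightarrow> pT (pCons 0 p) v = T (pT p v)"
proof -
  assume v: "v \<in> V"
  have "pT (pCons 0 p) v = (\<Sum>i\<le>Suc (degree p). sc (coeff (pCons 0 p) i) ((T ^^ i) v))"
    by (rule pT_bound) simp
  also have "\<dots> = (\<Sum>i\<le>degree p. sc (coeff p i) (T ((T ^^ i) v)))"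
    by (subst sum.atMost_Suc_shift) (simp add: vs.scale_zero_left)
  also have "\<dots> = T (pT p v)" unfolding pT_def using v by (subst T_sum) (auto simp: T_sc)
  finally show ?thesis .
qed

text \<open>The fundamental theorem of algebra splits off one monic linear factor per degree;
  \<open>c\<close> is the leading coefficient.\<close>

lemma pT_roots: "p \<noteq> 0 \<Longrightarrow> v \<in> V \<Longrightarrow> \<exists>c bs. c \<noteq> 0 \<and> pT p v = sc c (pl T bs v)"
proof (induction "degree p" arbitrary: p)
  case 0
  then obtain c where "p = [:c:]" "c \<noteq> 0" by (metis degree_eq_zeroE pCons_0_0)
  then show ?case by (intro exI[of _ c] exI[of _ "[]"]) (auto simp: pT_def)
next
  case (Suc d)
  then have "\<not> constant (poly p)" by (simp add: constant_degree)
  then obtain z where "poly p z = 0" using fundamental_theorem_of_algebra by blast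
  then obtain q where q: "p = [:-z, 1:] * q" by (metis poly_eq_0_iff_dvd dvdE)
  have q0: "q \<noteq> 0" using Suc.prems q by auto
  have "degree q = d"
    using degree_mult_eq[of "[:-z, 1:]" q] Suc.hyps(2) q0 q by (simp del: mult_pCons_left)
  then obtain c bs where c: "c \<noteq> 0" "pT q v = sc c (pl T bs v)"
    using Suc.hyps(1) q0 Suc.prems(2) by blast
  have "p = pCons 0 q - smult z q" using q by simp
  then have "pT p v = T (pT q v) - sc z (pT q v)" using Suc.prems by (simp add: pT_diff pT_smult pT_pCons0)
  also have "\<dots> = sc c (pl T (z # bs) v)"
    unfolding c using Suc.prems by (simp add: T_lin cvec_eq_iff algebra_simps)
  finally show ?case using c by blast
qed

text \<open>Inside a finite span the vectors \<open>(T ^^ k) v\<close> cannot stay independent. The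
  first dependence is a monic polynomial in \<open>T\<close> that kills \<open>v\<close>, and it
  splits into linear factors.\<close>

lemma vector_annihilator:
  assumes v: "v \<in> V" and B: "finite B" "V \<subseteq> vs.span B"
  shows "\<exists>bs. pl T bs v = 0"
proof -
  let ?S = "\<lambda>m. (\<lambda>k. (T ^^ k) v) ` {..<m}"
  have "\<exists>m. (T ^^ m) v \<in> vs.span (?S m)"
  proof (rule ccontr)
    assume "\<not> ?thesis"
    then have n: "(T ^^ m) v \<notin> vs.span (?S m)" for m by auto
    have "vs.independent (?S m) \<and> card (?S m) = m" for m
    proof (induction m)
      case (Suc m)
      have "(T ^^ m) v \<notin> ?S m" using n[of m] vs.span_base[of "(T ^^ m) v" "?S m"] by argo
      moreover have "?S (Suc m) = insert ((T ^^ m) v) (?S m)" by (simp add: lessThan_Suc)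
      moreover have "finite (?S m)" by simp
      ultimately show ?case using Suc vs.independent_insertI[OF n[of m]] card_insert_disjoint
        by metis
    qed (simp add: vs.independent_empty)
    moreover have "?S m \<subseteq> vs.span B" for m using v B by auto
    ultimately have "m \<le> card B" for m
      using vs.independent_span_bound[OF B(1), of "?S m" for m] by metis
    then show False by (metis not_less_eq_eq)
  qed
  then obtain m where m: "(T ^^ m) v \<in> vs.span (?S m)" by auto
  \<comment> \<open>Polynomials of degree below \<open>m\<close> applied to \<open>v\<close>; this
    subspace contains the span of the earlier powers and turns a span membership into a polynomial
    \<open>q\<close>.\<close>
  let ?W = "{pT q v | q. \<forall>i\<ge>m. coeff q i = 0}"
  have "vs.subspace ?W"
  proof (rule vs.subspaceI)
    show "0 \<in> ?W" by (rule CollectI, rule exI[of _ 0]) (simp add: pT_def vs.scale_zero_left)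
    fix x assume "x \<in> ?W"
    then obtain q where q: "x = pT q v" "\<forall>i\<ge>m. coeff q i = 0" by auto
    show "sc c x \<in> ?W" for c
      by (rule CollectI, rule exI[of _ "smult c q"]) (use q in \<open>auto simp: pT_smult\<close>)
    fix y assume "y \<in> ?W"
    then obtain r where r: "y = pT r v" "\<forall>i\<ge>m. coeff r i = 0" by auto
    show "x + y \<in> ?W"
      by (rule CollectI, rule exI[of _ "q + r"]) (use q r in \<open>auto simp: pT_add\<close>)
  qed
  moreover have "?S m \<subseteq> ?W" by (force simp: pT_monom[symmetric])
  ultimately have "vs.span (?S m) \<subseteq> ?W" by (rule vs.span_minimal[rotated])
  then obtain q where q: "(T ^^ m) v = pT q v" "\<forall>i\<ge>m. coeff q i = 0" using m by auto
  have "coeff (monom 1 m - q) m = 1" using q by simp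
  then have "monom 1 m - q \<noteq> 0" by auto
  then obtain c bs where "c \<noteq> 0" "pT (monom 1 m - q) v = sc c (pl T bs v)"
    using pT_roots v by blast
  then have "sc c (pl T bs v) = 0" using q by (simp add: pT_diff pT_monom)
  then show ?thesis using \<open>c \<noteq> 0\<close> by (auto simp: vs.scale_eq_0_iff)
qed

text \<open>Annihilators of the vectors of a finite basis are concatenated; the factors commute, so
  each basis vector is killed by its own part.\<close>

lemma annihilator_exists:
  assumes B: "finite B" "V \<subseteq> vs.span B"
  shows "\<exists>bs. \<forall>v\<in>V. pl T bs v = 0"
proof -
  obtain C where C: "C \<subseteq> V" "vs.independent C" "V \<subseteq> vs.span C"
    using vs.maximal_independent_subset[of V] by blast
  have "finite C" using vs.independent_span_bound[OF B(1) C(2)] C(1) B(2) by auto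
  then have "\<exists>bs. \<forall>v\<in>C. pl T bs v = 0" using C(1)
  proof (induction C)
    case (insert x C)
    then obtain bs where bs: "\<forall>v\<in>C. pl T bs v = 0" by auto
    obtain as where as: "pl T as x = 0" using vector_annihilator[OF _ B, of x] insert by auto
    interpret P: sub_endo V "pl T bs" by unfold_locales (rule V pl_endo)+
    interpret Q: sub_endo V "pl T as" by unfold_locales (rule V pl_endo)+
    have "pl T (as @ bs) v = 0" if "v \<in> insert x C" for v
      using that insert.prems bs as pl_comm[of x as bs] by (auto simp: pl_append Q.T_0 P.T_0)
    then show ?case by blast
  qed auto
  then obtain bs where bs: "\<forall>v\<in>C. pl T bs v = 0" by auto
  interpret P: sub_endo V "pl T bs" by unfold_locales (rule V pl_endo)+
  have "pl T bs v = 0 \<and> v \<in> V" if "v \<in> vs.span C" for v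
    using that
  proof (induction rule: vs.span_induct_alt)
    case (step c x y)
    then show ?case using bs C by (auto simp: P.T_lin)
  qed (auto simp: P.T_0)
  then show ?thesis using C(3) by blast
qed

end

section \<open>Finite-dimensional representations of sl2\<close>

text \<open>Two facts are the goal: \<open>h\<close> is diagonalisable with bounded integer
  eigenvalues (\<open>h_span\<close>), and a nonzero vector of weight \<open>a\<close> survives
  \<open>a\<close> applications of \<open>f\<close> (\<open>fpow_nonzero\<close>). Both come from
  polynomial identities between \<open>h\<close> and the Casimir operator \<open>c\<close>.\<close>

locale sl2 =
  fixes V :: "'x cvec set" and e f h :: "'x cvec \<Rightarrow> 'x cvec"
  assumes V: "vs.subspace V" and e: "endo V e" and f: "endo V f" and h: "endo V h"
    and ef: "v \<in> V \<Longrightarrow> e (f v) = f (e v) + h v"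
    and he: "v \<in> V \<Longrightarrow> h (e v) = e (h v) + sc 2 (e v)"
    and hf: "v \<in> V \<Longrightarrow> h (f v) = f (h v) - sc 2 (f v)"
    and fin: "\<exists>B. finite B \<and> V \<subseteq> vs.span B"
begin

sublocale E: sub_endo V e by unfold_locales (rule V e)+
sublocale F: sub_endo V f by unfold_locales (rule V f)+
sublocale H: sub_endo V h by unfold_locales (rule V h)+

lemmas lin = E.T_lin F.T_lin H.T_lin
lemmas nf = ef he hf lin vs.scale_right_distrib vs.scale_right_diff_distrib

text \<open>The Chevalley involution; every statement about \<open>e\<close> yields one about
  \<open>f\<close>.\<close>

lemma opp: "sl2 V f e (\<lambda>v. - h v)"
  using V e f fin by unfold_locales (auto simp: endo_def nf vs.scale_right_distrib)

lemma h_epow: "v \<in> V \<Longrightarrow> h ((e ^^ k) v) = (e ^^ k) (h v) + sc (2 * of_nat k) ((e ^^ k) v)"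
proof (induction k)
  case (Suc k)
  then show ?case by (simp add: nf) (simp add: cvec_eq_iff algebra_simps)
qed simp

lemma h_fpow: "v \<in> V \<Longrightarrow> h ((f ^^ k) v) = (f ^^ k) (h v) - sc (2 * of_nat k) ((f ^^ k) v)"
proof (induction k)
  case (Suc k)
  then show ?case by (simp add: nf) (simp add: cvec_eq_iff algebra_simps)
qed simp

lemma pl_h_epow:
  assumes "v \<in> V"
  shows "pl h (map (\<lambda>b. b + 2 * of_nat k) bs) ((e ^^ k) v) = (e ^^ k) (pl h bs v)"
proof (induction bs)
  case (Cons b bs)
  interpret P: sub_endo V "e ^^ k" by unfold_locales (rule V E.pow_endo)+
  show ?case using assms by (simp add: Cons h_epow P.T_lin) (simp add: cvec_eq_iff algebra_simps)
qed simp

text \<open>If the roots \<open>bs\<close> annihilate \<open>h\<close>, then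
  \<open>(e ^^ k) v\<close> is killed both by \<open>bs\<close> and by \<open>bs\<close> shifted by
  \<open>2 k\<close>. Outside a finite set of exponents \<open>k\<close> the two lists are disjoint,
  and coprimality applies.\<close>

lemma e_nilpotent: "\<exists>N. \<forall>v\<in>V. (e ^^ N) v = 0"
proof -
  obtain B where "finite B" "V \<subseteq> vs.span B" using fin by auto
  then obtain bs where bs: "\<And>v. v \<in> V \<Longrightarrow> pl h bs v = 0"
    using H.annihilator_exists[of B] by auto
  let ?Bad = "\<Union>a\<in>set bs. \<Union>b\<in>set bs. {k::nat. of_nat k = (b - a) / 2}"
  have f: "finite {k::nat. of_nat k = z}" for z :: complex
  proof (rule finite_subset)
    show "{k::nat. of_nat k = z} \<subseteq> {nat \<lfloor>Re z\<rfloor>}" by auto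
  qed simp
  have "finite ?Bad" by (intro finite_UN_I finite_set f)
  then obtain k where "k \<notin> ?Bad" using ex_new_if_finite infinite_UNIV_nat by blast
  then have k: "set (map (\<lambda>b. b + 2 * of_nat k) bs) \<inter> set bs = {}" by (auto simp: field_simps)
  interpret P: sub_endo V "e ^^ k" by unfold_locales (rule V E.pow_endo)+
  have "(e ^^ k) v = 0" if v: "v \<in> V" for v
  proof (rule H.pl_coprime[OF _ _ _ k])
    show "pl h (map (\<lambda>b. b + 2 * of_nat k) bs) ((e ^^ k) v) = 0"
      unfolding pl_h_epow[OF v] bs[OF v] by (rule P.T_0)
    show "pl h bs ((e ^^ k) v) = 0" using bs v by blast
  qed (use v in auto)
  then show ?thesis by blast
qed

text \<open>Twice the usual Casimir element \<open>e f + f e + h^2 / 2\<close>. In this scaling a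
  highest weight vector of weight \<open>a\<close> has the eigenvalue \<open>(a + 1)^2 - 1\<close>,
  which explains the form \<open>m^2 - 1\<close> of all eigenvalues below.\<close>

definition c :: "'x cvec \<Rightarrow> 'x cvec" where
  "c v = sc 4 (f (e v)) + h (h v) + sc 2 (h v)"

lemma c: "endo V c"
  unfolding endo_def c_def by (auto simp: nf) (auto simp: cvec_eq_iff algebra_simps)

sublocale C: sub_endo V c by unfold_locales (rule V c)+

lemma c_e: "v \<in> V \<Longrightarrow> c (e v) = e (c v)"
  unfolding c_def by (simp add: nf) (auto simp: cvec_eq_iff algebra_simps)

lemma c_f: "v \<in> V \<Longrightarrow> c (f v) = f (c v)"
  unfolding c_def by (simp add: nf) (auto simp: cvec_eq_iff algebra_simps)

lemma c_h: "v \<in> V \<Longrightarrow> c (h v) = h (c v)"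
  unfolding c_def by (simp add: nf)

lemma c_epow: "v \<in> V \<Longrightarrow> c ((e ^^ k) v) = (e ^^ k) (c v)"
  by (induction k) (auto simp: c_e)

lemma c_fpow: "v \<in> V \<Longrightarrow> c ((f ^^ k) v) = (f ^^ k) (c v)"
  by (induction k) (auto simp: c_f)

lemma fe_c: "v \<in> V \<Longrightarrow> sc 4 (f (e v)) = c v - h (h v) - sc 2 (h v)"
  by (simp add: c_def)

lemma ef_c: "v \<in> V \<Longrightarrow> sc 4 (e (f v)) = c v - h (h v) + sc 2 (h v)"
  unfolding c_def by (simp add: nf) (auto simp: cvec_eq_iff algebra_simps)

lemma c_highest: "v \<in> V \<Longrightarrow> e v = 0 \<Longrightarrow> h v = sc a v \<Longrightarrow> c v = sc (a ^ 2 + 2 * a) v"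
  by (simp add: c_def lin) (simp add: cvec_eq_iff algebra_simps power2_eq_square)

lemma c_opp: "v \<in> V \<Longrightarrow> sl2.c f e (\<lambda>v. - h v) v = c v"
  unfolding sl2.c_def[OF opp] c_def by (simp add: nf) (auto simp: cvec_eq_iff algebra_simps)

lemma pl_c_f: "v \<in> V \<Longrightarrow> pl c bs (f v) = f (pl c bs v)"
  by (induction bs) (auto simp: c_f lin)

lemma pl_c_h: "v \<in> V \<Longrightarrow> pl c bs (h v) = h (pl c bs v)"
  by (induction bs) (auto simp: c_h lin)

lemma pl_h_c: "v \<in> V \<Longrightarrow> pl h bs (c v) = c (pl h bs v)"
  by (induction bs) (auto simp: c_h C.T_lin)

lemma epow_f:
  "v \<in> V \<Longrightarrow> (e ^^ Suc k) (f v) =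
     f ((e ^^ Suc k) v) + sc (of_nat (Suc k)) ((e ^^ k) (h v) + sc (of_nat k) ((e ^^ k) v))"
proof (induction k)
  case (Suc k)
  then have "(e ^^ Suc (Suc k)) (f v) = e (f ((e ^^ Suc k) v))
     + sc (of_nat (Suc k)) (e ((e ^^ k) (h v)) + sc (of_nat k) (e ((e ^^ k) v)))"
    by (simp add: lin)
  also have "e (f ((e ^^ Suc k) v)) = f ((e ^^ Suc (Suc k)) v) + (e ^^ Suc k) (h v)
      + sc (2 * of_nat (Suc k)) ((e ^^ Suc k) v)"
    using Suc.prems h_epow[of v "Suc k"] by (simp add: ef)
  finally show ?case by (simp add: cvec_eq_iff algebra_simps)
qed (simp add: ef)

text \<open>If $e^N = 0$, then $[e^j, f] = j e^{j-1} (h + j - 1)$ lowers the exponent at the cost of one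
  linear factor in the Casimir element; so the latter has a squarefree annihilating polynomial.\<close>
lemma casimir_step:
  assumes N: "\<And>v. v \<in> V \<Longrightarrow> (e ^^ N) v = 0" and "j \<le> N" "v \<in> V"
  shows "(e ^^ j) (pl c (map (\<lambda>m. of_nat m ^ 2 - 1) [Suc j..<Suc N]) v) = 0"
  using assms(2,3)
proof (induction j arbitrary: v rule: inc_induct)
  case (step j)
  let ?L = "map (\<lambda>m. of_nat m ^ 2 - 1 :: complex) [Suc (Suc j)..<Suc N]"
  let ?w = "pl c ?L v"
  have w: "?w \<in> V" using step.prems by simp
  have 0: "(e ^^ Suc j) ?w = 0" using step by blast
  have "(e ^^ Suc j) (pl c ?L (f v)) = 0" using step F.T_in by blast
  then have "sc (of_nat (Suc j)) ((e ^^ j) (h ?w) + sc (of_nat j) ((e ^^ j) ?w)) = 0"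
    using step.prems 0 epow_f[OF w, of j] by (simp add: pl_c_f F.T_0)
  then have 1: "(e ^^ j) (h ?w) = sc (- of_nat j) ((e ^^ j) ?w)"
    by (simp add: vs.scale_eq_0_iff eq_neg_iff_add_eq_0 del: of_nat_Suc upt_Suc)
  \<comment> \<open>Hence \<open>(e ^^ j) ?w\<close> is killed by \<open>e\<close> and has weight
    \<open>j\<close>, so that \<open>c\<close> acts on it by \<open>(j + 1)^2 - 1\<close>. This is
    the one factor by which the list for \<open>j\<close> is longer than that for
    \<open>Suc j\<close>.\<close>
  have 2: "h ((e ^^ j) ?w) = sc (of_nat j) ((e ^^ j) ?w)"
    unfolding h_epow[OF w] 1 by (simp add: cvec_eq_iff algebra_simps)
  have "c ((e ^^ j) ?w) = sc (of_nat (Suc j) ^ 2 - 1) ((e ^^ j) ?w)"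
    using c_highest[OF _ _ 2] 0 w by (simp add: algebra_simps power2_eq_square del: upt_Suc)
  moreover interpret P: sub_endo V "e ^^ j" by unfold_locales (rule V E.pow_endo)+
  have "(e ^^ j) (pl c ((of_nat (Suc j) ^ 2 - 1) # ?L) v)
      = c ((e ^^ j) ?w) - sc (of_nat (Suc j) ^ 2 - 1) ((e ^^ j) ?w)"
    using w by (simp add: P.T_lin c_epow)
  moreover have "map (\<lambda>m. of_nat m ^ 2 - 1 :: complex) [Suc j..<Suc N] = (of_nat (Suc j) ^ 2 - 1) # ?L"
    using step by (simp add: upt_conv_Cons del: upt_Suc)
  ultimately show ?case by simp
qed (simp add: N)

text \<open>The case \<open>j = 0\<close> of \<open>casimir_step\<close> gives an annihilating list
  for \<open>c\<close>. Its entries are distinct because the squares of distinct natural numbers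
  are, so \<open>c\<close> is diagonalisable.\<close>

lemma casimir_span:
  "\<exists>N. \<forall>v\<in>V. v \<in> vs.span {u \<in> V. \<exists>m::nat. m \<le> N \<and> c u = sc (of_nat m ^ 2 - 1) u}"
proof -
  obtain N where N: "\<And>v. v \<in> V \<Longrightarrow> (e ^^ N) v = 0" using e_nilpotent by blast
  let ?L = "map (\<lambda>m. of_nat m ^ 2 - 1 :: complex) [Suc 0..<Suc N]"
  have "inj_on (\<lambda>m. of_nat m ^ 2 - 1 :: complex) {Suc 0..<Suc N}"
  proof (rule inj_onI)
    fix x y :: nat assume "of_nat x ^ 2 - 1 = (of_nat y ^ 2 - 1 :: complex)"
    then have "of_nat (x ^ 2) = (of_nat (y ^ 2) :: complex)" by simp
    then show "x = y" unfolding of_nat_eq_iff by simp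
  qed
  then have d: "distinct ?L" by (simp add: distinct_map del: upt_Suc)
  have "v \<in> vs.span {u \<in> V. \<exists>m::nat. m \<le> N \<and> c u = sc (of_nat m ^ 2 - 1) u}" if v: "v \<in> V" for v
  proof -
    have "pl c ?L v = 0" using casimir_step[OF N, of 0 v] v by (simp del: upt_Suc)
    from C.pl_distinct_span[OF v this d] show ?thesis
      by (rule set_mp[OF vs.span_mono, rotated]) (auto simp del: upt_Suc vs.scale_cancel_right, metis less_Suc_eq_le)
  qed
  then show ?thesis by blast
qed

text \<open>On the eigenspace of \<open>c\<close> for \<open>m^2 - 1\<close> one has
  \<open>4 f e = m^2 - (h + 1)^2 = - (h - (m - 1)) (h - (- m - 1))\<close>. Each further pair
  \<open>f\<close>, \<open>e\<close> contributes the same two roots moved down by 2, because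
  \<open>e\<close> raises the eigenvalue of \<open>h\<close> by 2.\<close>

definition Ls :: "complex \<Rightarrow> nat \<Rightarrow> complex list" where
  "Ls m k = concat (map (\<lambda>i. [m - 1 - 2 * of_nat i, - m - 1 - 2 * of_nat i]) [0..<k])"

lemma fpow_epow:
  assumes "v \<in> V" "c v = sc (m ^ 2 - 1) v"
  shows "sc (4 ^ k) ((f ^^ k) ((e ^^ k) v)) = sc ((-1) ^ k) (pl h (Ls m k) v)"
  using assms
proof (induction k arbitrary: v)
  case (Suc k)
  let ?ab = "[m - 1 - 2 * of_nat k, - m - 1 - 2 * of_nat k]"
  let ?v' = "pl h ?ab v"
  interpret P: sub_endo V "e ^^ k" by unfold_locales (rule V E.pow_endo)+
  interpret Q: sub_endo V "f ^^ k" by unfold_locales (rule V F.pow_endo)+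
  have u: "(e ^^ k) v \<in> V" using Suc.prems by simp
  have hh: "(e ^^ k) (h (h v)) = h ((e ^^ k) (h v)) - sc (2 * of_nat k) ((e ^^ k) (h v))"
    "(e ^^ k) (h v) = h ((e ^^ k) v) - sc (2 * of_nat k) ((e ^^ k) v)"
    using Suc.prems h_epow[of "h v" k] h_epow[of v k] by auto
  have "sc 4 (f (e ((e ^^ k) v))) = - (e ^^ k) ?v'"
    using Suc.prems unfolding fe_c[OF u] c_epow[OF Suc.prems(1)] Suc.prems(2)
    by (simp add: lin P.T_lin hh) (simp add: cvec_eq_iff algebra_simps power2_eq_square)
  then have 1: "sc 4 ((f ^^ Suc k) ((e ^^ Suc k) v)) = - (f ^^ k) ((e ^^ k) ?v')"
    using Suc.prems by (simp add: funpow_swap1 Q.T_lin[symmetric])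
  have "sc (4 ^ Suc k) ((f ^^ Suc k) ((e ^^ Suc k) v)) = sc (4 ^ k) (sc 4 ((f ^^ Suc k) ((e ^^ Suc k) v)))"
    by (simp add: mult.commute)
  also have "\<dots> = - sc (4 ^ k) ((f ^^ k) ((e ^^ k) ?v'))" unfolding 1 by (rule vs.scale_minus_right)
  also have "sc (4 ^ k) ((f ^^ k) ((e ^^ k) ?v')) = sc ((-1) ^ k) (pl h (Ls m k) ?v')"
  proof (rule Suc.IH)
    show "?v' \<in> V" using Suc.prems by (intro H.pl_in)
    show "c ?v' = sc (m ^ 2 - 1) ?v'" unfolding pl_h_c[OF Suc.prems(1), symmetric] Suc.prems(2)
      using H.pl_endo Suc.prems(1) by (simp only: endo_def)
  qed
  also have "pl h (Ls m k) ?v' = pl h (Ls m (Suc k)) v"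
    unfolding Ls_def by (simp only: H.pl_append upt_Suc_append map_append concat_append list.map concat.simps append_Nil2 zero_le append.simps if_True upt_Suc)
  finally show ?case by simp
qed (simp add: Ls_def)

lemma pl_uminus: "v \<in> V \<Longrightarrow> pl (\<lambda>v. - h v) bs v = sc ((-1) ^ length bs) (pl h (map uminus bs) v)"
proof (induction bs)
  case (Cons b bs)
  then show ?case by (simp add: lin) (simp add: cvec_eq_iff algebra_simps)
qed simp

lemma filter_concat_pairs:
  "(\<And>i. \<not> P (b i)) \<Longrightarrow> filter P (concat (map (\<lambda>i. [a i, b i]) xs)) = filter P (map a xs)"
  by (induction xs) auto

text \<open>On a Casimir eigenspace the nilpotency of \<open>e\<close> kills a product over the
  roots \<open>m - 1 - 2 i\<close> and \<open>- m - 1 - 2 i\<close>, and the nilpotency of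
  \<open>f\<close> one over the negatives of such numbers. No \<open>- m - 1 - 2 i\<close> is among
  these negatives, so only the roots \<open>m - 1 - 2 i\<close> survive. They are distinct integers,
  hence \<open>h\<close> is diagonalisable there.\<close>

lemma h_span:
  "\<exists>K::nat. \<forall>v\<in>V. v \<in> vs.span {u \<in> V. \<exists>a::int. \<bar>a\<bar> \<le> int K \<and> h u = sc (of_int a) u}"
proof -
  interpret O: sl2 V f e "\<lambda>v. - h v" by (rule opp)
  obtain N1 where N1: "\<And>v. v \<in> V \<Longrightarrow> (e ^^ N1) v = 0" using e_nilpotent by blast
  obtain N2 where N2: "\<And>v. v \<in> V \<Longrightarrow> (f ^^ N2) v = 0" using O.e_nilpotent by blast
  obtain M where M: "\<And>v. v \<in> V \<Longrightarrow> v \<in> vs.span {u \<in> V. \<exists>m::nat. m \<le> M \<and> c u = sc (of_nat m ^ 2 - 1) u}"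
    using casimir_span by blast
  \<comment> \<open>A bound for all numbers \<open>m - 1 - 2 i\<close> with \<open>m \<le> M\<close>
    and \<open>i < N1\<close>.\<close>
  let ?K = "M + 1 + 2 * N1"
  let ?E = "{u \<in> V. \<exists>a::int. \<bar>a\<bar> \<le> int ?K \<and> h u = sc (of_int a) u}"
  have "u \<in> vs.span ?E" if u: "u \<in> V" "c u = sc (of_nat m ^ 2 - 1) u" "m \<le> M" for u and m :: nat
  proof -
    interpret Q: sub_endo V "f ^^ N1" by unfold_locales (rule V F.pow_endo)+
    interpret P: sub_endo V "e ^^ N2" by unfold_locales (rule V E.pow_endo)+
    let ?A = "Ls (of_nat m) N1" and ?B = "map uminus (O.Ls (of_nat m) N2)"
    have "sc ((-1) ^ N1) (pl h ?A u) = 0"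
      unfolding fpow_epow[OF u(1,2), symmetric] N1[OF u(1)] by (simp add: Q.T_0)
    then have A: "pl h ?A u = 0" by (simp add: vs.scale_eq_0_iff)
    have "sc ((-1) ^ N2) (pl (\<lambda>v. - h v) (O.Ls (of_nat m) N2) u) = 0"
      using O.fpow_epow[OF u(1), of "of_nat m" N2] u N2[OF u(1)] c_opp by (simp add: P.T_0)
    then have B: "pl h ?B u = 0" using u by (simp add: vs.scale_eq_0_iff pl_uminus)
    let ?a = "\<lambda>i::nat. of_nat m - 1 - 2 * of_nat i :: complex"
    have "\<not> - of_nat m - 1 - 2 * of_nat i \<in> set ?B" for i :: nat
    proof
      assume "- of_nat m - 1 - 2 * of_nat i \<in> set ?B"
      moreover have "set ?B = (\<Union>j\<in>{0..<N2}. {- (of_nat m - 1 - 2 * of_nat j), - (- of_nat m - 1 - 2 * of_nat j)})"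
        by (simp add: O.Ls_def image_UN)
      ultimately obtain j :: nat where "(- of_nat m - 1 - 2 * of_nat i :: complex) = - (of_nat m - 1 - 2 * of_nat j)
         \<or> (- of_nat m - 1 - 2 * of_nat i :: complex) = - (- of_nat m - 1 - 2 * of_nat j)"
        by blast
      then have "(of_int (- int m - 1 - 2 * int i) :: complex) = of_int (- (int m - 1 - 2 * int j))
         \<or> (of_int (- int m - 1 - 2 * int i) :: complex) = of_int (- (- int m - 1 - 2 * int j))" by simp
      then show False unfolding of_int_eq_iff by linarith
    qed
    then have "filter (\<lambda>a. a \<in> set ?B) ?A = filter (\<lambda>a. a \<in> set ?B) (map ?a [0..<N1])"
      unfolding Ls_def by (intro filter_concat_pairs)
    then have "pl h (filter (\<lambda>a. a \<in> set ?B) (map ?a [0..<N1])) u = 0"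
      using H.pl_filter[OF u(1) A B] by simp
    moreover have "distinct (filter (\<lambda>a. a \<in> set ?B) (map ?a [0..<N1]))"
      by (intro distinct_filter) (auto simp: distinct_map intro!: inj_onI)
    ultimately have "u \<in> vs.span {w \<in> V. \<exists>b\<in>set (filter (\<lambda>a. a \<in> set ?B) (map ?a [0..<N1])). h w = sc b w}"
      by (intro H.pl_distinct_span u)
    then show ?thesis
    proof (rule set_mp[OF vs.span_mono, rotated], safe)
      fix w b assume b: "b \<in> set (filter (\<lambda>a. a \<in> set ?B) (map ?a [0..<N1]))" and w: "h w = sc b w"
      then obtain i where i: "i < N1" "b = ?a i" by auto
      show "\<exists>a::int. \<bar>a\<bar> \<le> int ?K \<and> h w = sc (of_int a) w"
        by (rule exI[of _ "int m - 1 - 2 * int i"]) (use i w u in auto)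
    qed
  qed
  then have "{u \<in> V. \<exists>m::nat. m \<le> M \<and> c u = sc (of_nat m ^ 2 - 1) u} \<subseteq> vs.span ?E" by blast
  then have "vs.span {u \<in> V. \<exists>m::nat. m \<le> M \<and> c u = sc (of_nat m ^ 2 - 1) u} \<subseteq> vs.span ?E"
    by (rule vs.span_minimal) (rule vs.subspace_span)
  then show ?thesis using M by blast
qed

text \<open>The form that simultaneous diagonalisation consumes: one squarefree polynomial with
  integer roots, valid on the whole space and inherited by subspaces.\<close>

lemma h_annihilator: "\<exists>K::nat. \<forall>v\<in>V. pl h (map of_int [- int K..int K]) v = 0"
proof -
  obtain K :: nat where K: "\<And>v. v \<in> V \<Longrightarrow> v \<in> vs.span {u \<in> V. \<exists>a::int. \<bar>a\<bar> \<le> int K \<and> h u = sc (of_int a) u}"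
    using h_span by blast
  let ?L = "map of_int [- int K..int K]"
  interpret P: sub_endo V "pl h ?L" by unfold_locales (rule V H.pl_endo)+
  have "pl h ?L v = 0 \<and> v \<in> V" if "v \<in> vs.span {u \<in> V. \<exists>a::int. \<bar>a\<bar> \<le> int K \<and> h u = sc (of_int a) u}" for v
    using that
  proof (induction rule: vs.span_induct_alt)
    case (step c x y)
    then obtain a :: int where a: "\<bar>a\<bar> \<le> int K" "h x = sc (of_int a) x" "x \<in> V" by auto
    have "(\<Prod>b\<leftarrow>?L. of_int a - b) = (0::complex)" using a(1)
      by (auto simp: prod_list_zero_iff intro!: image_eqI[of _ _ a])
    then have "pl h ?L x = 0" using H.pl_eigen[OF a(3,2), of ?L] by simp
    then show ?case using step a by (auto simp: P.T_lin)
  qed (auto simp: P.T_0)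
  then show ?thesis using K by blast
qed

text \<open>Here \<open>4 e f = c - h^2 + 2 h\<close>, and \<open>(f ^^ i) v\<close> has the weight
  \<open>b - 2 i\<close>; each pair \<open>e\<close>, \<open>f\<close> becomes a linear factor in
  \<open>c\<close>.\<close>

lemma epow_fpow:
  assumes "v \<in> V" "h v = sc b v"
  shows "sc (4 ^ k) ((e ^^ k) ((f ^^ k) v)) =
    pl c (map (\<lambda>i. (b - 2 * of_nat i) ^ 2 - 2 * (b - 2 * of_nat i)) [0..<k]) v"
  using assms
proof (induction k arbitrary: v)
  case (Suc k)
  let ?b = "b - 2 * of_nat k"
  let ?v' = "pl c [?b ^ 2 - 2 * ?b] v"
  interpret P: sub_endo V "e ^^ k" by unfold_locales (rule V E.pow_endo)+
  interpret Q: sub_endo V "f ^^ k" by unfold_locales (rule V F.pow_endo)+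
  have u: "(f ^^ k) v \<in> V" using Suc.prems by simp
  have hu: "h ((f ^^ k) v) = sc ?b ((f ^^ k) v)"
    using Suc.prems by (simp add: h_fpow Q.T_lin) (simp add: cvec_eq_iff algebra_simps)
  have "sc 4 (e (f ((f ^^ k) v))) = (f ^^ k) ?v'"
    using Suc.prems u unfolding ef_c[OF u] c_fpow[OF Suc.prems(1)] hu
    by (simp add: lin hu Q.T_lin) (simp add: cvec_eq_iff algebra_simps power2_eq_square)
  then have 1: "sc 4 ((e ^^ Suc k) ((f ^^ Suc k) v)) = (e ^^ k) ((f ^^ k) ?v')"
    using Suc.prems by (simp add: funpow_swap1 P.T_lin[symmetric])
  have "sc (4 ^ Suc k) ((e ^^ Suc k) ((f ^^ Suc k) v)) = sc (4 ^ k) (sc 4 ((e ^^ Suc k) ((f ^^ Suc k) v)))"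
    by (simp add: mult.commute)
  also have "\<dots> = pl c (map (\<lambda>i. (b - 2 * of_nat i) ^ 2 - 2 * (b - 2 * of_nat i)) [0..<k]) ?v'" unfolding 1
  proof (rule Suc.IH)
    show "?v' \<in> V" using Suc.prems by (intro C.pl_in)
    show "h ?v' = sc b ?v'" unfolding pl_c_h[OF Suc.prems(1), symmetric] Suc.prems(2)
      using C.pl_endo Suc.prems(1) by (simp only: endo_def)
  qed
  also have "\<dots> = pl c (map (\<lambda>i. (b - 2 * of_nat i) ^ 2 - 2 * (b - 2 * of_nat i)) [0..<Suc k]) v"
    by (simp only: C.pl_append[symmetric] upt_Suc zero_le if_True map_append list.map)
  finally show ?case .
qed simp

text \<open>If \<open>(f ^^ a) v = 0\<close>, then \<open>c\<close> satisfies on \<open>v\<close> a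
  polynomial with the roots \<open>(a - 2 i - 1)^2 - 1\<close>, \<open>i < a\<close>. Nilpotency of
  \<open>e\<close> gives another one with the roots \<open>(a + 2 j + 1)^2 - 1\<close>. The absolute
  values \<open>\<bar>a - 2 i - 1\<bar>\<close> are smaller than \<open>a\<close>, so the two have
  no common root.\<close>

lemma fpow_nonzero:
  assumes v: "v \<in> V" "h v = sc (of_nat a) v" and "(f ^^ a) v = 0"
  shows "v = 0"
proof -
  interpret O: sl2 V f e "\<lambda>v. - h v" by (rule opp)
  obtain N where N: "(e ^^ N) v = 0" using e_nilpotent v by blast
  interpret P: sub_endo V "e ^^ a" by unfold_locales (rule V E.pow_endo)+
  interpret Q: sub_endo V "f ^^ N" by unfold_locales (rule V F.pow_endo)+
  let ?A = "map (\<lambda>i. (of_nat a - 2 * of_nat i) ^ 2 - 2 * (of_nat a - 2 * of_nat i)) [0..<a] :: complex list"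
  let ?B = "map (\<lambda>i. (- of_nat a - 2 * of_nat i) ^ 2 - 2 * (- of_nat a - 2 * of_nat i)) [0..<N] :: complex list"
  have A: "pl c ?A v = 0" using epow_fpow[OF v, of a] assms(3) by (simp add: P.T_0)
  have "pl O.c bs v = pl c bs v" for bs
    using v(1) by (induction bs) (auto simp: c_opp)
  moreover have "- h v = sc (- of_nat a) v" using v by simp
  ultimately have B: "pl c ?B v = 0" using O.epow_fpow[OF v(1), of "- of_nat a" N] N
    by (simp add: Q.T_0)
  have "set ?A \<inter> set ?B = {}"
  proof -
    have False if "i < a" and eq: "(of_nat a - 2 * of_nat i) ^ 2 - 2 * (of_nat a - 2 * of_nat i) =
       ((- of_nat a - 2 * of_nat j) ^ 2 - 2 * (- of_nat a - 2 * of_nat j) :: complex)" for i j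
    proof -
      have "(of_int ((int a - 2 * int i - 1) ^ 2) :: complex) = of_int ((- int a - 2 * int j - 1) ^ 2)"
        using eq by (simp add: algebra_simps power2_eq_square)
      then have "(int a - 2 * int i - 1) ^ 2 = (- int a - 2 * int j - 1) ^ 2" by (simp only: of_int_eq_iff)
      then show False using that(1) unfolding power2_eq_iff by auto
    qed
    then show ?thesis by auto
  qed
  then show ?thesis using C.pl_coprime[OF v(1) A B] by simp
qed

end

section \<open>Weights in type A\<close>

text \<open>Coordinates with respect to the diagonal entries; they are unique only up to adding a constant,
  since the trace vanishes.\<close>
definition wt :: "nat \<Rightarrow> (nat \<Rightarrow> complex) \<Rightarrow> weight" where
  "wt n y = (\<lambda>h. if h \<in> cartan n then \<Sum>q\<le>n. y q * h $$ (q, q) else 0)"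

definition wi :: "nat \<Rightarrow> (nat \<Rightarrow> int) \<Rightarrow> weight" where
  "wi n a = wt n (\<lambda>q. of_int (a q))"

lemma elem_mat_carrier [simp]: "elem_mat n a b \<in> carrier_mat (n + 1) (n + 1)"
  by (simp add: elem_mat_def)

lemma elem_mat_dim [simp]: "dim_row (elem_mat n a b) = Suc n" "dim_col (elem_mat n a b) = Suc n"
  by (simp_all add: elem_mat_def)

lemma elem_mat_index [simp]:
  "j \<le> n \<Longrightarrow> k \<le> n \<Longrightarrow> elem_mat n a b $$ (j, k) = (if j = a \<and> k = b then 1 else 0)"
  by (simp add: elem_mat_def)

lemma cartan_iff:
  "h \<in> cartan n \<longleftrightarrow> h \<in> carrier_mat (Suc n) (Suc n) \<and> (\<Sum>q\<le>n. h $$ (q, q)) = 0 \<and>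
     (\<forall>j\<le>n. \<forall>k\<le>n. j \<noteq> k \<longrightarrow> h $$ (j, k) = 0)"
  by (auto simp: cartan_def sl_def diagonal_mat_def lessThan_Suc_atMost less_Suc_eq_le)

lemma coroot_index:
  "j \<le> n \<Longrightarrow> k \<le> n \<Longrightarrow> coroot n i $$ (j, k) =
     (if j = i - 1 \<and> k = i - 1 then 1 else 0) - (if j = i \<and> k = i then 1 else 0)"
  by (simp add: coroot_def)

lemma coroot_carrier [simp]: "coroot n i \<in> carrier_mat (Suc n) (Suc n)"
  using minus_carrier_mat[OF elem_mat_carrier[of n i i], of "elem_mat n (i - 1) (i - 1)"]
  by (simp add: coroot_def)

lemma coroot_dim [simp]: "dim_row (coroot n i) = Suc n" "dim_col (coroot n i) = Suc n"
  using coroot_carrier[of n i] by (auto simp del: coroot_carrier)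

lemma sum_coroot:
  assumes "i \<in> {1..n}"
  shows "(\<Sum>q\<le>n. y q * coroot n i $$ (q, q)) = (y (i - 1) - y i :: complex)"
proof -
  have "(\<Sum>q\<le>n. y q * coroot n i $$ (q, q)) =
    (\<Sum>q\<le>n. (if q = i - 1 then y q else 0) - (if q = i then y q else 0))"
    using assms by (intro sum.cong) (auto simp: coroot_index)
  also have "\<dots> = y (i - 1) - y i" using assms by (auto simp: sum_subtractf)
  finally show ?thesis .
qed

lemma coroot_cartan: "i \<in> {1..n} \<Longrightarrow> coroot n i \<in> cartan n"
  using sum_coroot[of i n "\<lambda>_. 1"] by (auto simp: cartan_iff coroot_index)

lemma cartan_add: "g \<in> cartan n \<Longrightarrow> h \<in> cartan n \<Longrightarrow> g + h \<in> cartan n"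
  by (auto simp: cartan_iff sum.distrib)

lemma cartan_smult: "h \<in> cartan n \<Longrightarrow> c \<cdot>\<^sub>m h \<in> cartan n"
  by (auto simp: cartan_iff sum_distrib_left[symmetric])

text \<open>Clear the diagonal from the bottom.\<close>
lemma cartan_induct [consumes 1]:
  assumes "h \<in> cartan n" and 0: "P (0\<^sub>m (Suc n) (Suc n))" and coroot: "\<And>i. i \<in> {1..n} \<Longrightarrow> P (coroot n i)"
    and add: "\<And>g h. g \<in> cartan n \<Longrightarrow> h \<in> cartan n \<Longrightarrow> P g \<Longrightarrow> P h \<Longrightarrow> P (g + h)"
    and smult: "\<And>c h. h \<in> cartan n \<Longrightarrow> P h \<Longrightarrow> P (c \<cdot>\<^sub>m h)"
  shows "P h"
proof -
  have "m \<le> n \<Longrightarrow> h \<in> cartan n \<Longrightarrow> (\<forall>q. m < q \<and> q \<le> n \<longrightarrow> h $$ (q, q) = 0) \<Longrightarrow> P h" for m h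
  proof (induction m arbitrary: h)
    case 0
    have "(\<Sum>q\<le>n. h $$ (q, q)) = (\<Sum>q\<le>n. if q = 0 then h $$ (0, 0) else 0)"
      using 0 by (intro sum.cong) auto
    then have "h $$ (0, 0) = 0" using 0 by (simp add: cartan_iff)
    then have "h $$ (j, k) = 0" if "j \<le> n" "k \<le> n" for j k
      using 0 that by (cases "j = k"; cases "j = 0") (auto simp: cartan_iff)
    then have "h = 0\<^sub>m (Suc n) (Suc n)"
      using 0 by (intro eq_matI) (auto simp: cartan_iff less_Suc_eq_le)
    then show ?case using assms(2) by simp
  next
    case (Suc m)
    let ?c = "h $$ (Suc m, Suc m)"
    let ?d = "coroot n (Suc m)"
    have d: "?d \<in> cartan n" using Suc.prems by (intro coroot_cartan) auto
    let ?g = "h + ?c \<cdot>\<^sub>m ?d"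
    have hc: "h \<in> carrier_mat (Suc n) (Suc n)" using Suc.prems by (simp add: cartan_iff)
    have "?g \<in> cartan n" using Suc.prems d by (intro cartan_add cartan_smult)
    moreover have "\<forall>q. m < q \<and> q \<le> n \<longrightarrow> ?g $$ (q, q) = 0"
    proof (intro allI impI)
      fix q assume q: "m < q \<and> q \<le> n"
      then have "?g $$ (q, q) = h $$ (q, q) + ?c * coroot n (Suc m) $$ (q, q)" using hc by simp
      then show "?g $$ (q, q) = 0"
        using Suc.prems q by (cases "q = Suc m") (auto simp: coroot_index)
    qed
    ultimately have "P ?g" using Suc by simp
    moreover have "P ((- ?c) \<cdot>\<^sub>m ?d)" using d Suc.prems by (intro smult coroot) auto
    moreover have "h = ?g + (- ?c) \<cdot>\<^sub>m ?d"
      using hc coroot_carrier[of n "Suc m"] by (intro eq_matI) auto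
    ultimately show ?case using add[of ?g "(- ?c) \<cdot>\<^sub>m ?d"] \<open>?g \<in> cartan n\<close> cartan_smult[OF d] by metis
  qed
  from this[of n h] show ?thesis using assms(1) by (meson linorder_not_less order_refl)
qed

lemma wt_add: "h \<in> cartan n \<Longrightarrow> g \<in> cartan n \<Longrightarrow> wt n y (g + h) = wt n y g + wt n y h"
proof -
  assume h: "h \<in> cartan n" "g \<in> cartan n"
  then have "(g + h) $$ (q, q) = g $$ (q, q) + h $$ (q, q)" if "q \<le> n" for q
    using that by (auto simp: cartan_iff)
  then show ?thesis using h unfolding wt_def by (simp add: cartan_add sum.distrib distrib_left)
qed

lemma wt_smult: "h \<in> cartan n \<Longrightarrow> wt n y (c \<cdot>\<^sub>m h) = c * wt n y h"
proof -
  assume h: "h \<in> cartan n"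
  then have "(c \<cdot>\<^sub>m h) $$ (q, q) = c * h $$ (q, q)" if "q \<le> n" for q
    using that by (auto simp: cartan_iff)
  then show ?thesis using h unfolding wt_def
    by (simp add: cartan_smult sum_distrib_left mult.left_commute)
qed

lemma wt_cartan_dual: "wt n y \<in> cartan_dual n"
  by (simp add: cartan_dual_def wt_add wt_smult) (simp add: wt_def)

lemma wt_coroot: "i \<in> {1..n} \<Longrightarrow> wt n y (coroot n i) = y (i - 1) - y i"
  using coroot_cartan[of i n] sum_coroot[of i n y] by (simp add: wt_def)

lemma cartan_dual_eqI:
  assumes "\<mu> \<in> cartan_dual n" "\<nu> \<in> cartan_dual n" "\<And>i. i \<in> {1..n} \<Longrightarrow> \<mu> (coroot n i) = \<nu> (coroot n i)"
  shows "\<mu> = \<nu>"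
proof
  fix h
  show "\<mu> h = \<nu> h"
  proof (cases "h \<in> cartan n")
    case True
    then show ?thesis
    proof (induction rule: cartan_induct)
      have "\<mu> (0 \<cdot>\<^sub>m h) = 0" "\<nu> (0 \<cdot>\<^sub>m h) = 0" using True assms by (auto simp: cartan_dual_def)
      moreover have "0 \<cdot>\<^sub>m h = 0\<^sub>m (Suc n) (Suc n)" using True by (intro eq_matI) (auto simp: cartan_iff)
      ultimately show "\<mu> (0\<^sub>m (Suc n) (Suc n)) = \<nu> (0\<^sub>m (Suc n) (Suc n))" by simp
    qed (use assms in \<open>auto simp: cartan_dual_def\<close>)
  qed (use assms in \<open>auto simp: cartan_dual_def\<close>)
qed

text \<open>The representative whose last diagonal coordinate vanishes. It is defined for any
  function, not only for weights, which \<open>refl_word_cong\<close> exploits.\<close>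

definition coords :: "nat \<Rightarrow> weight \<Rightarrow> nat \<Rightarrow> complex" where
  "coords n \<mu> q = (\<Sum>j\<in>{q<..n}. \<mu> (coroot n j))"

lemma coords_diff: "i \<in> {1..n} \<Longrightarrow> coords n \<mu> (i - 1) - coords n \<mu> i = \<mu> (coroot n i)"
proof -
  assume "i \<in> {1..n}"
  then have "{i - 1<..n} = insert i {i<..n}" by auto
  then show ?thesis by (simp add: coords_def)
qed

lemma wt_coords: "\<mu> \<in> cartan_dual n \<Longrightarrow> wt n (coords n \<mu>) = \<mu>"
  by (rule cartan_dual_eqI) (auto simp: wt_cartan_dual wt_coroot coords_diff simp del: One_nat_def)

lemma integral_wi:
  assumes "\<mu> \<in> cartan_dual n" "\<And>i. i \<in> {1..n} \<Longrightarrow> \<mu> (coroot n i) = of_int (z i)"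
  shows "\<mu> = wi n (\<lambda>q. \<Sum>j\<in>{q<..n}. z j)"
proof -
  have "coords n \<mu> q = of_int (\<Sum>j\<in>{q<..n}. z j)" for q
    using assms(2) unfolding coords_def of_int_sum by (intro sum.cong) auto
  then have "coords n \<mu> = (\<lambda>q. of_int (\<Sum>j\<in>{q<..n}. z j))" by auto
  then show ?thesis using wt_coords[OF assms(1)] by (simp add: wi_def)
qed

lemma wt_eq_iff: "wt n y = wt n z \<longleftrightarrow> (\<forall>q\<le>n. y q - z q = y n - z n)"
proof
  assume eq: "wt n y = wt n z"
  have st: "y (i - 1) - z (i - 1) = y i - z i" if "i \<in> {1..n}" for i
    using wt_coroot[OF that, of y] wt_coroot[OF that, of z] eq by (simp add: algebra_simps)
  show "\<forall>q\<le>n. y q - z q = y n - z n"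
  proof (intro allI impI)
    fix q assume "q \<le> n"
    then show "y q - z q = y n - z n"
    proof (induction rule: inc_induct)
      case (step m)
      have "y m - z m = y (Suc m) - z (Suc m)" using st[of "Suc m"] step.hyps by auto
      then show ?case using step.IH by (rule trans)
    qed simp
  qed
next
  assume eq: "\<forall>q\<le>n. y q - z q = y n - z n"
  show "wt n y = wt n z"
  proof (rule cartan_dual_eqI)
    fix i assume i: "i \<in> {1..n}"
    then have "i - 1 \<le> n" "i \<le> n" by auto
    then have "y (i - 1) - z (i - 1) = y i - z i" using eq by metis
    then show "wt n y (coroot n i) = wt n z (coroot n i)" using i by (simp add: wt_coroot algebra_simps)
  qed (rule wt_cartan_dual)+
qed

lemma wi_eq_iff: "wi n a = wi n b \<longleftrightarrow> (\<forall>q\<le>n. a q - b q = a n - b n)"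
  unfolding wi_def wt_eq_iff of_int_diff[symmetric] of_int_eq_iff ..

text \<open>The root carried by the matrix unit in position \<open>(p, q)\<close>; it is positive
  for \<open>p < q\<close>.\<close>

definition rt :: "nat \<Rightarrow> nat \<Rightarrow> nat \<Rightarrow> weight" where
  "rt n p q = wi n (\<lambda>k. (if k = p then 1 else 0) - (if k = q then 1 else 0))"

lemma rt_apply: "p \<le> n \<Longrightarrow> q \<le> n \<Longrightarrow> h \<in> cartan n \<Longrightarrow> rt n p q h = h $$ (p, p) - h $$ (q, q)"
proof -
  assume a: "p \<le> n" "q \<le> n" "h \<in> cartan n"
  have "rt n p q h = (\<Sum>k\<le>n. (if k = p then h $$ (k, k) else 0) - (if k = q then h $$ (k, k) else 0))"
    using a(3) by (auto simp: rt_def wi_def wt_def intro!: sum.cong)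
  then show ?thesis using a by (simp add: sum_subtractf)
qed

lemma simple_root_rt: "i \<in> {1..n} \<Longrightarrow> simple_root n i = rt n (i - 1) i"
proof
  fix h assume "i \<in> {1..n}"
  then show "simple_root n i h = rt n (i - 1) i h"
    by (cases "h \<in> cartan n") (auto simp: simple_root_def rt_apply, simp add: rt_def wi_def wt_def)
qed

lemma wt_plus: "wt n y h + wt n z h = wt n (\<lambda>q. y q + z q) h"
  and wt_minus: "wt n y h - wt n z h = wt n (\<lambda>q. y q - z q) h"
  and wt_uminus: "- wt n y h = wt n (\<lambda>q. - y q) h"
  and wt_scale: "c * wt n y h = wt n (\<lambda>q. c * y q) h"
  by (auto simp: wt_def sum.distrib sum_subtractf sum_negf sum_distrib_left algebra_simps)

lemma wi_plus: "wi n a h + wi n b h = wi n (\<lambda>q. a q + b q) h"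
  and wi_minus: "wi n a h - wi n b h = wi n (\<lambda>q. a q - b q) h"
  and wi_uminus: "- wi n a h = wi n (\<lambda>q. - a q) h"
  and wi_scale: "of_int c * wi n a h = wi n (\<lambda>q. c * a q) h"
  by (simp_all add: wi_def wt_plus wt_minus wt_uminus wt_scale)

lemma wi_cartan_dual: "wi n a \<in> cartan_dual n"
  by (simp add: wi_def wt_cartan_dual)

lemma wi_coroot: "i \<in> {1..n} \<Longrightarrow> wi n a (coroot n i) = of_int (a (i - 1) - a i)"
  by (simp add: wi_def wt_coroot)

section \<open>Reflections as permutations of the coordinates\<close>

lemma simple_refl_wt:
  assumes i: "i \<in> {1..n}"
  shows "simple_refl n i (wt n y) = wt n (y \<circ> transpose (i - 1) i)"
proof
  fix h
  show "simple_refl n i (wt n y) h = wt n (y \<circ> transpose (i - 1) i) h"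
    unfolding simple_refl_def wt_coroot[OF i] simple_root_rt[OF i] rt_def wi_def wt_scale wt_minus
    by (rule fun_cong[of _ _ h]) (use i in \<open>auto simp: wt_eq_iff transpose_def\<close>)
qed

text \<open>Permutations act on coordinates by precomposition, so the order of the letters is
  reversed: the first letter, which is the last reflection applied, becomes the innermost
  transposition.\<close>

primrec pw :: "nat list \<Rightarrow> nat \<Rightarrow> nat" where
  "pw [] = id"
| "pw (i # is) = pw is \<circ> transpose (i - 1) i"

lemma refl_word_Nil [simp]: "refl_word n [] \<mu> = \<mu>"
  and refl_word_Cons [simp]: "refl_word n (i # is) \<mu> = simple_refl n i (refl_word n is \<mu>)"
  and refl_word_append: "refl_word n (is @ js) \<mu> = refl_word n is (refl_word n js \<mu>)"
  by (simp_all add: refl_word_def)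

lemma refl_word_wt: "set is \<subseteq> {1..n} \<Longrightarrow> refl_word n is (wt n y) = wt n (y \<circ> pw is)"
  by (induction "is") (auto simp: simple_refl_wt comp_assoc simp del: One_nat_def)

lemma refl_word_wi: "set is \<subseteq> {1..n} \<Longrightarrow> refl_word n is (wi n a) = wi n (a \<circ> pw is)"
  by (simp add: wi_def refl_word_wt comp_def)

lemma pw_append: "pw (is @ js) = pw js \<circ> pw is"
  by (induction "is") (auto simp: comp_assoc)

lemma pw_permutes: "set is \<subseteq> {1..n} \<Longrightarrow> pw is permutes {..n}"
proof (induction "is")
  case (Cons i "is")
  then show ?case unfolding pw.simps by (intro permutes_compose permutes_swap_id) auto
qed (simp add: permutes_id)

lemma pw_rev: "pw (rev is) \<circ> pw is = id" "pw is \<circ> pw (rev is) = id"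
proof -
  have 1: "pw (rev is) \<circ> pw is = id" for "is"
  proof (induction "is")
    case (Cons i "is")
    have eq: "pw (rev (i # is)) \<circ> pw (i # is) = transpose (i - 1) i \<circ> (pw (rev is) \<circ> pw is) \<circ> transpose (i - 1) i"
      by (simp add: pw_append comp_assoc)
    show ?case unfolding eq Cons.IH by (simp add: fun_eq_iff)
  qed simp
  show "pw (rev is) \<circ> pw is = id" "pw is \<circ> pw (rev is) = id" using 1[of "is"] 1[of "rev is"] by auto
qed

lemma simple_refl_simple_refl:
  assumes "i \<in> {1..n}" shows "simple_refl n i (simple_refl n i \<mu>) = \<mu>"
proof -
  have "simple_root n i (coroot n i) = 2"
    using assms coroot_cartan[OF assms] by (auto simp: simple_root_def coroot_index)
  then show ?thesis by (auto simp: simple_refl_def fun_eq_iff)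
qed

lemma refl_word_rev: "set is \<subseteq> {1..n} \<Longrightarrow> refl_word n (rev is) (refl_word n is \<mu>) = \<mu>"
  by (induction "is") (auto simp: refl_word_append simple_refl_simple_refl simp del: One_nat_def)

text \<open>Words act on arbitrary functions, so equality in \<open>weyl_group n\<close> is tested on those; a function
  differs from a weight by one that vanishes on all coroots and is fixed by every reflection.\<close>
lemma refl_word_cong:
  assumes w: "set is \<subseteq> {1..n}" "set js \<subseteq> {1..n}" and eq: "pw is = pw js"
  shows "refl_word n is = refl_word n js"
proof
  fix \<mu>
  let ?\<nu> = "wt n (coords n \<mu>)"
  have "refl_word n is \<mu> = (\<lambda>h. refl_word n is ?\<nu> h + (\<mu> h - ?\<nu> h))" if "set is \<subseteq> {1..n}" for "is"
    using that
  proof (induction "is")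
    case (Cons i "is")
    then have i: "i \<in> {1..n}" by auto
    have "\<mu> (coroot n i) = ?\<nu> (coroot n i)" using wt_coroot[OF i] coords_diff[OF i] by metis
    then have "(\<lambda>h. refl_word n is ?\<nu> h + (\<mu> h - ?\<nu> h)) (coroot n i) = refl_word n is ?\<nu> (coroot n i)" by simp
    then show ?case using Cons by (auto simp: simple_refl_def fun_eq_iff)
  qed simp
  from this[OF w(1)] this[OF w(2)] show "refl_word n is \<mu> = refl_word n js \<mu>"
    using refl_word_wt[OF w(1), of "coords n \<mu>"] refl_word_wt[OF w(2), of "coords n \<mu>"] eq by simp
qed

subsection \<open>Ascents\<close>

text \<open>The inversions with respect to the dominant, that is weakly decreasing, order of the
  coordinates. Their number turns out to be the length of a shortest sorting word.\<close>

definition asc :: "nat \<Rightarrow> (nat \<Rightarrow> int) \<Rightarrow> (nat \<times> nat) set" where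
  "asc n a = {(p, q). p < q \<and> q \<le> n \<and> a p < a q}"

lemma asc_finite [simp]: "finite (asc n a)"
  by (rule finite_subset[of _ "{..n} \<times> {..n}"]) (auto simp: asc_def)

text \<open>Swapping neighbours preserves the relative order of every other pair of positions, so
  the transposition itself matches the ascents of both sequences except for the pair
  \<open>(i - 1, i)\<close>.\<close>

lemma card_asc_swap:
  assumes i: "i \<in> {1..n}" and lt: "a (i - 1) < a i"
  shows "card (asc n a) = Suc (card (asc n (a \<circ> transpose (i - 1) i)))"
proof -
  let ?t = "transpose (i - 1) i" let ?b = "a \<circ> ?t"
  have t: "?t k \<le> n \<longleftrightarrow> k \<le> n" for k using i by (auto simp: transpose_def)
  have o: "?t p < ?t q" if "p < q" "(p, q) \<noteq> (i - 1, i)" for p q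
    using that i by (auto simp: transpose_def split: if_splits)
  have "bij_betw (map_prod ?t ?t) (asc n ?b) (asc n a - {(i - 1, i)})"
  proof (rule bij_betwI[where g = "map_prod ?t ?t"])
    show "map_prod ?t ?t \<in> asc n ?b \<rightarrow> asc n a - {(i - 1, i)}"
    proof
      fix x assume "x \<in> asc n ?b"
      then obtain p q where x: "x = (p, q)" and pq: "p < q" "q \<le> n" "a (?t p) < a (?t q)"
        by (auto simp: asc_def)
      have ne: "(p, q) \<noteq> (i - 1, i)" using pq lt by auto
      have "(?t p, ?t q) \<noteq> (i - 1, i)"
      proof
        assume "(?t p, ?t q) = (i - 1, i)"
        then have "p = i" "q = i - 1"
          by (metis prod.inject transpose_involutory transpose_apply_first transpose_apply_second)+
        then show False using pq by auto
      qed
      then show "map_prod ?t ?t x \<in> asc n a - {(i - 1, i)}"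
        using o[OF pq(1) ne] pq t x by (simp add: asc_def del: One_nat_def)
    qed
    show "map_prod ?t ?t \<in> asc n a - {(i - 1, i)} \<rightarrow> asc n ?b"
      using o t by (auto simp: asc_def simp del: One_nat_def)
  qed auto
  then have "card (asc n ?b) = card (asc n a - {(i - 1, i)})" by (rule bij_betw_same_card)
  moreover have "(i - 1, i) \<in> asc n a" using i lt by (auto simp: asc_def)
  ultimately show ?thesis by (metis asc_finite card_Suc_Diff1)
qed

text \<open>One letter changes the number of ascents by at most one. This is the lower bound for the
  length of a Weyl group element.\<close>

lemma asc_length:
  assumes "set is \<subseteq> {1..n}"
  shows "card (asc n (a \<circ> pw is)) \<le> length is + card (asc n a)"
  using assms
proof (induction "is")
  case (Cons i "is")
  then have i: "i \<in> {1..n}" by auto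
  let ?b = "a \<circ> pw is"
  have eq: "a \<circ> pw (i # is) = ?b \<circ> transpose (i - 1) i" by (simp add: comp_assoc)
  consider "?b (i - 1) < ?b i" | "?b i < ?b (i - 1)" | "?b (i - 1) = ?b i" by linarith
  then have "card (asc n (?b \<circ> transpose (i - 1) i)) \<le> Suc (card (asc n ?b))"
  proof cases
    case 2
    then show ?thesis using card_asc_swap[OF i, of "?b \<circ> transpose (i - 1) i"] by (simp add: comp_assoc)
  next
    case 3
    then have "?b \<circ> transpose (i - 1) i = ?b" by (auto simp: transpose_def fun_eq_iff)
    then show ?thesis by simp
  qed (use card_asc_swap[OF i, of ?b] in simp)
  moreover have "set is \<subseteq> {1..n}" using Cons.prems by simp
  then have "card (asc n ?b) \<le> length is + card (asc n a)" by (rule Cons.IH)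
  moreover have "length (i # is) = Suc (length is)" by simp
  ultimately show ?case unfolding eq by linarith
qed simp

text \<open>Bubble sort: as long as there is an ascent there is one between neighbours, and swapping
  these removes exactly one.\<close>

lemma sorting_word:
  "\<exists>is. set is \<subseteq> {1..n} \<and> length is = card (asc n a) \<and> (\<forall>p q. p \<le> q \<and> q \<le> n \<longrightarrow> a (pw is q) \<le> a (pw is p))"
proof (induction "card (asc n a)" arbitrary: a)
  case 0
  then have "asc n a = {}" by simp
  then have "\<not> a p < a q" if "p < q" "q \<le> n" for p q using that by (auto simp: asc_def)
  then have "a q \<le> a p" if "p \<le> q" "q \<le> n" for p q
    using that by (metis linorder_not_less nat_less_le order_refl)
  then show ?case using 0 by (intro exI[of _ "[]"]) auto
next
  case (Suc m)
  have "\<exists>i\<in>{1..n}. a (i - 1) < a i"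
  proof (rule ccontr)
    assume "\<not> ?thesis"
    then have s: "a (Suc j) \<le> a j" if "Suc j \<le> n" for j using that by force
    have le: "a q \<le> a p" if "p \<le> q" "q \<le> n" for p q
      using that by (induction rule: dec_induct) (use s order_trans in force)+
    have "asc n a = {}" by (auto simp: asc_def) (meson le less_imp_le not_less)
    then show False using Suc by simp
  qed
  then obtain i where i: "i \<in> {1..n}" "a (i - 1) < a i" by blast
  let ?b = "a \<circ> transpose (i - 1) i"
  have "m = card (asc n ?b)" using card_asc_swap[of i n a] i Suc by simp
  then obtain js where js: "set js \<subseteq> {1..n}" "length js = card (asc n ?b)"
    "\<forall>p q. p \<le> q \<and> q \<le> n \<longrightarrow> ?b (pw js q) \<le> ?b (pw js p)" using Suc(1) by blast
  have "a (pw (js @ [i]) p) = ?b (pw js p)" for p by (simp add: pw_append)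
  then show ?case using js i card_asc_swap[of i n a] by (intro exI[of _ "js @ [i]"]) auto
qed

text \<open>The values drop by at least one at each step and must fit into \<open>{..n}\<close>.
  Counting from the left end gives \<open>p k + k \<le> n\<close>, counting from the right end the
  opposite bound.\<close>

lemma decreasing_permutation:
  assumes p: "p permutes {..n::nat}" and dec: "\<And>j k. j \<le> k \<Longrightarrow> k \<le> n \<Longrightarrow> p k \<le> p j"
  shows "k \<le> n \<Longrightarrow> p k = n - k"
proof -
  have le: "p k \<le> n" if "k \<le> n" for k using p that permutes_in_image[OF p, of k] by auto
  have s: "p (Suc k) < p k" if "Suc k \<le> n" for k
    using dec[of k "Suc k"] that permutes_inj[OF p] by (metis injD le_add2 le_neq_implies_less n_not_Suc_n plus_1_eq_Suc)
  have u: "p k + k \<le> n" if "k \<le> n" for k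
    using that
  proof (induction k)
    case (Suc k) then show ?case using s[of k] by simp
  qed (use le in auto)
  have l: "n \<le> p k + k" if "k \<le> n" for k
    using that
  proof (induction rule: inc_induct)
    case (step k) then show ?case using s[of k] by simp
  qed simp
  show "k \<le> n \<Longrightarrow> p k = n - k" using u[of k] l[of k] by simp
qed

text \<open>The permutation of the longest element in type A, continued by the identity so that it
  is an involution of all natural numbers.\<close>

definition rv :: "nat \<Rightarrow> nat \<Rightarrow> nat" where "rv n q = (if q \<le> n then n - q else q)"

lemma rv_rv [simp]: "rv n (rv n q) = q" by (simp add: rv_def)

lemma rv_word: "\<exists>is. set is \<subseteq> {1..n} \<and> pw is = rv n"
proof -
  obtain "is" where i: "set is \<subseteq> {1..n}" "\<forall>p q. p \<le> q \<and> q \<le> n \<longrightarrow> int (pw is q) \<le> int (pw is p)"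
    using sorting_word[of n int] by blast
  note P = pw_permutes[OF i(1)]
  have "pw is q = rv n q" for q
    using decreasing_permutation[OF P, of q] i(2) permutes_not_in[OF P, of q] by (auto simp: rv_def)
  then show ?thesis using i(1) by blast
qed

subsection \<open>The longest element\<close>

text \<open>The length is the number of inversions. A word \<open>js\<close> that sorts the
  permutation with that many letters is inverse to it, and no word is shorter by
  \<open>asc_length\<close>.\<close>

lemma weyl_length_word:
  assumes w: "set is \<subseteq> {1..n}"
  shows "weyl_length n (refl_word n is) = card (asc n (\<lambda>q. - int (pw is q)))"
  unfolding weyl_length_def
proof (rule Least_equality)
  let ?a = "\<lambda>q. - int (pw is q)"
  obtain js where js: "set js \<subseteq> {1..n}" "length js = card (asc n ?a)"
      "\<forall>p q. p \<le> q \<and> q \<le> n \<longrightarrow> ?a (pw js q) \<le> ?a (pw js p)" using sorting_word[of n ?a] by blast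
  \<comment> \<open>After sorting, \<open>pw is \<circ> pw js\<close> is increasing; composition
    with the reversal makes \<open>decreasing_permutation\<close> applicable.\<close>
  let ?p = "rv n \<circ> (pw is \<circ> pw js)"
  have q: "pw is \<circ> pw js permutes {..n}" using w js by (intro permutes_compose pw_permutes)
  obtain rs where rs: "set rs \<subseteq> {1..n}" "pw rs = rv n" using rv_word by blast
  have p: "?p permutes {..n}" using permutes_compose[OF q pw_permutes[OF rs(1)]] rs by simp
  have "pw is (pw js k) = k" for k
  proof (cases "k \<le> n")
    case True
    have "?p k = n - k"
    proof (rule decreasing_permutation[OF p _ True])
      fix i k assume ik: "i \<le> k" "k \<le> n"
      then have "pw is (pw js i) \<le> pw is (pw js k)" using js(3) by auto
      moreover have "pw is (pw js k) \<le> n" using permutes_in_image[OF q, of k] ik by simp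
      ultimately show "?p k \<le> ?p i" by (auto simp: rv_def)
    qed
    then show ?thesis using permutes_in_image[OF q, of k] True by (auto simp: rv_def split: if_splits)
  next
    case False
    then show ?thesis using permutes_not_in[OF q, of k] by simp
  qed
  then have "pw is \<circ> pw js = id" by auto
  then have "pw is = pw (rev js)" using pw_rev(2)[of js] by (metis comp_assoc comp_id id_comp)
  then have "refl_word n (rev js) = refl_word n is" using js w by (intro refl_word_cong) auto
  then show "\<exists>js\<in>lists {1..n}. length js = card (asc n ?a) \<and> refl_word n js = refl_word n is"
    using js by (intro bexI[of _ "rev js"]) auto
next
  fix k assume "\<exists>js\<in>lists {1..n}. length js = k \<and> refl_word n js = refl_word n is"
  then obtain js where js: "set js \<subseteq> {1..n}" "length js = k" "refl_word n js = refl_word n is" by auto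
  \<comment> \<open>Testing on one regular weight suffices. It determines the permutation on
    \<open>{..n}\<close> only up to an additive constant, but ascents are insensitive to
    that.\<close>
  have eq: "wi n (\<lambda>q. - int (pw js q)) = wi n (\<lambda>q. - int (pw is q))"
    using refl_word_wt[OF js(1), of "\<lambda>q. of_int (- int q)"] refl_word_wt[OF w, of "\<lambda>q. of_int (- int q)"] js(3)
    by (simp add: comp_def wi_def)
  have c: "\<forall>q\<le>n. int (pw is q) - int (pw js q) = int (pw is n) - int (pw js n)"
  proof (intro allI impI)
    fix q assume "q \<le> n"
    then have "- int (pw js q) - (- int (pw is q)) = - int (pw js n) - (- int (pw is n))"
      using eq unfolding wi_eq_iff by blast
    then show "int (pw is q) - int (pw js q) = int (pw is n) - int (pw js n)" by linarith
  qed
  have "asc n (\<lambda>q. - int (pw is q)) = asc n ((\<lambda>q. - int q) \<circ> pw js)"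
  proof -
    have "- int (pw is p) < - int (pw is q) \<longleftrightarrow> - int (pw js p) < - int (pw js q)" if "p \<le> n" "q \<le> n" for p q
      using c[rule_format, OF that(1)] c[rule_format, OF that(2)] by linarith
    then show ?thesis unfolding asc_def by auto
  qed
  moreover have id: "asc n (\<lambda>q. - int q) = {}" by (auto simp: asc_def)
  ultimately show "card (asc n (\<lambda>q. - int (pw is q))) \<le> k"
    using asc_length[OF js(1), of "\<lambda>q. - int q"] js(2) id by simp
qed

text \<open>Reversal turns every pair of positions into an ascent. A permutation with that many
  ascents is strictly decreasing, hence the reversal itself, which gives the uniqueness demanded by
  the description operator.\<close>

lemma longest_element_word:
  assumes "set is \<subseteq> {1..n}" "pw is = rv n"
  shows "longest_element n = refl_word n is"
  unfolding longest_element_def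
proof (rule the_equality)
  let ?all = "{(p, q). p < q \<and> q \<le> n}"
  have fin: "finite ?all" by (rule finite_subset[of _ "{..n} \<times> {..n}"]) auto
  have top: "asc n (\<lambda>q. - int (pw is q)) = ?all" unfolding assms(2) by (auto simp: asc_def rv_def)
  have le: "asc n a \<subseteq> ?all" for a by (auto simp: asc_def)
  show "refl_word n is \<in> weyl_group n \<and> (\<forall>v\<in>weyl_group n. weyl_length n v \<le> weyl_length n (refl_word n is))"
  proof safe
    show "refl_word n is \<in> weyl_group n" using assms by (auto simp: weyl_group_def)
    fix v assume "v \<in> weyl_group n"
    then obtain js where "set js \<subseteq> {1..n}" "v = refl_word n js" by (auto simp: weyl_group_def)
    then show "weyl_length n v \<le> weyl_length n (refl_word n is)"
      unfolding weyl_length_word[OF assms(1)] top using weyl_length_word card_mono[OF fin le] by metis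
  qed
  fix w assume w: "w \<in> weyl_group n \<and> (\<forall>v\<in>weyl_group n. weyl_length n v \<le> weyl_length n w)"
  then obtain js where js: "set js \<subseteq> {1..n}" "w = refl_word n js" by (auto simp: weyl_group_def)
  have "refl_word n is \<in> weyl_group n" using assms by (auto simp: weyl_group_def)
  then have "card ?all \<le> card (asc n (\<lambda>q. - int (pw js q)))"
    using w js assms weyl_length_word[of "is"] weyl_length_word[of js] top by auto
  then have "asc n (\<lambda>q. - int (pw js q)) = ?all" using le fin by (intro card_subset_eq) (auto intro: card_mono antisym)
  then have d: "pw js q < pw js p" if "p < q" "q \<le> n" for p q using that by (auto simp: asc_def)
  note P = pw_permutes[OF js(1)]
  have "pw js k \<le> pw js j" if "j \<le> k" "k \<le> n" for j k using d[of j k] that by (cases "j = k") auto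
  then have "pw js q = rv n q" for q
    using decreasing_permutation[OF P, of q] permutes_not_in[OF P, of q] by (auto simp: rv_def)
  then have "pw js = pw is" using assms by auto
  then show "w = refl_word n is" using js assms refl_word_cong by metis
qed

lemma longest_element_wt: "longest_element n (wt n y) = wt n (y \<circ> rv n)"
  using rv_word[of n] longest_element_word refl_word_wt by metis

subsection \<open>Root lattice and saturated cells\<close>

lemma wt_sum: "(\<Sum>i\<in>I. wt n (f i) h) = wt n (\<lambda>q. \<Sum>i\<in>I. f i q) h"
proof (cases "h \<in> cartan n")
  case True
  then show ?thesis by (simp add: wt_def sum_distrib_right) (rule sum.swap)
qed (simp add: wt_def)

text \<open>Diagonal coordinates of the combination of simple roots with coefficients
  \<open>c\<close>. The \<open>i\<close>-th root contributes \<open>+1\<close> at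
  \<open>i - 1\<close> and \<open>-1\<close> at \<open>i\<close>, so partial sums of the coordinates
  recover the coefficients.\<close>

definition root_coords :: "nat \<Rightarrow> (nat \<Rightarrow> int) \<Rightarrow> nat \<Rightarrow> int" where
  "root_coords n c q = (if q < n then c (Suc q) else 0) - (if q = 0 then 0 else c q)"

lemma root_sum: "(\<lambda>h. \<Sum>i=1..n. of_int (c i) * simple_root n i h) = wi n (root_coords n c)"
proof
  fix h
  have "(\<Sum>i=1..n. of_int (c i) * simple_root n i h) =
      (\<Sum>i=1..n. wt n (\<lambda>q. of_int (c i) * of_int ((if q = i - 1 then 1 else 0) - (if q = i then 1 else 0))) h)"
    by (intro sum.cong) (auto simp: simple_root_rt rt_def wi_def wt_scale simp del: One_nat_def)
  also have "\<dots> = wt n (\<lambda>q. \<Sum>i=1..n. of_int (c i) * of_int ((if q = i - 1 then 1 else 0) - (if q = i then 1 else 0))) h"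
    by (rule wt_sum)
  also have "(\<lambda>q. \<Sum>i=1..n. of_int (c i) * of_int ((if q = i - 1 then 1 else 0) - (if q = i then 1 else 0)) :: complex)
      = (\<lambda>q. of_int ((if q < n then c (Suc q) else 0) - (if q = 0 \<or> n < q then 0 else c q)))"
  proof
    fix q
    have "(\<Sum>i=1..n. of_int (c i) * of_int ((if q = i - 1 then 1 else 0) - (if q = i then 1 else 0)) :: complex)
      = (\<Sum>i=1..n. (if i = Suc q then of_int (c i) else 0) - (if i = q then of_int (c i) else 0))"
      by (intro sum.cong) auto
    then show "(\<Sum>i=1..n. of_int (c i) * of_int ((if q = i - 1 then 1 else 0) - (if q = i then 1 else 0)) :: complex)
      = of_int ((if q < n then c (Suc q) else 0) - (if q = 0 \<or> n < q then 0 else c q))"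
      by (auto simp: sum_subtractf)
  qed
  also have "wt n \<dots> h = wi n (root_coords n c) h"
    unfolding wi_def[symmetric] by (rule fun_cong[of _ _ h]) (auto simp: wi_eq_iff root_coords_def)
  finally show "(\<Sum>i=1..n. of_int (c i) * simple_root n i h) = wi n (root_coords n c) h" .
qed

lemma root_coords_partial: "i \<le> n \<Longrightarrow> (\<Sum>q<i. root_coords n c q) = (if i = 0 then 0 else c i)"
  by (induction i) (auto simp: root_coords_def)

lemma root_coords_total: "(\<Sum>q\<le>n. root_coords n c q) = 0"
  using root_coords_partial[of n n c] by (auto simp: lessThan_Suc_atMost[symmetric] root_coords_def)

lemma root_coords_inverse:
  "(\<Sum>q\<le>n. z q) = 0 \<Longrightarrow> q \<le> n \<Longrightarrow> root_coords n (\<lambda>i. \<Sum>q<i. z q) q = z q"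
  by (auto simp: root_coords_def lessThan_Suc_atMost[symmetric])

text \<open>Membership in the cone of the positive roots: the sum of the first \<open>i\<close>
  coordinates is the coefficient of the \<open>i\<close>-th simple root.\<close>

definition pos_coords :: "nat \<Rightarrow> (nat \<Rightarrow> int) \<Rightarrow> bool" where
  "pos_coords n z \<longleftrightarrow> (\<Sum>q\<le>n. z q) = 0 \<and> (\<forall>i\<le>n. 0 \<le> (\<Sum>q<i. z q))"

lemma wi_cong: "(\<And>q. q \<le> n \<Longrightarrow> a q = b q) \<Longrightarrow> wi n a = wi n b"
  by (simp add: wi_eq_iff)

lemma root_lattice_eq: "root_lattice n = {wi n z | z. (\<Sum>q\<le>n. z q) = 0}"
proof
  show "root_lattice n \<subseteq> {wi n z | z. (\<Sum>q\<le>n. z q) = 0}"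
    unfolding root_lattice_def root_sum using root_coords_total by blast
  show "{wi n z | z. (\<Sum>q\<le>n. z q) = 0} \<subseteq> root_lattice n"
  proof safe
    fix z assume z: "(\<Sum>q\<le>n. z q) = (0::int)"
    have "wi n z = wi n (root_coords n (\<lambda>i. \<Sum>q<i. z q))"
      by (rule wi_cong) (use root_coords_inverse z in simp)
    then show "wi n z \<in> root_lattice n" unfolding root_lattice_def root_sum by auto
  qed
qed

lemma root_lattice_pos_eq: "root_lattice_pos n = {wi n z | z. pos_coords n z}"
proof
  show "root_lattice_pos n \<subseteq> {wi n z | z. pos_coords n z}"
  proof
    fix \<mu> assume "\<mu> \<in> root_lattice_pos n"
    then obtain c :: "nat \<Rightarrow> nat" where "\<mu> = (\<lambda>h. \<Sum>i=1..n. of_int (int (c i)) * simple_root n i h)"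
      by (auto simp: root_lattice_pos_def)
    then have "\<mu> = wi n (root_coords n (\<lambda>i. int (c i)))" by (simp only: root_sum)
    moreover have "pos_coords n (root_coords n (\<lambda>i. int (c i)))"
      by (auto simp: pos_coords_def root_coords_total root_coords_partial)
    ultimately show "\<mu> \<in> {wi n z | z. pos_coords n z}" by blast
  qed
  show "{wi n z | z. pos_coords n z} \<subseteq> root_lattice_pos n"
  proof safe
    fix z assume z: "pos_coords n z"
    let ?c = "\<lambda>i. \<Sum>q<i. z q"
    have "wi n z = wi n (root_coords n ?c)"
      by (rule wi_cong) (use root_coords_inverse z in \<open>simp add: pos_coords_def\<close>)
    also have "\<dots> = (\<lambda>h. \<Sum>i=1..n. of_nat (nat (?c i)) * simple_root n i h)"
      unfolding root_sum[symmetric] using z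
      by (intro ext sum.cong) (auto simp: pos_coords_def)
    finally show "wi n z \<in> root_lattice_pos n" unfolding root_lattice_pos_def
      by (intro CollectI exI[of _ "\<lambda>i. nat (?c i)"] conjI TrueI)
  qed
qed

lemma pos_coords_unique:
  assumes "wi n z \<in> root_lattice_pos n" shows "\<exists>k. pos_coords n (\<lambda>q. z q - k)"
proof -
  obtain w where w: "wi n z = wi n w" "pos_coords n w" using assms by (auto simp: root_lattice_pos_eq)
  let ?k = "z n - w n"
  have eq: "z q - ?k = w q" if "q \<le> n" for q 
  proof -
    have "z q - w q = z n - w n" using w(1) that unfolding wi_eq_iff by blast
    then show ?thesis by linarith
  qed
  have "(\<Sum>q\<le>n. z q - ?k) = (\<Sum>q\<le>n. w q)" by (rule sum.cong) (use eq in auto)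
  moreover have "(\<Sum>q<i. z q - ?k) = (\<Sum>q<i. w q)" if "i \<le> n" for i
    by (rule sum.cong) (use eq that in auto)
  ultimately have "pos_coords n (\<lambda>q. z q - ?k)" using w(2) unfolding pos_coords_def by auto
  then show ?thesis by blast
qed

text \<open>The map \<open>- w0\<close> permutes the simple roots. In coordinates, an initial sum of
  the reversed sequence is a final sum of \<open>z\<close>, which is minus an initial sum because
  the total vanishes.\<close>

lemma pos_coords_rv: "pos_coords n z \<Longrightarrow> pos_coords n (\<lambda>q. - z (rv n q))"
proof -
  assume z: "pos_coords n z"
  have r: "(\<Sum>q<i. z (rv n q)) = (\<Sum>q\<in>{n + 1 - i..n}. z q)" if "i \<le> n + 1" for i
  proof (rule sum.reindex_bij_witness[where i = "rv n" and j = "rv n"])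
    fix q assume "q \<in> {..<i}" then show "rv n q \<in> {n + 1 - i..n}" using that by (auto simp: rv_def)
  next
    fix q assume "q \<in> {n + 1 - i..n}" then show "rv n q \<in> {..<i}" using that by (auto simp: rv_def)
  qed auto
  have s: "(\<Sum>q\<in>{n + 1 - i..n}. z q) + (\<Sum>q<n + 1 - i. z q) = (\<Sum>q\<le>n. z q)" for i
  proof -
    have e: "{..n} = {n + 1 - i..n} \<union> {..<n + 1 - i}" by auto
    show ?thesis unfolding e by (rule sum.union_disjoint[symmetric]) auto
  qed
  have "0 \<le> (\<Sum>q<i. - z (rv n q))" if "i \<le> n" for i
  proof (cases "i = 0")
    case False
    then have "0 \<le> (\<Sum>q<n + 1 - i. z q)" using z by (simp add: pos_coords_def)
    then show ?thesis using r[of i] s[of i] z that by (simp add: sum_negf pos_coords_def)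
  qed simp
  moreover have "(\<Sum>q\<le>n. - z (rv n q)) = 0"
    using r[of "n + 1"] z by (simp add: sum_negf pos_coords_def lessThan_Suc_atMost atMost_atLeast0)
  ultimately show ?thesis by (simp add: pos_coords_def)
qed

lemma root_lattice_pos_rv:
  assumes "wi n z \<in> root_lattice_pos n"
  shows "wi n (\<lambda>q. - z (rv n q)) \<in> root_lattice_pos n"
proof -
  obtain k where "pos_coords n (\<lambda>q. z q - k)" using pos_coords_unique[OF assms] by blast
  then have "pos_coords n (\<lambda>q. - (z (rv n q) - k))" using pos_coords_rv by fastforce
  moreover have "wi n (\<lambda>q. - z (rv n q)) = wi n (\<lambda>q. - (z (rv n q) - k))" by (simp add: wi_eq_iff)
  ultimately show ?thesis unfolding root_lattice_pos_eq by blast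
qed

lemma pos_coords_add: "pos_coords n y \<Longrightarrow> pos_coords n z \<Longrightarrow> pos_coords n (\<lambda>q. y q + z q)"
  by (simp add: pos_coords_def sum.distrib)

lemma root_lattice_pos_add:
  assumes "\<mu> \<in> root_lattice_pos n" "\<nu> \<in> root_lattice_pos n"
  shows "(\<lambda>h. \<mu> h + \<nu> h) \<in> root_lattice_pos n"
proof -
  obtain y z where "\<mu> = wi n y" "\<nu> = wi n z" and p: "pos_coords n y" "pos_coords n z"
    using assms by (auto simp: root_lattice_pos_eq)
  then have "(\<lambda>h. \<mu> h + \<nu> h) = wi n (\<lambda>q. y q + z q)" by (simp add: wi_plus)
  then show ?thesis using pos_coords_add[OF p] by (auto simp: root_lattice_pos_eq)
qed

lemma pos_coords_rt: "p < q \<Longrightarrow> q \<le> n \<Longrightarrow> pos_coords n (\<lambda>k. (if k = p then 1 else 0) - (if k = q then 1 else 0))"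
  by (auto simp: pos_coords_def sum_subtractf)

lemma rt_pos: "p < q \<Longrightarrow> q \<le> n \<Longrightarrow> rt n p q \<in> root_lattice_pos n"
  unfolding rt_def root_lattice_pos_eq by (rule CollectI, rule exI, rule conjI[OF refl pos_coords_rt])

lemma zero_pos: "(\<lambda>h. 0) \<in> root_lattice_pos n"
proof -
  have "(\<lambda>h. 0) = wi n (\<lambda>q. 0)" by (auto simp: wi_def wt_def)
  then show ?thesis by (auto simp: root_lattice_pos_eq pos_coords_def)
qed

section \<open>Dominant weights, orbits and saturated cells\<close>

definition antitone :: "nat \<Rightarrow> (nat \<Rightarrow> int) \<Rightarrow> bool" where
  "antitone n a \<longleftrightarrow> (\<forall>p q. p \<le> q \<and> q \<le> n \<longrightarrow> a q \<le> a p)"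

lemma dominant_wi:
  assumes "\<mu> \<in> dominant_weights n" shows "\<exists>a. \<mu> = wi n a \<and> antitone n a"
proof -
  have d: "\<mu> \<in> cartan_dual n" using assms by (simp add: dominant_weights_def)
  have "\<forall>i\<in>{1..n}. \<exists>k. \<mu> (coroot n i) = of_nat k" using assms by (auto simp: dominant_weights_def Nats_def)
  then obtain k where k: "\<And>i. i \<in> {1..n} \<Longrightarrow> \<mu> (coroot n i) = of_nat (k i)" by metis
  then have "\<mu> = wi n (\<lambda>q. \<Sum>j\<in>{q<..n}. int (k j))" by (intro integral_wi d) simp
  moreover have "antitone n (\<lambda>q. \<Sum>j\<in>{q<..n}. int (k j))"
    unfolding antitone_def by (auto intro!: sum_mono2)
  ultimately show ?thesis by blast
qed

lemma wi_dominant: "antitone n a \<Longrightarrow> wi n a \<in> dominant_weights n"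
proof -
  assume a: "antitone n a"
  have "wi n a (coroot n i) \<in> \<nat>" if "i \<in> {1..n}" for i
  proof -
    have "0 \<le> a (i - 1) - a i" using a that by (auto simp: antitone_def)
    then have "wi n a (coroot n i) = of_nat (nat (a (i - 1) - a i))" using that by (simp add: wi_coroot)
    then show ?thesis by simp
  qed
  then show ?thesis by (simp add: dominant_weights_def wi_cartan_dual)
qed

text \<open>Exchange argument: the positions gained by the permutation carry values at most
  \<open>a i\<close>, the positions lost carry values at least \<open>a i\<close>, and there are
  equally many of both.\<close>

lemma antitone_partial_sum:
  assumes a: "antitone n a" and p: "p permutes {..n}" and i: "i \<le> n"
  shows "(\<Sum>q<i. a (p q)) \<le> (\<Sum>q<i. a q)"
proof -
  let ?T = "{..<i}" let ?P = "p ` ?T"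
  have inj: "inj_on p ?T" using permutes_inj[OF p] by (auto simp: inj_on_def)
  have P: "?P \<subseteq> {..n}" using permutes_in_image[OF p] i by force
  have "(\<Sum>q<i. a (p q)) = sum a ?P" using inj by (simp add: sum.reindex)
  also have "\<dots> = sum a (?P \<inter> ?T) + sum a (?P - ?T)" by (simp add: sum.Int_Diff)
  also have "sum a (?P - ?T) \<le> of_nat (card (?P - ?T)) * a i"
    using P a by (intro sum_bounded_above) (auto simp: antitone_def)
  also have "card (?P - ?T) = card (?T - ?P)"
  proof -
    have "card ?P = card ?T" using inj by (rule card_image)
    then show ?thesis using card_Diff_subset_Int[of ?P ?T] card_Diff_subset_Int[of ?T ?P]
      by (simp add: Int_commute)
  qed
  also have "of_nat (card (?T - ?P)) * a i \<le> sum a (?T - ?P)"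
    using i a by (intro sum_bounded_below) (auto simp: antitone_def)
  also have "sum a (?P \<inter> ?T) + sum a (?T - ?P) = sum a ?T"
    using sum.Int_Diff[of ?T a ?P] by (simp add: Int_commute)
  finally show ?thesis by simp
qed

lemma weyl_orbit_wi: "weyl_orbit n (wi n a) = {wi n (a \<circ> pw is) | is. set is \<subseteq> {1..n}}"
proof -
  have "weyl_orbit n (wi n a) = {refl_word n is (wi n a) | is. set is \<subseteq> {1..n}}"
    by (auto simp: weyl_orbit_def weyl_group_def)
  also have "\<dots> = {wi n (a \<circ> pw is) | is. set is \<subseteq> {1..n}}"
  proof (intro Collect_cong ex_cong1 rev_conj_cong refl)
    fix \<nu> "is"
    show "(\<nu> = refl_word n is (wi n a)) = (\<nu> = wi n (a \<circ> pw is))" if "set is \<subseteq> {1..n}"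
      unfolding refl_word_wi[OF that] ..
  qed
  finally show ?thesis .
qed

lemma conv_hull_Re_le:
  assumes "\<nu> \<in> conv_hull A" "\<And>\<mu>. \<mu> \<in> A \<Longrightarrow> Re (\<mu> h) \<le> B"
  shows "Re (\<nu> h) \<le> B"
proof -
  obtain S c where S: "finite S" "S \<subseteq> A" "\<forall>\<mu>\<in>S. 0 \<le> c \<mu>" "sum c S = (1::real)"
    and \<nu>: "\<nu> = (\<lambda>h. \<Sum>\<mu>\<in>S. complex_of_real (c \<mu>) * \<mu> h)" using assms(1) by (auto simp: conv_hull_def)
  have "Re (\<nu> h) = (\<Sum>\<mu>\<in>S. c \<mu> * Re (\<mu> h))" by (simp add: \<nu>)
  also have "\<dots> \<le> (\<Sum>\<mu>\<in>S. c \<mu> * B)" using S assms(2) by (intro sum_mono mult_left_mono) auto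
  also have "\<dots> = B" using S(4) by (simp add: sum_distrib_right[symmetric])
  finally show ?thesis .
qed

lemma conv_hull_Re_ge:
  assumes "\<nu> \<in> conv_hull A" "\<And>\<mu>. \<mu> \<in> A \<Longrightarrow> B \<le> Re (\<mu> h)"
  shows "B \<le> Re (\<nu> h)"
proof -
  obtain S c where S: "finite S" "S \<subseteq> A" "\<forall>\<mu>\<in>S. 0 \<le> c \<mu>" "sum c S = (1::real)"
    and \<nu>: "\<nu> = (\<lambda>h. \<Sum>\<mu>\<in>S. complex_of_real (c \<mu>) * \<mu> h)" using assms(1) by (auto simp: conv_hull_def)
  have "B = (\<Sum>\<mu>\<in>S. c \<mu> * B)" using S(4) by (simp add: sum_distrib_right[symmetric])
  also have "\<dots> \<le> (\<Sum>\<mu>\<in>S. c \<mu> * Re (\<mu> h))" using S assms(2) by (intro sum_mono mult_left_mono) auto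
  also have "\<dots> = Re (\<nu> h)" by (simp add: \<nu>)
  finally show ?thesis .
qed

lemma conv_hull_base: "\<mu> \<in> A \<Longrightarrow> \<mu> \<in> conv_hull A"
  unfolding conv_hull_def by (rule CollectI, rule exI[of _ "{\<mu>}"], rule exI[of _ "\<lambda>_. 1"]) auto

text \<open>A multiple of the \<open>i\<close>-th fundamental coweight.\<close>
definition coweight :: "nat \<Rightarrow> nat \<Rightarrow> complex mat" where
  "coweight n i = mat (Suc n) (Suc n)
     (\<lambda>(j, k). if j \<noteq> k then 0 else if j < i then of_nat (n + 1) - of_nat i else - of_nat i)"

lemma wt_coweight:
  assumes "i \<le> n"
  shows "wt n y (coweight n i) = of_nat (n + 1) * (\<Sum>q<i. y q) - of_nat i * (\<Sum>q\<le>n. y q)"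
proof -
  have s: "(\<Sum>q\<le>n. y q * coweight n i $$ (q, q)) = of_nat (n + 1) * (\<Sum>q<i. y q) - of_nat i * (\<Sum>q\<le>n. y q)" for y
  proof -
    have "(\<Sum>q\<le>n. y q * coweight n i $$ (q, q)) = (\<Sum>q\<le>n. of_nat (n + 1) * (if q < i then y q else 0) - of_nat i * y q)"
      by (intro sum.cong) (auto simp: coweight_def algebra_simps)
    also have "\<dots> = of_nat (n + 1) * (\<Sum>q\<le>n. if q < i then y q else 0) - of_nat i * (\<Sum>q\<le>n. y q)"
      by (simp add: sum_subtractf sum_distrib_left)
    also have "(\<Sum>q\<le>n. if q < i then y q else 0) = (\<Sum>q<i. y q)"
      using assms by (intro sum.mono_neutral_cong_right) auto
    finally show ?thesis .
  qed
  have "coweight n i \<in> cartan n" using s[of "\<lambda>_. 1"] by (auto simp: cartan_iff, auto simp: coweight_def)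
  then show ?thesis using s by (simp add: wt_def)
qed

text \<open>The fundamental coweights are linear and, on the orbit, are maximal at the dominant
  weight; hence they are bounded by that value on the convex hull. The lattice condition turns the
  resulting inequalities into nonnegative integer coefficients.\<close>

lemma cell_le:
  assumes a: "antitone n a" and \<nu>: "\<nu> \<in> saturated_cell n (wi n a)"
  shows "(\<lambda>h. wi n a h - \<nu> h) \<in> root_lattice_pos n"
proof -
  obtain z where z: "(\<lambda>h. \<nu> h - wi n a h) = wi n z" "(\<Sum>q\<le>n. z q) = 0"
    using \<nu> by (auto simp: saturated_cell_def root_lattice_eq)
  have "0 \<le> (\<Sum>q<i. - z q)" if i: "i \<le> n" for i
  proof -
    have "Re (\<nu> (coweight n i)) \<le> Re (wi n a (coweight n i))"
    proof (rule conv_hull_Re_le)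
      show "\<nu> \<in> conv_hull (weyl_orbit n (wi n a))" using \<nu> by (simp add: saturated_cell_def)
      fix \<mu> assume "\<mu> \<in> weyl_orbit n (wi n a)"
      then obtain "is" where w: "set is \<subseteq> {1..n}" and \<mu>: "\<mu> = wi n (a \<circ> pw is)" by (auto simp: weyl_orbit_wi)
      note p = pw_permutes[OF w]
      have "(\<Sum>q\<le>n. a (pw is q)) = (\<Sum>q\<le>n. a q)" using sum.permute[OF p, of a] by (simp add: comp_def)
      moreover have "real_of_int ((int n + 1) * (\<Sum>q<i. a (pw is q))) \<le> real_of_int ((int n + 1) * (\<Sum>q<i. a q))"
        using antitone_partial_sum[OF a p i] by (simp only: of_int_le_iff) (simp add: mult_left_mono)
      ultimately show "Re (\<mu> (coweight n i)) \<le> Re (wi n a (coweight n i))"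
        unfolding \<mu> wi_def wt_coweight[OF i] of_int_sum[symmetric] by simp
    qed
    moreover have "\<nu> (coweight n i) - wi n a (coweight n i) = of_nat (n + 1) * of_int (\<Sum>q<i. z q)"
      using fun_cong[OF z(1), of "coweight n i"] z(2) unfolding wi_def wt_coweight[OF i] of_int_sum[symmetric] by simp
    ultimately have "real (n + 1) * of_int (\<Sum>q<i. z q) \<le> 0"
      by (metis Re_complex_of_real complex_of_real_def diff_le_0_iff_le minus_complex.simps(1) of_real_mult of_real_of_int_eq of_real_of_nat_eq)
    then have "real_of_int (\<Sum>q<i. z q) \<le> 0" by (simp only: mult_le_0_iff) auto
    then have "(\<Sum>q<i. z q) \<le> 0" by (simp only: of_int_le_0_iff)
    then show ?thesis by (simp add: sum_negf)
  qed
  moreover have "(\<lambda>h. wi n a h - \<nu> h) = wi n (\<lambda>q. - z q)"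
  proof
    fix h show "wi n a h - \<nu> h = wi n (\<lambda>q. - z q) h"
      using fun_cong[OF z(1), of h] wi_uminus[of n z h] by (simp add: algebra_simps)
  qed
  ultimately show ?thesis using z(2) by (auto simp: root_lattice_pos_eq pos_coords_def sum_negf)
qed

text \<open>A convex combination is reflected term by term. The coefficients travel along because
  the reflection is an involution, and the lattice condition survives since coordinate sums are
  invariant under permutations.\<close>

lemma cell_refl:
  assumes i: "i \<in> {1..n}" and \<nu>: "\<nu> \<in> saturated_cell n (wi n a)"
  shows "simple_refl n i \<nu> \<in> saturated_cell n (wi n a)"
proof -
  let ?O = "weyl_orbit n (wi n a)" and ?s = "simple_refl n i"
  obtain S c where S: "finite S" "S \<subseteq> ?O" "\<forall>\<mu>\<in>S. 0 \<le> c \<mu>" "sum c S = (1::real)"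
    and \<nu>S: "\<nu> = (\<lambda>h. \<Sum>\<mu>\<in>S. complex_of_real (c \<mu>) * \<mu> h)"
    using \<nu> by (auto simp: conv_hull_def saturated_cell_def)
  have inj: "inj_on ?s S" by (rule inj_on_inverseI[of _ ?s]) (simp add: simple_refl_simple_refl[OF i])
  have "?s \<mu> \<in> ?O" if "\<mu> \<in> ?O" for \<mu>
  proof -
    obtain js where js: "js \<in> lists {1..n}" "\<mu> = refl_word n js (wi n a)"
      using \<open>\<mu> \<in> ?O\<close> by (auto simp: weyl_orbit_def weyl_group_def)
    then have "?s \<mu> = refl_word n (i # js) (wi n a)" by simp
    moreover have "refl_word n (i # js) \<in> weyl_group n" using js i by (simp add: weyl_group_def)
    ultimately show ?thesis unfolding weyl_orbit_def by (rule image_eqI)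
  qed
  then have "?s ` S \<subseteq> ?O" using S by blast
  moreover have "?s \<nu> = (\<lambda>h. \<Sum>\<mu>\<in>?s ` S. complex_of_real (c (?s \<mu>)) * \<mu> h)"
  proof
    fix h
    have "?s \<nu> h = (\<Sum>\<mu>\<in>S. complex_of_real (c \<mu>) * ?s \<mu> h)"
      by (simp add: \<nu>S simple_refl_def sum_subtractf sum_distrib_right right_diff_distrib mult.assoc)
    then show "?s \<nu> h = (\<Sum>\<mu>\<in>?s ` S. complex_of_real (c (?s \<mu>)) * \<mu> h)"
      using inj by (simp add: sum.reindex simple_refl_simple_refl[OF i])
  qed
  moreover have "sum (\<lambda>\<mu>. c (?s \<mu>)) (?s ` S) = 1"
    using inj S(4) by (simp add: sum.reindex simple_refl_simple_refl[OF i])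
  ultimately have "?s \<nu> \<in> conv_hull ?O"
    using S unfolding conv_hull_def
    by (intro CollectI exI[of _ "?s ` S"] exI[of _ "\<lambda>\<mu>. c (?s \<mu>)"]) (auto simp: simple_refl_simple_refl[OF i])
  moreover have "(\<lambda>h. ?s \<nu> h - wi n a h) \<in> root_lattice n"
  proof -
    obtain z where z: "(\<lambda>h. \<nu> h - wi n a h) = wi n z" "(\<Sum>q\<le>n. z q) = 0"
      using \<nu> by (auto simp: saturated_cell_def root_lattice_eq)
    have \<nu>z: "\<nu> = wi n (\<lambda>q. a q + z q)"
    proof
      fix h show "\<nu> h = wi n (\<lambda>q. a q + z q) h"
        using fun_cong[OF z(1), of h] wi_plus[of n a h z]
        by (simp add: algebra_simps)
    qed
    let ?t = "transpose (i - 1) i"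
    have "?s \<nu> = wi n ((\<lambda>q. a q + z q) \<circ> ?t)" unfolding \<nu>z wi_def simple_refl_wt[OF i] by (simp add: comp_def)
    then have "(\<lambda>h. ?s \<nu> h - wi n a h) = wi n (\<lambda>q. a (?t q) + z (?t q) - a q)" by (simp add: wi_minus)
    moreover have "?t permutes {..n}" using i by (intro permutes_swap_id) auto
    then have "(\<Sum>q\<le>n. a (?t q)) = (\<Sum>q\<le>n. a q)" "(\<Sum>q\<le>n. z (?t q)) = (\<Sum>q\<le>n. z q)"
      using sum.permute[of ?t "{..n}" a] sum.permute[of ?t "{..n}" z] by (simp_all add: comp_def)
    then have "(\<Sum>q\<le>n. a (?t q) + z (?t q) - a q) = 0" using z(2) by (simp add: sum.distrib sum_subtractf)
    ultimately show ?thesis unfolding root_lattice_eq by auto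
  qed
  ultimately show ?thesis by (simp add: saturated_cell_def)
qed

lemma orbit_cell: "set is \<subseteq> {1..n} \<Longrightarrow> refl_word n is (wi n a) \<in> saturated_cell n (wi n a)"
proof -
  assume w: "set is \<subseteq> {1..n}"
  have "refl_word n is (wi n a) \<in> conv_hull (weyl_orbit n (wi n a))"
    using w by (intro conv_hull_base) (auto simp: weyl_orbit_def weyl_group_def)
  moreover have "(\<lambda>h. refl_word n is (wi n a) h - wi n a h) = wi n (\<lambda>q. a (pw is q) - a q)"
    by (simp add: refl_word_wi[OF w] wi_minus)
  moreover have "(\<Sum>q\<le>n. a (pw is q) - a q) = 0"
    using sum.permute[OF pw_permutes[OF w], of a] by (simp add: comp_def sum_subtractf)
  ultimately show ?thesis unfolding saturated_cell_def root_lattice_eq by auto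
qed

lemma longest_element_wi: "longest_element n (wi n a) = wi n (\<lambda>q. a (rv n q))"
  by (simp add: wi_def longest_element_wt comp_def)

section \<open>Cells along the enumeration of the dominant weights\<close>

locale enumerated =
  fixes n :: nat and lam :: "nat \<Rightarrow> weight"
  assumes enum: "dominant_enumeration n lam"
begin

lemma lam_dominant: "lam r \<in> dominant_weights n"
  using enum by (auto simp: dominant_enumeration_def bij_betw_def)

lemma lam_surj: "\<mu> \<in> dominant_weights n \<Longrightarrow> \<exists>r. \<mu> = lam r"
  using enum by (auto simp: dominant_enumeration_def bij_betw_def)

definition la :: "nat \<Rightarrow> nat \<Rightarrow> int" where "la r = (SOME a. lam r = wi n a \<and> antitone n a)"

lemma la: "lam r = wi n (la r)" "antitone n (la r)"
  using someI_ex[OF dominant_wi[OF lam_dominant[of r]]] by (simp_all add: la_def)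

lemma enum_le: "(\<lambda>h. lam r h - lam s h) \<in> root_lattice_pos n \<Longrightarrow> s \<le> r"
  using enum by (simp add: dominant_enumeration_def)

text \<open>The bound is strict: \<open>cells 0\<close> is empty, and the canonical submodule of
  index \<open>s\<close> belongs to \<open>cells (Suc s)\<close>.\<close>

definition cells :: "nat \<Rightarrow> weight set" where "cells K = (\<Union>r<K. saturated_cell n (lam r))"

lemma cells_mono: "K \<le> L \<Longrightarrow> cells K \<subseteq> cells L"
  unfolding cells_def by (intro UN_mono) auto

lemma cells_refl: "i \<in> {1..n} \<Longrightarrow> \<nu> \<in> cells K \<Longrightarrow> simple_refl n i \<nu> \<in> cells K"
  using cell_refl[of i n _ "la _"] by (auto simp: cells_def la(1))

lemma cells_refl_word: "set is \<subseteq> {1..n} \<Longrightarrow> \<nu> \<in> cells K \<Longrightarrow> refl_word n is \<nu> \<in> cells K"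
  by (induction "is") (auto simp: cells_refl simp del: One_nat_def)

lemma lam_cells: "lam r \<in> cells L \<Longrightarrow> r < L"
proof -
  assume "lam r \<in> cells L"
  then obtain s where s: "s < L" "lam r \<in> saturated_cell n (lam s)" by (auto simp: cells_def)
  then have "(\<lambda>h. lam s h - lam r h) \<in> root_lattice_pos n" using cell_le[OF la(2)] by (simp add: la(1))
  then show ?thesis using enum_le s by fastforce
qed

text \<open>The lowest weight of the orbit of \<open>lam r\<close>, where the functional "value at
  the generator" of \<open>nabla n (lam r) d\<close> is supported.\<close>

definition low :: "nat \<Rightarrow> weight" where "low r = longest_element n (lam r)"

lemma low_wi: "low r = wi n (\<lambda>q. la r (rv n q))"
  by (simp add: low_def la(1) longest_element_wi)

lemma low_reversed: "\<exists>js. set js \<subseteq> {1..n} \<and> pw js = rv n \<and> refl_word n js (low r) = lam r"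
proof -
  obtain js where js: "set js \<subseteq> {1..n}" "pw js = rv n" using rv_word by blast
  then have "refl_word n js (low r) = lam r"
    by (simp add: low_wi refl_word_wi la(1) comp_def)
  then show ?thesis using js by blast
qed

lemma low_cells: "low r \<in> cells L \<Longrightarrow> r < L"
  using low_reversed[of r] cells_refl_word lam_cells by metis

text \<open>The longest element carries this weight to \<open>lam K\<close> plus a positive root. If
  that were in the cell of some \<open>lam s\<close> with \<open>s \<le> K\<close>, then
  \<open>lam s\<close> would lie above \<open>lam K\<close>, so \<open>s = K\<close> by the
  enumeration, and minus a positive root would be positive.\<close>

lemma low_top:
  assumes "p < q" "q \<le> n" shows "(\<lambda>h. low K h - rt n p q h) \<notin> cells (Suc K)"
proof
  assume "(\<lambda>h. low K h - rt n p q h) \<in> cells (Suc K)"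
  moreover obtain js where js: "set js \<subseteq> {1..n}" "pw js = rv n" using rv_word by blast
  ultimately have "refl_word n js (\<lambda>h. low K h - rt n p q h) \<in> cells (Suc K)" by (intro cells_refl_word)
  moreover have "refl_word n js (\<lambda>h. low K h - rt n p q h) = (\<lambda>h. lam K h + rt n (n - q) (n - p) h)"
  proof -
    have "refl_word n js (\<lambda>h. low K h - rt n p q h)
        = wi n (\<lambda>k. la K k - ((if rv n k = p then 1 else 0) - (if rv n k = q then 1 else 0)))"
      unfolding low_wi rt_def wi_minus refl_word_wi[OF js(1)] js(2) by (simp add: comp_def)
    also have "\<dots> = wi n (\<lambda>k. la K k + ((if k = n - q then 1 else 0) - (if k = n - p then 1 else 0)))"
      using assms by (intro wi_cong) (auto simp: rv_def)
    finally show ?thesis by (simp only: la(1)[of K] rt_def wi_plus)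
  qed
  ultimately obtain s where s: "s \<le> K" "(\<lambda>h. lam K h + rt n (n - q) (n - p) h) \<in> saturated_cell n (lam s)"
    by (auto simp: cells_def less_Suc_eq_le)
  let ?r = "rt n (n - q) (n - p)"
  have r: "?r \<in> root_lattice_pos n" using assms by (intro rt_pos) auto
  have d: "(\<lambda>h. lam s h - (lam K h + ?r h)) \<in> root_lattice_pos n"
    using s(2) cell_le[OF la(2)] by (simp add: la(1))
  have "(\<lambda>h. lam s h - lam K h) \<in> root_lattice_pos n" using root_lattice_pos_add[OF d r] by simp
  then have "s = K" using enum_le s(1) by fastforce
  then have "(\<lambda>h. - ?r h) \<in> root_lattice_pos n" using d by simp
  then have "wi n (\<lambda>k. - ((if k = n - q then 1 else 0) - (if k = n - p then 1 else 0))) \<in> root_lattice_pos n"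
    by (simp add: rt_def wi_uminus)
  \<comment> \<open>Coordinates are determined only up to a constant \<open>k\<close>; comparing
    totals shows that it is zero.\<close>
  then obtain k where k: "pos_coords n (\<lambda>j. - ((if j = n - q then 1 else 0) - (if j = n - p then 1 else 0)) - k)"
    using pos_coords_unique by blast
  let ?z = "\<lambda>j. (if j = n - q then 1 else 0) - (if j = n - p then 1 else 0) :: int"
  have z: "pos_coords n ?z" using assms by (intro pos_coords_rt) auto
  have "(\<Sum>j\<le>n. - ?z j - k) = - (\<Sum>j\<le>n. ?z j) - of_nat (n + 1) * k"
    by (simp add: sum_subtractf sum_negf)
  then have "k = 0" using k z by (simp add: pos_coords_def)
  \<comment> \<open>The first \<open>n - p\<close> positions contain \<open>n - q\<close> but not
    \<open>n - p\<close>, so this partial sum isolates a coefficient \<open>-1\<close>.\<close>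
  then have "0 \<le> (\<Sum>j<n - p. - ?z j)" using k unfolding pos_coords_def by (metis (no_types, lifting) diff_0_right diff_le_self sum.cong)
  moreover have "(\<Sum>j<n - p. ?z j) = 1" using assms by (simp add: sum_subtractf)
  ultimately show False by (simp add: sum_negf del: minus_diff_eq)
qed

text \<open>The simple reflection sends \<open>low K\<close> to \<open>low K\<close> plus
  \<open>k\<close> times the root, hence the weight in question to \<open>low K\<close> minus the
  root, which \<open>low_top\<close> excludes.\<close>

lemma low_string:
  assumes i: "i \<in> {1..n}" and k: "low K (coroot n i) = - of_nat k"
  shows "(\<lambda>h. low K h + of_nat (k + 1) * simple_root n i h) \<notin> cells (Suc K)"
proof
  let ?\<nu> = "\<lambda>h. low K h + of_nat (k + 1) * simple_root n i h"
  assume "?\<nu> \<in> cells (Suc K)"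
  then have "simple_refl n i ?\<nu> \<in> cells (Suc K)" by (rule cells_refl[OF i])
  moreover have "simple_root n i (coroot n i) = 2"
    using i coroot_cartan[OF i] by (auto simp: simple_root_def coroot_index)
  then have "simple_refl n i ?\<nu> = (\<lambda>h. low K h - rt n (i - 1) i h)"
    unfolding simple_refl_def k simple_root_rt[OF i, symmetric] by (simp add: fun_eq_iff algebra_simps)
  ultimately show False using low_top[of "i - 1" i K] i by simp
qed

text \<open>Sorting the coordinates finds the dominant weight of the orbit; undoing the sorting
  shows that the given weight lies in its cell.\<close>

lemma integral_sorted:
  assumes "\<nu> = wi n b"
  shows "\<exists>is m. set is \<subseteq> {1..n} \<and> refl_word n is \<nu> = lam m \<and> \<nu> \<in> saturated_cell n (lam m)"
proof -
  obtain "is" where w: "set is \<subseteq> {1..n}" "\<forall>p q. p \<le> q \<and> q \<le> n \<longrightarrow> b (pw is q) \<le> b (pw is p)"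
    using sorting_word[of n b] by blast
  have d: "refl_word n is \<nu> = wi n (b \<circ> pw is)" by (simp add: assms refl_word_wi[OF w(1)])
  have "antitone n (b \<circ> pw is)" using w(2) by (simp add: antitone_def)
  then obtain m where m: "wi n (b \<circ> pw is) = lam m" using lam_surj wi_dominant by metis
  have "refl_word n (rev is) (wi n (b \<circ> pw is)) \<in> saturated_cell n (wi n (b \<circ> pw is))"
    using w(1) by (intro orbit_cell) auto
  moreover have "refl_word n (rev is) (wi n (b \<circ> pw is)) = \<nu>"
    using refl_word_rev[OF w(1), of \<nu>] d by simp
  ultimately have "\<nu> \<in> saturated_cell n (lam m)" using m by metis
  then show ?thesis using w(1) d m by metis
qed

text \<open>The lowest weight of the orbit of \<open>\<nu>\<close> lies above \<open>low j\<close> for some \<open>j < K\<close>; reversing the order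
  turns this into dominance.\<close>
lemma stable_subset_cells:
  assumes int: "\<And>\<nu>. \<nu> \<in> T \<Longrightarrow> \<exists>b. \<nu> = wi n b"
    and refl: "\<And>\<nu> i. \<nu> \<in> T \<Longrightarrow> i \<in> {1..n} \<Longrightarrow> simple_refl n i \<nu> \<in> T"
    and low: "\<And>\<nu>. \<nu> \<in> T \<Longrightarrow> \<exists>j<K. (\<lambda>h. \<nu> h - low j h) \<in> root_lattice_pos n"
  shows "T \<subseteq> cells K"
proof
  fix \<nu> assume \<nu>: "\<nu> \<in> T"
  have word: "refl_word n is \<mu> \<in> T" if "set is \<subseteq> {1..n}" "\<mu> \<in> T" for "is" \<mu>
    using that by (induction "is") (auto simp: refl simp del: One_nat_def)
  obtain "is" m where w: "set is \<subseteq> {1..n}" "refl_word n is \<nu> = lam m" "\<nu> \<in> saturated_cell n (lam m)"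
    using integral_sorted int[OF \<nu>] by blast
  obtain js where js: "set js \<subseteq> {1..n}" "pw js = rv n" using rv_word by blast
  have "refl_word n js (lam m) \<in> T" using word[OF js(1) word[OF w(1) \<nu>]] w(2) by simp
  moreover have "refl_word n js (lam m) = low m"
    by (simp add: low_wi la(1) refl_word_wi[OF js(1)] js(2) comp_def)
  ultimately obtain j where j: "j < K" "(\<lambda>h. low m h - low j h) \<in> root_lattice_pos n" using low by metis
  then have "wi n (\<lambda>q. la m (rv n q) - la j (rv n q)) \<in> root_lattice_pos n" by (simp add: low_wi wi_minus)
  from root_lattice_pos_rv[OF this] have "(\<lambda>h. lam j h - lam m h) \<in> root_lattice_pos n"
    by (simp add: la(1) wi_minus)
  then have "m < K" using enum_le j(1) by fastforce
  then show "\<nu> \<in> cells K" using w(3) by (auto simp: cells_def)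
qed

text \<open>On finitely many convex hulls the values at the coroots are bounded. Integral weights
  with bounded values are finite in number, and each of them lies in some cell.\<close>

lemma finite_cells:
  assumes F: "finite F" "F \<subseteq> dominant_weights n" and W: "W \<subseteq> (\<Union>\<mu>\<in>F. conv_hull (weyl_orbit n \<mu>))"
    and int: "\<And>\<nu>. \<nu> \<in> W \<Longrightarrow> \<exists>b. \<nu> = wi n b"
  shows "\<exists>k. W \<subseteq> cells k"
proof -
  have "\<exists>B. \<forall>\<nu>\<in>conv_hull (weyl_orbit n \<mu>). \<forall>i\<in>{1..n}. \<bar>Re (\<nu> (coroot n i))\<bar> \<le> B" if "\<mu> \<in> F" for \<mu>
  proof -
    have "\<mu> \<in> dominant_weights n" using F(2) that by auto
    then obtain a where a: "\<mu> = wi n a" using dominant_wi by auto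
    let ?B = "real_of_int (2 * (\<Sum>q\<le>n. \<bar>a q\<bar>))"
    have "\<bar>Re (\<kappa> (coroot n i))\<bar> \<le> ?B" if i: "i \<in> {1..n}" and \<kappa>: "\<kappa> \<in> weyl_orbit n \<mu>" for i \<kappa>
    proof -
      obtain "is" where w: "set is \<subseteq> {1..n}" "\<kappa> = wi n (a \<circ> pw is)" using \<kappa> by (auto simp: a weyl_orbit_wi)
      have b: "\<bar>a (pw is q)\<bar> \<le> (\<Sum>q\<le>n. \<bar>a q\<bar>)" if "q \<le> n" for q
        using permutes_in_image[OF pw_permutes[OF w(1)], of q] that by (intro member_le_sum) auto
      have "\<bar>a (pw is (i - 1)) - a (pw is i)\<bar> \<le> 2 * (\<Sum>q\<le>n. \<bar>a q\<bar>)" 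
      proof -
        have "i - 1 \<le> n" "i \<le> n" using i by auto
        from b[OF this(1)] b[OF this(2)] show ?thesis by linarith
      qed
      then have "real_of_int \<bar>a (pw is (i - 1)) - a (pw is i)\<bar> \<le> ?B" by (simp only: of_int_le_iff)
      then show ?thesis using i by (simp add: w(2) wi_coroot)
    qed
    then have bd: "Re (\<kappa> (coroot n i)) \<le> ?B" "- ?B \<le> Re (\<kappa> (coroot n i))"
      if "i \<in> {1..n}" "\<kappa> \<in> weyl_orbit n \<mu>" for i \<kappa> using that by (fastforce simp: abs_le_iff)+
    have "\<bar>Re (\<nu> (coroot n i))\<bar> \<le> ?B" if \<nu>: "\<nu> \<in> conv_hull (weyl_orbit n \<mu>)" and i: "i \<in> {1..n}" for \<nu> i
    proof -
      have "Re (\<nu> (coroot n i)) \<le> ?B" by (rule conv_hull_Re_le[OF \<nu> bd(1)[OF i]])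
      moreover have "- ?B \<le> Re (\<nu> (coroot n i))" by (rule conv_hull_Re_ge[OF \<nu> bd(2)[OF i]])
      ultimately show ?thesis by linarith
    qed
    then show ?thesis by blast
  qed
  then obtain B where B: "\<And>\<mu> \<nu> i. \<mu> \<in> F \<Longrightarrow> \<nu> \<in> conv_hull (weyl_orbit n \<mu>) \<Longrightarrow> i \<in> {1..n} \<Longrightarrow> \<bar>Re (\<nu> (coroot n i))\<bar> \<le> B \<mu>"
    by metis
  obtain C :: int where C: "\<And>\<mu>. \<mu> \<in> F \<Longrightarrow> B \<mu> \<le> of_int C"
  proof -
    have "B \<mu> \<le> Max (B ` F)" if "\<mu> \<in> F" for \<mu> using F(1) that by simp
    then show ?thesis using that[of "\<lceil>Max (B ` F)\<rceil>"] by (meson le_of_int_ceiling order_trans)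
  qed
  have "W \<subseteq> (\<lambda>z. wi n (\<lambda>q. \<Sum>j\<in>{q<..n}. z j)) ` ({1..n} \<rightarrow>\<^sub>E {- C..C})"
  proof
    fix \<nu> assume \<nu>: "\<nu> \<in> W"
    then obtain b where b: "\<nu> = wi n b" using int by blast
    obtain \<mu> where \<mu>: "\<mu> \<in> F" "\<nu> \<in> conv_hull (weyl_orbit n \<mu>)" using W \<nu> by blast
    let ?z = "restrict (\<lambda>i. b (i - 1) - b i) {1..n}"
    have "?z \<in> {1..n} \<rightarrow>\<^sub>E {- C..C}"
    proof (rule PiE_I)
      fix i assume i: "i \<in> {1..n}"
      then have "\<bar>Re (\<nu> (coroot n i))\<bar> \<le> of_int C" using B[OF \<mu> i] C[OF \<mu>(1)] by linarith
      then have "\<bar>b (i - 1) - b i\<bar> \<le> C" unfolding b wi_coroot[OF i] by simp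
      then show "?z i \<in> {- C..C}" using i by auto
    qed auto
    moreover have "\<nu> = wi n (\<lambda>q. \<Sum>j\<in>{q<..n}. ?z j)"
      by (rule integral_wi) (simp_all add: b wi_coroot wi_cartan_dual)
    ultimately show "\<nu> \<in> (\<lambda>z. wi n (\<lambda>q. \<Sum>j\<in>{q<..n}. z j)) ` ({1..n} \<rightarrow>\<^sub>E {- C..C})" by blast
  qed
  then have "finite W" by (rule finite_subset) (intro finite_imageI finite_PiE, auto)
  moreover have "\<forall>\<nu>\<in>W. \<exists>m. \<nu> \<in> saturated_cell n (lam m)"
  proof
    fix \<nu> assume "\<nu> \<in> W"
    then obtain b where "\<nu> = wi n b" using int by auto
    from integral_sorted[OF this] show "\<exists>m. \<nu> \<in> saturated_cell n (lam m)" by auto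
  qed
  then obtain m where m: "\<And>\<nu>. \<nu> \<in> W \<Longrightarrow> \<nu> \<in> saturated_cell n (lam (m \<nu>))" by metis
  ultimately have "finite (m ` W)" by simp
  then obtain k where "\<forall>\<nu>\<in>W. m \<nu> < k" unfolding finite_nat_set_iff_bounded by auto
  then have "W \<subseteq> cells k" using m by (auto simp: cells_def)
  then show ?thesis ..
qed

end

section \<open>Extension of functionals and decomposition into eigenspaces\<close>

interpretation vfun: vector_space_pair "sc :: complex \<Rightarrow> 'x cvec \<Rightarrow> 'x cvec" "(*) :: complex \<Rightarrow> complex \<Rightarrow> complex"
  by unfold_locales (auto simp: algebra_simps)

lemma linear_functional_extend:
  fixes f :: "'x cvec \<Rightarrow> complex"
  assumes Y: "vs.subspace Y" and add: "\<And>v w. v \<in> Y \<Longrightarrow> w \<in> Y \<Longrightarrow> f (v + w) = f v + f w"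
    and scale: "\<And>c v. v \<in> Y \<Longrightarrow> f (sc c v) = c * f v"
  shows "\<exists>g. (\<forall>v w. g (v + w) = g v + g w) \<and> (\<forall>c v. g (sc c v) = c * g v) \<and> (\<forall>v\<in>Y. g v = f v)"
proof -
  obtain B where B: "B \<subseteq> Y" "vs.independent B" "Y \<subseteq> vs.span B"
    using vs.maximal_independent_subset[of Y] by blast
  obtain g where g: "Vector_Spaces.linear sc (*) g" "\<forall>x\<in>B. g x = f x"
    using vfun.linear_independent_extend[OF B(2)] by blast
  interpret g: Vector_Spaces.linear sc "(*)" g by (rule g)
  have f0: "f 0 = 0" using scale[of 0 0] vs.subspace_0[OF Y] by simp
  have "g v = f v \<and> v \<in> Y" if "v \<in> vs.span B" for v
    using that
  proof (induction rule: vs.span_induct_alt)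
    case (step c x y)
    then have "x \<in> Y" "sc c x \<in> Y" using B Y by (auto simp: vs.subspace_scale)
    then show ?case using step g(2) Y by (auto simp: g.add g.scale add scale vs.subspace_add)
  qed (use Y f0 in \<open>auto simp: g.zero vs.subspace_0\<close>)
  then show ?thesis using B(3) g.add g.scale by blast
qed

text \<open>Simultaneous diagonalisation, one operator at a time.\<close>
lemma joint_eigenspan:
  fixes H :: "'i \<Rightarrow> 'x cvec \<Rightarrow> 'x cvec"
  assumes "vs.subspace U" "\<And>i. i \<in> set is \<Longrightarrow> endo U (H i)"
    and "\<And>i j v. i \<in> set is \<Longrightarrow> j \<in> set is \<Longrightarrow> v \<in> U \<Longrightarrow> H i (H j v) = H j (H i v)"
    and "\<And>i. i \<in> set is \<Longrightarrow> \<exists>K::nat. \<forall>v\<in>U. pl (H i) (map of_int [- int K..int K]) v = 0"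
  shows "U \<subseteq> vs.span {u \<in> U. \<forall>i\<in>set is. \<exists>a::int. H i u = sc (of_int a) u}"
  using assms
proof (induction "is" arbitrary: U)
  case Nil
  then show ?case using vs.span_base by auto
next
  case (Cons i "is")
  let ?E = "{u \<in> U. \<forall>j\<in>set (i # is). \<exists>a::int. H j u = sc (of_int a) u}"
  interpret H: sub_endo U "H i" using Cons.prems by unfold_locales auto
  obtain K :: nat where K: "\<And>v. v \<in> U \<Longrightarrow> pl (H i) (map of_int [- int K..int K]) v = 0"
    using Cons.prems(4)[of i] by auto
  have "{u \<in> U. \<exists>b\<in>set (map of_int [- int K..int K]). H i u = sc b u} \<subseteq> vs.span ?E"
  proof safe
    fix u b assume u: "u \<in> U" "b \<in> set (map of_int [- int K..int K])" "H i u = sc b u"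
    then obtain a :: int where a: "b = of_int a" by auto
    let ?U = "{w \<in> U. H i w = sc (of_int a) w}"
    have sub: "vs.subspace ?U"
      by (rule vs.subspaceI) (auto simp: H.T_lin vs.scale_right_distrib mult.commute)
    have "?U \<subseteq> vs.span {u \<in> ?U. \<forall>i\<in>set is. \<exists>a::int. H i u = sc (of_int a) u}"
    proof (rule Cons.IH[OF sub])
      fix j assume j: "j \<in> set is"
      interpret J: sub_endo U "H j" using Cons.prems j by unfold_locales auto
      have "H i (H j w) = H j (H i w)" if "w \<in> U" for w using Cons.prems(3)[of i j w] j that by simp
      then show "endo ?U (H j)" by (auto simp: endo_def J.T_lin)
      show "\<exists>K::nat. \<forall>v\<in>?U. pl (H j) (map of_int [- int K..int K]) v = 0"
        using Cons.prems(4)[of j] j by auto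
    next
      fix j k v assume "j \<in> set is" "k \<in> set is" "v \<in> ?U"
      then show "H j (H k v) = H k (H j v)" using Cons.prems(3)[of j k v] by simp
    qed
    then have "u \<in> vs.span {u \<in> ?U. \<forall>i\<in>set is. \<exists>a::int. H i u = sc (of_int a) u}" using u a by blast
    then show "u \<in> vs.span ?E" by (rule set_mp[OF vs.span_mono, rotated]) auto
  qed
  then have sp: "vs.span {u \<in> U. \<exists>b\<in>set (map of_int [- int K..int K]). H i u = sc b u} \<subseteq> vs.span ?E"
    by (rule vs.span_minimal) (rule vs.subspace_span)
  have "distinct (map of_int [- int K..int K] :: complex list)" by (auto simp: distinct_map inj_on_def)
  then show ?case using H.pl_distinct_span K sp by blast
qed

lemma span_UN_form:
  assumes "\<And>i. i \<in> I \<Longrightarrow> vs.subspace (E i)" "v \<in> vs.span (\<Union>i\<in>I. E i)"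
  shows "\<exists>f D. finite D \<and> D \<subseteq> I \<and> (\<forall>i\<in>D. f i \<in> E i) \<and> v = (\<Sum>i\<in>D. f i)"
  using assms(2)
proof (induction rule: vs.span_induct_alt)
  case base
  show ?case by (rule exI, rule exI[of _ "{}"]) auto
next
  case (step c x y)
  then obtain f D j where D: "finite D" "D \<subseteq> I" "\<forall>i\<in>D. f i \<in> E i" "y = (\<Sum>i\<in>D. f i)"
    and j: "j \<in> I" "x \<in> E j" by auto
  have cx: "sc c x \<in> E j" using j assms(1) by (simp add: vs.subspace_scale)
  let ?f = "\<lambda>i. (if i = j then sc c x else 0) + (if i \<in> D then f i else 0)"
  have "?f i \<in> E i" if "i \<in> insert j D" for i
    using that cx D j assms(1)[of i] by (auto simp: vs.subspace_add)
  moreover have "(\<Sum>i\<in>insert j D. ?f i) = sc c x + y"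
    using D(1) by (simp add: sum.distrib D(4) sum.If_cases Int_absorb1 insert_absorb subset_insertI)
  ultimately show ?case using D j by (intro exI[of _ ?f] exI[of _ "insert j D"]) auto
qed

text \<open>Applied to the weight spaces in all degrees, indexed by pairs of a degree and a weight.
  Only independence is assumed, so projections make sense on the span of the family.\<close>

locale direct_family =
  fixes E :: "'i \<Rightarrow> 'x cvec set"
  assumes E_sub: "vs.subspace (E i)"
    and E_ind: "finite D \<Longrightarrow> (\<And>i. i \<in> D \<Longrightarrow> f i \<in> E i) \<Longrightarrow> (\<Sum>i\<in>D. f i) = 0 \<Longrightarrow> i \<in> D \<Longrightarrow> f i = 0"
begin

definition is_dec :: "'x cvec \<Rightarrow> ('i \<Rightarrow> 'x cvec) \<Rightarrow> bool" where
  "is_dec v f \<longleftrightarrow> (\<forall>i. f i \<in> E i) \<and> finite {i. f i \<noteq> 0} \<and> v = (\<Sum>i\<in>{i. f i \<noteq> 0}. f i)"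

lemma is_dec_sum:
  assumes "is_dec v f" "finite D" "{i. f i \<noteq> 0} \<subseteq> D" shows "v = (\<Sum>i\<in>D. f i)"
  using assms by (auto simp: is_dec_def intro!: sum.mono_neutral_left)

lemma is_decI:
  assumes "finite D" "\<And>i. f i \<in> E i" "\<And>i. i \<notin> D \<Longrightarrow> f i = 0" "v = (\<Sum>i\<in>D. f i)"
  shows "is_dec v f"
proof -
  have "{i. f i \<noteq> 0} \<subseteq> D" using assms(3) by auto
  moreover from this have "v = (\<Sum>i\<in>{i. f i \<noteq> 0}. f i)"
    unfolding assms(4) using assms(1) by (intro sum.mono_neutral_right) auto
  ultimately show ?thesis using assms(1,2) by (auto simp: is_dec_def finite_subset)
qed

lemma is_dec_unique: "is_dec v f \<Longrightarrow> is_dec v g \<Longrightarrow> f = g"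
proof
  fix i assume f: "is_dec v f" and g: "is_dec v g"
  let ?D = "insert i ({i. f i \<noteq> 0} \<union> {i. g i \<noteq> 0})"
  have fin: "finite ?D" using f g by (auto simp: is_dec_def)
  have "(\<Sum>i\<in>?D. f i - g i) = 0"
    using is_dec_sum[OF f fin] is_dec_sum[OF g fin] by (simp add: sum_subtractf subset_insertI2 del: sum.insert)
  moreover have "f j - g j \<in> E j" for j using f g E_sub by (auto simp: is_dec_def vs.subspace_diff)
  ultimately have "f i - g i = 0" using E_ind[OF fin, of "\<lambda>i. f i - g i" i] by blast
  then show "f i = g i" by simp
qed

lemma is_dec_exists: "v \<in> vs.span (\<Union>i. E i) \<Longrightarrow> \<exists>f. is_dec v f"
proof -
  assume "v \<in> vs.span (\<Union>i. E i)"
  then obtain f D where D: "finite D" "\<forall>i\<in>D. f i \<in> E i" "v = (\<Sum>i\<in>D. f i)"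
    using span_UN_form[of UNIV E v] E_sub by blast
  have "is_dec v (\<lambda>i. if i \<in> D then f i else 0)"
    using D E_sub by (intro is_decI[OF D(1)]) (auto simp: vs.subspace_0)
  then show ?thesis by blast
qed

text \<open>The projection to the \<open>i\<close>-th summand along the others; meaningful on the
  span of all \<open>E i\<close>.\<close>

definition cmp :: "'i \<Rightarrow> 'x cvec \<Rightarrow> 'x cvec" where "cmp i v = (THE f. is_dec v f) i"

lemma cmp_eq: "is_dec v f \<Longrightarrow> cmp i v = f i"
  unfolding cmp_def using is_dec_unique by (metis the_equality)

lemma is_dec_add: "is_dec v f \<Longrightarrow> is_dec w g \<Longrightarrow> is_dec (v + w) (\<lambda>i. f i + g i)"
proof -
  assume f: "is_dec v f" and g: "is_dec w g"
  let ?D = "{i. f i \<noteq> 0} \<union> {i. g i \<noteq> 0}"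
  have fin: "finite ?D" using f g by (auto simp: is_dec_def)
  have "v + w = (\<Sum>i\<in>?D. f i + g i)"
    unfolding sum.distrib using is_dec_sum[OF f fin] is_dec_sum[OF g fin] by auto
  then show ?thesis using f g E_sub by (intro is_decI[OF fin]) (auto simp: is_dec_def vs.subspace_add)
qed

lemma is_dec_scale: "is_dec v f \<Longrightarrow> is_dec (sc c v) (\<lambda>i. sc c (f i))"
proof -
  assume f: "is_dec v f"
  then show ?thesis using E_sub
    by (intro is_decI[of "{i. f i \<noteq> 0}"]) (auto simp: is_dec_def vs.subspace_scale vs.scale_sum_right)
qed

lemma cmp_add:
  "v \<in> vs.span (\<Union>i. E i) \<Longrightarrow> w \<in> vs.span (\<Union>i. E i) \<Longrightarrow> cmp i (v + w) = cmp i v + cmp i w"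
  using is_dec_exists is_dec_add cmp_eq by metis

lemma cmp_scale: "v \<in> vs.span (\<Union>i. E i) \<Longrightarrow> cmp i (sc c v) = sc c (cmp i v)"
  using is_dec_exists is_dec_scale cmp_eq by metis

lemma cmp_base: "v \<in> E i \<Longrightarrow> cmp j v = (if j = i then v else 0)"
proof -
  assume v: "v \<in> E i"
  have "is_dec v (\<lambda>j. if j = i then v else 0)"
    by (rule is_decI[of "{i}"]) (use v E_sub in \<open>auto simp: vs.subspace_0\<close>)
  then show ?thesis by (rule cmp_eq)
qed

end

subsection \<open>Matrix identities in the special linear algebra\<close>

lemma sl_iff: "x \<in> sl n \<longleftrightarrow> x \<in> carrier_mat (Suc n) (Suc n) \<and> (\<Sum>j\<le>n. x $$ (j, j)) = 0"
  by (simp add: sl_def lessThan_Suc_atMost)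

lemma sl_dims: "x \<in> sl n \<Longrightarrow> dim_row x = Suc n \<and> dim_col x = Suc n"
  by (auto simp: sl_def)

lemma sl_carrier: "x \<in> sl n \<Longrightarrow> x \<in> carrier_mat (Suc n) (Suc n)"
  by (auto simp: sl_def)

lemma sl_add: "x \<in> sl n \<Longrightarrow> y \<in> sl n \<Longrightarrow> x + y \<in> sl n"
  by (auto simp: sl_iff sum.distrib)

lemma sl_smult: "x \<in> sl n \<Longrightarrow> c \<cdot>\<^sub>m x \<in> sl n"
  by (auto simp: sl_iff sum_distrib_left[symmetric])

lemma sl_zero: "0\<^sub>m (Suc n) (Suc n) \<in> sl n"
  by (auto simp: sl_iff)

lemma cartan_sl: "h \<in> cartan n \<Longrightarrow> h \<in> sl n"
  by (simp add: cartan_def)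

lemma elem_mat_sl: "a \<le> n \<Longrightarrow> b \<le> n \<Longrightarrow> a \<noteq> b \<Longrightarrow> elem_mat n a b \<in> sl n"
proof -
  assume "a \<le> n" "b \<le> n" "a \<noteq> b"
  then have "(\<Sum>j\<le>n. elem_mat n a b $$ (j, j)) = 0" by (intro sum.neutral) auto
  then show ?thesis by (simp add: sl_iff elem_mat_def)
qed

lemma x_pos_sl: "i \<in> {1..n} \<Longrightarrow> x_pos n i \<in> sl n"
  and x_neg_sl: "i \<in> {1..n} \<Longrightarrow> x_neg n i \<in> sl n"
  by (auto simp: x_pos_def x_neg_def intro!: elem_mat_sl)

lemma mult_index:
  "x \<in> carrier_mat (Suc n) (Suc n) \<Longrightarrow> y \<in> carrier_mat (Suc n) (Suc n) \<Longrightarrow> j \<le> n \<Longrightarrow> k \<le> n \<Longrightarrow>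
   (x * y) $$ (j, k) = (\<Sum>l\<le>n. x $$ (j, l) * y $$ (l, k))"
  by (auto simp: scalar_prod_def atLeast0LessThan lessThan_Suc_atMost intro!: sum.cong)

lemma bracket_carrier:
  "x \<in> carrier_mat (Suc n) (Suc n) \<Longrightarrow> y \<in> carrier_mat (Suc n) (Suc n) \<Longrightarrow> bracket x y \<in> carrier_mat (Suc n) (Suc n)"
  unfolding bracket_def by (intro minus_carrier_mat mult_carrier_mat)

lemma bracket_index:
  "x \<in> carrier_mat (Suc n) (Suc n) \<Longrightarrow> y \<in> carrier_mat (Suc n) (Suc n) \<Longrightarrow> j \<le> n \<Longrightarrow> k \<le> n \<Longrightarrow>
   bracket x y $$ (j, k) = (\<Sum>l\<le>n. x $$ (j, l) * y $$ (l, k)) - (\<Sum>l\<le>n. y $$ (j, l) * x $$ (l, k))"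
proof -
  assume a: "x \<in> carrier_mat (Suc n) (Suc n)" "y \<in> carrier_mat (Suc n) (Suc n)" "j \<le> n" "k \<le> n"
  then have "bracket x y $$ (j, k) = (x * y) $$ (j, k) - (y * x) $$ (j, k)"
    unfolding bracket_def by (subst index_minus_mat) auto
  then show ?thesis using a by (simp only: mult_index)
qed

lemma bracket_sl: "x \<in> sl n \<Longrightarrow> y \<in> sl n \<Longrightarrow> bracket x y \<in> sl n"
proof -
  assume a: "x \<in> sl n" "y \<in> sl n"
  note c = sl_carrier[OF a(1)] sl_carrier[OF a(2)]
  have "(\<Sum>j\<le>n. bracket x y $$ (j, j)) =
      (\<Sum>j\<le>n. \<Sum>l\<le>n. x $$ (j, l) * y $$ (l, j)) - (\<Sum>j\<le>n. \<Sum>l\<le>n. y $$ (j, l) * x $$ (l, j))"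
    using c by (simp add: bracket_index sum_subtractf)
  also have "(\<Sum>j\<le>n. \<Sum>l\<le>n. y $$ (j, l) * x $$ (l, j)) = (\<Sum>j\<le>n. \<Sum>l\<le>n. x $$ (j, l) * y $$ (l, j))"
    by (subst sum.swap) (simp add: mult.commute)
  finally show ?thesis using bracket_carrier[OF c] by (simp add: sl_def lessThan_Suc_atMost)
qed

lemma sum_delta_prod:
  fixes n :: nat
  shows
  "(\<Sum>l\<le>n. f l * (if l = a \<and> P then 1 else 0)) = (if a \<le> n \<and> P then f a else (0::complex))"
  "(\<Sum>l\<le>n. (if P \<and> l = a then 1 else 0) * f l) = (if a \<le> n \<and> P then f a else (0::complex))"
proof -
  have "f l * (if l = a \<and> P then 1 else 0) = (if l = a then if P then f a else 0 else 0)"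
    "(if P \<and> l = a then 1 else 0) * f l = (if l = a then if P then f a else 0 else 0)" for l by auto
  then show "(\<Sum>l\<le>n. f l * (if l = a \<and> P then 1 else 0)) = (if a \<le> n \<and> P then f a else 0)"
    "(\<Sum>l\<le>n. (if P \<and> l = a then 1 else 0) * f l) = (if a \<le> n \<and> P then f a else 0)" by simp_all
qed

lemma bracket_elem_elem:
  assumes "a \<le> n" "b \<le> n" "c \<le> n" "d \<le> n"
  shows "bracket (elem_mat n a b) (elem_mat n c d) =
    (if b = c then elem_mat n a d else 0\<^sub>m (Suc n) (Suc n)) - (if d = a then elem_mat n c b else 0\<^sub>m (Suc n) (Suc n))"
    (is "_ = ?R")
proof (rule eq_matI)
  have c: "elem_mat n p q \<in> carrier_mat (Suc n) (Suc n)" for p q by (simp add: elem_mat_def)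
  have R: "?R \<in> carrier_mat (Suc n) (Suc n)" by (rule minus_carrier_mat) (auto simp: c)
  fix j k assume "j < dim_row ?R" "k < dim_col ?R"
  then have jk: "j \<le> n" "k \<le> n" using R by auto
  have "(\<Sum>l\<le>n. elem_mat n a b $$ (j, l) * elem_mat n c d $$ (l, k))
     = (\<Sum>l\<le>n. (if j = a \<and> l = b then 1 else 0) * (if l = c \<and> k = d then 1 else 0))"
    using jk by (intro sum.cong) auto
  moreover have "(\<Sum>l\<le>n. elem_mat n c d $$ (j, l) * elem_mat n a b $$ (l, k))
     = (\<Sum>l\<le>n. (if j = c \<and> l = d then 1 else 0) * (if l = a \<and> k = b then 1 else 0))"
    using jk by (intro sum.cong) auto
  ultimately show "bracket (elem_mat n a b) (elem_mat n c d) $$ (j, k) = ?R $$ (j, k)"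
    using assms jk by (simp add: bracket_index[OF c c] sum_delta_prod c)
qed (use bracket_carrier[of "elem_mat n a b" n "elem_mat n c d"] in \<open>auto simp: elem_mat_def\<close>)

lemma bracket_cartan_elem:
  assumes h: "h \<in> cartan n" and ab: "a \<le> n" "b \<le> n"
  shows "bracket h (elem_mat n a b) = rt n a b h \<cdot>\<^sub>m elem_mat n a b"
proof (rule eq_matI)
  have c: "elem_mat n a b \<in> carrier_mat (Suc n) (Suc n)" "h \<in> carrier_mat (Suc n) (Suc n)"
    using h by (auto simp: elem_mat_def cartan_iff)
  fix j k assume "j < dim_row (rt n a b h \<cdot>\<^sub>m elem_mat n a b)" "k < dim_col (rt n a b h \<cdot>\<^sub>m elem_mat n a b)"
  then have jk: "j \<le> n" "k \<le> n" by (auto simp: elem_mat_def)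
  have "(\<Sum>l\<le>n. h $$ (j, l) * elem_mat n a b $$ (l, k)) = (\<Sum>l\<le>n. h $$ (j, l) * (if l = a \<and> k = b then 1 else 0))"
    using jk by (intro sum.cong) auto
  moreover have "(\<Sum>l\<le>n. elem_mat n a b $$ (j, l) * h $$ (l, k)) = (\<Sum>l\<le>n. (if j = a \<and> l = b then 1 else 0) * h $$ (l, k))"
    using jk by (intro sum.cong) auto
  moreover have "h $$ (j, a) = (if j = a then h $$ (a, a) else 0)" "h $$ (b, k) = (if b = k then h $$ (b, b) else 0)"
    using h ab jk by (auto simp: cartan_iff)
  ultimately show "bracket h (elem_mat n a b) $$ (j, k) = (rt n a b h \<cdot>\<^sub>m elem_mat n a b) $$ (j, k)"
    using ab jk h c by (simp add: bracket_index sum_delta_prod rt_apply)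
qed (use bracket_carrier[of h n "elem_mat n a b"] h in \<open>auto simp: elem_mat_def cartan_iff\<close>)

lemma bracket_cartan_cartan:
  assumes g: "g \<in> cartan n" and h: "h \<in> cartan n"
  shows "bracket g h = 0\<^sub>m (Suc n) (Suc n)"
proof (rule eq_matI)
  have c: "g \<in> carrier_mat (Suc n) (Suc n)" "h \<in> carrier_mat (Suc n) (Suc n)"
    using g h by (auto simp: cartan_iff)
  fix j k assume "j < dim_row (0\<^sub>m (Suc n) (Suc n))" "k < dim_col (0\<^sub>m (Suc n) (Suc n))"
  then have jk: "j \<le> n" "k \<le> n" by auto
  have "g $$ (j, l) * h $$ (l, k) = h $$ (j, l) * g $$ (l, k)" if "l \<le> n" for l
    using that jk g h by (cases "j = l"; cases "l = k") (auto simp: cartan_iff)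
  then show "bracket g h $$ (j, k) = 0\<^sub>m (Suc n) (Suc n) $$ (j, k)" using c jk by (simp add: bracket_index)
qed (use bracket_carrier[of g n h] g h in \<open>auto simp: cartan_iff\<close>)

lemma bracket_pos_neg: "i \<in> {1..n} \<Longrightarrow> bracket (x_pos n i) (x_neg n i) = coroot n i"
  by (auto simp: x_pos_def x_neg_def bracket_elem_elem coroot_def)

lemma rt_coroot: "i \<in> {1..n} \<Longrightarrow> rt n (i - 1) i (coroot n i) = 2" "i \<in> {1..n} \<Longrightarrow> rt n i (i - 1) (coroot n i) = - 2"
  by (auto simp: rt_apply coroot_cartan coroot_index)

text \<open>An induction adapted to one matrix \<open>x\<close>: the Cartan case is needed only for
  matrices with the diagonal of \<open>x\<close>, the matrix unit case only for positions with a
  nonzero entry. Thus for strictly upper triangular \<open>x\<close> only positive roots arise. The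
  off-diagonal entries are added one by one.\<close>

lemma sl_decompose:
  assumes add: "\<And>x y. x \<in> sl n \<Longrightarrow> y \<in> sl n \<Longrightarrow> P x \<Longrightarrow> P y \<Longrightarrow> P (x + y)"
    and smult: "\<And>c x. x \<in> sl n \<Longrightarrow> P x \<Longrightarrow> P (c \<cdot>\<^sub>m x)"
    and cartan: "\<And>h. h \<in> cartan n \<Longrightarrow> \<forall>q\<le>n. h $$ (q, q) = x $$ (q, q) \<Longrightarrow> P h"
    and elem: "\<And>a b. a \<le> n \<Longrightarrow> b \<le> n \<Longrightarrow> a \<noteq> b \<Longrightarrow> x $$ (a, b) \<noteq> 0 \<Longrightarrow> P (elem_mat n a b)"
    and x: "x \<in> sl n"
  shows "P x"
proof -
  let ?off = "{(a, b). a \<le> n \<and> b \<le> n \<and> a \<noteq> b}"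
  have fin: "finite ?off" by (rule finite_subset[of _ "{..n} \<times> {..n}"]) auto
  let ?cut = "\<lambda>T. mat (Suc n) (Suc n) (\<lambda>(a, b). if a = b \<or> (a, b) \<in> T then x $$ (a, b) else 0)"
  have tr: "(\<Sum>j\<le>n. x $$ (j, j)) = 0" using x by (simp add: sl_def lessThan_Suc_atMost)
  have cut_sl: "?cut T \<in> sl n" for T using tr by (simp add: sl_def lessThan_Suc_atMost)
  have "P (?cut T)" if "finite T" "T \<subseteq> ?off" for T
    using that
  proof (induction T)
    case empty
    show ?case using tr by (intro cartan) (auto simp: cartan_iff)
  next
    case (insert e T)
    obtain a b where e: "e = (a, b)" and ab: "a \<le> n" "b \<le> n" "a \<noteq> b" using insert.prems by auto
    show ?case
    proof (cases "x $$ (a, b) = 0")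
      case True
      then have "?cut (insert e T) = ?cut T" by (intro eq_matI) (auto simp: e)
      then show ?thesis using insert by simp
    next
      case False
      have "?cut (insert e T) = ?cut T + x $$ (a, b) \<cdot>\<^sub>m elem_mat n a b"
        using insert.hyps ab by (intro eq_matI) (auto simp: e less_Suc_eq_le)
      moreover have "P (x $$ (a, b) \<cdot>\<^sub>m elem_mat n a b)"
        using ab False by (intro smult elem elem_mat_sl) auto
      ultimately show ?thesis using add[OF cut_sl[of T] sl_smult[OF elem_mat_sl[OF ab]]] insert by auto
    qed
  qed
  from this[OF fin] have "P (?cut ?off)" by simp
  moreover have "?cut ?off = x" using sl_carrier[OF x] by (intro eq_matI) (auto simp: less_Suc_eq_le)
  ultimately show ?thesis by simp
qed

text \<open>The strictly upper triangular matrices form a subalgebra that contains the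
  generators.\<close>

lemma n_pos_upper:
  assumes x: "x \<in> n_pos n"
  shows "x \<in> sl n \<and> (\<forall>a\<le>n. \<forall>b\<le>a. x $$ (a, b) = 0)"
proof -
  let ?U = "{x \<in> sl n. \<forall>a\<le>n. \<forall>b\<le>a. x $$ (a, b) = 0}"
  have br: "bracket x y \<in> ?U" if x: "x \<in> ?U" and y: "y \<in> ?U" for x y
  proof -
    have z: "(\<Sum>l\<le>n. x $$ (a, l) * y $$ (l, b)) = 0" if "a \<le> n" "b \<le> a" "x \<in> ?U" "y \<in> ?U" for a b x y
    proof (rule sum.neutral, intro ballI)
      fix l assume "l \<in> {..n}"
      then show "x $$ (a, l) * y $$ (l, b) = 0" using that by (cases "l \<le> a") auto
    qed
    have "bracket x y $$ (a, b) = 0" if "a \<le> n" "b \<le> a" for a b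
    proof -
      have "b \<le> n" using that by simp
      then show ?thesis using that x y z[OF that x y] z[OF that y x] by (simp add: bracket_index[of x n y] sl_carrier)
    qed
    then show ?thesis using x y bracket_sl by auto
  qed
  have "lie_subalgebra n ?U"
    unfolding lie_subalgebra_def
  proof (intro conjI ballI allI)
    fix x y assume xy: "x \<in> ?U" "y \<in> ?U"
    show "x + y \<in> ?U" using xy sl_add sl_dims by auto
    show "bracket x y \<in> ?U" by (rule br[OF xy])
  next
    fix c x assume "x \<in> ?U"
    then show "c \<cdot>\<^sub>m x \<in> ?U" using sl_smult sl_dims by auto
  qed (auto simp: sl_zero)
  moreover have "x_pos n ` {1..n} \<subseteq> ?U" using x_pos_sl by (auto simp: x_pos_def)
  ultimately show ?thesis using x unfolding n_pos_def by blast
qed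

text \<open>Commuting the unit at \<open>(a, b)\<close> with the next generator yields the unit at
  \<open>(a, Suc b)\<close>.\<close>

lemma elem_mat_n_pos: "a < b \<Longrightarrow> b \<le> n \<Longrightarrow> elem_mat n a b \<in> n_pos n"
  unfolding n_pos_def
proof safe
  fix U assume ab: "a < b" "b \<le> n" and U: "lie_subalgebra n U" "x_pos n ` {1..n} \<subseteq> U"
  have x: "x_pos n i \<in> U" if "i \<in> {1..n}" for i using that U by blast
  have "Suc a \<le> b" using ab by simp
  then show "elem_mat n a b \<in> U" using ab(2)
  proof (induction rule: dec_induct)
    case base
    then show ?case using x[of "Suc a"] by (simp add: x_pos_def)
  next
    case (step b)
    have "bracket (elem_mat n a b) (x_pos n (Suc b)) = elem_mat n a (Suc b)"
      using step by (auto simp: x_pos_def bracket_elem_elem intro!: eq_matI)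
    moreover have "elem_mat n a b \<in> U" "x_pos n (Suc b) \<in> U" using step x[of "Suc b"] by auto
    ultimately show ?case using U(1) unfolding lie_subalgebra_def by metis
  qed
qed

section \<open>Graded representations of the current algebra\<close>

lemma cartan_dual_outside: "\<mu> \<in> cartan_dual n \<Longrightarrow> h \<notin> cartan n \<Longrightarrow> \<mu> h = 0"
proof -
  assume "\<mu> \<in> cartan_dual n" "h \<notin> cartan n"
  moreover from this have "\<forall>h. h \<notin> cartan n \<longrightarrow> \<mu> h = 0"
    unfolding cartan_dual_def mem_Collect_eq by (elim conjE)
  ultimately show ?thesis by blast
qed

lemma cartan_dual_neq:
  assumes "\<mu> \<in> cartan_dual n" "\<nu> \<in> cartan_dual n" "\<mu> \<noteq> \<nu>"
  shows "\<exists>h\<in>cartan n. \<mu> h \<noteq> \<nu> h"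
proof (rule ccontr)
  assume eq: "\<not> ?thesis"
  have "\<mu> h = \<nu> h" for h
    using eq cartan_dual_outside[OF assms(1), of h] cartan_dual_outside[OF assms(2), of h] by metis
  then have "\<mu> = \<nu>" by (rule ext)
  then show False using assms(3) by simp
qed

lemma cartan_dual_combine:
  "\<mu> \<in> cartan_dual n \<Longrightarrow> \<nu> \<in> cartan_dual n \<Longrightarrow> (\<lambda>h. \<mu> h + c * \<nu> h) \<in> cartan_dual n"
proof -
  assume "\<mu> \<in> cartan_dual n" "\<nu> \<in> cartan_dual n"
  then obtain y z where "\<mu> = wt n y" "\<nu> = wt n z" using wt_coords by metis
  then show ?thesis by (simp add: wt_scale wt_plus wt_cartan_dual)
qed

lemma rt_cartan_dual: "rt n a b \<in> cartan_dual n"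
  by (simp add: rt_def wi_cartan_dual)

text \<open>The grading is assumed to be independent; that homogeneous vectors span belongs to
  \<open>gsub\<close> and is checked there for the whole space as well as for submodules.\<close>

locale current_rep =
  fixes n :: nat and S :: "'x cvec set" and A :: "complex mat \<Rightarrow> nat \<Rightarrow> 'x cvec \<Rightarrow> 'x cvec"
    and G :: "int \<Rightarrow> 'x cvec set"
  assumes S_sub: "vs.subspace S"
    and A_endo: "x \<in> sl n \<Longrightarrow> endo S (A x s)"
    and A_addl: "x \<in> sl n \<Longrightarrow> y \<in> sl n \<Longrightarrow> v \<in> S \<Longrightarrow> A (x + y) s v = A x s v + A y s v"
    and A_scl: "x \<in> sl n \<Longrightarrow> v \<in> S \<Longrightarrow> A (c \<cdot>\<^sub>m x) s v = sc c (A x s v)"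
    and A_br: "x \<in> sl n \<Longrightarrow> y \<in> sl n \<Longrightarrow> v \<in> S \<Longrightarrow>
      A (bracket x y) (r + s) v = A x r (A y s v) - A y s (A x r v)"
    and G_sub: "vs.subspace (G d)" and G_S: "G d \<subseteq> S"
    and A_G: "x \<in> sl n \<Longrightarrow> v \<in> G d \<Longrightarrow> A x s v \<in> G (d + int s)"
    and G_ind: "finite D \<Longrightarrow> (\<And>d. d \<in> D \<Longrightarrow> f d \<in> G d) \<Longrightarrow> (\<Sum>d\<in>D. f d) = 0 \<Longrightarrow> d \<in> D \<Longrightarrow> f d = 0"
    and G_fin: "\<exists>B. finite B \<and> G d \<subseteq> vs.span B"
begin

lemma A_in: "x \<in> sl n \<Longrightarrow> v \<in> S \<Longrightarrow> A x s v \<in> S"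
  and A_add: "x \<in> sl n \<Longrightarrow> v \<in> S \<Longrightarrow> w \<in> S \<Longrightarrow> A x s (v + w) = A x s v + A x s w"
  and A_sc: "x \<in> sl n \<Longrightarrow> v \<in> S \<Longrightarrow> A x s (sc c v) = sc c (A x s v)"
  using A_endo by (auto simp: endo_def)

lemma A_0: "x \<in> sl n \<Longrightarrow> A x s 0 = 0"
  using A_sc[of x 0 s 0] S_sub by (simp add: vs.subspace_0)

lemma A_zero_left: "v \<in> S \<Longrightarrow> A (0\<^sub>m (Suc n) (Suc n)) s v = 0"
proof -
  have "0 \<cdot>\<^sub>m 0\<^sub>m (Suc n) (Suc n) = (0\<^sub>m (Suc n) (Suc n) :: complex mat)" by auto
  then show "v \<in> S \<Longrightarrow> ?thesis" using A_scl[OF sl_zero, of v 0 s] by simp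
qed

section \<open>Graded submodules and their weights\<close>

definition gsub :: "'x cvec set \<Rightarrow> bool" where
  "gsub X \<longleftrightarrow> vs.subspace X \<and> X \<subseteq> S \<and> (\<forall>x\<in>sl n. \<forall>s. \<forall>v\<in>X. A x s v \<in> X) \<and>
     X \<subseteq> vs.span (\<Union>d. G d \<inter> X)"

lemma gsub_subspace: "gsub X \<Longrightarrow> vs.subspace X"
  and gsub_S: "gsub X \<Longrightarrow> v \<in> X \<Longrightarrow> v \<in> S"
  and gsub_A: "gsub X \<Longrightarrow> x \<in> sl n \<Longrightarrow> v \<in> X \<Longrightarrow> A x s v \<in> X"
  and gsub_graded: "gsub X \<Longrightarrow> X \<subseteq> vs.span (\<Union>d. G d \<inter> X)"
  by (auto simp: gsub_def)

definition weight_vector :: "weight \<Rightarrow> 'x cvec \<Rightarrow> bool" where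
  "weight_vector \<nu> v \<longleftrightarrow> (\<forall>h\<in>cartan n. A h 0 v = sc (\<nu> h) v)"

definition wts :: "'x cvec set \<Rightarrow> weight set" where
  "wts X = {\<nu> \<in> cartan_dual n. \<exists>v\<in>X. v \<noteq> 0 \<and> weight_vector \<nu> v}"

text \<open>A function outside \<open>cartan_dual n\<close> may agree on the Cartan subalgebra with
  a genuine weight. Its space is set to zero, as otherwise the family would not be
  independent.\<close>

definition E :: "int \<times> weight \<Rightarrow> 'x cvec set" where
  "E i = (if snd i \<in> cartan_dual n then {v \<in> G (fst i). weight_vector (snd i) v} else {0})"

lemma E_G: "v \<in> E (d, \<nu>) \<Longrightarrow> v \<in> G d"
  using G_sub[of d] by (auto simp: E_def vs.subspace_0 split: if_splits)

lemma E_subspace: "vs.subspace (E i)"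
proof (cases "snd i \<in> cartan_dual n")
  case True
  show ?thesis
  proof (rule vs.subspaceI)
    show "0 \<in> E i" using G_sub True by (auto simp: E_def weight_vector_def A_0 cartan_sl vs.subspace_0)
    fix x assume x: "x \<in> E i"
    show "sc c x \<in> E i" for c
      using x G_sub G_S True by (auto simp: E_def weight_vector_def A_sc cartan_sl vs.subspace_scale subsetD[OF G_S] mult.commute)
    fix y assume y: "y \<in> E i"
    show "x + y \<in> E i"
      using x y G_sub True by (auto simp: E_def weight_vector_def A_add cartan_sl vs.subspace_add subsetD[OF G_S] vs.scale_right_distrib)
  qed
qed (simp add: E_def vs.subspace_single_0)

lemma weight_vector_independent:
  assumes "finite N" "N \<subseteq> cartan_dual n" "\<And>\<nu>. \<nu> \<in> N \<Longrightarrow> g \<nu> \<in> S \<and> weight_vector \<nu> (g \<nu>)"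
    "(\<Sum>\<nu>\<in>N. g \<nu>) = 0" "\<nu> \<in> N"
  shows "g \<nu> = 0"
  using assms
proof (induction N arbitrary: g \<nu>)
  case (insert \<nu>0 N)
  have z: "g \<kappa> = 0" if \<kappa>: "\<kappa> \<in> N" for \<kappa>
  proof -
    have "\<kappa> \<noteq> \<nu>0" using \<kappa> insert.hyps by auto
    then obtain h where h: "\<kappa> h \<noteq> \<nu>0 h" by (meson ext)
    moreover have "h \<in> cartan n"
    proof (rule ccontr)
      assume "h \<notin> cartan n"
      then have "\<kappa> h = 0" "\<nu>0 h = 0" using insert.prems \<kappa> by (auto simp: cartan_dual_def)
      then show False using h by simp
    qed
    ultimately have h: "h \<in> cartan n" "\<kappa> h \<noteq> \<nu>0 h" by auto
    interpret H: sub_endo S "A h 0" using S_sub A_endo[OF cartan_sl[OF h(1)]] by unfold_locales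
    have "0 = A h 0 (\<Sum>\<nu>\<in>insert \<nu>0 N. g \<nu>) - sc (\<nu>0 h) (\<Sum>\<nu>\<in>insert \<nu>0 N. g \<nu>)"
      unfolding insert.prems(3) by (simp add: H.T_0)
    also have "\<dots> = (\<Sum>\<nu>\<in>insert \<nu>0 N. A h 0 (g \<nu>) - sc (\<nu>0 h) (g \<nu>))"
      using insert.prems(2) by (subst H.T_sum) (auto simp: sum_subtractf vs.scale_sum_right)
    also have "\<dots> = (\<Sum>\<nu>\<in>insert \<nu>0 N. sc (\<nu> h - \<nu>0 h) (g \<nu>))"
      using insert.prems(2) h(1) by (intro sum.cong) (auto simp: weight_vector_def vs.scale_left_diff_distrib)
    also have "\<dots> = (\<Sum>\<nu>\<in>N. sc (\<nu> h - \<nu>0 h) (g \<nu>))" using insert.hyps by simp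
    finally have "sc (\<kappa> h - \<nu>0 h) (g \<kappa>) = 0"
      using insert.IH[of "\<lambda>\<nu>. sc (\<nu> h - \<nu>0 h) (g \<nu>)" \<kappa>] insert.prems \<kappa>
      by (auto simp: weight_vector_def A_sc cartan_sl mult.commute H.V_simps)
    then show ?thesis using h(2) by (simp add: vs.scale_eq_0_iff)
  qed
  then have "g \<nu>0 = 0" using insert.prems(3) insert.hyps by simp
  then show ?case using z insert.prems by auto
qed simp

lemma E_independent:
  assumes "finite D" "\<And>i. i \<in> D \<Longrightarrow> f i \<in> E i" "(\<Sum>i\<in>D. f i) = 0" "i \<in> D"
  shows "f i = 0"
proof -
  obtain d \<nu> where i: "i = (d, \<nu>)" by (cases i)
  let ?N = "\<lambda>d. {\<nu>. (d, \<nu>) \<in> D}"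
  have "finite (?N d)" for d
    by (rule finite_subset[OF _ finite_imageI[OF assms(1), of snd]]) force
  with assms(1) have fin: "finite (fst ` D)" "finite (?N d)" for d by auto
  have "D = (SIGMA d:fst ` D. ?N d)" by force
  then have "(\<Sum>d\<in>fst ` D. \<Sum>\<nu>\<in>?N d. f (d, \<nu>)) = (\<Sum>i\<in>D. f i)"
    using fin by (simp add: sum.Sigma)
  moreover have "(\<Sum>\<nu>\<in>?N d. f (d, \<nu>)) \<in> G d" for d
  proof (intro vs.subspace_sum[OF G_sub])
    fix \<nu> assume "\<nu> \<in> ?N d"
    then have "(d, \<nu>) \<in> D" by simp
    then show "f (d, \<nu>) \<in> G d" by (rule E_G[OF assms(2)])
  qed
  ultimately have 0: "(\<Sum>\<nu>\<in>?N d. f (d, \<nu>)) = 0"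
    using G_ind[OF fin(1), of "\<lambda>d. \<Sum>\<nu>\<in>?N d. f (d, \<nu>)" d] assms(3,4) i by force
  show ?thesis
  proof (cases "\<nu> \<in> cartan_dual n")
    case False
    then show ?thesis using assms(2)[OF assms(4)] i by (simp add: E_def)
  next
    case True
    let ?N' = "?N d \<inter> cartan_dual n"
    have "(\<Sum>\<nu>\<in>?N'. f (d, \<nu>)) = (\<Sum>\<nu>\<in>?N d. f (d, \<nu>))"
      using fin assms(2) by (intro sum.mono_neutral_left) (force simp: E_def)+
    moreover have "f (d, \<kappa>) \<in> S \<and> weight_vector \<kappa> (f (d, \<kappa>))" if "\<kappa> \<in> ?N'" for \<kappa>
      using assms(2)[of "(d, \<kappa>)"] that G_S[of d] by (auto simp: E_def)
    ultimately have "f (d, \<nu>) = 0"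
      using weight_vector_independent[of ?N' "\<lambda>\<nu>. f (d, \<nu>)" \<nu>] 0 fin True assms(4) i by auto
    then show ?thesis by (simp add: i)
  qed
qed

sublocale D: direct_family E
  by unfold_locales (fact E_subspace, fact E_independent)

lemma A_coroot_br:
  assumes i: "i \<in> {1..n}" and v: "v \<in> S"
  shows "A (x_pos n i) 0 (A (x_neg n i) 0 v) = A (x_neg n i) 0 (A (x_pos n i) 0 v) + A (coroot n i) 0 v"
    and "A (coroot n i) 0 (A (x_pos n i) 0 v) = A (x_pos n i) 0 (A (coroot n i) 0 v) + sc 2 (A (x_pos n i) 0 v)"
    and "A (coroot n i) 0 (A (x_neg n i) 0 v) = A (x_neg n i) 0 (A (coroot n i) 0 v) - sc 2 (A (x_neg n i) 0 v)"
proof -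
  note sl = x_pos_sl[OF i] x_neg_sl[OF i] cartan_sl[OF coroot_cartan[OF i]]
  have "A (coroot n i) 0 v = A (x_pos n i) 0 (A (x_neg n i) 0 v) - A (x_neg n i) 0 (A (x_pos n i) 0 v)"
    using A_br[OF sl(1,2) v, of 0 0] by (simp add: bracket_pos_neg[OF i])
  then show "A (x_pos n i) 0 (A (x_neg n i) 0 v) = A (x_neg n i) 0 (A (x_pos n i) 0 v) + A (coroot n i) 0 v"
    by simp
  have "bracket (coroot n i) (x_pos n i) = 2 \<cdot>\<^sub>m x_pos n i" "bracket (coroot n i) (x_neg n i) = - 2 \<cdot>\<^sub>m x_neg n i"
    using bracket_cartan_elem[OF coroot_cartan[OF i], of "i - 1" i] rt_coroot[OF i]
      bracket_cartan_elem[OF coroot_cartan[OF i], of i "i - 1"] i by (auto simp: x_pos_def x_neg_def)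
  then have "sc 2 (A (x_pos n i) 0 v) = A (coroot n i) 0 (A (x_pos n i) 0 v) - A (x_pos n i) 0 (A (coroot n i) 0 v)"
    "sc (- 2) (A (x_neg n i) 0 v) = A (coroot n i) 0 (A (x_neg n i) 0 v) - A (x_neg n i) 0 (A (coroot n i) 0 v)"
    using A_br[OF sl(3,1) v, of 0 0] A_br[OF sl(3,2) v, of 0 0] sl v by (simp_all add: A_scl)
  then show "A (coroot n i) 0 (A (x_pos n i) 0 v) = A (x_pos n i) 0 (A (coroot n i) 0 v) + sc 2 (A (x_pos n i) 0 v)"
    "A (coroot n i) 0 (A (x_neg n i) 0 v) = A (x_neg n i) 0 (A (coroot n i) 0 v) - sc 2 (A (x_neg n i) 0 v)"
    by (simp_all add: algebra_simps)
qed

text \<open>The letters with exponent 0 preserve the degree, so each graded component of a submodule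
  is a finite-dimensional representation.\<close>

lemma sl2_layer:
  assumes X: "gsub X" and i: "i \<in> {1..n}"
  shows "sl2 (X \<inter> G d) (A (x_pos n i) 0) (A (x_neg n i) 0) (A (coroot n i) 0)"
proof -
  have e: "endo (X \<inter> G d) (A x 0)" if "x \<in> sl n" for x
    using that gsub_A[OF X that] A_G[OF that, of _ d 0] gsub_S[OF X]
    by (auto simp: endo_def A_add A_sc)
  show ?thesis
  proof unfold_locales
    show "vs.subspace (X \<inter> G d)" by (rule vs.subspace_inter[OF gsub_subspace[OF X] G_sub])
    show "\<exists>B. finite B \<and> X \<inter> G d \<subseteq> vs.span B" using G_fin[of d] by blast
  qed (use e[OF x_pos_sl[OF i]] e[OF x_neg_sl[OF i]] e[OF cartan_sl[OF coroot_cartan[OF i]]]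
      A_coroot_br[OF i] gsub_S[OF X] in auto)
qed

lemma A_cartan_commute:
  assumes "g \<in> cartan n" "h \<in> cartan n" "v \<in> S" shows "A g 0 (A h 0 v) = A h 0 (A g 0 v)"
  using A_br[of g h v 0 0] assms by (simp add: bracket_cartan_cartan cartan_sl A_zero_left)

lemma coroot_weight_vector:
  assumes v: "v \<in> S" and z: "\<And>i. i \<in> {1..n} \<Longrightarrow> A (coroot n i) 0 v = sc (of_int (z i)) v"
  shows "\<exists>b. weight_vector (wi n b) v"
proof -
  let ?b = "\<lambda>q. \<Sum>j\<in>{q<..n}. z j"
  have b: "?b (i - 1) - ?b i = z i" if "i \<in> {1..n}" for i
  proof -
    have "{i - 1<..n} = insert i {i<..n}" using that by auto
    then show ?thesis by simp
  qed
  have "A h 0 v = sc (wi n ?b h) v" if "h \<in> cartan n" for h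
    using that
  proof (induction rule: cartan_induct)
    case 1
    have "wi n ?b (0\<^sub>m (Suc n) (Suc n)) = 0" by (auto simp: wi_def wt_def)
    then show ?case using v by (simp add: A_zero_left)
  next
    case (2 i)
    then show ?case using z[OF 2] by (simp add: wi_coroot b del: One_nat_def)
  next
    case (3 g h)
    then show ?case using v by (simp add: A_addl cartan_sl wi_def wt_add vs.scale_left_distrib)
  next
    case (4 c h)
    then show ?case using v by (simp add: A_scl cartan_sl wi_def wt_smult)
  qed
  then show ?thesis unfolding weight_vector_def by blast
qed

text \<open>On a component every coroot is diagonalisable with integer eigenvalues, by its own copy
  of sl2. The coroots commute and determine the weight, so joint eigenvectors are vectors of
  integral weight.\<close>

lemma layer_span:
  assumes X: "gsub X"
  shows "X \<inter> G d \<subseteq> vs.span (\<Union>b. E (d, wi n b) \<inter> X)"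
proof -
  let ?U = "X \<inter> G d"
  have "?U \<subseteq> vs.span {u \<in> ?U. \<forall>i\<in>set [1..<Suc n]. \<exists>a::int. A (coroot n i) 0 u = sc (of_int a) u}"
  proof (rule joint_eigenspan)
    show "vs.subspace ?U" by (rule vs.subspace_inter[OF gsub_subspace[OF X] G_sub])
    fix i assume "i \<in> set [1..<Suc n]"
    then have i: "i \<in> {1..n}" by auto
    interpret sl2 ?U "A (x_pos n i) 0" "A (x_neg n i) 0" "A (coroot n i) 0" by (rule sl2_layer[OF X i])
    show "endo ?U (A (coroot n i) 0)" by (rule h)
    show "\<exists>K::nat. \<forall>v\<in>?U. pl (A (coroot n i) 0) (map of_int [- int K..int K]) v = 0" by (rule h_annihilator)
  next
    fix i j v assume "i \<in> set [1..<Suc n]" "j \<in> set [1..<Suc n]" "v \<in> ?U"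
    then show "A (coroot n i) 0 (A (coroot n j) 0 v) = A (coroot n j) 0 (A (coroot n i) 0 v)"
      using gsub_S[OF X] by (intro A_cartan_commute coroot_cartan) auto
  qed
  also have "\<dots> \<subseteq> vs.span (\<Union>b. E (d, wi n b) \<inter> X)"
  proof (rule vs.span_mono, safe)
    fix u assume u: "u \<in> X" "u \<in> G d" "\<forall>i\<in>set [1..<Suc n]. \<exists>a::int. A (coroot n i) 0 u = sc (of_int a) u"
    then have "\<forall>i\<in>{1..n}. \<exists>a::int. A (coroot n i) 0 u = sc (of_int a) u" by auto
    then obtain z :: "nat \<Rightarrow> int" where z: "\<And>i. i \<in> {1..n} \<Longrightarrow> A (coroot n i) 0 u = sc (of_int (z i)) u" by metis
    obtain b where "weight_vector (wi n b) u" using coroot_weight_vector[OF gsub_S[OF X u(1)] z] by blast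
    then show "u \<in> (\<Union>b. E (d, wi n b) \<inter> X)" using u by (auto simp: E_def wi_cartan_dual)
  qed
  finally show ?thesis .
qed

lemma weight_span:
  assumes X: "gsub X"
  shows "X \<subseteq> vs.span (\<Union>d b. E (d, wi n b) \<inter> X)"
proof -
  have "(\<Union>d. G d \<inter> X) \<subseteq> vs.span (\<Union>d b. E (d, wi n b) \<inter> X)"
  proof
    fix v assume "v \<in> (\<Union>d. G d \<inter> X)"
    then obtain d where "v \<in> X \<inter> G d" by auto
    then have "v \<in> vs.span (\<Union>b. E (d, wi n b) \<inter> X)" using layer_span[OF X] by blast
    then show "v \<in> vs.span (\<Union>d b. E (d, wi n b) \<inter> X)" by (rule set_mp[OF vs.span_mono, rotated]) auto
  qed
  then have "vs.span (\<Union>d. G d \<inter> X) \<subseteq> vs.span (\<Union>d b. E (d, wi n b) \<inter> X)"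
    by (rule vs.span_minimal) (rule vs.subspace_span)
  then show ?thesis using gsub_graded[OF X] by blast
qed

lemma gsub_E_span: "gsub X \<Longrightarrow> X \<subseteq> vs.span (\<Union>i. E i \<inter> X)"
  using weight_span by (rule order_trans[OF _ vs.span_mono]) auto

text \<open>The vectors that define \<open>wts\<close> need not be homogeneous. Applying
  \<open>A h 0 - \<nu> h\<close>, with \<open>h\<close> separating two weights, to a decomposition
  of such a vector kills every component of a weight other than \<open>\<nu>\<close>.\<close>

lemma weight_in_span:
  assumes v: "v \<in> vs.span (\<Union>i\<in>UNIV \<times> C. E i)" "weight_vector \<nu> v" "\<nu> \<in> cartan_dual n" "v \<noteq> 0"
  shows "\<nu> \<in> C"
proof (rule ccontr)
  assume \<nu>: "\<nu> \<notin> C"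
  obtain f D where D: "finite D" "D \<subseteq> UNIV \<times> C" "\<forall>i\<in>D. f i \<in> E i" and vf: "v = (\<Sum>i\<in>D. f i)"
    using span_UN_form[OF E_subspace v(1)] by blast
  have "f i = 0" if i: "i \<in> D" for i
  proof (cases "snd i \<in> cartan_dual n")
    case False
    then show ?thesis using D i by (auto simp: E_def)
  next
    case True
    have "snd i \<noteq> \<nu>" using i D(2) \<nu> by auto
    then obtain h where h: "h \<in> cartan n" "snd i h \<noteq> \<nu> h" using cartan_dual_neq[OF True v(3)] by blast
    interpret H: sub_endo S "A h 0" using S_sub A_endo[OF cartan_sl[OF h(1)]] by unfold_locales
    have fS: "f j \<in> S" if "j \<in> D" for j using D(3) that E_G[of "f j" "fst j" "snd j"] G_S[of "fst j"] by auto
    have "0 = A h 0 v - sc (\<nu> h) v" using v(2) h(1) by (simp add: weight_vector_def)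
    also have "\<dots> = (\<Sum>j\<in>D. A h 0 (f j) - sc (\<nu> h) (f j))"
      unfolding vf using fS by (subst H.T_sum) (auto simp: sum_subtractf vs.scale_sum_right)
    also have "\<dots> = (\<Sum>j\<in>D. sc (snd j h - \<nu> h) (f j))"
    proof (rule sum.cong)
      fix j assume "j \<in> D"
      then show "A h 0 (f j) - sc (\<nu> h) (f j) = sc (snd j h - \<nu> h) (f j)"
        using D(3) h(1) by (cases "snd j \<in> cartan_dual n")
          (auto simp: E_def weight_vector_def vs.scale_left_diff_distrib H.T_0)
    qed simp
    finally have "sc (snd i h - \<nu> h) (f i) = 0"
      using E_independent[OF D(1), of "\<lambda>j. sc (snd j h - \<nu> h) (f j)" i] D(3) i E_subspace
      by (auto simp: vs.subspace_scale)
    then show ?thesis using h(2) by (simp add: vs.scale_eq_0_iff)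
  qed
  then show False using vf v(4) by simp
qed

lemma wtsI: "v \<in> E (d, \<nu>) \<Longrightarrow> v \<in> X \<Longrightarrow> v \<noteq> 0 \<Longrightarrow> \<nu> \<in> wts X"
  by (auto simp: wts_def E_def split: if_splits)

lemma wts_mono: "X \<subseteq> Y \<Longrightarrow> wts X \<subseteq> wts Y"
  by (auto simp: wts_def)

lemma wts_span:
  assumes X: "gsub X" and C: "wts X \<subseteq> C"
  shows "X \<subseteq> vs.span (\<Union>i\<in>UNIV \<times> C. E i)"
proof -
  have "(\<Union>d b. E (d, wi n b) \<inter> X) \<subseteq> vs.span (\<Union>i\<in>UNIV \<times> C. E i)"
  proof safe
    fix v d b assume v: "v \<in> E (d, wi n b)" "v \<in> X"
    show "v \<in> vs.span (\<Union>i\<in>UNIV \<times> C. E i)"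
    proof (cases "v = 0")
      case False
      then have "wi n b \<in> C" using wtsI[OF v] C by auto
      then show ?thesis using v by (intro vs.span_base) auto
    qed (simp add: vs.span_zero)
  qed
  then have "vs.span (\<Union>d b. E (d, wi n b) \<inter> X) \<subseteq> vs.span (\<Union>i\<in>UNIV \<times> C. E i)"
    by (rule vs.span_minimal) (rule vs.subspace_span)
  then show ?thesis using weight_span[OF X] by blast
qed

text \<open>Otherwise the weight spaces of the weights different from \<open>\<nu>\<close> would
  span \<open>X\<close>, and \<open>\<nu>\<close> could not occur.\<close>

lemma wts_homogeneous:
  assumes X: "gsub X" and \<nu>: "\<nu> \<in> wts X"
  shows "\<exists>d. \<exists>v\<in>E (d, \<nu>) \<inter> X. v \<noteq> 0"
proof (rule ccontr)
  assume n: "\<not> ?thesis"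
  have "(\<Union>d b. E (d, wi n b) \<inter> X) \<subseteq> vs.span (\<Union>i\<in>UNIV \<times> (- {\<nu>}). E i)"
  proof safe
    fix v d b assume v: "v \<in> E (d, wi n b)" "v \<in> X"
    show "v \<in> vs.span (\<Union>i\<in>UNIV \<times> (- {\<nu>}). E i)"
    proof (cases "v = 0")
      case False
      then have "wi n b \<noteq> \<nu>" using n v by auto
      then show ?thesis using v by (intro vs.span_base) auto
    qed (simp add: vs.span_zero)
  qed
  then have "vs.span (\<Union>d b. E (d, wi n b) \<inter> X) \<subseteq> vs.span (\<Union>i\<in>UNIV \<times> (- {\<nu>}). E i)"
    by (rule vs.span_minimal) (rule vs.subspace_span)
  then have "X \<subseteq> vs.span (\<Union>i\<in>UNIV \<times> (- {\<nu>}). E i)" using weight_span[OF X] by blast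
  then show False using \<nu> weight_in_span[of _ "- {\<nu>}" \<nu>] unfolding wts_def by blast
qed

lemma wts_integral:
  assumes X: "gsub X" and \<nu>: "\<nu> \<in> wts X" shows "\<exists>b. \<nu> = wi n b"
proof -
  have sub: "(\<Union>d b. E (d, wi n b) \<inter> X) \<subseteq> (\<Union>i\<in>UNIV \<times> range (wi n). E i)" by auto
  have "X \<subseteq> vs.span (\<Union>i\<in>UNIV \<times> range (wi n). E i)"
    by (rule order_trans[OF weight_span[OF X] vs.span_mono[OF sub]])
  then have "\<nu> \<in> range (wi n)" using \<nu> weight_in_span[of _ "range (wi n)" \<nu>] unfolding wts_def by blast
  then show ?thesis by blast
qed

lemma A_elem_E:
  assumes "a \<le> n" "b \<le> n" "a \<noteq> b" "v \<in> E (d, \<nu>)"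
  shows "A (elem_mat n a b) s v \<in> E (d + int s, \<lambda>h. \<nu> h + rt n a b h)"
proof (cases "\<nu> \<in> cartan_dual n")
  case False
  then have "v = 0" using assms by (simp add: E_def)
  then show ?thesis using A_0[OF elem_mat_sl[OF assms(1-3)]] E_subspace by (simp add: vs.subspace_0)
next
  case True
  note sl = elem_mat_sl[OF assms(1-3)]
  have v: "v \<in> S" "v \<in> G d" "weight_vector \<nu> v" using assms(4) True G_S[of d] by (auto simp: E_def)
  have "A h 0 (A (elem_mat n a b) s v) = sc (\<nu> h + rt n a b h) (A (elem_mat n a b) s v)" if h: "h \<in> cartan n" for h
  proof -
    have "sc (rt n a b h) (A (elem_mat n a b) s v) = A h 0 (A (elem_mat n a b) s v) - A (elem_mat n a b) s (A h 0 v)"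
      using A_br[OF cartan_sl[OF h] sl v(1), of 0 s] assms(1,2) h v(1) by (simp add: bracket_cartan_elem A_scl sl)
    moreover have "A (elem_mat n a b) s (A h 0 v) = sc (\<nu> h) (A (elem_mat n a b) s v)"
      using v h sl by (simp add: weight_vector_def A_sc)
    ultimately show ?thesis by (simp add: vs.scale_left_distrib algebra_simps)
  qed
  moreover have "(\<lambda>h. \<nu> h + rt n a b h) \<in> cartan_dual n"
    using cartan_dual_combine[OF True rt_cartan_dual, of 1] by simp
  ultimately show ?thesis using A_G[OF sl v(2)] by (simp add: E_def weight_vector_def)
qed

lemma A_elem_pow_E:
  assumes "a \<le> n" "b \<le> n" "a \<noteq> b" "v \<in> E (d, \<nu>)"
  shows "(A (elem_mat n a b) 0 ^^ k) v \<in> E (d, \<lambda>h. \<nu> h + of_nat k * rt n a b h)"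
proof (induction k)
  case (Suc k)
  then show ?case using A_elem_E[OF assms(1-3) Suc, of 0] by (simp add: algebra_simps)
qed (simp add: assms)

lemma A_pow_in: "gsub X \<Longrightarrow> x \<in> sl n \<Longrightarrow> v \<in> X \<Longrightarrow> (A x 0 ^^ k) v \<in> X"
  by (induction k) (auto simp: gsub_A)

text \<open>With \<open>a\<close> the value at the coroot, apply the lowering operator
  \<open>a\<close> times, or the raising operator \<open>- a\<close> times; by
  \<open>fpow_nonzero\<close> for the triple or its opposite the result is a nonzero vector of the
  reflected weight.\<close>

lemma wts_refl:
  assumes X: "gsub X" and \<nu>: "\<nu> \<in> wts X" and i: "i \<in> {1..n}"
  shows "simple_refl n i \<nu> \<in> wts X"
proof -
  obtain d v where v: "v \<in> E (d, \<nu>)" "v \<in> X" "v \<noteq> 0" using wts_homogeneous[OF X \<nu>] by blast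
  obtain b where b: "\<nu> = wi n b" using wts_integral[OF X \<nu>] by blast
  let ?a = "b (i - 1) - b i"
  interpret sl2 "X \<inter> G d" "A (x_pos n i) 0" "A (x_neg n i) 0" "A (coroot n i) 0" by (rule sl2_layer[OF X i])
  interpret O: sl2 "X \<inter> G d" "A (x_neg n i) 0" "A (x_pos n i) 0" "\<lambda>v. - A (coroot n i) 0 v" by (rule opp)
  have vV: "v \<in> X \<inter> G d" using v E_G by auto
  have "\<nu> \<in> cartan_dual n" using \<nu> by (simp add: wts_def)
  then have hv: "A (coroot n i) 0 v = sc (of_int ?a) v"
    using v(1) coroot_cartan[OF i] by (simp add: E_def weight_vector_def b wi_coroot[OF i] del: One_nat_def)
  have \<nu>i: "\<nu> (coroot n i) = of_int ?a" unfolding b by (rule wi_coroot[OF i])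
  have ne: "(\<lambda>h. - rt n (i - 1) i h) = rt n i (i - 1)"
    by (simp add: rt_def wi_uminus fun_eq_iff)
  show ?thesis
  proof (cases "0 \<le> ?a")
    case True
    let ?w = "(A (x_neg n i) 0 ^^ nat ?a) v"
    have "?w \<noteq> 0" using fpow_nonzero[OF vV, of "nat ?a"] hv True v(3) by auto
    moreover have "?w \<in> X" using A_pow_in[OF X x_neg_sl[OF i] v(2)] .
    moreover have "?w \<in> E (d, \<lambda>h. \<nu> h + of_nat (nat ?a) * rt n i (i - 1) h)"
      unfolding x_neg_def using i v by (intro A_elem_pow_E) auto
    moreover have "(\<lambda>h. \<nu> h + of_nat (nat ?a) * rt n i (i - 1) h) = simple_refl n i \<nu>"
      unfolding simple_refl_def \<nu>i simple_root_rt[OF i] ne[symmetric] using True by simp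
    ultimately show ?thesis using wtsI by metis
  next
    case False
    let ?w = "(A (x_pos n i) 0 ^^ nat (- ?a)) v"
    have "- A (coroot n i) 0 v = sc (of_nat (nat (- ?a))) v"
      unfolding hv vs.scale_minus_left[symmetric] using False by (intro arg_cong[of _ _ "\<lambda>c. sc c v"]) simp
    then have "?w \<noteq> 0" using O.fpow_nonzero[OF vV] v(3) by auto
    moreover have "?w \<in> X" using A_pow_in[OF X x_pos_sl[OF i] v(2)] .
    moreover have "?w \<in> E (d, \<lambda>h. \<nu> h + of_nat (nat (- ?a)) * rt n (i - 1) i h)"
      unfolding x_pos_def using i v by (intro A_elem_pow_E) auto
    moreover have "(\<lambda>h. \<nu> h + of_nat (nat (- ?a)) * rt n (i - 1) i h) = simple_refl n i \<nu>"
      unfolding simple_refl_def \<nu>i simple_root_rt[OF i] using False by (simp add: algebra_simps fun_eq_iff)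
    ultimately show ?thesis using wtsI by metis
  qed
qed

text \<open>The largest graded submodule of \<open>X\<close> with weights in \<open>C\<close>.\<close>
definition Nm :: "weight set \<Rightarrow> 'x cvec set \<Rightarrow> 'x cvec set" where
  "Nm C X = vs.span (\<Union>{Y. gsub Y \<and> Y \<subseteq> X \<and> wts Y \<subseteq> C})"

lemma Nm_max: "gsub Y \<Longrightarrow> Y \<subseteq> X \<Longrightarrow> wts Y \<subseteq> C \<Longrightarrow> Y \<subseteq> Nm C X"
  unfolding Nm_def by (rule order_trans[OF _ vs.span_superset]) auto

lemma Nm_sub: "gsub X \<Longrightarrow> Nm C X \<subseteq> X"
  unfolding Nm_def by (rule vs.span_minimal) (auto simp: gsub_subspace)

lemma Nm_gsub:
  assumes X: "gsub X" shows "gsub (Nm C X)"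
  unfolding gsub_def
proof (intro conjI ballI allI)
  let ?F = "\<Union>{Y. gsub Y \<and> Y \<subseteq> X \<and> wts Y \<subseteq> C}"
  show "vs.subspace (Nm C X)" by (simp add: Nm_def vs.subspace_span)
  show NS: "Nm C X \<subseteq> S" using Nm_sub[OF X] X by (auto simp: gsub_def)
  fix x s v assume x: "x \<in> sl n" and "v \<in> Nm C X"
  then have "v \<in> vs.span ?F" by (simp add: Nm_def)
  then have "A x s v \<in> vs.span ?F \<and> v \<in> S"
  proof (induction rule: vs.span_induct_alt)
    case base
    then show ?case using S_sub by (simp add: A_0[OF x] vs.span_zero vs.subspace_0)
  next
    case (step c u w)
    then have "u \<in> S" using gsub_S by auto
    moreover have "A x s u \<in> vs.span ?F"
      using step(1) x by (intro vs.span_base) (auto simp: gsub_A)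
    ultimately show ?case using step x S_sub
      by (simp add: A_add A_sc vs.subspace_scale vs.subspace_add vs.span_add vs.span_scale)
  qed
  then show "A x s v \<in> Nm C X" by (simp add: Nm_def)
next
  let ?F = "\<Union>{Y. gsub Y \<and> Y \<subseteq> X \<and> wts Y \<subseteq> C}"
  have "?F \<subseteq> vs.span (\<Union>d. G d \<inter> Nm C X)"
  proof safe
    fix v Y assume Y: "v \<in> Y" "gsub Y" "Y \<subseteq> X" "wts Y \<subseteq> C"
    then have "v \<in> vs.span (\<Union>d. G d \<inter> Y)" using gsub_graded by blast
    then show "v \<in> vs.span (\<Union>d. G d \<inter> Nm C X)"
      by (rule set_mp[OF vs.span_mono, rotated]) (use Nm_max[OF Y(2-4)] in auto)
  qed
  then show "Nm C X \<subseteq> vs.span (\<Union>d. G d \<inter> Nm C X)"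
    unfolding Nm_def by (rule vs.span_minimal) (rule vs.subspace_span)
qed

text \<open>A sum of submodules could have new weight vectors, but it lies in the span of the weight
  spaces with weights in \<open>C\<close>, and \<open>weight_in_span\<close> applies.\<close>

lemma Nm_wts:
  assumes X: "gsub X" shows "wts (Nm C X) \<subseteq> C"
proof -
  have "(\<Union>{Y. gsub Y \<and> Y \<subseteq> X \<and> wts Y \<subseteq> C}) \<subseteq> vs.span (\<Union>i\<in>UNIV \<times> C. E i)"
    using wts_span by blast
  then have "Nm C X \<subseteq> vs.span (\<Union>i\<in>UNIV \<times> C. E i)"
    unfolding Nm_def by (rule vs.span_minimal) (rule vs.subspace_span)
  then show ?thesis using weight_in_span unfolding wts_def by blast
qed

lemma Nm_eq: "gsub X \<Longrightarrow> wts X \<subseteq> C \<Longrightarrow> Nm C X = X"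
  using Nm_max[of X X C] Nm_sub[of X C] by blast

text \<open>Lets the induction replace \<open>X\<close> by a smaller submodule without changing the
  canonical submodules below.\<close>

lemma Nm_Nm: assumes X: "gsub X" and C: "C \<subseteq> C'" shows "Nm C (Nm C' X) = Nm C X"
proof
  note g = Nm_gsub[OF X] and w = Nm_wts[OF X] and s = Nm_sub[OF X]
  show "Nm C (Nm C' X) \<subseteq> Nm C X"
    using Nm_sub[OF g] s by (intro Nm_max[OF Nm_gsub[OF g] _ Nm_wts[OF g]]) blast
  have "Nm C X \<subseteq> Nm C' X" using C w[of C] by (intro Nm_max[OF g s]) blast
  then show "Nm C X \<subseteq> Nm C (Nm C' X)" by (rule Nm_max[OF g _ w])
qed

end

section \<open>Coinduced functions on words\<close>

abbreviation words :: "nat \<Rightarrow> current_word set" where "words n \<equiv> lists (sl n \<times> UNIV)"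

definition wdeg :: "current_word \<Rightarrow> nat" where "wdeg u = sum_list (map snd u)"

text \<open>A functional on the global Weyl module of highest weight \<open>m\<close>, read off on the words that span it.\<close>
definition word_functionals :: "nat \<Rightarrow> weight \<Rightarrow> (current_word \<Rightarrow> complex) set" where
  "word_functionals n m = {g. (\<forall>u. u \<notin> words n \<longrightarrow> g u = 0) \<and>
     (\<forall>w\<in>words n. \<forall>u\<in>words n. \<forall>x\<in>sl n. \<forall>y\<in>sl n. \<forall>s.
        g (w @ (x + y, s) # u) = g (w @ (x, s) # u) + g (w @ (y, s) # u)) \<and>
     (\<forall>w\<in>words n. \<forall>u\<in>words n. \<forall>c. \<forall>x\<in>sl n. \<forall>s. g (w @ (c \<cdot>\<^sub>m x, s) # u) = c * g (w @ (x, s) # u)) \<and>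
     (\<forall>w\<in>words n. \<forall>u\<in>words n. \<forall>x\<in>sl n. \<forall>y\<in>sl n. \<forall>r s.
        g (w @ (bracket x y, r + s) # u) = g (w @ (x, r) # (y, s) # u) - g (w @ (y, s) # (x, r) # u)) \<and>
     (\<forall>w\<in>words n. \<forall>x\<in>n_pos n. \<forall>s. g (w @ [(x, s)]) = 0) \<and>
     (\<forall>w\<in>words n. \<forall>i\<in>{1..n}. \<forall>k. m (coroot n i) = of_nat k \<longrightarrow> g (w @ replicate (k + 1) (x_neg n i, 0)) = 0) \<and>
     (\<forall>w\<in>words n. \<forall>h\<in>cartan n. g (w @ [(h, 0)]) = m h * g w)}"

lemma word_functionalsD:
  assumes "g \<in> word_functionals n m"
  shows "u \<notin> words n \<Longrightarrow> g u = 0"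
    and "w \<in> words n \<Longrightarrow> u \<in> words n \<Longrightarrow> x \<in> sl n \<Longrightarrow> y \<in> sl n \<Longrightarrow>
        g (w @ (x + y, s) # u) = g (w @ (x, s) # u) + g (w @ (y, s) # u)"
    and "w \<in> words n \<Longrightarrow> u \<in> words n \<Longrightarrow> x \<in> sl n \<Longrightarrow> g (w @ (c \<cdot>\<^sub>m x, s) # u) = c * g (w @ (x, s) # u)"
    and "w \<in> words n \<Longrightarrow> u \<in> words n \<Longrightarrow> x \<in> sl n \<Longrightarrow> y \<in> sl n \<Longrightarrow>
        g (w @ (bracket x y, r + s) # u) = g (w @ (x, r) # (y, s) # u) - g (w @ (y, s) # (x, r) # u)"
    and "w \<in> words n \<Longrightarrow> x \<in> n_pos n \<Longrightarrow> g (w @ [(x, s)]) = 0"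
    and "w \<in> words n \<Longrightarrow> i \<in> {1..n} \<Longrightarrow> m (coroot n i) = of_nat k \<Longrightarrow> g (w @ replicate (k + 1) (x_neg n i, 0)) = 0"
    and "w \<in> words n \<Longrightarrow> h \<in> cartan n \<Longrightarrow> g (w @ [(h, 0)]) = m h * g w"
proof -
  note c = assms[unfolded word_functionals_def mem_Collect_eq]
  show "u \<notin> words n \<Longrightarrow> g u = 0"
    by (rule c[THEN conjunct1, rule_format])
  show "w \<in> words n \<Longrightarrow> u \<in> words n \<Longrightarrow> x \<in> sl n \<Longrightarrow> y \<in> sl n \<Longrightarrow>
        g (w @ (x + y, s) # u) = g (w @ (x, s) # u) + g (w @ (y, s) # u)"
    by (rule c[THEN conjunct2, THEN conjunct1, rule_format])
  show "w \<in> words n \<Longrightarrow> u \<in> words n \<Longrightarrow> x \<in> sl n \<Longrightarrow> g (w @ (c \<cdot>\<^sub>m x, s) # u) = c * g (w @ (x, s) # u)"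
    by (rule c[THEN conjunct2, THEN conjunct2, THEN conjunct1, rule_format])
  show "w \<in> words n \<Longrightarrow> u \<in> words n \<Longrightarrow> x \<in> sl n \<Longrightarrow> y \<in> sl n \<Longrightarrow>
        g (w @ (bracket x y, r + s) # u) = g (w @ (x, r) # (y, s) # u) - g (w @ (y, s) # (x, r) # u)"
    by (rule c[THEN conjunct2, THEN conjunct2, THEN conjunct2, THEN conjunct1, rule_format])
  show "w \<in> words n \<Longrightarrow> x \<in> n_pos n \<Longrightarrow> g (w @ [(x, s)]) = 0"
    by (rule c[THEN conjunct2, THEN conjunct2, THEN conjunct2, THEN conjunct2, THEN conjunct1, rule_format])
  show "w \<in> words n \<Longrightarrow> i \<in> {1..n} \<Longrightarrow> m (coroot n i) = of_nat k \<Longrightarrow> g (w @ replicate (k + 1) (x_neg n i, 0)) = 0"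
    by (rule c[THEN conjunct2, THEN conjunct2, THEN conjunct2, THEN conjunct2, THEN conjunct2, THEN conjunct1, rule_format])
  show "w \<in> words n \<Longrightarrow> h \<in> cartan n \<Longrightarrow> g (w @ [(h, 0)]) = m h * g w"
    by (rule c[THEN conjunct2, THEN conjunct2, THEN conjunct2, THEN conjunct2, THEN conjunct2, THEN conjunct2, rule_format])
qed

lemmas word_functionalsD' = word_functionalsD(2)[where w = "[]", simplified] word_functionalsD(3)[where w = "[]", simplified]
  word_functionalsD(4)[where w = "[]", simplified] word_functionalsD(5)[where w = "[]", simplified]
  word_functionalsD(7)[where w = "[]", simplified]

definition word_act :: "complex mat \<Rightarrow> nat \<Rightarrow> (current_word \<Rightarrow> complex) \<Rightarrow> current_word \<Rightarrow> complex" where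
  "word_act x s g = (\<lambda>u. - g ((x, s) # u))"

lemma word_act_functional:
  assumes g: "g \<in> word_functionals n m" and x: "x \<in> sl n"
  shows "word_act x s g \<in> word_functionals n m"
proof -
  note D = word_functionalsD[OF g]
  have c: "(x, s) # w \<in> words n" if "w \<in> words n" for w using that x by auto
  show ?thesis
    unfolding word_functionals_def mem_Collect_eq word_act_def
  proof (intro conjI allI ballI impI)
    fix u assume "u \<notin> words n"
    then show "- g ((x, s) # u) = 0" using D(1)[of "(x, s) # u"] by simp
  next
    fix w u y z t assume "w \<in> words n" "u \<in> words n" "y \<in> sl n" "z \<in> sl n"
    then show "- g ((x, s) # w @ (y + z, t) # u) = - g ((x, s) # w @ (y, t) # u) + - g ((x, s) # w @ (z, t) # u)"
      using D(2)[OF c] by simp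
  next
    fix w u a y t assume "w \<in> words n" "u \<in> words n" "y \<in> sl n"
    then show "- g ((x, s) # w @ (a \<cdot>\<^sub>m y, t) # u) = a * - g ((x, s) # w @ (y, t) # u)"
      using D(3)[OF c] by simp
  next
    fix w u y z r t assume "w \<in> words n" "u \<in> words n" "y \<in> sl n" "z \<in> sl n"
    then show "- g ((x, s) # w @ (bracket y z, r + t) # u)
        = - g ((x, s) # w @ (y, r) # (z, t) # u) - - g ((x, s) # w @ (z, t) # (y, r) # u)"
      using D(4)[OF c] by simp
  next
    fix w y t assume "w \<in> words n" "y \<in> n_pos n"
    then show "- g ((x, s) # w @ [(y, t)]) = 0" using D(5)[OF c] by simp
  next
    fix w i k assume "w \<in> words n" "i \<in> {1..n}" "m (coroot n i) = of_nat k"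
    then show "- g ((x, s) # w @ replicate (k + 1) (x_neg n i, 0)) = 0" using D(6)[OF c] by simp
  next
    fix w h assume "w \<in> words n" "h \<in> cartan n"
    then show "- g ((x, s) # w @ [(h, 0)]) = m h * - g ((x, s) # w)" using D(7)[OF c] by simp
  qed
qed

definition low_letters :: "nat \<Rightarrow> complex mat set" where
  "low_letters n = cartan n \<union> {elem_mat n a b | a b. b < a \<and> a \<le> n}"

lemma low_letters_sl: "x \<in> low_letters n \<Longrightarrow> x \<in> sl n"
  by (auto simp: low_letters_def cartan_sl intro: elem_mat_sl)

abbreviation low_words :: "nat \<Rightarrow> current_word set" where "low_words n \<equiv> lists (low_letters n \<times> UNIV)"

lemma low_words_words: "u \<in> low_words n \<Longrightarrow> u \<in> words n"
  using low_letters_sl by (induction u) auto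

text \<open>The span of the words in the opposite Borel subalgebra is stable under all letters: commute a
  letter to the right until it meets the generator.\<close>
lemma low_words_letter:
  assumes "u \<in> low_words n" "x \<in> sl n" "g \<in> word_functionals n m" "\<forall>u\<in>low_words n. g u = 0"
  shows "g ((x, s) # u) = 0"
  using assms
proof (induction u arbitrary: x s g rule: list.induct)
  case Nil
  note D = word_functionalsD'[OF Nil(3)]
  show ?case
  proof (rule sl_decompose[of n "\<lambda>x. g [(x, s)] = 0"])
    fix a b assume ab: "a \<le> n" "b \<le> n" "a \<noteq> b"
    show "g [(elem_mat n a b, s)] = 0"
    proof (cases "a < b")
      case True
      then show ?thesis using D(4) ab elem_mat_n_pos by simp
    next
      case False
      then have "b < a" using ab by simp
      then have "elem_mat n a b \<in> low_letters n" unfolding low_letters_def using ab by blast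
      then have "[(elem_mat n a b, s)] \<in> low_words n" by simp
      then show ?thesis using Nil by blast
    qed
  next
    fix h assume "h \<in> cartan n"
    then have "[(h, s)] \<in> low_words n" by (auto simp: low_letters_def)
    then show "g [(h, s)] = 0" using Nil by blast
  qed (use D(1,2)[of "[]"] Nil in auto)
next
  case (Cons l u)
  obtain y t where l: "l = (y, t)" by (cases l)
  have y: "y \<in> low_letters n" and u: "u \<in> low_words n" using Cons.prems l by auto
  have ysl: "y \<in> sl n" using y by (rule low_letters_sl)
  have "g ((bracket x y, s + t) # u) = 0"
    using Cons.IH[OF u bracket_sl[OF Cons.prems(2) ysl]] Cons.prems by blast
  moreover have "word_act y t g ((x, s) # u) = 0"
  proof (rule Cons.IH[OF u Cons.prems(2) word_act_functional[OF Cons.prems(3) ysl]])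
    show "\<forall>u\<in>low_words n. word_act y t g u = 0"
    proof
      fix w assume "w \<in> low_words n"
      then have "(y, t) # w \<in> low_words n" using y by auto
      then show "word_act y t g w = 0" using Cons.prems(4) by (simp add: word_act_def)
    qed
  qed
  ultimately show ?case
    using word_functionalsD'(3)[OF Cons.prems(3) low_words_words[OF u] Cons.prems(2) ysl, of s t]
    by (simp add: l word_act_def)
qed

text \<open>The part of the Poincare-Birkhoff-Witt theorem that matters here: vanishing on
  \<open>low_words\<close> is inherited by \<open>word_act x s g\<close> for every letter, so the
  letters of an arbitrary word can be absorbed one after the other.\<close>

lemma low_words_determine:
  assumes "u \<in> words n" "g \<in> word_functionals n m" "\<forall>u\<in>low_words n. g u = 0"
  shows "g u = 0"
  using assms
proof (induction u arbitrary: g rule: list.induct)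
  case (Cons l u)
  obtain x s where l: "l = (x, s)" by (cases l)
  have x: "x \<in> sl n" and u: "u \<in> words n" using Cons.prems l by auto
  have "word_act x s g u = 0"
  proof (rule Cons.IH[OF u word_act_functional[OF Cons.prems(2) x]])
    show "\<forall>u\<in>low_words n. word_act x s g u = 0"
      using low_words_letter[OF _ x Cons.prems(2,3)] by (simp add: word_act_def)
  qed
  then show ?case by (simp add: word_act_def l)
qed simp

lemma low_words_exist:
  assumes "g \<in> word_functionals n m" "g u \<noteq> 0"
  shows "\<exists>w\<in>low_words n. g w \<noteq> 0"
  using low_words_determine[of u n g m] word_functionalsD(1)[OF assms(1)] assms by blast

text \<open>Each lower triangular letter subtracts a positive root from the weight of the generator.
  The order of quantifiers matters: \<open>\<beta>\<close> depends on the word only, not on the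
  functional, so that the induction can pass to \<open>word_act y s g\<close>.\<close>

lemma low_word_weight:
  assumes "u \<in> low_words n"
  shows "\<exists>\<beta>\<in>root_lattice_pos n. \<forall>g\<in>word_functionals n m. \<forall>h\<in>cartan n. g ((h, 0) # u) = (m h - \<beta> h) * g u"
  using assms
proof (induction u rule: list.induct)
  case Nil
  show ?case using zero_pos by (intro bexI[of _ "\<lambda>h. 0"]) (auto simp: word_functionalsD')
next
  case (Cons l u)
  obtain y s where l: "l = (y, s)" by (cases l)
  have y: "y \<in> low_letters n" and u: "u \<in> low_words n" using Cons.prems l by auto
  note ysl = low_letters_sl[OF y] and uw = low_words_words[OF u]
  obtain \<beta> where \<beta>: "\<beta> \<in> root_lattice_pos n"
    and eq: "\<And>g h. g \<in> word_functionals n m \<Longrightarrow> h \<in> cartan n \<Longrightarrow> g ((h, 0) # u) = (m h - \<beta> h) * g u"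
    using Cons u by auto
  \<comment> \<open>The Cartan letter is moved past \<open>l\<close>; the commutator is the last
    summand.\<close>
  have step: "g ((h, 0) # l # u) = (m h - \<beta> h) * g (l # u) + g ((bracket h y, s) # u)"
    if g: "g \<in> word_functionals n m" and h: "h \<in> cartan n" for g h
    using word_functionalsD'(3)[OF g uw cartan_sl[OF h] ysl, of 0 s] eq[OF word_act_functional[OF g ysl] h, of s]
    by (simp add: l word_act_def algebra_simps)
  consider "y \<in> cartan n" | a b where "y = elem_mat n a b" "b < a" "a \<le> n"
    using y by (auto simp: low_letters_def)
  then show ?case
  proof cases
    case 1
    have 0: "g ((bracket h y, s) # u) = 0" if g: "g \<in> word_functionals n m" and h: "h \<in> cartan n" for g h
    proof -
      have "0 \<cdot>\<^sub>m 0\<^sub>m (Suc n) (Suc n) = (0\<^sub>m (Suc n) (Suc n) :: complex mat)" by auto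
      then show ?thesis using word_functionalsD'(2)[OF g uw sl_zero, of 0 s] bracket_cartan_cartan[OF h 1] by simp
    qed
    have "g ((h, 0) # l # u) = (m h - \<beta> h) * g (l # u)"
      if "g \<in> word_functionals n m" "h \<in> cartan n" for g h using step[OF that] 0[OF that] by simp
    then show ?thesis using \<beta> by blast
  next
    case 2
    let ?\<gamma> = "\<lambda>h. \<beta> h + rt n b a h"
    have 0: "g ((bracket h y, s) # u) = - rt n b a h * g (l # u)"
      if g: "g \<in> word_functionals n m" and h: "h \<in> cartan n" for g h
    proof -
      have "bracket h y = (- rt n b a h) \<cdot>\<^sub>m y" using bracket_cartan_elem[OF h, of a b] 2 h by (simp add: rt_apply)
      then show ?thesis using word_functionalsD'(2)[OF g uw ysl] by (simp add: l)
    qed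
    have "g ((h, 0) # l # u) = (m h - ?\<gamma> h) * g (l # u)"
      if "g \<in> word_functionals n m" "h \<in> cartan n" for g h
      using step[OF that] 0[OF that] by (simp add: algebra_simps)
    moreover have "?\<gamma> \<in> root_lattice_pos n" using \<beta> rt_pos[of b a n] 2 by (intro root_lattice_pos_add) auto
    ultimately show ?thesis by (intro bexI[of _ ?\<gamma>] ballI)
  qed
qed

lemma root_lattice_pos_dual: "\<beta> \<in> root_lattice_pos n \<Longrightarrow> \<beta> \<in> cartan_dual n"
  by (auto simp: root_lattice_pos_eq wi_cartan_dual)

subsection \<open>Homomorphisms to coinduced functions\<close>

context current_rep
begin

text \<open>\<open>p\<close> is a morphism from \<open>X\<close> to the dual global Weyl module whose lowest weight is \<open>\<mu>\<close>,
  placed so that its lowest weight space has degree \<open>r\<close>; elements of the latter are functions on words.\<close>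
definition nhom :: "'x cvec set \<Rightarrow> weight \<Rightarrow> int \<Rightarrow> ('x cvec \<Rightarrow> current_word \<Rightarrow> complex) \<Rightarrow> bool" where
  "nhom X \<mu> r p \<longleftrightarrow> (\<forall>v\<in>X. p v \<in> word_functionals n (\<lambda>h. - \<mu> h)) \<and>
     (\<forall>v\<in>X. \<forall>w\<in>X. \<forall>u. p (v + w) u = p v u + p w u) \<and>
     (\<forall>c. \<forall>v\<in>X. \<forall>u. p (sc c v) u = c * p v u) \<and>
     (\<forall>x\<in>sl n. \<forall>s. \<forall>v\<in>X. \<forall>u. p (A x s v) u = - p v ((x, s) # u)) \<and>
     (\<forall>d. \<forall>v\<in>X \<inter> G d. \<forall>u. p v u \<noteq> 0 \<longrightarrow> int (wdeg u) = r - d)"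

lemma nhomD:
  assumes "nhom X \<mu> r p"
  shows "v \<in> X \<Longrightarrow> p v \<in> word_functionals n (\<lambda>h. - \<mu> h)"
    and "v \<in> X \<Longrightarrow> w \<in> X \<Longrightarrow> p (v + w) u = p v u + p w u"
    and "v \<in> X \<Longrightarrow> p (sc c v) u = c * p v u"
    and "x \<in> sl n \<Longrightarrow> v \<in> X \<Longrightarrow> p (A x s v) u = - p v ((x, s) # u)"
    and "v \<in> X \<Longrightarrow> v \<in> G d \<Longrightarrow> p v u \<noteq> 0 \<Longrightarrow> int (wdeg u) = r - d"
  using assms unfolding nhom_def by blast+

lemma nhom_mono: "nhom X \<mu> r p \<Longrightarrow> Y \<subseteq> X \<Longrightarrow> nhom Y \<mu> r p"
  unfolding nhom_def by blast

text \<open>The letters of a word act from left to right, because a morphism moves the first letter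
  of its argument onto the vector first. This is the action of the reversed word; the signs of the
  dual action are kept separate.\<close>

primrec awr :: "current_word \<Rightarrow> 'x cvec \<Rightarrow> 'x cvec" where
  "awr [] v = v"
| "awr (l # u) v = awr u (A (fst l) (snd l) v)"

lemma awr_in: "gsub X \<Longrightarrow> u \<in> words n \<Longrightarrow> v \<in> X \<Longrightarrow> awr u v \<in> X"
  by (induction u arbitrary: v) (auto simp: gsub_A)

lemma awr_add: "u \<in> words n \<Longrightarrow> v \<in> S \<Longrightarrow> w \<in> S \<Longrightarrow> awr u (v + w) = awr u v + awr u w"
  by (induction u arbitrary: v w) (auto simp: A_add A_in)

lemma awr_sc: "u \<in> words n \<Longrightarrow> v \<in> S \<Longrightarrow> awr u (sc c v) = sc c (awr u v)"
  by (induction u arbitrary: v) (auto simp: A_sc A_in)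

lemma awr_append: "awr (u @ w) v = awr w (awr u v)"
  by (induction u arbitrary: v) auto

lemma awr_G: "u \<in> words n \<Longrightarrow> v \<in> G d \<Longrightarrow> awr u v \<in> G (d + int (wdeg u))"
proof (induction u arbitrary: v d)
  case (Cons l u)
  then have "awr u (A (fst l) (snd l) v) \<in> G (d + int (snd l) + int (wdeg u))"
    by (intro Cons.IH) (auto simp: A_G)
  then show ?case by (simp add: wdeg_def algebra_simps)
qed (simp add: wdeg_def)

lemma awr_replicate: "awr (replicate k (x, 0)) v = (A x 0 ^^ k) v"
  by (induction k arbitrary: v) (auto simp: funpow_swap1)

lemma nhom_awr:
  assumes "gsub X" "nhom X \<mu> r p" "u \<in> words n" "v \<in> X"
  shows "p v (u @ w) = (-1) ^ length u * p (awr u v) w"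
  using assms(3,4)
proof (induction u arbitrary: v rule: list.induct)
  case (Cons l u)
  then have "p (A (fst l) (snd l) v) (u @ w) = (-1) ^ length u * p (awr u (A (fst l) (snd l) v)) w"
    using assms(1) by (intro Cons.IH) (auto simp: gsub_A)
  moreover have "p (A (fst l) (snd l) v) (u @ w) = - p v (l # u @ w)"
    using nhomD(4)[OF assms(2), of "fst l" v "snd l" "u @ w"] Cons.prems by auto
  ultimately show ?case by (simp add: minus_equation_iff[of "p v (l # u @ w)"])
qed simp

text \<open>At the empty word the degree condition leaves only \<open>d = r\<close>, and comparing
  the two ways of evaluating a Cartan element leaves only the weight \<open>\<mu>\<close>.\<close>

lemma nhom_generator_weight:
  assumes p: "nhom X \<mu> r p" and \<mu>: "\<mu> \<in> cartan_dual n" and v: "v \<in> X" "v \<in> E (d, \<nu>)" "p v [] \<noteq> 0"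
    and X: "gsub X"
  shows "d = r \<and> \<nu> = \<mu>"
proof
  have "v \<noteq> 0"
  proof
    assume "v = 0"
    then show False using nhomD(3)[OF p v(1), of 0 "[]"] v(3) by simp
  qed
  then have \<nu>: "\<nu> \<in> cartan_dual n" using v(2) by (auto simp: E_def split: if_splits)
  show "d = r" using nhomD(5)[OF p v(1) E_G[OF v(2)] v(3)] by (simp add: wdeg_def)
  show "\<nu> = \<mu>"
  proof (rule ccontr)
    assume "\<nu> \<noteq> \<mu>"
    then obtain h where h: "h \<in> cartan n" "\<nu> h \<noteq> \<mu> h" using cartan_dual_neq \<nu> \<mu> by blast
    have "A h 0 v = sc (\<nu> h) v" using v(2) \<nu> h(1) by (simp add: E_def weight_vector_def)
    then have "\<nu> h * p v [] = - p v [(h, 0)]"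
      using nhomD(3)[OF p v(1), of "\<nu> h" "[]"] nhomD(4)[OF p cartan_sl[OF h(1)] v(1), of 0 "[]"] by simp
    also have "\<dots> = \<mu> h * p v []" using word_functionalsD'(5)[OF nhomD(1)[OF p v(1)] h(1)] by simp
    finally show False using h(2) v(3) by simp
  qed
qed

lemma nhom_span_nonzero:
  assumes f0: "\<And>v w. v \<in> X \<Longrightarrow> w \<in> X \<Longrightarrow> f (v + w) = f v + (f w :: complex)" "\<And>c v. v \<in> X \<Longrightarrow> f (sc c v) = c * f v"
    and X: "vs.subspace X" and B: "B \<subseteq> X" and v: "v \<in> vs.span B" "f v \<noteq> 0"
  shows "\<exists>b\<in>B. f b \<noteq> 0"
proof (rule ccontr)
  assume n: "\<not> ?thesis"
  have "f v = 0 \<and> v \<in> X" using v(1)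
  proof (induction rule: vs.span_induct_alt)
    case base
    show ?case using f0(2)[of 0 0] X by (simp add: vs.subspace_0)
  next
    case (step c x y)
    then have "x \<in> X" "f x = 0" using B n by auto
    then show ?case using step f0 X by (simp add: vs.subspace_add vs.subspace_scale)
  qed
  then show False using v(2) by simp
qed

text \<open>A nonzero value at a word is, up to sign, a nonzero value at the empty word for another
  vector of \<open>X\<close>. Some weight component of that vector has a nonzero value too, and it
  must have the weight \<open>\<mu>\<close>.\<close>

lemma nhom_low_weight:
  assumes X: "gsub X" and p: "nhom X \<mu> r p" and \<mu>: "\<mu> \<in> cartan_dual n" and v: "v \<in> X" "p v \<noteq> (\<lambda>_. 0)"
  shows "\<mu> \<in> wts X"
proof -
  obtain u where u: "p v u \<noteq> 0" using v(2) by auto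
  have uw: "u \<in> words n" using word_functionalsD(1)[OF nhomD(1)[OF p v(1)]] u by blast
  let ?y = "awr u v"
  have y: "?y \<in> X" by (rule awr_in[OF X uw v(1)])
  have "p ?y [] \<noteq> 0" using nhom_awr[OF X p uw v(1), of "[]"] u by auto
  then have "\<exists>b\<in>(\<Union>i. E i \<inter> X). p b [] \<noteq> 0"
    using nhomD(2,3)[OF p] gsub_E_span[OF X] y
    by (intro nhom_span_nonzero[of X "\<lambda>v. p v []" _ ?y] gsub_subspace[OF X]) auto
  then obtain d \<nu> b where b: "b \<in> E (d, \<nu>)" "b \<in> X" "p b [] \<noteq> 0" by auto
  then have "\<nu> = \<mu>" using nhom_generator_weight[OF p \<mu> b(2,1,3) X] by simp
  moreover have "b \<noteq> 0" using nhomD(3)[OF p b(2), of 0 "[]"] b(3) by auto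
  ultimately show ?thesis using wtsI b by blast
qed

text \<open>A nonzero functional is nonzero at a word of \<open>low_words\<close>, on which the
  Cartan subalgebra acts through a known weight; so \<open>\<mu>\<close> is the lowest weight that
  can be seen.\<close>

lemma nhom_weight:
  assumes p: "nhom X \<mu> r p" and \<mu>: "\<mu> \<in> cartan_dual n" and \<nu>: "\<nu> \<in> cartan_dual n"
    and v: "v \<in> X" "weight_vector \<nu> v" "p v \<noteq> (\<lambda>_. 0)"
  shows "(\<lambda>h. \<nu> h - \<mu> h) \<in> root_lattice_pos n"
proof -
  note g = nhomD(1)[OF p v(1)]
  obtain u0 where "p v u0 \<noteq> 0" using v(3) by auto
  from low_words_exist[OF g this] obtain u where u: "u \<in> low_words n" "p v u \<noteq> 0" by auto
  obtain \<beta> where \<beta>: "\<beta> \<in> root_lattice_pos n"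
    and eq: "\<And>g h. g \<in> word_functionals n (\<lambda>h. - \<mu> h) \<Longrightarrow> h \<in> cartan n \<Longrightarrow> g ((h, 0) # u) = (- \<mu> h - \<beta> h) * g u"
    using low_word_weight[OF u(1), of "\<lambda>h. - \<mu> h"] by blast
  have "\<nu> h - \<mu> h = \<beta> h" for h
  proof (cases "h \<in> cartan n")
    case True
    have "\<nu> h * p v u = p (A h 0 v) u"
      using nhomD(3)[OF p v(1)] v(2) True by (simp add: weight_vector_def)
    also have "\<dots> = (\<mu> h + \<beta> h) * p v u"
      unfolding nhomD(4)[OF p cartan_sl[OF True] v(1)] eq[OF g True] by (simp add: algebra_simps)
    finally show ?thesis using u(2) by simp
  next
    case False
    then show ?thesis
      using cartan_dual_outside[OF \<mu>] cartan_dual_outside[OF \<nu>] cartan_dual_outside[OF root_lattice_pos_dual[OF \<beta>]]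
      by simp
  qed
  then show ?thesis using \<beta> by simp
qed

end

context current_rep
begin

text \<open>Dual global Weyl modules are injective relative to modules without weights below their lowest
  weight: extend the functional "value at the generator" and coinduce.\<close>
lemma nhom_extend:
  assumes Y: "gsub Y" and X: "gsub X" and YX: "Y \<subseteq> X" and p: "nhom Y \<mu> r p" and \<mu>: "\<mu> \<in> cartan_dual n"
    and top: "\<And>a b. a < b \<Longrightarrow> b \<le> n \<Longrightarrow> (\<lambda>h. \<mu> h - rt n a b h) \<notin> wts X"
    and string: "\<And>i k. i \<in> {1..n} \<Longrightarrow> \<mu> (coroot n i) = - of_nat k \<Longrightarrow>
        (\<lambda>h. \<mu> h + of_nat (k + 1) * simple_root n i h) \<notin> wts X"
  shows "\<exists>P. nhom X \<mu> r P \<and> (\<forall>v\<in>Y. P v = p v)"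
proof -
  obtain g where g: "\<And>v w. g (v + w) = g v + g w" "\<And>c v. g (sc c v) = c * g v" "\<And>v. v \<in> Y \<Longrightarrow> g v = p v []"
    using linear_functional_extend[OF gsub_subspace[OF Y], of "\<lambda>v. p v []"] nhomD(2,3)[OF p] by metis
  have g0: "g 0 = 0" using g(2)[of 0 0] by simp
  \<comment> \<open>First extend linearly, then project to degree \<open>r\<close> and weight
    \<open>\<mu>\<close>; thus \<open>f\<close> vanishes on every other weight space of
    \<open>X\<close>.\<close>
  define f where "f v = g (D.cmp (r, \<mu>) v)" for v
  have Xsp: "v \<in> vs.span (\<Union>i. E i)" if "v \<in> X" for v
  proof -
    have "vs.span (\<Union>i. E i \<inter> X) \<subseteq> vs.span (\<Union>i. E i)" by (rule vs.span_mono) auto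
    then show ?thesis using gsub_E_span[OF X] that by blast
  qed
  have f_add: "f (v + w) = f v + f w" if "v \<in> X" "w \<in> X" for v w
    unfolding f_def using that by (simp add: D.cmp_add Xsp g)
  have f_sc: "f (sc c v) = c * f v" if "v \<in> X" for v c
    unfolding f_def using that by (simp add: D.cmp_scale Xsp g)
  have f0: "f 0 = 0" using f_sc[of 0 0] gsub_subspace[OF X] by (simp add: vs.subspace_0)
  have f_E: "f v = (if i = (r, \<mu>) then g v else 0)" if "v \<in> E i" for v i
    unfolding f_def D.cmp_base[OF that] using g0 by auto
  note X0 = gsub_subspace[OF X]
  \<comment> \<open>Each relation is an identity \<open>f (T v) = 0\<close> for a linear
    \<open>T\<close>, so it may be tested on homogeneous weight vectors.\<close>
  have kill: "f (T v) = 0" if T: "\<And>v. v \<in> X \<Longrightarrow> T v \<in> X" "\<And>v w. v \<in> X \<Longrightarrow> w \<in> X \<Longrightarrow> T (v + w) = T v + T w"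
      "\<And>c v. v \<in> X \<Longrightarrow> T (sc c v) = sc c (T v)" and TE: "\<And>d \<nu> v. v \<in> E (d, \<nu>) \<Longrightarrow> v \<in> X \<Longrightarrow> v \<noteq> 0 \<Longrightarrow> f (T v) = 0"
      and v: "v \<in> X" for T v
  proof (rule ccontr)
    assume "f (T v) \<noteq> 0"
    moreover have T0: "T 0 = 0" using T(3)[of 0 0] X0 by (simp add: vs.subspace_0)
    ultimately have "\<exists>b\<in>(\<Union>i. E i \<inter> X). f (T b) \<noteq> 0"
      using gsub_E_span[OF X] v T f_add f_sc
      by (intro nhom_span_nonzero[of X "\<lambda>v. f (T v)" _ v] X0) auto
    then obtain d \<nu> b where "b \<in> E (d, \<nu>)" "b \<in> X" "f (T b) \<noteq> 0" by auto
    then show False using TE T0 f0 by metis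
  qed
  \<comment> \<open>A root vector for \<open>(a, b)\<close> reaches the weight \<open>\<mu>\<close>
    only from \<open>\<mu> - rt n a b\<close>, which \<open>top\<close> excludes.\<close>
  have f_npos: "f (A x s v) = 0" if x: "x \<in> n_pos n" and v: "v \<in> X" for x s v
  proof -
    have xs: "x \<in> sl n" and up: "\<forall>a\<le>n. \<forall>b\<le>a. x $$ (a, b) = 0" using n_pos_upper[OF x] by auto
    have "\<forall>v\<in>X. f (A x s v) = 0"
    proof (rule sl_decompose[of n "\<lambda>x. \<forall>v\<in>X. f (A x s v) = 0"])
      fix h assume h: "h \<in> cartan n" "\<forall>q\<le>n. h $$ (q, q) = x $$ (q, q)"
      have "h = 0\<^sub>m (Suc n) (Suc n)"
        using h up by (intro eq_matI) (auto simp: cartan_iff less_Suc_eq_le, metis order_refl)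
      then show "\<forall>v\<in>X. f (A h s v) = 0" using gsub_S[OF X] f0 by (simp add: A_zero_left)
    next
      fix a b assume ab: "a \<le> n" "b \<le> n" "a \<noteq> b" "x $$ (a, b) \<noteq> 0"
      then have lt: "a < b" using up by (meson not_less)
      note sl = elem_mat_sl[OF ab(1-3)]
      show "\<forall>v\<in>X. f (A (elem_mat n a b) s v) = 0"
      proof
        fix v assume "v \<in> X"
        then show "f (A (elem_mat n a b) s v) = 0"
        proof (rule kill[rotated 4])
          fix d \<nu> v assume v: "v \<in> E (d, \<nu>)" "v \<in> X" "v \<noteq> 0"
          have "(\<lambda>h. \<nu> h + rt n a b h) \<noteq> \<mu>"
          proof
            assume "(\<lambda>h. \<nu> h + rt n a b h) = \<mu>"
            then have "\<nu> = (\<lambda>h. \<mu> h - rt n a b h)" by auto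
            then show False using top[OF lt ab(2)] wtsI[OF v] by simp
          qed
          then show "f (A (elem_mat n a b) s v) = 0" using f_E[OF A_elem_E[OF ab(1-3) v(1)], of s] by simp
        qed (use gsub_A[OF X sl] gsub_S[OF X] in \<open>auto simp: A_add A_sc sl\<close>)
      qed
    next
      fix x y assume "x \<in> sl n" "y \<in> sl n" "\<forall>v\<in>X. f (A x s v) = 0" "\<forall>v\<in>X. f (A y s v) = 0"
      then show "\<forall>v\<in>X. f (A (x + y) s v) = 0" using gsub_S[OF X] gsub_A[OF X] by (simp add: A_addl f_add)
    next
      fix c x assume "x \<in> sl n" "\<forall>v\<in>X. f (A x s v) = 0"
      then show "\<forall>v\<in>X. f (A (c \<cdot>\<^sub>m x) s v) = 0" using gsub_S[OF X] gsub_A[OF X] by (simp add: A_scl f_sc)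
    qed (rule xs)
    then show ?thesis using v by blast
  qed
  \<comment> \<open>The power \<open>k + 1\<close> reaches the weight \<open>\<mu>\<close> only from
    \<open>\<mu>\<close> plus \<open>k + 1\<close> simple roots, which \<open>string\<close>
    excludes.\<close>
  have f_xneg: "f ((A (x_neg n i) 0 ^^ (k + 1)) v) = 0"
    if i: "i \<in> {1..n}" and k: "\<mu> (coroot n i) = - of_nat k" and v: "v \<in> X" for i k v
    using v
  proof (rule kill[rotated 4])
    interpret T: sub_endo X "A (x_neg n i) 0"
      using X0 gsub_A[OF X x_neg_sl[OF i]] gsub_S[OF X]
      by unfold_locales (auto simp: endo_def A_add A_sc x_neg_sl[OF i])
    interpret Tk: sub_endo X "A (x_neg n i) 0 ^^ (k + 1)" by unfold_locales (rule X0 T.pow_endo)+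
    show "(A (x_neg n i) 0 ^^ (k + 1)) v \<in> X" if "v \<in> X" for v by (rule Tk.T_in[OF that])
    show "(A (x_neg n i) 0 ^^ (k + 1)) (v + w) = (A (x_neg n i) 0 ^^ (k + 1)) v + (A (x_neg n i) 0 ^^ (k + 1)) w"
      if "v \<in> X" "w \<in> X" for v w by (rule Tk.T_add[OF that])
    show "(A (x_neg n i) 0 ^^ (k + 1)) (sc c v) = sc c ((A (x_neg n i) 0 ^^ (k + 1)) v)" if "v \<in> X" for c v
      by (rule Tk.T_sc[OF that])
    fix d \<nu> v assume v: "v \<in> E (d, \<nu>)" "v \<in> X" "v \<noteq> 0"
    have sr: "simple_root n i h = - rt n i (i - 1) h" for h
      unfolding simple_root_rt[OF i] by (simp add: rt_def wi_uminus)
    have "(\<lambda>h. \<nu> h + of_nat (k + 1) * rt n i (i - 1) h) \<noteq> \<mu>"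
    proof
      assume "(\<lambda>h. \<nu> h + of_nat (k + 1) * rt n i (i - 1) h) = \<mu>"
      then have "\<nu> = (\<lambda>h. \<mu> h + of_nat (k + 1) * simple_root n i h)" unfolding sr by auto
      then show False using string[OF i k] wtsI[OF v] by simp
    qed
    moreover have "(A (x_neg n i) 0 ^^ (k + 1)) v \<in> E (d, \<lambda>h. \<nu> h + of_nat (k + 1) * rt n i (i - 1) h)"
      unfolding x_neg_def using i v by (intro A_elem_pow_E) auto
    ultimately show "f ((A (x_neg n i) 0 ^^ (k + 1)) v) = 0" using f_E by simp
  qed
  have f_cartan: "f (A h 0 v) = \<mu> h * f v" if h: "h \<in> cartan n" and v: "v \<in> X" for h v
  proof -
    note hs = cartan_sl[OF h]
    have "f (A h 0 v - sc (\<mu> h) v) = 0"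
      using v
    proof (rule kill[rotated 4])
      fix d \<nu> v assume v: "v \<in> E (d, \<nu>)" "v \<in> X" "v \<noteq> 0"
      then have "A h 0 v - sc (\<mu> h) v = sc (\<nu> h - \<mu> h) v"
        using h by (auto simp: E_def weight_vector_def vs.scale_left_diff_distrib split: if_splits)
      then show "f (A h 0 v - sc (\<mu> h) v) = 0" using f_sc[OF v(2)] f_E[OF v(1)] by auto
    next
      fix v w assume "v \<in> X" "w \<in> X"
      then show "A h 0 (v + w) - sc (\<mu> h) (v + w) = A h 0 v - sc (\<mu> h) v + (A h 0 w - sc (\<mu> h) w)"
        using gsub_S[OF X] by (simp add: A_add hs vs.scale_right_distrib)
    next
      fix c v assume "v \<in> X"
      then show "A h 0 (sc c v) - sc (\<mu> h) (sc c v) = sc c (A h 0 v - sc (\<mu> h) v)"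
        using gsub_S[OF X] by (simp add: A_sc hs vs.scale_right_diff_distrib mult.commute)
    qed (use gsub_A[OF X hs] X0 in \<open>auto simp: vs.subspace_diff vs.subspace_scale\<close>)
    moreover have "A h 0 v = (A h 0 v - sc (\<mu> h) v) + sc (\<mu> h) v" by simp
    moreover have "A h 0 v - sc (\<mu> h) v \<in> X" "sc (\<mu> h) v \<in> X"
      using gsub_A[OF X hs v] v X0 by (auto simp: vs.subspace_diff vs.subspace_scale)
    ultimately show ?thesis using f_add f_sc[OF v] by (metis add_0)
  qed
  \<comment> \<open>Homogeneity of the extension: nonzero values occur only in degree
    \<open>r\<close>, because \<open>f\<close> was built from one graded weight space.\<close>
  have f_deg: "d = r" if v: "v \<in> X" "v \<in> G d" "f v \<noteq> 0" for v d
  proof -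
    have "\<exists>b\<in>(\<Union>b. E (d, wi n b) \<inter> X). f b \<noteq> 0"
      using layer_span[OF X, of d] v f_add f_sc by (intro nhom_span_nonzero[of X f _ v] X0) auto
    then show ?thesis using f_E by (metis (no_types, lifting) IntE UN_E fst_conv)
  qed
  \<comment> \<open>The only possible extension, since by \<open>nhom_awr\<close> a morphism is
    determined by its values at the empty word.\<close>
  define P where "P v u = (if u \<in> words n then (-1) ^ length u * f (awr u v) else 0)" for v u
  have P_append: "P v (w @ u) = (-1) ^ length w * P (awr w v) u" if "w \<in> words n" for v w u
    using that by (simp add: P_def awr_append power_add)
  have PX: "P v \<in> word_functionals n (\<lambda>h. - \<mu> h)" if v: "v \<in> X" for v
    unfolding word_functionals_def mem_Collect_eq
  proof (intro conjI allI ballI impI)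
    fix u assume "u \<notin> words n" then show "P v u = 0" by (simp add: P_def)
  next
    fix w u x y s assume a: "w \<in> words n" "u \<in> words n" "x \<in> sl n" "y \<in> sl n"
    have w: "awr w v \<in> X" by (rule awr_in[OF X a(1) v])
    have "P (awr w v) ((x + y, s) # u) = P (awr w v) ((x, s) # u) + P (awr w v) ((y, s) # u)"
      using a w gsub_S[OF X] gsub_A[OF X]
      by (simp add: P_def sl_add A_addl A_in awr_add f_add awr_in[OF X] distrib_left)
    then show "P v (w @ (x + y, s) # u) = P v (w @ (x, s) # u) + P v (w @ (y, s) # u)"
      unfolding P_append[OF a(1)] by (simp add: distrib_left)
  next
    fix w u c x s assume a: "w \<in> words n" "u \<in> words n" "x \<in> sl n"
    have w: "awr w v \<in> X" by (rule awr_in[OF X a(1) v])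
    have "P (awr w v) ((c \<cdot>\<^sub>m x, s) # u) = c * P (awr w v) ((x, s) # u)"
      using a w gsub_S[OF X] gsub_A[OF X]
      by (simp add: P_def sl_smult A_scl A_in awr_sc f_sc awr_in[OF X])
    then show "P v (w @ (c \<cdot>\<^sub>m x, s) # u) = c * P v (w @ (x, s) # u)"
      unfolding P_append[OF a(1)] by simp
  next
    fix w u x y t s assume a: "w \<in> words n" "u \<in> words n" "x \<in> sl n" "y \<in> sl n"
    have w: "awr w v \<in> X" by (rule awr_in[OF X a(1) v])
    let ?v = "awr w v"
    have xy: "A x t (A y s ?v) \<in> X" "A y s (A x t ?v) \<in> X" using a w gsub_A[OF X] by auto
    have "f (awr u (A x t (A y s ?v))) = f (awr u (A (bracket x y) (t + s) ?v + A y s (A x t ?v)))"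
      using A_br[OF a(3,4) gsub_S[OF X w], of t s] by simp
    also have "\<dots> = f (awr u (A (bracket x y) (t + s) ?v)) + f (awr u (A y s (A x t ?v)))"
      using xy gsub_A[OF X bracket_sl[OF a(3,4)] w] gsub_S[OF X] a(2) by (simp add: awr_add f_add awr_in[OF X])
    finally have "P ?v ((bracket x y, t + s) # u) = P ?v ((x, t) # (y, s) # u) - P ?v ((y, s) # (x, t) # u)"
      using a by (simp add: P_def bracket_sl algebra_simps)
    then show "P v (w @ (bracket x y, t + s) # u) = P v (w @ (x, t) # (y, s) # u) - P v (w @ (y, s) # (x, t) # u)"
      unfolding P_append[OF a(1)] by (simp add: right_diff_distrib)
  next
    fix w x s assume a: "w \<in> words n" "x \<in> n_pos n"
    then show "P v (w @ [(x, s)]) = 0"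
      unfolding P_append[OF a(1)] using f_npos[OF a(2) awr_in[OF X a(1) v]] by (simp add: P_def)
  next
    fix w i k assume a: "w \<in> words n" "i \<in> {1..n}" "- \<mu> (coroot n i) = of_nat k"
    then have "\<mu> (coroot n i) = - of_nat k" by (metis minus_minus)
    from f_xneg[OF a(2) this awr_in[OF X a(1) v]]
    have "P (awr w v) (replicate (k + 1) (x_neg n i, 0)) = 0" unfolding P_def awr_replicate by simp
    then show "P v (w @ replicate (k + 1) (x_neg n i, 0)) = 0" unfolding P_append[OF a(1)] by simp
  next
    fix w h assume a: "w \<in> words n" "h \<in> cartan n"
    show "P v (w @ [(h, 0)]) = - \<mu> h * P v w"
      unfolding P_append[OF a(1)] using f_cartan[OF a(2) awr_in[OF X a(1) v]] a cartan_sl[OF a(2)]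
      by (simp add: P_def)
  qed
  have "nhom X \<mu> r P"
    unfolding nhom_def
  proof (intro conjI ballI allI impI)
    fix v w u assume "v \<in> X" "w \<in> X"
    then show "P (v + w) u = P v u + P w u"
      using gsub_S[OF X] by (simp add: P_def awr_add f_add awr_in[OF X] distrib_left)
  next
    fix c v u assume "v \<in> X"
    then show "P (sc c v) u = c * P v u"
      using gsub_S[OF X] by (simp add: P_def awr_sc f_sc awr_in[OF X])
  next
    fix x s v u assume "x \<in> sl n" "v \<in> X"
    then show "P (A x s v) u = - P v ((x, s) # u)" by (simp add: P_def)
  next
    fix d v u assume v: "v \<in> X \<inter> G d" "P v u \<noteq> 0"
    then have u: "u \<in> words n" "f (awr u v) \<noteq> 0" by (auto simp: P_def split: if_splits)
    then have "d + int (wdeg u) = r" using v by (intro f_deg[OF awr_in[OF X] awr_G]) auto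
    then show "int (wdeg u) = r - d" by simp
  qed (rule PX)
  moreover have "P v = p v" if v: "v \<in> Y" for v
  proof
    fix u
    \<comment> \<open>The projection loses nothing on \<open>Y\<close>: by
      \<open>nhom_generator_weight\<close> the functional \<open>p y []\<close> already vanishes on
      the weight spaces that \<open>f\<close> discards.\<close>
    have f_eq: "f y = p y []" if y: "y \<in> Y" for y
    proof (rule ccontr)
      assume ne: "f y \<noteq> p y []"
      have lin: "f (v + w) - p (v + w) [] = (f v - p v []) + (f w - p w [])"
        "f (sc c v) - p (sc c v) [] = c * (f v - p v [])" if "v \<in> Y" "w \<in> Y" for v w c
        using that YX f_add[of v w] f_sc[of v c] nhomD(2)[OF p that, of "[]"] nhomD(3)[OF p that(1), of c "[]"]
        by (auto simp: algebra_simps)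
      have "\<exists>b\<in>(\<Union>i. E i \<inter> Y). f b - p b [] \<noteq> 0"
        using gsub_E_span[OF Y] y ne lin by (intro nhom_span_nonzero[of Y _ _ y] gsub_subspace[OF Y]) auto
      then obtain d \<nu> b where b: "b \<in> E (d, \<nu>)" "b \<in> Y" "f b \<noteq> p b []" by auto
      show False
      proof (cases "p b [] = 0")
        case True
        then show False using b f_E[OF b(1)] g(3)[OF b(2)] by (auto split: if_splits)
      next
        case False
        then show False using nhom_generator_weight[OF p \<mu> b(2,1) False Y] b f_E[OF b(1)] g(3)[OF b(2)] by simp
      qed
    qed
    show "P v u = p v u"
    proof (cases "u \<in> words n")
      case True
      then show ?thesis using nhom_awr[OF Y p True v, of "[]"] f_eq[OF awr_in[OF Y True v]] by (simp add: P_def)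
    next
      case False
      then show ?thesis using word_functionalsD(1)[OF nhomD(1)[OF p v]] by (simp add: P_def)
    qed
  qed
  ultimately show ?thesis by blast
qed

text \<open>The degree \<open>d\<close> part of \<open>v\<close>. One vector \<open>w\<close> serves
  all morphisms at once, which is needed when a map into a direct sum has many components.\<close>

lemma homogeneous_component:
  assumes X: "gsub X" and v: "v \<in> X"
  shows "\<exists>w\<in>X \<inter> G d. \<forall>\<mu> r p u. nhom X \<mu> r p \<longrightarrow> p w u = (if int (wdeg u) = r - d then p v u else 0)"
proof -
  have "v \<in> vs.span (\<Union>d. G d \<inter> X)" using gsub_graded[OF X] v by blast
  then have "v \<in> X \<and> (\<exists>w\<in>X \<inter> G d. \<forall>\<mu> r p u. nhom X \<mu> r p \<longrightarrow> p w u = (if int (wdeg u) = r - d then p v u else 0))"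
  proof (induction rule: vs.span_induct_alt)
    case base
    have "p 0 u = 0" if "nhom X \<mu> r p" for \<mu> r p u
      using nhomD(3)[OF that, of 0 0 u] gsub_subspace[OF X] by (simp add: vs.subspace_0)
    then show ?case using gsub_subspace[OF X] G_sub by (intro conjI bexI[of _ 0]) (auto simp: vs.subspace_0)
  next
    case (step c x y)
    then obtain e where x: "x \<in> G e" "x \<in> X" by auto
    obtain w where w: "w \<in> X" "w \<in> G d" "\<And>\<mu> r p u. nhom X \<mu> r p \<Longrightarrow> p w u = (if int (wdeg u) = r - d then p y u else 0)"
      and y: "y \<in> X" using step by blast
    let ?w = "(if e = d then sc c x else 0) + w"
    have cx: "sc c x \<in> X" "(if e = d then sc c x else 0) \<in> X \<inter> G d"
      using x gsub_subspace[OF X] G_sub by (auto simp: vs.subspace_scale vs.subspace_0)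
    then have "?w \<in> X \<inter> G d" using w gsub_subspace[OF X] G_sub by (auto simp: vs.subspace_add)
    moreover have "p ?w u = (if int (wdeg u) = r - d then p (sc c x + y) u else 0)" if p: "nhom X \<mu> r p" for \<mu> r p u
    proof -
      have "p 0 u = 0" using nhomD(3)[OF p, of 0 0 u] gsub_subspace[OF X] by (simp add: vs.subspace_0)
      then have "p ?w u = (if e = d then c * p x u else 0) + p w u"
        using nhomD(2)[OF p _ w(1), of "if e = d then sc c x else 0" u] cx(2) nhomD(3)[OF p x(2)] by auto
      moreover have "p (sc c x + y) u = c * p x u + p y u" using nhomD(2)[OF p cx(1) y] nhomD(3)[OF p x(2)] by simp
      moreover have "p x u \<noteq> 0 \<Longrightarrow> int (wdeg u) = r - e" by (rule nhomD(5)[OF p x(2,1)])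
      ultimately show ?thesis using w(3)[OF p, of u] by (cases "p x u = 0") auto
    qed
    moreover have "sc c x + y \<in> X" using cx y gsub_subspace[OF X] by (simp add: vs.subspace_add)
    ultimately show ?case by blast
  qed
  then show ?thesis by blast
qed

end

section \<open>Presentations by dual global Weyl modules\<close>

abbreviation zf :: "current_word \<Rightarrow> complex" where "zf \<equiv> \<lambda>_. 0"

text \<open>Nonzero values in finitely many degrees only: this condition selects the restricted dual
  inside the full dual.\<close>

definition word_nabla :: "nat \<Rightarrow> weight \<Rightarrow> (current_word \<Rightarrow> complex) set" where
  "word_nabla n \<mu> = {g \<in> word_functionals n (\<lambda>h. - longest_element n \<mu> h). finite (wdeg ` {u. g u \<noteq> 0})}"

definition word_sum :: "nat \<Rightarrow> 'j set \<Rightarrow> ('j \<Rightarrow> weight) \<Rightarrow> ('j \<Rightarrow> current_word \<Rightarrow> complex) set" where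
  "word_sum n J w = {g. (\<forall>j. j \<notin> J \<longrightarrow> g j = zf) \<and> (\<forall>j\<in>J. g j \<in> word_nabla n (w j)) \<and> finite {j. g j \<noteq> zf}}"

lemma zf_nabla: "zf \<in> word_nabla n \<mu>"
  by (auto simp: word_nabla_def word_functionals_def)

lemma word_functionals_diff:
  assumes "f \<in> word_functionals n m" "g \<in> word_functionals n m"
  shows "(\<lambda>u. f u - g u) \<in> word_functionals n m"
  unfolding word_functionals_def mem_Collect_eq
  by (intro conjI allI ballI impI)
    (simp_all only: word_functionalsD[OF assms(1)] word_functionalsD[OF assms(2)] algebra_simps
      simp_thms add_0_left add_0_right)

lemma word_nabla_diff:
  assumes f: "f \<in> word_nabla n \<mu>" and g: "g \<in> word_nabla n \<mu>"
  shows "(\<lambda>u. f u - g u) \<in> word_nabla n \<mu>"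
proof -
  have "wdeg ` {u. f u - g u \<noteq> 0} \<subseteq> wdeg ` {u. f u \<noteq> 0} \<union> wdeg ` {u. g u \<noteq> 0}" by auto
  then show ?thesis using f g word_functionals_diff unfolding word_nabla_def
    by (auto intro: finite_subset)
qed

context current_rep
begin

text \<open>\<open>\<phi>\<close> induces an isomorphism of \<open>X/N\<close> with a direct sum of dual global Weyl modules.\<close>
definition pres :: "'x cvec set \<Rightarrow> 'x cvec set \<Rightarrow> 'j set \<Rightarrow> ('j \<Rightarrow> weight) \<Rightarrow> ('j \<Rightarrow> int) \<Rightarrow>
    ('x cvec \<Rightarrow> 'j \<Rightarrow> current_word \<Rightarrow> complex) \<Rightarrow> bool" where
  "pres X N J w r \<phi> \<longleftrightarrow> (\<forall>j\<in>J. nhom X (longest_element n (w j)) (r j) (\<lambda>v. \<phi> v j)) \<and>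
     (\<forall>v\<in>X. \<phi> v \<in> word_sum n J w) \<and> (\<forall>v\<in>X. \<phi> v = (\<lambda>_. zf) \<longleftrightarrow> v \<in> N) \<and> (\<forall>g\<in>word_sum n J w. \<exists>v\<in>X. \<phi> v = g)"

lemma presD:
  assumes "pres X N J w r \<phi>"
  shows "j \<in> J \<Longrightarrow> nhom X (longest_element n (w j)) (r j) (\<lambda>v. \<phi> v j)"
    and "v \<in> X \<Longrightarrow> \<phi> v \<in> word_sum n J w"
    and "v \<in> X \<Longrightarrow> \<phi> v = (\<lambda>_. zf) \<longleftrightarrow> v \<in> N"
    and "g \<in> word_sum n J w \<Longrightarrow> \<exists>v\<in>X. \<phi> v = g"
  using assms unfolding pres_def by blast+

lemma pres_zero: "pres X N J w r \<phi> \<Longrightarrow> v \<in> X \<Longrightarrow> j \<notin> J \<Longrightarrow> \<phi> v j = zf"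
  using presD(2) unfolding word_sum_def by blast

text \<open>A vector is a finite sum of homogeneous ones, and each of these contributes one word
  degree; hence morphisms land in the restricted dual automatically.\<close>

lemma nhom_finite_degrees:
  assumes X: "gsub X" and p: "nhom X \<mu> r p" and v: "v \<in> X"
  shows "finite (wdeg ` {u. p v u \<noteq> 0})"
proof -
  have "v \<in> vs.span (\<Union>d. G d \<inter> X)" using gsub_graded[OF X] v by blast
  then have "v \<in> X \<and> finite (wdeg ` {u. p v u \<noteq> 0})"
  proof (induction rule: vs.span_induct_alt)
    case base
    have "p 0 u = 0" for u
      using nhomD(3)[OF p, of 0 0 u] gsub_subspace[OF X] by (simp add: vs.subspace_0)
    then show ?case using gsub_subspace[OF X] by (simp add: vs.subspace_0)
  next
    case (step c x y)
    then obtain e where x: "x \<in> G e" "x \<in> X" by auto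
    have cx: "sc c x \<in> X" using x gsub_subspace[OF X] by (simp add: vs.subspace_scale)
    have "{u. p (sc c x + y) u \<noteq> 0} \<subseteq> {u. p x u \<noteq> 0} \<union> {u. p y u \<noteq> 0}"
      using nhomD(2)[OF p cx] nhomD(3)[OF p x(2)] step by auto
    moreover have "wdeg ` {u. p x u \<noteq> 0} \<subseteq> {nat (r - e)}" using nhomD(5)[OF p x(2,1)] by fastforce
    ultimately have "wdeg ` {u. p (sc c x + y) u \<noteq> 0} \<subseteq> {nat (r - e)} \<union> wdeg ` {u. p y u \<noteq> 0}" by blast
    then have "finite (wdeg ` {u. p (sc c x + y) u \<noteq> 0})"
      by (rule finite_subset) (use step in simp)
    then show ?case using cx step gsub_subspace[OF X] by (simp add: vs.subspace_add)
  qed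
  then show ?thesis by blast
qed

lemma nhom_nabla: "gsub X \<Longrightarrow> nhom X (longest_element n \<mu>) r p \<Longrightarrow> v \<in> X \<Longrightarrow> p v \<in> word_nabla n \<mu>"
  using nhom_finite_degrees nhomD(1) unfolding word_nabla_def by blast

text \<open>The kernel is graded because homogeneous components of different degrees have values at
  words of different degrees and cannot cancel.\<close>

lemma kernel_gsub:
  assumes X: "gsub X" and p: "\<And>i. i \<in> I \<Longrightarrow> nhom X (\<mu> i) (r i) (p i)"
  shows "gsub {v \<in> X. \<forall>i\<in>I. p i v = zf}"
proof -
  let ?K = "{v \<in> X. \<forall>i\<in>I. p i v = zf}"
  note X0 = gsub_subspace[OF X]
  have z: "p i 0 = zf" if "i \<in> I" for i
    using nhomD(3)[OF p[OF that], of 0 0] X0 by (auto simp: vs.subspace_0)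
  show ?thesis
    unfolding gsub_def
  proof (intro conjI ballI allI)
    show "vs.subspace ?K"
      by (rule vs.subspaceI)
        (use X0 z nhomD(2,3)[OF p] in \<open>auto simp: vs.subspace_0 vs.subspace_add vs.subspace_scale fun_eq_iff\<close>)
    show "?K \<subseteq> S" using gsub_S[OF X] by auto
    fix x s v assume "x \<in> sl n" "v \<in> ?K"
    then show "A x s v \<in> ?K" using gsub_A[OF X] nhomD(4)[OF p] by (auto simp: fun_eq_iff)
  next
    show "?K \<subseteq> vs.span (\<Union>d. G d \<inter> ?K)"
    proof
      fix v assume v: "v \<in> ?K"
      have sub: "vs.subspace (G d \<inter> X)" for d by (rule vs.subspace_inter[OF G_sub X0])
      have "v \<in> vs.span (\<Union>d\<in>UNIV. G d \<inter> X)" using v gsub_graded[OF X] by auto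
      from span_UN_form[OF sub this] obtain f D
        where D: "finite D" "\<forall>d\<in>D. f d \<in> G d \<inter> X" "v = (\<Sum>d\<in>D. f d)" by blast
      have "p i (f d) u = 0" if i: "i \<in> I" and d: "d \<in> D" for i d u
      proof (cases "int (wdeg u) = r i - d")
        case False
        then show ?thesis using nhomD(5)[OF p[OF i], of "f d" d u] D(2) d by auto
      next
        case True
        have ps: "p i (\<Sum>d\<in>T. f d) u = (\<Sum>d\<in>T. p i (f d) u)" if "finite T" "T \<subseteq> D" for T
          using that
        proof (induction T)
          case (insert e T)
          moreover have "(\<Sum>d\<in>T. f d) \<in> X" using insert D(2) by (intro vs.subspace_sum[OF X0]) auto
          ultimately show ?case using nhomD(2)[OF p[OF i], of "f e" "\<Sum>d\<in>T. f d" u] D(2) by auto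
        qed (simp add: z[OF i])
        have "0 = (\<Sum>d\<in>D. p i (f d) u)" using ps[OF D(1)] v i D(3) by auto
        also have "\<dots> = (\<Sum>e\<in>D. if e = d then p i (f d) u else 0)"
        proof (rule sum.cong)
          fix e assume e: "e \<in> D"
          show "p i (f e) u = (if e = d then p i (f d) u else 0)"
            using nhomD(5)[OF p[OF i], of "f e" e u] D(2) e True by auto
        qed simp
        finally show ?thesis using D(1) d by simp
      qed
      then have "f d \<in> G d \<inter> ?K" if "d \<in> D" for d using D(2) that by auto
      then show "v \<in> vs.span (\<Union>d. G d \<inter> ?K)"
        unfolding D(3) by (intro vs.span_sum vs.span_base) blast
    qed
  qed
qed

lemma pres_homogeneous:
  assumes X: "gsub X" and \<phi>: "pres X N J w r \<phi>" and t: "t \<in> J" and g: "g \<in> word_nabla n (w t)"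
    and hom: "\<And>u. g u \<noteq> 0 \<Longrightarrow> int (wdeg u) = r t - d"
  shows "\<exists>v\<in>X \<inter> G d. \<phi> v = (\<lambda>j. if j = t then g else zf)"
proof -
  let ?g = "\<lambda>j. if j = t then g else zf"
  have "{j. ?g j \<noteq> zf} \<subseteq> {t}" by auto
  then have "?g \<in> word_sum n J w" using t g zf_nabla by (auto simp: word_sum_def finite_subset)
  then obtain v where v: "v \<in> X" "\<phi> v = ?g" using presD(4)[OF \<phi>] by blast
  obtain v' where v': "v' \<in> X \<inter> G d"
    and eq: "\<And>\<mu> r p u. nhom X \<mu> r p \<Longrightarrow> p v' u = (if int (wdeg u) = r - d then p v u else 0)"
    using homogeneous_component[OF X v(1), of d] by blast
  have "\<phi> v' j = ?g j" for j
  proof (cases "j \<in> J")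
    case True
    show ?thesis
    proof
      fix u
      show "\<phi> v' j u = ?g j u" using eq[OF presD(1)[OF \<phi> True], of u] v(2) hom[of u] by auto
    qed
  next
    case False
    then show ?thesis using pres_zero[OF \<phi>] v' t by auto
  qed
  then show ?thesis using v' by (intro bexI[of _ v']) auto
qed

text \<open>Every summand with a nonzero part in degree \<open>d\<close> is reached from
  \<open>X \<inter> G d\<close>. A finite spanning set of this space meets only finitely many
  summands, as each image has finite support.\<close>

lemma homogeneous_finite:
  assumes X: "gsub X" and \<phi>: "pres X N J w r \<phi>"
  shows "finite {t \<in> J. \<exists>g\<in>word_nabla n (w t). g \<noteq> zf \<and> (\<forall>u. g u \<noteq> 0 \<longrightarrow> int (wdeg u) = r t - d)}"
    (is "finite ?T")
proof -
  let ?V = "X \<inter> G d"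
  obtain B where B: "finite B" "G d \<subseteq> vs.span B" using G_fin by blast
  obtain C where C: "C \<subseteq> ?V" "vs.independent C" "?V \<subseteq> vs.span C"
    using vs.maximal_independent_subset[of ?V] by blast
  have "finite C" using vs.independent_span_bound[OF B(1) C(2)] C(1) B(2) by auto
  moreover have "finite {t. \<phi> b t \<noteq> zf}" if "b \<in> C" for b
    using presD(2)[OF \<phi>, of b] C(1) that by (auto simp: word_sum_def)
  ultimately have fin: "finite (\<Union>b\<in>C. {t. \<phi> b t \<noteq> zf})" by blast
  show ?thesis
  proof (rule finite_subset[OF _ fin], safe)
    fix t g assume t: "t \<in> J" and g: "g \<in> word_nabla n (w t)" "g \<noteq> zf" "\<forall>u. g u \<noteq> 0 \<longrightarrow> int (wdeg u) = r t - d"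
    obtain v where v: "v \<in> ?V" "\<phi> v = (\<lambda>j. if j = t then g else zf)"
      using pres_homogeneous[OF X \<phi> t g(1)] g(3) by blast
    obtain u where u: "g u \<noteq> 0" using g(2) by auto
    note p = presD(1)[OF \<phi> t]
    have "\<exists>b\<in>C. \<phi> b t u \<noteq> 0"
      using v u C(1,3) nhomD(2,3)[OF p]
      by (intro nhom_span_nonzero[of X "\<lambda>v. \<phi> v t u" _ v] gsub_subspace[OF X]) auto
    then obtain b where b: "b \<in> C" "\<phi> b t u \<noteq> 0" by blast
    then have "\<phi> b t \<noteq> zf" by auto
    then show "t \<in> (\<Union>b\<in>C. {t. \<phi> b t \<noteq> zf})" using b(1) by blast
  qed
qed

text \<open>A finite spanning set of the component is caught by one step of the exhausting
  chain.\<close>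

lemma fin_layer_in_chain:
  assumes X: "gsub X" and F: "\<And>k. gsub (F k)" "\<And>k. F k \<subseteq> F (Suc k)" "(\<Union>k. F k) = X"
  shows "\<exists>k. X \<inter> G d \<subseteq> F k"
proof -
  let ?V = "X \<inter> G d"
  obtain B where B: "finite B" "G d \<subseteq> vs.span B" using G_fin by blast
  obtain C where C: "C \<subseteq> ?V" "vs.independent C" "?V \<subseteq> vs.span C"
    using vs.maximal_independent_subset[of ?V] by blast
  have "finite C" using vs.independent_span_bound[OF B(1) C(2)] C(1) B(2) by auto
  moreover have mono: "F i \<subseteq> F j" if "i \<le> j" for i j using that F(2) by (rule lift_Suc_mono_le[rotated])
  have "\<forall>b\<in>C. \<exists>k. b \<in> F k" using C(1) F(3) by blast
  then obtain k where k: "\<And>b. b \<in> C \<Longrightarrow> b \<in> F (k b)" by metis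
  obtain m where "\<forall>b\<in>C. k b \<le> m" using \<open>finite C\<close> finite_nat_set_iff_bounded_le[of "k ` C"] by auto
  then have "C \<subseteq> F m" using k mono by blast
  then have "vs.span C \<subseteq> F m" using gsub_subspace[OF F(1)] by (rule vs.span_minimal)
  then show ?thesis using C(3) by blast
qed

end

section \<open>Splitting off the summands of the largest weight\<close>

locale enumerated_rep = current_rep n S A G + enumerated n lam
  for n :: nat and S :: "'x cvec set" and A G lam
begin

text \<open>The components of type \<open>lam K\<close> of the maps \<open>\<phi> k\<close> extend to all of \<open>X\<close> by relative injectivity.
  Together they give a surjection onto a direct sum, with kernel the largest submodule whose
  weights lie in the smaller cells; the remaining components filter this kernel.\<close>
lemma main_step:
  fixes J :: "nat \<Rightarrow> 't set" and w :: "'t \<Rightarrow> weight" and r :: "'t \<Rightarrow> int"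
  assumes X: "gsub X" and wX: "wts X \<subseteq> cells (Suc K)"
    and F: "\<And>k. gsub (F k)" "\<And>k. F k \<subseteq> F (Suc k)" "(\<Union>k. F k) = X" "F 0 = {0}"
    and \<phi>: "\<And>k. pres (F (Suc k)) (F k) (J k) w r (\<phi> k)"
    and dom: "\<And>k t. t \<in> J k \<Longrightarrow> w t \<in> dominant_weights n"
  defines "I \<equiv> {(k, t). t \<in> J k \<and> w t = lam K}"
  shows "\<exists>\<Phi>. pres X (Nm (cells K) X) I (\<lambda>i. lam K) (\<lambda>i. r (snd i)) \<Phi>"
    and "\<exists>F' J' \<phi>'. (\<forall>k. gsub (F' k) \<and> F' k \<subseteq> F' (Suc k)) \<and> (\<Union>k. F' k) = Nm (cells K) X \<and> F' 0 = {0} \<and>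
      (\<forall>k. pres (F' (Suc k)) (F' k) (J' k) w r (\<phi>' k)) \<and> (\<forall>k. J' k \<subseteq> J k)"
proof -
  have FX: "F k \<subseteq> X" for k using F(3) by blast
  have Fmono: "F i \<subseteq> F j" if "i \<le> j" for i j using that F(2) by (rule lift_Suc_mono_le[rotated])
  have low: "longest_element n (lam m) = low m" for m by (simp add: low_def)
  have low_dual: "low m \<in> cartan_dual n" for m by (simp add: low_wi wi_cartan_dual)
  have "\<exists>P. nhom X (low K) (r t) P \<and> (\<forall>v\<in>F (Suc k). P v = \<phi> k v t)" if "(k, t) \<in> I" for k t
  proof (rule nhom_extend[OF F(1) X FX _ low_dual])
    show "nhom (F (Suc k)) (low K) (r t) (\<lambda>v. \<phi> k v t)" using presD(1)[OF \<phi>, of t k] that by (simp add: I_def low)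
    show "(\<lambda>h. low K h - rt n a b h) \<notin> wts X" if "a < b" "b \<le> n" for a b using low_top[OF that] wX by blast
    show "(\<lambda>h. low K h + of_nat (k + 1) * simple_root n i h) \<notin> wts X"
      if "i \<in> {1..n}" "low K (coroot n i) = - of_nat k" for i k using low_string[OF that] wX by blast
  qed
  then obtain Q where Q: "\<And>k t. (k, t) \<in> I \<Longrightarrow> nhom X (low K) (r t) (Q k t)"
    "\<And>k t v. (k, t) \<in> I \<Longrightarrow> v \<in> F (Suc k) \<Longrightarrow> Q k t v = \<phi> k v t" by metis
  define \<Phi> where "\<Phi> v i = (if i \<in> I then Q (fst i) (snd i) v else zf)" for v i
  have \<Phi>h: "nhom X (low K) (r (snd i)) (\<lambda>v. \<Phi> v i)" if "i \<in> I" for i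
    using Q(1)[of "fst i" "snd i"] that by (simp add: \<Phi>_def)
  have \<Phi>_out: "\<Phi> v i = zf" if "i \<notin> I" for v i using that by (simp add: \<Phi>_def)
  have \<Phi>_new: "\<Phi> v (k, t) = \<phi> k v t" if "(k, t) \<in> I" "v \<in> F (Suc k)" for v k t
    using Q(2) that by (simp add: \<Phi>_def)
  \<comment> \<open>The extension is prescribed on \<open>F (Suc k)\<close>, and there
    \<open>\<phi> k\<close> vanishes on \<open>F k\<close>; so \<open>\<Phi>\<close> is triangular
    with respect to the filtration.\<close>
  have \<Phi>_old: "\<Phi> v (k, t) = zf" if v: "v \<in> F k" for v k t
  proof (cases "(k, t) \<in> I")
    case True
    have "\<phi> k v = (\<lambda>_. zf)" using presD(3)[OF \<phi>, of v k] v F(2) by blast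
    then show ?thesis using \<Phi>_new[OF True, of v] v F(2) by auto
  qed (rule \<Phi>_out)
  have \<Phi>_add: "\<Phi> (v + w) i u = \<Phi> v i u + \<Phi> w i u" if "v \<in> X" "w \<in> X" for v w i u
    using nhomD(2)[OF \<Phi>h, of i v w u] that by (cases "i \<in> I") (auto simp: \<Phi>_out)
  have \<Phi>_sc: "\<Phi> (sc c v) i u = c * \<Phi> v i u" if "v \<in> X" for v c i u
    using nhomD(3)[OF \<Phi>h, of i v c u] that by (cases "i \<in> I") (auto simp: \<Phi>_out)
  have \<Phi>_0: "\<Phi> 0 = (\<lambda>_. zf)"
    using \<Phi>_sc[of 0 0] gsub_subspace[OF X] by (auto simp: vs.subspace_0 fun_eq_iff)
  \<comment> \<open>If \<open>v\<close> lies in \<open>F m\<close>, only layers below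
    \<open>m\<close> contribute. In each of them only summands that are nonzero in degree
    \<open>d\<close> matter, and there are finitely many.\<close>
  have fin_hom: "finite {i. \<Phi> v i \<noteq> zf}" if v: "v \<in> X \<inter> G d" for v d
  proof -
    obtain m where m: "X \<inter> G d \<subseteq> F m" using fin_layer_in_chain[OF X F(1-3)] by blast
    let ?T = "\<lambda>k. {t \<in> J k. \<exists>g\<in>word_nabla n (w t). g \<noteq> zf \<and> (\<forall>u. g u \<noteq> 0 \<longrightarrow> int (wdeg u) = r t - d)}"
    have "{i. \<Phi> v i \<noteq> zf} \<subseteq> (SIGMA k:{..<m}. ?T k)"
    proof safe
      fix k t assume ne: "\<Phi> v (k, t) \<noteq> zf"
      then have I: "(k, t) \<in> I" using \<Phi>_out by blast
      have "v \<in> F m" using v m by blast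
      then show "k < m" using \<Phi>_old[of v k t] ne Fmono[of m k] by (meson in_mono not_less)
      show "t \<in> J k" using I by (simp add: I_def)
      have "\<Phi> v (k, t) \<in> word_nabla n (w t)"
        using nhom_nabla[OF X, of "lam K" _ "\<lambda>v. \<Phi> v (k, t)" v] \<Phi>h[OF I] v I by (simp add: low I_def)
      moreover have "\<forall>u. \<Phi> v (k, t) u \<noteq> 0 \<longrightarrow> int (wdeg u) = r t - d"
        using nhomD(5)[OF \<Phi>h[OF I], of v d] v by simp
      ultimately show "\<exists>g\<in>word_nabla n (w t). g \<noteq> zf \<and> (\<forall>u. g u \<noteq> 0 \<longrightarrow> int (wdeg u) = r t - d)"
        using ne by blast
    qed
    moreover have "finite (SIGMA k:{..<m}. ?T k)" using homogeneous_finite[OF F(1) \<phi>] by blast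
    ultimately show ?thesis by (rule finite_subset)
  qed
  have fin: "finite {i. \<Phi> v i \<noteq> zf}" if v: "v \<in> X" for v
  proof -
    have "v \<in> vs.span (\<Union>d. G d \<inter> X)" using gsub_graded[OF X] v by blast
    then have "v \<in> X \<and> finite {i. \<Phi> v i \<noteq> zf}"
    proof (induction rule: vs.span_induct_alt)
      case base
      then show ?case using gsub_subspace[OF X] by (simp add: vs.subspace_0 \<Phi>_0)
    next
      case (step c x y)
      then obtain d where x: "x \<in> X \<inter> G d" by auto
      have cx: "sc c x \<in> X" using x gsub_subspace[OF X] by (simp add: vs.subspace_scale)
      have "{i. \<Phi> (sc c x + y) i \<noteq> zf} \<subseteq> {i. \<Phi> x i \<noteq> zf} \<union> {i. \<Phi> y i \<noteq> zf}"
        using \<Phi>_add[OF cx] \<Phi>_sc[of x c] step x by (auto simp: fun_eq_iff)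
      then show ?case using fin_hom[OF x] step cx gsub_subspace[OF X]
        by (auto simp: vs.subspace_add intro: finite_subset)
    qed
    then show ?thesis by blast
  qed
  have \<Phi>_sum: "\<Phi> v \<in> word_sum n I (\<lambda>i. lam K)" if v: "v \<in> X" for v
  proof -
    have "\<Phi> v i \<in> word_nabla n (lam K)" if "i \<in> I" for i
      using nhom_nabla[OF X _ v, of "lam K" _ "\<lambda>v. \<Phi> v i"] \<Phi>h[OF that] by (simp add: low)
    then show ?thesis unfolding word_sum_def using fin[OF v] \<Phi>_out by simp
  qed
  \<comment> \<open>Elimination from the top layer downwards: correcting the components in layer
    \<open>m\<close> by some \<open>y\<close> in \<open>F (Suc m)\<close> disturbs only lower
    layers. The control of the preimage, in \<open>F m\<close>, is used again for
    \<open>\<phi>'\<close>.\<close>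
  have surj: "\<exists>v\<in>F m. \<Phi> v = g" if "g \<in> word_sum n I (\<lambda>i. lam K)" "\<forall>k t. g (k, t) \<noteq> zf \<longrightarrow> k < m" for g m
    using that
  proof (induction m arbitrary: g)
    case 0
    then have "g = (\<lambda>_. zf)" by auto
    then show ?case using F(4) \<Phi>_0 by auto
  next
    case (Suc m)
    let ?y = "\<lambda>t. if (m, t) \<in> I then g (m, t) else zf"
    have "{t. ?y t \<noteq> zf} \<subseteq> snd ` {i. g i \<noteq> zf}"
    proof
      fix t assume "t \<in> {t. ?y t \<noteq> zf}"
      then have "g (m, t) \<noteq> zf" by (auto split: if_splits)
      then show "t \<in> snd ` {i. g i \<noteq> zf}" by (intro image_eqI[of _ _ "(m, t)"]) auto
    qed
    moreover have "finite (snd ` {i. g i \<noteq> zf})" using Suc.prems(1) by (auto simp: word_sum_def)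
    ultimately have fin_y: "finite {t. ?y t \<noteq> zf}" by (rule finite_subset)
    have "?y t \<in> word_nabla n (w t)" if "t \<in> J m" for t
    proof (cases "(m, t) \<in> I")
      case True
      then have "w t = lam K" by (simp add: I_def)
      moreover have "g (m, t) \<in> word_nabla n (lam K)" using Suc.prems(1) True unfolding word_sum_def by blast
      ultimately show ?thesis using True by simp
    qed (simp add: zf_nabla)
    moreover have "?y t = zf" if "t \<notin> J m" for t using that by (simp add: I_def)
    ultimately have "?y \<in> word_sum n (J m) w"
      using fin_y unfolding word_sum_def by blast
    then obtain y where y: "y \<in> F (Suc m)" "\<phi> m y = ?y" using presD(4)[OF \<phi>] by blast
    have yX: "y \<in> X" using y FX by blast
    let ?g = "\<lambda>i u. g i u - \<Phi> y i u"
    have yk: "\<Phi> y (k, t) = zf" if "m < k" for k t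
      using \<Phi>_old[of y k t] y(1) Fmono[of "Suc m" k] that by auto
    have ym: "\<Phi> y (m, t) = g (m, t)" for t
    proof (cases "(m, t) \<in> I")
      case True then show ?thesis using \<Phi>_new[OF True y(1)] y(2) by simp
    next
      case False then show ?thesis using Suc.prems(1) \<Phi>_out by (auto simp: word_sum_def)
    qed
    have "?g \<in> word_sum n I (\<lambda>i. lam K)"
    proof -
      have "{i. ?g i \<noteq> zf} \<subseteq> {i. g i \<noteq> zf} \<union> {i. \<Phi> y i \<noteq> zf}" by (auto simp: fun_eq_iff)
      then have f: "finite {i. ?g i \<noteq> zf}"
        using fin[OF yX] Suc.prems(1) by (auto simp: word_sum_def intro: finite_subset)
      have "?g i \<in> word_nabla n (lam K)" if i: "i \<in> I" for i
      proof -
        have a: "g i \<in> word_nabla n (lam K)" "\<Phi> y i \<in> word_nabla n (lam K)"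
          using Suc.prems(1) \<Phi>_sum[OF yX] i by (auto simp: word_sum_def)
        show ?thesis by (rule word_nabla_diff[OF a])
      qed
      then show ?thesis using f Suc.prems(1) \<Phi>_out by (auto simp: word_sum_def)
    qed
    moreover have "\<forall>k t. ?g (k, t) \<noteq> zf \<longrightarrow> k < m"
    proof (intro allI impI)
      fix k t assume "?g (k, t) \<noteq> zf"
      then show "k < m" using yk[of k t] ym[of t] Suc.prems(2)[rule_format, of k t]
        by (cases k m rule: linorder_cases) (auto simp: fun_eq_iff)
    qed
    ultimately obtain z where z: "z \<in> F m" "\<Phi> z = ?g" using Suc.IH by blast
    have "z \<in> F (Suc m)" "z \<in> X" using z F(2) FX by blast+
    then have "y + z \<in> F (Suc m)" using y(1) gsub_subspace[OF F(1)] by (simp add: vs.subspace_add)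
    moreover have "\<Phi> (y + z) = g" using \<Phi>_add[OF yX \<open>z \<in> X\<close>] z(2) by (auto simp: fun_eq_iff)
    ultimately show ?case by blast
  qed
  define X' where "X' = {v \<in> X. \<forall>i\<in>I. \<Phi> v i = zf}"
  have X'_iff: "v \<in> X' \<longleftrightarrow> v \<in> X \<and> \<Phi> v = (\<lambda>_. zf)" for v
    unfolding X'_def using \<Phi>_out by (auto simp: fun_eq_iff)
  have X'g: "gsub X'" unfolding X'_def by (rule kernel_gsub[OF X \<Phi>h])
  define F' where "F' k = {v \<in> F k. \<forall>i\<in>I. \<Phi> v i = zf}" for k
  have F'_eq: "F' k = F k \<inter> X'" for k using FX[of k] by (auto simp: F'_def X'_def)
  have F'g: "gsub (F' k)" for k unfolding F'_def by (rule kernel_gsub[OF F(1) nhom_mono[OF \<Phi>h FX]])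
  define J' where "J' k = {t \<in> J k. w t \<noteq> lam K}" for k
  define \<phi>' where "\<phi>' k v t = (if w t \<noteq> lam K then \<phi> k v t else zf)" for k v t
  have pres': "pres (F' (Suc k)) (F' k) (J' k) w r (\<phi>' k)" for k
    unfolding pres_def
  proof (intro conjI ballI)
    fix t assume "t \<in> J' k"
    then have "nhom (F (Suc k)) (longest_element n (w t)) (r t) (\<lambda>v. \<phi>' k v t)"
      using presD(1)[OF \<phi>, of t k] by (simp add: J'_def \<phi>'_def)
    then show "nhom (F' (Suc k)) (longest_element n (w t)) (r t) (\<lambda>v. \<phi>' k v t)"
      by (rule nhom_mono) (simp add: F'_eq)
  next
    fix v assume v: "v \<in> F' (Suc k)"
    then have vF: "v \<in> F (Suc k)" "v \<in> X'" by (auto simp: F'_eq)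
    have s: "\<phi> k v \<in> word_sum n (J k) w" by (rule presD(2)[OF \<phi> vF(1)])
    have "{t. \<phi>' k v t \<noteq> zf} \<subseteq> {t. \<phi> k v t \<noteq> zf}" by (auto simp: \<phi>'_def)
    then show "\<phi>' k v \<in> word_sum n (J' k) w"
      using s by (auto simp: word_sum_def J'_def \<phi>'_def intro: finite_subset)
    \<comment> \<open>On the kernel of \<open>\<Phi>\<close> the components of type
      \<open>lam K\<close> vanish, so removing them from \<open>\<phi> k\<close> changes
      nothing.\<close>
    have "\<phi> k v t = zf" if "w t = lam K" for t
    proof (cases "t \<in> J k")
      case True
      then have I: "(k, t) \<in> I" using that by (simp add: I_def)
      then show ?thesis using \<Phi>_new[OF I vF(1)] vF(2) by (simp add: X'_iff)
    qed (use pres_zero[OF \<phi> vF(1)] in simp)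
    then have "\<phi>' k v = \<phi> k v" by (auto simp: \<phi>'_def)
    then show "(\<phi>' k v = (\<lambda>_. zf)) = (v \<in> F' k)" using presD(3)[OF \<phi> vF(1)] vF(2) by (simp add: F'_eq)
  next
    fix g assume g: "g \<in> word_sum n (J' k) w"
    then have "g \<in> word_sum n (J k) w"
      using zf_nabla by (auto simp: word_sum_def J'_def)
    then obtain y where y: "y \<in> F (Suc k)" "\<phi> k y = g" using presD(4)[OF \<phi>] by blast
    have yX: "y \<in> X" using y FX by blast
    \<comment> \<open>The preimage \<open>y\<close> need not lie in the kernel of
      \<open>\<Phi>\<close>. As \<open>g\<close> has no components of type \<open>lam K\<close>, the
      defect \<open>\<Phi> y\<close> sits in the layers below \<open>k\<close>; it is removed by
      some \<open>z\<close> in \<open>F k\<close>, which \<open>\<phi> k\<close> does not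
      see.\<close>
    have "\<forall>i t. \<Phi> y (i, t) \<noteq> zf \<longrightarrow> i < k"
    proof (intro allI impI)
      fix i t assume ne: "\<Phi> y (i, t) \<noteq> zf"
      then have I: "(i, t) \<in> I" using \<Phi>_out by blast
      show "i < k"
      proof (rule ccontr)
        assume "\<not> i < k"
        then consider "i = k" | "k < i" by linarith
        then show False
        proof cases
          case 1
          then have "\<phi> k y t \<noteq> zf" using \<Phi>_new[of k t y] I ne y(1) by simp
          then show False using g y(2) I 1 by (auto simp: word_sum_def J'_def I_def)
        next
          case 2
          then show False using \<Phi>_old[of y i t] Fmono[of "Suc k" i] y(1) ne by auto
        qed
      qed
    qed
    then obtain z where z: "z \<in> F k" "\<Phi> z = \<Phi> y" using surj[OF \<Phi>_sum[OF yX]] by blast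
    have z': "z \<in> F (Suc k)" "z \<in> X" using z F(2) FX by blast+
    let ?v = "y + sc (- 1) z"
    have sz: "sc (- 1) z \<in> F (Suc k)" "sc (- 1) z \<in> X"
      by (rule vs.subspace_scale[OF gsub_subspace[OF F(1)] z'(1)], rule vs.subspace_scale[OF gsub_subspace[OF X] z'(2)])
    have v: "?v \<in> F (Suc k)" "?v \<in> X"
      by (rule vs.subspace_add[OF gsub_subspace[OF F(1)] y(1) sz(1)], rule vs.subspace_add[OF gsub_subspace[OF X] yX sz(2)])
    have "\<Phi> ?v = (\<lambda>_. zf)" using \<Phi>_add[OF yX sz(2)] \<Phi>_sc[OF z'(2), of "- 1"] z(2) by (auto simp: fun_eq_iff)
    then have vF': "?v \<in> F' (Suc k)" using v by (simp add: F'_eq X'_iff)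
    have z0: "\<phi> k z = (\<lambda>_. zf)" using presD(3)[OF \<phi> z'(1)] z(1) by simp
    have "\<phi> k ?v t = g t" for t
    proof (cases "t \<in> J k")
      case True
      show ?thesis
      proof
        fix u
        show "\<phi> k ?v t u = g t u"
          using nhomD(2)[OF presD(1)[OF \<phi> True] y(1) sz(1), of u] nhomD(3)[OF presD(1)[OF \<phi> True] z'(1), of "- 1" u]
            z0 y(2) by simp
      qed
    next
      case False
      then show ?thesis using pres_zero[OF \<phi> v(1) False] g by (auto simp: word_sum_def J'_def)
    qed
    moreover have "g t = zf" if "w t = lam K" for t using g that by (auto simp: word_sum_def J'_def)
    ultimately have "\<phi>' k ?v = g" by (auto simp: \<phi>'_def)
    then show "\<exists>v\<in>F' (Suc k). \<phi>' k v = g" using vF' by blast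
  qed
  have F'_props: "F' k \<subseteq> F' (Suc k)" "(\<Union>k. F' k) = X'" "F' 0 = {0}" for k
    using F(2)[of k] F(3,4) \<Phi>_0 gsub_subspace[OF X'g] by (auto simp: F'_eq X'_def vs.subspace_0)
  have "wts X' \<subseteq> cells K"
  proof (rule stable_subset_cells)
    show "\<exists>b. \<nu> = wi n b" if "\<nu> \<in> wts X'" for \<nu> by (rule wts_integral[OF X'g that])
    show "simple_refl n i \<nu> \<in> wts X'" if "\<nu> \<in> wts X'" "i \<in> {1..n}" for \<nu> i by (rule wts_refl[OF X'g that])
    fix \<nu> assume "\<nu> \<in> wts X'"
    then obtain v where v: "v \<in> X'" "v \<noteq> 0" "weight_vector \<nu> v" and \<nu>: "\<nu> \<in> cartan_dual n" by (auto simp: wts_def)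
    then obtain k0 where "v \<in> F' k0" using F'_props(2) by blast
    \<comment> \<open>The first step containing \<open>v\<close> exhibits a nonzero component of
      some type \<open>lam j\<close>. This puts the weight of \<open>v\<close> above
      \<open>low j\<close>, and \<open>low j\<close> itself is a weight of \<open>X\<close>, whence
      \<open>j \<le> K\<close>; the value \<open>K\<close> has been removed.\<close>
    define k where "k = (LEAST k. v \<in> F' k)"
    have k: "v \<in> F' k" unfolding k_def by (rule LeastI[of "\<lambda>k. v \<in> F' k", OF \<open>v \<in> F' k0\<close>])
    have k': "v \<notin> F' i" if "i < k" for i using not_less_Least[of i "\<lambda>k. v \<in> F' k"] that by (simp add: k_def)
    have "v \<notin> F' 0" using v(2) F'_props(3) by (metis singletonD)
    then have "k \<noteq> 0" using k by metis
    then obtain l where l: "k = Suc l" using not0_implies_Suc by blast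
    have vl: "v \<in> F' (Suc l)" "v \<notin> F' l" using k unfolding l by (blast, intro k') (simp add: l)
    then have "\<phi>' l v \<noteq> (\<lambda>_. zf)" using presD(3)[OF pres', of v l] by simp
    then obtain t where t: "\<phi>' l v t \<noteq> zf" by auto
    then have tJ: "t \<in> J' l" using pres_zero[OF pres' vl(1)] by blast
    obtain j where j: "w t = lam j" using lam_surj dom[of t l] tJ by (auto simp: J'_def)
    note p = presD(1)[OF pres' tJ, unfolded j low]
    have "(\<lambda>h. \<nu> h - low j h) \<in> root_lattice_pos n"
      by (rule nhom_weight[OF p low_dual \<nu> vl(1) v(3) t])
    moreover have "low j \<in> wts (F' (Suc l))" by (rule nhom_low_weight[OF F'g p low_dual vl(1) t])
    then have "low j \<in> cells (Suc K)" using wts_mono[of "F' (Suc l)" X] wX FX by (auto simp: F'_eq)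
    then have "j < Suc K" by (rule low_cells)
    moreover have "j \<noteq> K" using tJ j by (auto simp: J'_def)
    ultimately show "\<exists>j<K. (\<lambda>h. \<nu> h - low j h) \<in> root_lattice_pos n" by (intro exI[of _ j]) auto
  qed
  then have "X' \<subseteq> Nm (cells K) X" by (intro Nm_max X'g) (auto simp: X'_def)
  \<comment> \<open>A nonzero component of \<open>\<Phi>\<close> would produce the weight
    \<open>low K\<close>, which lies outside \<open>cells K\<close>.\<close>
  moreover have "Nm (cells K) X \<subseteq> X'"
  proof
    fix v assume v: "v \<in> Nm (cells K) X"
    have "\<Phi> v i = zf" if i: "i \<in> I" for i
    proof (rule ccontr)
      assume "\<Phi> v i \<noteq> zf"
      then have "low K \<in> wts (Nm (cells K) X)"
        using nhom_low_weight[OF Nm_gsub[OF X] nhom_mono[OF \<Phi>h[OF i] Nm_sub[OF X]] low_dual v] by blast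
      then show False using Nm_wts[OF X, of "cells K"] low_cells[of K K] by blast
    qed
    then show "v \<in> X'" using v Nm_sub[OF X] by (auto simp: X'_def)
  qed
  ultimately have X'N: "X' = Nm (cells K) X" by blast
  have "pres X X' I (\<lambda>i. lam K) (\<lambda>i. r (snd i)) \<Phi>"
    unfolding pres_def
  proof (intro conjI ballI)
    fix g assume g: "g \<in> word_sum n I (\<lambda>i. lam K)"
    then have "finite (fst ` {i. g i \<noteq> zf})" by (simp add: word_sum_def)
    then obtain m where "\<forall>k\<in>fst ` {i. g i \<noteq> zf}. k < m" unfolding finite_nat_set_iff_bounded by auto
    then have "\<forall>k t. g (k, t) \<noteq> zf \<longrightarrow> k < m" by force
    then show "\<exists>v\<in>X. \<Phi> v = g" using surj[OF g] FX by blast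
  qed (use \<Phi>h \<Phi>_sum X'_iff in \<open>auto simp: low\<close>)
  then show "\<exists>\<Phi>. pres X (Nm (cells K) X) I (\<lambda>i. lam K) (\<lambda>i. r (snd i)) \<Phi>" unfolding X'N by blast
  show "\<exists>F' J' \<phi>'. (\<forall>k. gsub (F' k) \<and> F' k \<subseteq> F' (Suc k)) \<and> (\<Union>k. F' k) = Nm (cells K) X \<and> F' 0 = {0} \<and>
      (\<forall>k. pres (F' (Suc k)) (F' k) (J' k) w r (\<phi>' k)) \<and> (\<forall>k. J' k \<subseteq> J k)"
    using F'g F'_props pres' X'N by (intro exI[of _ F'] exI[of _ J'] exI[of _ \<phi>']) (auto simp: J'_def)
qed

end

text \<open>All relations are homogeneous for \<open>wdeg\<close>, so a functional may be truncated
  to one degree.\<close>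

lemma word_functionals_homogeneous:
  assumes g: "g \<in> word_functionals n m"
  shows "(\<lambda>u. if wdeg u = e then g u else 0) \<in> word_functionals n m"
proof -
  note D = word_functionalsD[OF g]
  have d: "wdeg (w @ u) = wdeg w + wdeg u" "wdeg ((x, s) # u) = s + wdeg u" "wdeg [] = 0" for w u x s
    by (simp_all add: wdeg_def)
  have r: "wdeg (replicate k (x, 0)) = 0" for k x by (induction k) (simp_all add: wdeg_def)
  show ?thesis
    unfolding word_functionals_def mem_Collect_eq
  proof (intro conjI allI ballI impI)
    fix w i k assume "w \<in> words n" "i \<in> {1..n}" "m (coroot n i) = of_nat k"
    then show "(if wdeg (w @ replicate (k + 1) (x_neg n i, 0)) = e then g (w @ replicate (k + 1) (x_neg n i, 0)) else 0) = 0"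
      using D(6) by metis
  next
    fix w h assume "w \<in> words n" "h \<in> cartan n"
    then show "(if wdeg (w @ [(h, 0)]) = e then g (w @ [(h, 0)]) else 0) = m h * (if wdeg w = e then g w else 0)"
      using D(7) by (simp add: d)
  next
    fix w u x y s assume "w \<in> words n" "u \<in> words n" "x \<in> sl n" "y \<in> sl n"
    then show "(if wdeg (w @ (x + y, s) # u) = e then g (w @ (x + y, s) # u) else 0) =
      (if wdeg (w @ (x, s) # u) = e then g (w @ (x, s) # u) else 0) + (if wdeg (w @ (y, s) # u) = e then g (w @ (y, s) # u) else 0)"
      using D(2) by (simp add: d)
  next
    fix w u c x s assume "w \<in> words n" "u \<in> words n" "x \<in> sl n"
    then show "(if wdeg (w @ (c \<cdot>\<^sub>m x, s) # u) = e then g (w @ (c \<cdot>\<^sub>m x, s) # u) else 0) =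
      c * (if wdeg (w @ (x, s) # u) = e then g (w @ (x, s) # u) else 0)"
      using D(3) by (simp add: d)
  next
    fix w u x y r s assume "w \<in> words n" "u \<in> words n" "x \<in> sl n" "y \<in> sl n"
    then show "(if wdeg (w @ (bracket x y, r + s) # u) = e then g (w @ (bracket x y, r + s) # u) else 0) =
      (if wdeg (w @ (x, r) # (y, s) # u) = e then g (w @ (x, r) # (y, s) # u) else 0) -
      (if wdeg (w @ (y, s) # (x, r) # u) = e then g (w @ (y, s) # (x, r) # u) else 0)"
      using D(4)[of w u x y r s] by (simp add: d add.assoc add.left_commute)
  qed (use D(1,5) in auto)
qed

section \<open>Reindexing of summands and finiteness of multiplicities\<close>

context current_rep
begin

lemma pres_reindex:
  fixes \<rho> :: "'i \<Rightarrow> 'j"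
  assumes \<phi>: "pres X N I w r \<phi>" and inj: "inj_on \<rho> I"
    and w': "\<And>i. i \<in> I \<Longrightarrow> w' (\<rho> i) = w i" and r': "\<And>i. i \<in> I \<Longrightarrow> r' (\<rho> i) = r i"
  shows "\<exists>\<phi>'. pres X N (\<rho> ` I) w' r' \<phi>'"
proof -
  let ?i = "inv_into I \<rho>"
  define \<phi>' where "\<phi>' v j = (if j \<in> \<rho> ` I then \<phi> v (?i j) else zf)" for v j
  have inv: "?i (\<rho> i) = i" if "i \<in> I" for i using inj that by simp
  have fin: "finite {j. (if j \<in> \<rho> ` I then g (?i j) else zf) \<noteq> zf}" if "finite {i. g i \<noteq> zf}" for g :: "'i \<Rightarrow> current_word \<Rightarrow> complex"
  proof (rule finite_subset[OF _ finite_imageI[OF that, of \<rho>]])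
    show "{j. (if j \<in> \<rho> ` I then g (?i j) else zf) \<noteq> zf} \<subseteq> \<rho> ` {i. g i \<noteq> zf}"
      using inv by (auto split: if_splits)
  qed
  have "pres X N (\<rho> ` I) w' r' \<phi>'"
    unfolding pres_def
  proof (intro conjI ballI)
    fix j assume "j \<in> \<rho> ` I"
    then show "nhom X (longest_element n (w' j)) (r' j) (\<lambda>v. \<phi>' v j)"
      using presD(1)[OF \<phi>] by (auto simp: \<phi>'_def inv w' r')
  next
    fix v assume v: "v \<in> X"
    have s: "\<phi> v \<in> word_sum n I w" by (rule presD(2)[OF \<phi> v])
    then show "\<phi>' v \<in> word_sum n (\<rho> ` I) w'"
      using fin[of "\<phi> v"] by (auto simp: word_sum_def \<phi>'_def inv w')
    have "\<phi>' v = (\<lambda>_. zf) \<longleftrightarrow> \<phi> v = (\<lambda>_. zf)"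
    proof
      assume 0: "\<phi>' v = (\<lambda>_. zf)"
      have "\<phi> v i = zf" for i
      proof (cases "i \<in> I")
        case True
        then show ?thesis using fun_cong[OF 0, of "\<rho> i"] by (simp add: \<phi>'_def inv)
      qed (use pres_zero[OF \<phi> v] in simp)
      then show "\<phi> v = (\<lambda>_. zf)" by auto
    qed (auto simp: \<phi>'_def)
    then show "\<phi>' v = (\<lambda>_. zf) \<longleftrightarrow> v \<in> N" using presD(3)[OF \<phi> v] by simp
  next
    fix g assume g: "g \<in> word_sum n (\<rho> ` I) w'"
    let ?g = "\<lambda>i. if i \<in> I then g (\<rho> i) else zf"
    have "\<rho> ` {i. ?g i \<noteq> zf} \<subseteq> {j. g j \<noteq> zf}" by (auto split: if_splits)
    then have "finite (\<rho> ` {i. ?g i \<noteq> zf})" using g by (auto simp: word_sum_def intro: finite_subset)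
    moreover have "inj_on \<rho> {i. ?g i \<noteq> zf}" using inj by (rule inj_on_subset) (auto split: if_splits)
    ultimately have "finite {i. ?g i \<noteq> zf}" by (rule finite_imageD)
    then have "?g \<in> word_sum n I w" using g w' by (auto simp: word_sum_def)
    then obtain v where v: "v \<in> X" "\<phi> v = ?g" using presD(4)[OF \<phi>] by blast
    have "\<phi>' v = g" using v(2) g inv by (auto simp: \<phi>'_def word_sum_def fun_eq_iff)
    then show "\<exists>v\<in>X. \<phi>' v = g" using v(1) by blast
  qed
  then show ?thesis by blast
qed

lemma pres_drop_zero:
  assumes \<phi>: "pres X N J w r \<phi>"
  shows "pres X N {j \<in> J. word_nabla n (w j) \<noteq> {zf}} w r \<phi>"
proof -
  let ?J = "{j \<in> J. word_nabla n (w j) \<noteq> {zf}}"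
  have "word_sum n ?J w = word_sum n J w"
  proof
    show "word_sum n ?J w \<subseteq> word_sum n J w"
    proof
      fix g assume g: "g \<in> word_sum n ?J w"
      have "g j \<in> word_nabla n (w j)" if "j \<in> J" for j
        using g that zf_nabla by (cases "j \<in> ?J") (auto simp: word_sum_def)
      then show "g \<in> word_sum n J w" using g by (auto simp: word_sum_def)
    qed
  qed (auto simp: word_sum_def)
  then show ?thesis using \<phi> unfolding pres_def by auto
qed

text \<open>A homogeneous nonzero element of \<open>word_nabla n \<mu>\<close> marks every summand
  of this weight and shift in one common degree of \<open>X\<close>, where
  \<open>homogeneous_finite\<close> counts them.\<close>

lemma multiplicity_finite:
  assumes X: "gsub X" and \<phi>: "pres X N J w r \<phi>" and ne: "word_nabla n \<mu> \<noteq> {zf}"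
  shows "finite {j \<in> J. w j = \<mu> \<and> r j = d}"
proof -
  obtain g where g: "g \<in> word_nabla n \<mu>" "g \<noteq> zf" using ne zf_nabla by blast
  then obtain u where u: "g u \<noteq> 0" by auto
  let ?g = "\<lambda>w. if wdeg w = wdeg u then g w else 0"
  have "wdeg ` {w. ?g w \<noteq> 0} \<subseteq> {wdeg u}" by auto
  then have "?g \<in> word_nabla n \<mu>"
    using g(1) word_functionals_homogeneous unfolding word_nabla_def by (auto intro: finite_subset)
  moreover have "?g u \<noteq> 0" using u by simp
  then have "?g \<noteq> zf" by metis
  ultimately have "{j \<in> J. w j = \<mu> \<and> r j = d} \<subseteq>
    {t \<in> J. \<exists>g\<in>word_nabla n (w t). g \<noteq> zf \<and> (\<forall>v. g v \<noteq> 0 \<longrightarrow> int (wdeg v) = r t - (d - int (wdeg u)))}"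
    by (intro Collect_mono impI conjI) (auto intro!: bexI[of _ ?g] split: if_splits)
  then show ?thesis using homogeneous_finite[OF X \<phi>] by (rule finite_subset)
qed

end

context enumerated_rep
begin

text \<open>Induction on the number of cells: \<open>main_step\<close> handles the last one and
  hands a filtration of the kernel to the induction hypothesis. The index type stays
  \<open>nat \<times> 't\<close> at every stage, since the new filtration uses subsets of the old
  index sets.\<close>

lemma canonical_presentations:
  fixes J :: "nat \<Rightarrow> 't set" and w :: "'t \<Rightarrow> weight" and r :: "'t \<Rightarrow> int"
  assumes "gsub X" "wts X \<subseteq> cells K" "\<And>k. gsub (F k)" "\<And>k. F k \<subseteq> F (Suc k)" "(\<Union>k. F k) = X" "F 0 = {0}"
    and "\<And>k. pres (F (Suc k)) (F k) (J k) w r (\<phi> k)" and "\<And>k t. t \<in> J k \<Longrightarrow> w t \<in> dominant_weights n" and "s < K"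
  shows "\<exists>\<Phi>. \<exists>I :: (nat \<times> 't) set. (\<forall>i\<in>I. w (snd i) = lam s) \<and> pres (Nm (cells (Suc s)) X) (Nm (cells s) X) I (\<lambda>i. lam s) (\<lambda>i. r (snd i)) \<Phi>"
  using assms
proof (induction K arbitrary: X F J \<phi>)
  case (Suc K)
  note X = Suc.prems(1)
  let ?I = "{(k, t). t \<in> J k \<and> w t = lam K}"
  have step: "\<exists>\<Phi>. pres X (Nm (cells K) X) ?I (\<lambda>i. lam K) (\<lambda>i. r (snd i)) \<Phi>"
    "\<exists>F' J' \<phi>'. (\<forall>k. gsub (F' k) \<and> F' k \<subseteq> F' (Suc k)) \<and> (\<Union>k. F' k) = Nm (cells K) X \<and> F' 0 = {0} \<and>
      (\<forall>k. pres (F' (Suc k)) (F' k) (J' k) w r (\<phi>' k)) \<and> (\<forall>k. J' k \<subseteq> J k)"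
    by (rule main_step[OF Suc.prems(1-7)], erule Suc.prems(8))+
  show ?case
  proof (cases "s = K")
    case True
    obtain \<Phi> where "pres X (Nm (cells K) X) ?I (\<lambda>i. lam K) (\<lambda>i. r (snd i)) \<Phi>" using step(1) by (rule exE)
    then show ?thesis unfolding True Nm_eq[OF X Suc.prems(2)] by (intro exI[of _ \<Phi>] exI[of _ ?I]) auto
  next
    case False
    then have s: "s < K" using Suc.prems(9) by simp
    obtain F' J' \<phi>' where F'0: "(\<forall>k. gsub (F' k) \<and> F' k \<subseteq> F' (Suc k)) \<and> (\<Union>k. F' k) = Nm (cells K) X \<and> F' 0 = {0} \<and>
      (\<forall>k. pres (F' (Suc k)) (F' k) (J' k) w r (\<phi>' k)) \<and> (\<forall>k. J' k \<subseteq> J k)" using step(2) by (elim exE) (rule that)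
    then have F': "\<And>k. gsub (F' k)" "\<And>k. F' k \<subseteq> F' (Suc k)" "(\<Union>k. F' k) = Nm (cells K) X" "F' 0 = {0}"
      "\<And>k. pres (F' (Suc k)) (F' k) (J' k) w r (\<phi>' k)" "\<And>k. J' k \<subseteq> J k" by simp_all
    have "w t \<in> dominant_weights n" if "t \<in> J' k" for k t using F'(6) Suc.prems(8) that by blast
    from Suc.IH[OF Nm_gsub[OF X] Nm_wts[OF X] F'(1-5) this s]
    show ?thesis using Nm_Nm[OF X cells_mono[of "Suc s" K]] Nm_Nm[OF X cells_mono[of s K]] s by auto
  qed
qed simp

end

section \<open>Embedding vector spaces into function spaces\<close>

definition emb :: "('v, 'b) gmod_scheme \<Rightarrow> ('v \<Rightarrow> 'x cvec) \<Rightarrow> bool" where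
  "emb V \<iota> \<longleftrightarrow> inj_on \<iota> (carrier V) \<and> \<zero>\<^bsub>V\<^esub> \<in> carrier V \<and> \<iota> \<zero>\<^bsub>V\<^esub> = 0 \<and>
     (\<forall>v\<in>carrier V. \<forall>w\<in>carrier V. v \<oplus>\<^bsub>V\<^esub> w \<in> carrier V \<and> \<iota> (v \<oplus>\<^bsub>V\<^esub> w) = \<iota> v + \<iota> w) \<and>
     (\<forall>c. \<forall>v\<in>carrier V. c \<odot>\<^bsub>V\<^esub> v \<in> carrier V \<and> \<iota> (c \<odot>\<^bsub>V\<^esub> v) = sc c (\<iota> v))"

lemma embD:
  assumes "emb V \<iota>"
  shows "v \<in> carrier V \<Longrightarrow> w \<in> carrier V \<Longrightarrow> \<iota> v = \<iota> w \<Longrightarrow> v = w"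
    and "\<zero>\<^bsub>V\<^esub> \<in> carrier V" and "\<iota> \<zero>\<^bsub>V\<^esub> = 0"
    and "v \<in> carrier V \<Longrightarrow> w \<in> carrier V \<Longrightarrow> v \<oplus>\<^bsub>V\<^esub> w \<in> carrier V"
    and "v \<in> carrier V \<Longrightarrow> w \<in> carrier V \<Longrightarrow> \<iota> (v \<oplus>\<^bsub>V\<^esub> w) = \<iota> v + \<iota> w"
    and "v \<in> carrier V \<Longrightarrow> c \<odot>\<^bsub>V\<^esub> v \<in> carrier V"
    and "v \<in> carrier V \<Longrightarrow> \<iota> (c \<odot>\<^bsub>V\<^esub> v) = sc c (\<iota> v)"
  using assms unfolding emb_def inj_on_def by blast+

lemma emb_subspace: "emb V \<iota> \<Longrightarrow> vs.subspace (\<iota> ` carrier V)"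
proof (rule vs.subspaceI)
  assume e: "emb V \<iota>"
  note D = embD[OF e]
  show "0 \<in> \<iota> ` carrier V" using D(2,3) by (metis imageI)
  fix x assume "x \<in> \<iota> ` carrier V"
  then obtain v where v: "v \<in> carrier V" "x = \<iota> v" by auto
  show "sc c x \<in> \<iota> ` carrier V" for c using D(6,7)[OF v(1), of c] v(2) by (metis imageI)
  fix y assume "y \<in> \<iota> ` carrier V"
  then obtain w where w: "w \<in> carrier V" "y = \<iota> w" by auto
  show "x + y \<in> \<iota> ` carrier V" using D(4,5)[OF v(1) w(1)] v(2) w(2) by (metis imageI)
qed

text \<open>All axioms are equations and are pulled back along the injection; the negative of
  \<open>v\<close> is \<open>-1\<close> times \<open>v\<close>.\<close>

lemma emb_vectorspace:
  assumes e: "emb V \<iota>" shows "vectorspace (class_ring :: complex ring) V"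
proof (rule vs_criteria)
  note D = embD[OF e]
  show "field (class_ring :: complex ring)" by (rule class_field)
  show "\<forall>v\<in>carrier V. \<exists>neg_v\<in>carrier V. v \<oplus>\<^bsub>V\<^esub> neg_v = \<zero>\<^bsub>V\<^esub>"
  proof
    fix v assume v: "v \<in> carrier V"
    have m: "(- 1) \<odot>\<^bsub>V\<^esub> v \<in> carrier V" by (rule D(6)[OF v])
    have "\<iota> (v \<oplus>\<^bsub>V\<^esub> ((- 1) \<odot>\<^bsub>V\<^esub> v)) = \<iota> \<zero>\<^bsub>V\<^esub>"
      using D(5)[OF v m] D(7)[OF v, of "- 1"] D(3) by simp
    then have "v \<oplus>\<^bsub>V\<^esub> ((- 1) \<odot>\<^bsub>V\<^esub> v) = \<zero>\<^bsub>V\<^esub>" by (rule D(1)[OF D(4)[OF v m] D(2)])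
    then show "\<exists>neg_v\<in>carrier V. v \<oplus>\<^bsub>V\<^esub> neg_v = \<zero>\<^bsub>V\<^esub>" using D(6)[OF v] by blast
  qed
qed (auto intro!: embD(1)[OF e] simp: embD[OF e] cvec_eq_iff algebra_simps)

lemma emb_carrier_update: 
  assumes e: "emb V \<iota>" and N: "N \<subseteq> carrier V" "vs.subspace (\<iota> ` N)" and W: "carrier W = N" "\<zero>\<^bsub>W\<^esub> = \<zero>\<^bsub>V\<^esub>" "(\<oplus>\<^bsub>W\<^esub>) = (\<oplus>\<^bsub>V\<^esub>)" "(\<odot>\<^bsub>W\<^esub>) = (\<odot>\<^bsub>V\<^esub>)"
  shows "emb W \<iota>"
proof -
  note D = embD[OF e]
  have cl: "x \<in> N" if "x \<in> carrier V" "\<iota> x \<in> \<iota> ` N" for x using D(1) N(1) that by blast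
  show ?thesis
    unfolding emb_def W
  proof (intro conjI ballI allI)
    show "inj_on \<iota> N" using e N(1) by (auto simp: emb_def intro: inj_on_subset)
    show "\<zero>\<^bsub>V\<^esub> \<in> N" using D(2,3) N(2) by (intro cl) (auto simp: vs.subspace_0)
    show "\<iota> \<zero>\<^bsub>V\<^esub> = 0" by (rule D(3))
    fix v assume v: "v \<in> N"
    then have vV: "v \<in> carrier V" using N(1) by blast
    show "c \<odot>\<^bsub>V\<^esub> v \<in> N" for c
      using D(6,7)[OF vV] v N(2) by (intro cl) (auto simp: vs.subspace_scale)
    show "\<iota> (c \<odot>\<^bsub>V\<^esub> v) = sc c (\<iota> v)" for c by (rule D(7)[OF vV])
    fix w assume w: "w \<in> N"
    then have wV: "w \<in> carrier V" using N(1) by blast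
    show "v \<oplus>\<^bsub>V\<^esub> w \<in> N" using D(4,5)[OF vV wV] v w N(2) by (intro cl) (auto simp: vs.subspace_add)
    show "\<iota> (v \<oplus>\<^bsub>V\<^esub> w) = \<iota> v + \<iota> w" by (rule D(5)[OF vV wV])
  qed
qed

lemma emb_finsum:
  assumes e: "emb V \<iota>" and "finite T" "\<And>t. t \<in> T \<Longrightarrow> g t \<in> carrier V"
  shows "finsum V g T \<in> carrier V \<and> \<iota> (finsum V g T) = (\<Sum>t\<in>T. \<iota> (g t))"
proof -
  interpret vectorspace "class_ring :: complex ring" V by (rule emb_vectorspace[OF e])
  show ?thesis using assms(2,3)
  proof (induction T)
    case (insert t T)
    then have g: "g \<in> T \<rightarrow> carrier V" "g t \<in> carrier V" by auto
    show ?case using insert g by (simp add: finsum_insert embD[OF e])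
  qed (simp add: embD[OF e])
qed

text \<open>The spanning set on the right may consist of vectors outside the image. A maximal
  independent subset of the image is then finite and pulls back to generators.\<close>

lemma emb_fin_dim:
  assumes e: "emb V \<iota>"
  shows "vectorspace.fin_dim (class_ring :: complex ring) V \<longleftrightarrow> (\<exists>B. finite B \<and> \<iota> ` carrier V \<subseteq> vs.span B)"
proof -
  interpret vectorspace "class_ring :: complex ring" V by (rule emb_vectorspace[OF e])
  have lc: "lincomb a T \<in> carrier V \<and> \<iota> (lincomb a T) = (\<Sum>t\<in>T. sc (a t) (\<iota> t))" if "finite T" "T \<subseteq> carrier V" for a T
  proof -
    have m: "a t \<odot>\<^bsub>V\<^esub> t \<in> carrier V" if "t \<in> T" for t using embD(6)[OF e] \<open>T \<subseteq> carrier V\<close> that by blast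
    have "(\<Sum>t\<in>T. \<iota> (a t \<odot>\<^bsub>V\<^esub> t)) = (\<Sum>t\<in>T. sc (a t) (\<iota> t))"
      using embD(7)[OF e] \<open>T \<subseteq> carrier V\<close> by (intro sum.cong) auto
    then show ?thesis unfolding lincomb_def using emb_finsum[OF e that(1) m] by simp
  qed
  show ?thesis
  proof
    assume "fin_dim"
    then obtain T where T: "finite T" "T \<subseteq> carrier V" "span T = carrier V" by (auto simp: fin_dim_def)
    have "\<iota> v \<in> vs.span (\<iota> ` T)" if "v \<in> carrier V" for v
    proof -
      obtain a T' where "finite T'" "T' \<subseteq> T" "v = lincomb a T'" using \<open>v \<in> carrier V\<close>[folded T(3)] unfolding span_def by (elim CollectE exE conjE) (rule that)
      have "\<iota> v = (\<Sum>t\<in>T'. sc (a t) (\<iota> t))"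
        unfolding \<open>v = lincomb a T'\<close> using lc[OF \<open>finite T'\<close> order_trans[OF \<open>T' \<subseteq> T\<close> T(2)]] by (rule conjunct2)
      moreover have "(\<Sum>t\<in>T'. sc (a t) (\<iota> t)) \<in> vs.span (\<iota> ` T)"
        by (rule vs.span_sum, rule vs.span_scale, rule vs.span_base, rule imageI, rule subsetD[OF \<open>T' \<subseteq> T\<close>])
      ultimately show ?thesis by simp
    qed
    then show "\<exists>B. finite B \<and> \<iota> ` carrier V \<subseteq> vs.span B" using T(1) by blast
  next
    assume "\<exists>B. finite B \<and> \<iota> ` carrier V \<subseteq> vs.span B"
    then obtain B where B: "finite B" "\<iota> ` carrier V \<subseteq> vs.span B" by blast
    obtain C where C: "C \<subseteq> \<iota> ` carrier V" "vs.independent C" "\<iota> ` carrier V \<subseteq> vs.span C"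
      using vs.maximal_independent_subset[of "\<iota> ` carrier V"] by blast
    have finC: "finite C" using vs.independent_span_bound[OF B(1) C(2)] C(1) B(2) by auto
    let ?T = "inv_into (carrier V) \<iota> ` C"
    have T: "finite ?T" "?T \<subseteq> carrier V" using finC C(1) by (auto intro: inv_into_into)
    have inj: "inj_on (inv_into (carrier V) \<iota>) C" using C(1) by (rule inj_on_inv_into)
    have "v \<in> span ?T" if v: "v \<in> carrier V" for v
    proof -
      obtain u where u: "\<iota> v = (\<Sum>c\<in>C. sc (u c) c)" using C(3) v vs.span_finite[OF finC] by blast
      have "\<iota> (lincomb (u \<circ> \<iota>) ?T) = (\<Sum>c\<in>C. sc (u c) c)"
        using lc[OF T] inj C(1) by (simp add: sum.reindex f_inv_into_f subset_iff)
      then have "v = lincomb (u \<circ> \<iota>) ?T" using u v lc[OF T] by (intro embD(1)[OF e]) auto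
      then show ?thesis unfolding span_def using T(1) by (intro CollectI exI conjI) auto
    qed
    moreover have "span ?T \<subseteq> carrier V" by (rule span_is_subset2) (rule T(2))
    ultimately show "fin_dim" unfolding fin_dim_def using T by blast
  qed
qed

text \<open>A basis is obtained where it is available, in the free space \<open>U\<close> of
  finitely supported functions on the carrier. Evaluation of formal combinations maps
  \<open>U\<close> onto \<open>V\<close>, and any complement \<open>C\<close> of its kernel maps
  bijectively; the embedding is the inverse.\<close>

lemma emb_exists:
  fixes V :: "('v, 'b) gmod_scheme"
  assumes vs: "vectorspace (class_ring :: complex ring) V"
  shows "\<exists>\<iota> :: 'v \<Rightarrow> 'v cvec. emb V \<iota>"
proof -
  interpret V: vectorspace "class_ring :: complex ring" V by (rule vs)
  let ?supp = "\<lambda>f :: 'v cvec. {v. ev f v \<noteq> 0}"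
  define U where "U = {f :: 'v cvec. finite (?supp f) \<and> ?supp f \<subseteq> carrier V}"
  define val where "val f = (\<Oplus>\<^bsub>V\<^esub>v\<in>?supp f. ev f v \<odot>\<^bsub>V\<^esub> v)" for f
  have val_on: "val f = (\<Oplus>\<^bsub>V\<^esub>v\<in>T. ev f v \<odot>\<^bsub>V\<^esub> v)" if "finite T" "T \<subseteq> carrier V" "?supp f \<subseteq> T" for f T
    unfolding val_def using that by (intro V.M.add.finprod_mono_neutral_cong_left) (auto simp: V.lmult_0[simplified])
  have U_sub: "vs.subspace U"
  proof (rule vs.subspaceI)
    fix f g assume "f \<in> U" "g \<in> U"
    moreover have "?supp (f + g) \<subseteq> ?supp f \<union> ?supp g" by auto
    ultimately show "f + g \<in> U" by (auto simp: U_def intro: finite_subset)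
  next
    fix c f assume "f \<in> U"
    moreover have "?supp (sc c f) \<subseteq> ?supp f" by auto
    ultimately show "sc c f \<in> U" by (auto simp: U_def intro: finite_subset)
  qed (simp add: U_def)
  have val_in: "val f \<in> carrier V" if "f \<in> U" for f
    unfolding val_def using that by (intro V.M.finsum_closed) (auto simp: U_def)
  have val_add: "val (f + g) = val f \<oplus>\<^bsub>V\<^esub> val g" if "f \<in> U" "g \<in> U" for f g
  proof -
    let ?T = "?supp f \<union> ?supp g"
    have T: "finite ?T" "?T \<subseteq> carrier V" using that by (auto simp: U_def)
    have "val (f + g) = (\<Oplus>\<^bsub>V\<^esub>v\<in>?T. (ev f v \<odot>\<^bsub>V\<^esub> v) \<oplus>\<^bsub>V\<^esub> (ev g v \<odot>\<^bsub>V\<^esub> v))"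
      using T by (subst val_on[OF T]) (auto intro!: V.M.finsum_cong' simp: V.smult_l_distr[simplified])
    also have "\<dots> = val f \<oplus>\<^bsub>V\<^esub> val g"
      using T by (subst V.M.finsum_addf) (auto simp: val_on[OF T])
    finally show ?thesis .
  qed
  have val_sc: "val (sc c f) = c \<odot>\<^bsub>V\<^esub> val f" if "f \<in> U" for c f
  proof -
    let ?T = "?supp f"
    have T: "finite ?T" "?T \<subseteq> carrier V" using that by (auto simp: U_def)
    have "val (sc c f) = (\<Oplus>\<^bsub>V\<^esub>v\<in>?T. c \<odot>\<^bsub>V\<^esub> (ev f v \<odot>\<^bsub>V\<^esub> v))"
      using T by (subst val_on[OF T]) (auto intro!: V.M.finsum_cong' simp: V.smult_assoc1[simplified])
    also have "\<dots> = c \<odot>\<^bsub>V\<^esub> val f"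
      using T by (subst V.finsum_smult[symmetric]) (auto simp: val_on[OF T])
    finally show ?thesis .
  qed
  define K where "K = {f \<in> U. val f = \<zero>\<^bsub>V\<^esub>}"
  \<comment> \<open>A basis of the kernel is extended to a basis of \<open>U\<close>; the added
    vectors span the complement.\<close>
  obtain B where B: "B \<subseteq> K" "vs.independent B" "K \<subseteq> vs.span B" using vs.maximal_independent_subset[of K] by blast
  have "B \<subseteq> U" using B(1) by (auto simp: K_def)
  from vs.maximal_independent_subset_extend[OF this B(2)]
  obtain B' where B': "B \<subseteq> B'" "B' \<subseteq> U" "vs.independent B'" "U \<subseteq> vs.span B'" by blast
  define C where "C = vs.span (B' - B)"
  have C_sub: "vs.subspace C" unfolding C_def by (rule vs.subspace_span)
  have CU: "C \<subseteq> U" unfolding C_def using B' U_sub by (intro vs.span_minimal) auto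
  have spanK: "vs.span B \<subseteq> K"
  proof (rule vs.span_minimal[OF B(1)])
    show "vs.subspace K"
    proof (rule vs.subspaceI)
      show "0 \<in> K" using U_sub by (simp add: K_def vs.subspace_0 val_def)
    qed (use U_sub in \<open>auto simp: K_def vs.subspace_add vs.subspace_scale val_add val_sc\<close>)
  qed
  have val_inj: "f = g" if "f \<in> C" "g \<in> C" "val f = val g" for f g
  proof -
    have "f + sc (- 1) g \<in> C" by (intro vs.subspace_add[OF C_sub] vs.subspace_scale[OF C_sub] that)
    moreover have "val (f + sc (- 1) g) = \<zero>\<^bsub>V\<^esub>"
    proof -
      have fU: "f \<in> U" "g \<in> U" "sc (- 1) g \<in> U" using that CU vs.subspace_scale[OF U_sub] by blast+
      have "val (g + sc (- 1) g) = val g \<oplus>\<^bsub>V\<^esub> val (sc (- 1) g)" by (rule val_add[OF fU(2,3)])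
      moreover have "g + sc (- 1) g = sc 0 g" by (simp add: cvec_eq_iff)
      moreover have "val (sc 0 g) = \<zero>\<^bsub>V\<^esub>" by (simp add: val_def)
      ultimately show ?thesis using val_add[OF fU(1,3)] that(3) by simp
    qed
    ultimately have "f + sc (- 1) g \<in> vs.span (B' - B) \<inter> vs.span B"
      using CU B(3) by (auto simp: C_def K_def)
    moreover have "vs.span (B' - B) \<inter> vs.span B = {0}"
    proof -
      have "x = 0" if x: "x \<in> vs.span (B' - B)" "x \<in> vs.span B" for x
      proof -
        have r1: "\<forall>b. vs.representation B' x b \<noteq> 0 \<longrightarrow> b \<in> B' - B"
          using vs.representation_extend[OF B'(3) x(1)] vs.representation_ne_zero by (metis Diff_subset)
        have r2: "\<forall>b. vs.representation B' x b \<noteq> 0 \<longrightarrow> b \<in> B"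
          using vs.representation_extend[OF B'(3) x(2) B'(1)] vs.representation_ne_zero by metis
        have xs: "x \<in> vs.span B'" using x(2) vs.span_mono[OF B'(1)] by blast
        have "x = (\<Sum>b | vs.representation B' x b \<noteq> 0. sc (vs.representation B' x b) b)"
          using vs.sum_nonzero_representation_eq[OF B'(3) xs] by simp
        also have "{b. vs.representation B' x b \<noteq> 0} = {}" using r1 r2 by blast
        finally show "x = 0" by simp
      qed
      then show ?thesis using vs.span_zero by blast
    qed
    ultimately have "f + sc (- 1) g = 0" by blast
    then show "f = g" by (simp add: cvec_eq_iff)
  qed
  have val_surj: "\<exists>f\<in>C. val f = v" if v: "v \<in> carrier V" for v
  proof -
    let ?\<delta> = "Cvec (\<lambda>w. if w = v then 1 else 0)"
    have ev: "ev ?\<delta> w = (if w = v then 1 else 0)" for w by (simp add: Cvec_inverse)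
    have U: "?\<delta> \<in> U" using v by (simp add: U_def ev)
    have "val ?\<delta> = v" using v by (subst val_on[of "{v}"]) (auto simp: ev V.smult_one[simplified])
    have "?\<delta> \<in> vs.span ((B' - B) \<union> B)" using U B'(1,4) by (simp add: Un_absorb2 subset_iff)
    then obtain f k where fk: "?\<delta> = f + k" "f \<in> vs.span (B' - B)" "k \<in> vs.span B" unfolding vs.span_Un by auto
    have f: "f \<in> C" "f \<in> U" using fk(2) CU by (auto simp: C_def)
    have k: "k \<in> U" "val k = \<zero>\<^bsub>V\<^esub>" using fk(3) spanK by (auto simp: K_def)
    have "v = val f" using \<open>val ?\<delta> = v\<close> val_add[OF f(2) k(1)] val_in[OF f(2)] fk(1) k(2) by simp
    then show ?thesis using f(1) by blast
  qed
  define \<iota> where "\<iota> v = (SOME f. f \<in> C \<and> val f = v)" for v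
  have \<iota>: "\<iota> v \<in> C" "val (\<iota> v) = v" if "v \<in> carrier V" for v
    using someI_ex[of "\<lambda>f. f \<in> C \<and> val f = v"] val_surj[OF that] unfolding \<iota>_def by blast+
  have \<iota>_eq: "\<iota> v = f" if "f \<in> C" "val f = v" for f v
  proof -
    have "v \<in> carrier V" using that CU val_in by blast
    then show ?thesis using \<iota> that by (intro val_inj) auto
  qed
  have "emb V \<iota>"
    unfolding emb_def
  proof (intro conjI ballI allI)
    show "inj_on \<iota> (carrier V)" using \<iota>(2) by (metis inj_onI)
    show "\<iota> \<zero>\<^bsub>V\<^esub> = 0"
    proof (rule \<iota>_eq)
      show "0 \<in> C" using C_sub by (rule vs.subspace_0)
      show "val 0 = \<zero>\<^bsub>V\<^esub>" by (simp add: val_def)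
    qed
    fix v w assume v: "v \<in> carrier V" and w: "w \<in> carrier V"
    show "\<iota> (v \<oplus>\<^bsub>V\<^esub> w) = \<iota> v + \<iota> w"
      using \<iota>[OF v] \<iota>[OF w] C_sub CU by (intro \<iota>_eq) (auto simp: vs.subspace_add val_add subset_iff)
  next
    fix c v assume v: "v \<in> carrier V"
    show "\<iota> (c \<odot>\<^bsub>V\<^esub> v) = sc c (\<iota> v)"
      using \<iota>[OF v] C_sub CU by (intro \<iota>_eq) (auto simp: vs.subspace_scale val_sc subset_iff)
  qed auto
  then show ?thesis by blast
qed

lemma emb_subspace_iff:
  assumes e: "emb V \<iota>"
  shows "VectorSpace.subspace (class_ring :: complex ring) N V \<longleftrightarrow> N \<subseteq> carrier V \<and> vs.subspace (\<iota> ` N)"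
proof
  assume "VectorSpace.subspace (class_ring :: complex ring) N V"
  then have s: "submodule (class_ring :: complex ring) N V" unfolding VectorSpace.subspace_def by blast
  have N: "N \<subseteq> carrier V" by (rule submodule.subset[OF s])
  have "vs.subspace (\<iota> ` N)"
  proof (rule vs.subspaceI)
    show "0 \<in> \<iota> ` N" using submodule.zero_closed[OF s] embD(3)[OF e] by (metis imageI)
    fix x assume "x \<in> \<iota> ` N"
    then obtain v where v: "v \<in> N" "x = \<iota> v" by blast
    then have vV: "v \<in> carrier V" using N by blast
    show "sc c x \<in> \<iota> ` N" for c
      using submodule.smult_closed[OF s _ v(1), of c] embD(7)[OF e vV, of c] v(2) by (metis UNIV_I class_ring_simps(1) imageI)
    fix y assume "y \<in> \<iota> ` N"
    then obtain w where w: "w \<in> N" "y = \<iota> w" by blast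
    then have wV: "w \<in> carrier V" using N by blast
    show "x + y \<in> \<iota> ` N"
      using submodule.m_closed[OF s v(1) w(1)] embD(5)[OF e vV wV] v(2) w(2) by (metis imageI)
  qed
  then show "N \<subseteq> carrier V \<and> vs.subspace (\<iota> ` N)" using N by blast
next
  assume "N \<subseteq> carrier V \<and> vs.subspace (\<iota> ` N)"
  then have N: "N \<subseteq> carrier V" and s: "vs.subspace (\<iota> ` N)" by blast+
  have "emb (V\<lparr>carrier := N\<rparr>) \<iota>" by (rule emb_carrier_update[OF e N s]) simp_all
  note D = embD[OF this, simplified]
  interpret vectorspace "class_ring :: complex ring" V by (rule emb_vectorspace[OF e])
  show "VectorSpace.subspace (class_ring :: complex ring) N V"
    by (intro VectorSpace.subspace.intro vectorspace_axioms submodule.intro module_axioms) (use N D in auto)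
qed

lemma emb_fin_dim_update:
  assumes e: "emb V \<iota>" and N: "N \<subseteq> carrier V" "vs.subspace (\<iota> ` N)"
  shows "vectorspace.fin_dim (class_ring :: complex ring) (V\<lparr>carrier := N\<rparr>) \<longleftrightarrow> (\<exists>B. finite B \<and> \<iota> ` N \<subseteq> vs.span B)"
  using emb_fin_dim[OF emb_carrier_update[OF e N], of "V\<lparr>carrier := N\<rparr>"] by simp

section \<open>Quotients\<close>

locale emb_quotient =
  fixes V :: "'v gmod" and \<iota> :: "'v \<Rightarrow> 'x cvec" and N :: "'v set"
  assumes e: "emb V \<iota>" and N_sub: "N \<subseteq> carrier V" and N_vs: "vs.subspace (\<iota> ` N)"
begin

abbreviation cos :: "'v \<Rightarrow> 'v set" where "cos v \<equiv> N +>\<^bsub>V\<^esub> v"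

lemma coset_mem:
  assumes v: "v \<in> carrier V"
  shows "x \<in> cos v \<longleftrightarrow> x \<in> carrier V \<and> \<iota> x - \<iota> v \<in> \<iota> ` N"
proof
  assume "x \<in> cos v"
  then obtain h where h: "h \<in> N" "x = h \<oplus>\<^bsub>V\<^esub> v" by (auto simp: a_r_coset_def')
  then have hV: "h \<in> carrier V" using N_sub by blast
  show "x \<in> carrier V \<and> \<iota> x - \<iota> v \<in> \<iota> ` N" using h embD(4,5)[OF e hV v] by auto
next
  assume x: "x \<in> carrier V \<and> \<iota> x - \<iota> v \<in> \<iota> ` N"
  then obtain h where h: "h \<in> N" "\<iota> x - \<iota> v = \<iota> h" by blast
  then have hV: "h \<in> carrier V" using N_sub by blast
  have "\<iota> x = \<iota> (h \<oplus>\<^bsub>V\<^esub> v)" using embD(5)[OF e hV v] h(2) by (simp add: algebra_simps)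
  then have "x = h \<oplus>\<^bsub>V\<^esub> v" using embD(1)[OF e _ embD(4)[OF e hV v]] x by blast
  then show "x \<in> cos v" using h(1) by (auto simp: a_r_coset_def')
qed

lemma coset_eq:
  assumes v: "v \<in> carrier V" and w: "w \<in> carrier V"
  shows "cos v = cos w \<longleftrightarrow> \<iota> v - \<iota> w \<in> \<iota> ` N"
proof
  have "v \<in> cos v" using coset_mem[OF v] v vs.subspace_0[OF N_vs] by simp
  moreover assume "cos v = cos w"
  ultimately show "\<iota> v - \<iota> w \<in> \<iota> ` N" using coset_mem[OF w] by blast
next
  assume d: "\<iota> v - \<iota> w \<in> \<iota> ` N"
  have "\<iota> x - \<iota> v \<in> \<iota> ` N \<longleftrightarrow> \<iota> x - \<iota> w \<in> \<iota> ` N" for x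
    using vs.subspace_add[OF N_vs d, of "\<iota> x - \<iota> v"] vs.subspace_diff[OF N_vs _ d, of "\<iota> x - \<iota> w"]
    by (auto simp: algebra_simps)
  then show "cos v = cos w" using coset_mem[OF v] coset_mem[OF w] by blast
qed

lemma coset_self: "v \<in> carrier V \<Longrightarrow> v \<in> cos v"
  using coset_mem[of v v] vs.subspace_0[OF N_vs] by simp

lemma coset_zero: "cos \<zero>\<^bsub>V\<^esub> = N"
proof -
  have "x \<in> cos \<zero>\<^bsub>V\<^esub> \<longleftrightarrow> x \<in> N" for x
    using coset_mem[OF embD(2)[OF e], of x] embD(3)[OF e] N_sub embD(1)[OF e, of x] by auto
  then show ?thesis by blast
qed

lemma coset_add:
  assumes v: "v \<in> carrier V" and w: "w \<in> carrier V"
  shows "cos v <+>\<^bsub>V\<^esub> cos w = cos (v \<oplus>\<^bsub>V\<^esub> w)"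
proof
  note vw = embD(4,5)[OF e v w]
  show "cos v <+>\<^bsub>V\<^esub> cos w \<subseteq> cos (v \<oplus>\<^bsub>V\<^esub> w)"
  proof
    fix x assume "x \<in> cos v <+>\<^bsub>V\<^esub> cos w"
    then obtain h k where hk: "h \<in> cos v" "k \<in> cos w" "x = h \<oplus>\<^bsub>V\<^esub> k" by (auto simp: set_add_def')
    then have h: "h \<in> carrier V" "\<iota> h - \<iota> v \<in> \<iota> ` N" and k: "k \<in> carrier V" "\<iota> k - \<iota> w \<in> \<iota> ` N"
      using coset_mem v w by blast+
    have "(\<iota> h - \<iota> v) + (\<iota> k - \<iota> w) \<in> \<iota> ` N" by (rule vs.subspace_add[OF N_vs h(2) k(2)])
    then have "\<iota> x - \<iota> (v \<oplus>\<^bsub>V\<^esub> w) \<in> \<iota> ` N" using vw(2) embD(5)[OF e h(1) k(1)] hk(3) by (simp add: algebra_simps)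
    then show "x \<in> cos (v \<oplus>\<^bsub>V\<^esub> w)" using coset_mem[OF vw(1)] embD(4)[OF e h(1) k(1)] hk(3) by blast
  qed
  show "cos (v \<oplus>\<^bsub>V\<^esub> w) \<subseteq> cos v <+>\<^bsub>V\<^esub> cos w"
  proof
    fix x assume "x \<in> cos (v \<oplus>\<^bsub>V\<^esub> w)"
    then have x: "x \<in> carrier V" "\<iota> x - \<iota> (v \<oplus>\<^bsub>V\<^esub> w) \<in> \<iota> ` N" using coset_mem[OF vw(1)] by blast+
    then obtain h where h: "h \<in> N" "\<iota> x - \<iota> (v \<oplus>\<^bsub>V\<^esub> w) = \<iota> h" by blast
    then have hV: "h \<in> carrier V" using N_sub by blast
    have hv: "h \<oplus>\<^bsub>V\<^esub> v \<in> carrier V" "\<iota> (h \<oplus>\<^bsub>V\<^esub> v) = \<iota> h + \<iota> v" by (rule embD(4)[OF e hV v], rule embD(5)[OF e hV v])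
    have "\<iota> x = \<iota> ((h \<oplus>\<^bsub>V\<^esub> v) \<oplus>\<^bsub>V\<^esub> w)"
      using h(2) vw(2) hv(2) embD(5)[OF e hv(1) w] by (simp add: algebra_simps)
    then have "x = (h \<oplus>\<^bsub>V\<^esub> v) \<oplus>\<^bsub>V\<^esub> w" using embD(1)[OF e x(1) embD(4)[OF e hv(1) w]] by blast
    moreover have "h \<oplus>\<^bsub>V\<^esub> v \<in> cos v" using h(1) by (auto simp: a_r_coset_def')
    ultimately show "x \<in> cos v <+>\<^bsub>V\<^esub> cos w" using coset_self[OF w] by (auto simp: set_add_def')
  qed
qed

text \<open>The operations of \<open>quotient_gmod\<close> are unions over all representatives of a
  coset. Compatibility with \<open>N\<close> makes the members of the union equal, so it collapses
  to a single coset.\<close>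

lemma coset_map:
  assumes v: "v \<in> carrier V" and f: "\<And>w. w \<in> carrier V \<Longrightarrow> f w \<in> carrier V"
    and c: "\<And>w. w \<in> carrier V \<Longrightarrow> \<iota> w - \<iota> v \<in> \<iota> ` N \<Longrightarrow> \<iota> (f w) - \<iota> (f v) \<in> \<iota> ` N"
  shows "(\<Union>w\<in>cos v. cos (f w)) = cos (f v)"
proof -
  have "cos (f w) = cos (f v)" if "w \<in> cos v" for w
    using that coset_eq[of "f w" "f v"] coset_mem[OF v] f v c by blast
  then show ?thesis using coset_self[OF v] by blast
qed

lemma quotient_carrier: "carrier (quotient_gmod V N) = cos ` carrier V"
  by (auto simp: quotient_gmod_def A_RCOSETS_def')

lemma quotient_zero: "\<zero>\<^bsub>quotient_gmod V N\<^esub> = cos \<zero>\<^bsub>V\<^esub>"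
  by (simp add: quotient_gmod_def coset_zero)

lemma quotient_add: "v \<in> carrier V \<Longrightarrow> w \<in> carrier V \<Longrightarrow> cos v \<oplus>\<^bsub>quotient_gmod V N\<^esub> cos w = cos (v \<oplus>\<^bsub>V\<^esub> w)"
  by (simp add: quotient_gmod_def coset_add)

lemma quotient_smult:
  assumes v: "v \<in> carrier V" shows "c \<odot>\<^bsub>quotient_gmod V N\<^esub> cos v = cos (c \<odot>\<^bsub>V\<^esub> v)"
proof -
  have "(\<Union>w\<in>cos v. cos (c \<odot>\<^bsub>V\<^esub> w)) = cos (c \<odot>\<^bsub>V\<^esub> v)"
  proof (rule coset_map[OF v embD(6)[OF e]])
    fix w assume w: "w \<in> carrier V" "\<iota> w - \<iota> v \<in> \<iota> ` N"
    have "sc c (\<iota> w - \<iota> v) \<in> \<iota> ` N" by (rule vs.subspace_scale[OF N_vs w(2)])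
    then show "\<iota> (c \<odot>\<^bsub>V\<^esub> w) - \<iota> (c \<odot>\<^bsub>V\<^esub> v) \<in> \<iota> ` N"
      using embD(7)[OF e w(1)] embD(7)[OF e v] by (simp add: vs.scale_right_diff_distrib)
  qed
  then show ?thesis by (simp add: quotient_gmod_def)
qed

lemma quotient_act:
  assumes v: "v \<in> carrier V" and c: "\<And>w. w \<in> carrier V \<Longrightarrow> act V x s w \<in> carrier V"
    "\<And>w. w \<in> carrier V \<Longrightarrow> \<iota> w - \<iota> v \<in> \<iota> ` N \<Longrightarrow> \<iota> (act V x s w) - \<iota> (act V x s v) \<in> \<iota> ` N"
  shows "act (quotient_gmod V N) x s (cos v) = cos (act V x s v)"
  using coset_map[of v "act V x s", OF v c] by (simp add: quotient_gmod_def)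

lemma quotient_grd: "grd (quotient_gmod V N) d = cos ` grd V d"
  by (simp add: quotient_gmod_def)

end

text \<open>Both modules are seen in one function space, with equal images and the same operators
  \<open>T\<close>; one embedding followed by the inverse of the other is the isomorphism. Degrees
  are compared in the direction of the map, as in \<open>degree0_hom\<close>.\<close>

lemma emb_iso:
  assumes Q: "emb Q a" and W: "emb W b" and im: "a ` carrier Q = b ` carrier W"
    and aQ: "\<And>x s C. x \<in> sl n \<Longrightarrow> C \<in> carrier Q \<Longrightarrow> act Q x s C \<in> carrier Q \<and> a (act Q x s C) = T x s (a C)"
    and aW: "\<And>x s g. x \<in> sl n \<Longrightarrow> g \<in> carrier W \<Longrightarrow> act W x s g \<in> carrier W \<and> b (act W x s g) = T x s (b g)"
    and gQ: "\<And>d. grd Q d \<subseteq> carrier Q"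
    and gW: "\<And>d C g. C \<in> grd Q d \<Longrightarrow> g \<in> carrier W \<Longrightarrow> b g = a C \<Longrightarrow> g \<in> grd W d"
  shows "gmod_iso n Q W"
proof -
  let ?\<theta> = "\<lambda>C. inv_into (carrier W) b (a C)"
  have \<theta>: "?\<theta> C \<in> carrier W" "b (?\<theta> C) = a C" if "C \<in> carrier Q" for C
  proof -
    have "a C \<in> b ` carrier W" using im that by blast
    then show "?\<theta> C \<in> carrier W" "b (?\<theta> C) = a C" by (rule inv_into_into, rule f_inv_into_f)
  qed
  have \<theta>_eq: "?\<theta> C = g" if "C \<in> carrier Q" "g \<in> carrier W" "a C = b g" for C g
    using embD(1)[OF W \<theta>(1)[OF that(1)] that(2)] \<theta>(2)[OF that(1)] that(3) by simp
  have lin: "linear_map (class_ring :: complex ring) Q W ?\<theta>"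
  proof (rule linear_map.intro[OF emb_vectorspace[OF Q] emb_vectorspace[OF W]])
    show "mod_hom (class_ring :: complex ring) Q W ?\<theta>"
    proof (intro mod_hom.intro mod_hom_axioms.intro)
      show "Module.module (class_ring :: complex ring) Q" using emb_vectorspace[OF Q] by (rule vectorspace.axioms)
      show "Module.module (class_ring :: complex ring) W" using emb_vectorspace[OF W] by (rule vectorspace.axioms)
      show "?\<theta> \<in> LinearCombinations.module_hom (class_ring :: complex ring) Q W"
        unfolding LinearCombinations.module_hom_def mem_Collect_eq
      proof (intro conjI allI impI)
        show "?\<theta> \<in> carrier Q \<rightarrow> carrier W" using \<theta>(1) by blast
        fix C D assume "C \<in> carrier Q \<and> D \<in> carrier Q"
        then have C: "C \<in> carrier Q" and D: "D \<in> carrier Q" by blast+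
        show "?\<theta> (C \<oplus>\<^bsub>Q\<^esub> D) = ?\<theta> C \<oplus>\<^bsub>W\<^esub> ?\<theta> D"
          using embD(5)[OF Q C D] embD(5)[OF W \<theta>(1)[OF C] \<theta>(1)[OF D]] \<theta>(2)[OF C] \<theta>(2)[OF D]
          by (intro \<theta>_eq embD(4)[OF Q C D] embD(4)[OF W \<theta>(1)[OF C] \<theta>(1)[OF D]]) simp
      next
        fix c C assume "c \<in> carrier (class_ring :: complex ring) \<and> C \<in> carrier Q"
        then have C: "C \<in> carrier Q" by blast
        show "?\<theta> (c \<odot>\<^bsub>Q\<^esub> C) = c \<odot>\<^bsub>W\<^esub> ?\<theta> C"
          using embD(7)[OF Q C] embD(7)[OF W \<theta>(1)[OF C]] \<theta>(2)[OF C]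
          by (intro \<theta>_eq embD(6)[OF Q C] embD(6)[OF W \<theta>(1)[OF C]]) simp
      qed
    qed
  qed
  have act: "?\<theta> (act Q x s C) = act W x s (?\<theta> C)" if "x \<in> sl n" "C \<in> carrier Q" for x s C
    using aQ[OF that] aW[OF that(1) \<theta>(1)[OF that(2)]] \<theta>(2)[OF that(2)] by (intro \<theta>_eq) auto
  have "?\<theta> ` grd Q d \<subseteq> grd W d" for d
  proof
    fix g assume "g \<in> ?\<theta> ` grd Q d"
    then obtain C where C: "C \<in> grd Q d" "g = ?\<theta> C" by blast
    then have CQ: "C \<in> carrier Q" using gQ by blast
    show "g \<in> grd W d" using gW[OF C(1) \<theta>(1)[OF CQ] \<theta>(2)[OF CQ]] C(2) by simp
  qed
  then have "degree0_hom n Q W ?\<theta>" unfolding degree0_hom_def using lin act by blast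
  moreover have "bij_betw ?\<theta> (carrier Q) (carrier W)"
  proof (rule bij_betw_imageI)
    show "inj_on ?\<theta> (carrier Q)"
    proof (rule inj_onI)
      fix C D assume CD: "C \<in> carrier Q" "D \<in> carrier Q" and eq: "?\<theta> C = ?\<theta> D"
      have "a C = a D" using \<theta>(2)[OF CD(1)] \<theta>(2)[OF CD(2)] unfolding eq by (rule box_equals[OF refl])
      then show "C = D" by (rule embD(1)[OF Q CD])
    qed
    show "?\<theta> ` carrier Q = carrier W"
    proof
      show "carrier W \<subseteq> ?\<theta> ` carrier Q"
      proof
        fix g assume g: "g \<in> carrier W"
        then obtain C where "C \<in> carrier Q" "a C = b g" using im by (metis imageE imageI)
        then show "g \<in> ?\<theta> ` carrier Q" using \<theta>_eq[of C g] g by blast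
      qed
    qed (use \<theta>(1) in blast)
  qed
  ultimately show ?thesis unfolding gmod_iso_def by blast
qed

section \<open>Dual global Weyl modules as spaces of functions on words\<close>

text \<open>The pairing of functions on words with formal combinations of words; it makes functions
  on words into functionals on the free word module.\<close>

definition pev :: "(current_word \<Rightarrow> complex) \<Rightarrow> (current_word \<Rightarrow>\<^sub>0 complex) \<Rightarrow> complex" where
  "pev g p = (\<Sum>u\<in>Poly_Mapping.keys p. Poly_Mapping.lookup p u * g u)"

lemma pev_superset: "finite T \<Longrightarrow> Poly_Mapping.keys p \<subseteq> T \<Longrightarrow> pev g p = (\<Sum>u\<in>T. Poly_Mapping.lookup p u * g u)"
  unfolding pev_def by (intro sum.mono_neutral_left) (auto simp: in_keys_iff)

lemma pev_add: "pev g (p + q) = pev g p + pev g q"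
proof -
  let ?T = "Poly_Mapping.keys p \<union> Poly_Mapping.keys q"
  have T: "finite ?T" by simp
  show ?thesis
    using pev_superset[OF T keys_add, of g] pev_superset[OF T, of p g] pev_superset[OF T, of q g]
    by (simp add: lookup_add distrib_right sum.distrib)
qed

lemma pev_single: "pev g (Poly_Mapping.single u c) = c * g u"
  by (simp add: pev_def)

lemma pev_zero: "pev g 0 = 0"
  by (simp add: pev_def)

lemma pev_sum: "pev g (\<Sum>t\<in>T. f t) = (\<Sum>t\<in>T. pev g (f t))"
  by (induction T rule: infinite_finite_induct) (simp_all add: pev_add pev_zero)

lemma pev_diff: "pev g (p - q) = pev g p - pev g q"
  using pev_add[of g "p - q" q] by simp

lemma lookup_scale: "Poly_Mapping.lookup (Poly_Mapping.map ((*) (c :: complex)) p) u = c * Poly_Mapping.lookup p u"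
  by (simp add: Poly_Mapping.map.rep_eq when_def)

lemma keys_scale: "Poly_Mapping.keys (Poly_Mapping.map ((*) (c :: complex)) p) \<subseteq> Poly_Mapping.keys p"
  by (auto simp: in_keys_iff lookup_scale)

lemma pev_scale: "pev g (Poly_Mapping.map ((*) c) p) = c * pev g p"
proof -
  have "pev g (Poly_Mapping.map ((*) c) p) = (\<Sum>u\<in>Poly_Mapping.keys p. Poly_Mapping.lookup (Poly_Mapping.map ((*) c) p) u * g u)"
    by (rule pev_superset[OF finite_keys keys_scale])
  also have "\<dots> = c * pev g p" unfolding pev_def sum_distrib_left lookup_scale mult.assoc ..
  finally show ?thesis .
qed

lemma pev_fun: "pev (\<lambda>u. f u + g u) p = pev f p + pev g p" "pev (\<lambda>u. c * f u) p = c * pev f p"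
  unfolding pev_def sum_distrib_left sum.distrib[symmetric] by (auto intro!: sum.cong simp: distrib_left)

definition pre :: "complex mat \<Rightarrow> nat \<Rightarrow> (current_word \<Rightarrow>\<^sub>0 complex) \<Rightarrow> current_word \<Rightarrow>\<^sub>0 complex" where
  "pre x s f = (\<Sum>u\<in>Poly_Mapping.keys f. Poly_Mapping.single ((x, s) # u) (Poly_Mapping.lookup f u))"

lemma pev_pre: "pev g (pre x s p) = - pev (word_act x s g) p"
  unfolding pre_def pev_sum pev_single by (simp add: pev_def word_act_def sum_negf)

lemma lookup_pre: "Poly_Mapping.lookup (pre x s p) v = (if v \<noteq> [] \<and> hd v = (x, s) then Poly_Mapping.lookup p (tl v) else 0)"
proof -
  have "Poly_Mapping.lookup (pre x s p) v = (\<Sum>u\<in>Poly_Mapping.keys p. if (x, s) # u = v then Poly_Mapping.lookup p u else 0)"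
    by (simp add: pre_def lookup_sum lookup_single when_def)
  also have "\<dots> = (if v \<noteq> [] \<and> hd v = (x, s) then Poly_Mapping.lookup p (tl v) else 0)"
  proof (cases "v \<noteq> [] \<and> hd v = (x, s)")
    case True
    then obtain w where v: "v = (x, s) # w" by (cases v) auto
    show ?thesis using True unfolding v by (auto simp: sum.delta in_keys_iff)
  next
    case False
    then have "(x, s) # u \<noteq> v" for u by auto
    then show ?thesis using False by auto
  qed
  finally show ?thesis .
qed

lemma pre_add: "pre x s (p + q) = pre x s p + pre x s q"
  by (rule poly_mapping_eqI) (simp add: lookup_pre lookup_add)

lemma pre_single: "pre x s (Poly_Mapping.single u c) = Poly_Mapping.single ((x, s) # u) c"
  by (simp add: pre_def)

lemma pre_keys: "Poly_Mapping.keys (pre x s p) \<subseteq> (#) (x, s) ` Poly_Mapping.keys p"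
proof
  fix v assume "v \<in> Poly_Mapping.keys (pre x s p)"
  then have "Poly_Mapping.lookup (pre x s p) v \<noteq> 0" by (simp add: in_keys_iff)
  then have "v \<noteq> [] \<and> hd v = (x, s) \<and> tl v \<in> Poly_Mapping.keys p"
    unfolding lookup_pre by (auto simp: in_keys_iff split: if_splits)
  then show "v \<in> (#) (x, s) ` Poly_Mapping.keys p" by (metis image_eqI list.collapse)
qed

lemma word_nabla_add:
  assumes f: "f \<in> word_nabla n \<mu>" and g: "g \<in> word_nabla n \<mu>"
  shows "(\<lambda>u. f u + g u) \<in> word_nabla n \<mu>"
  using word_nabla_diff[OF f word_nabla_diff[OF zf_nabla g]] by simp

lemma word_nabla_scale:
  assumes f: "f \<in> word_nabla n \<mu>" shows "(\<lambda>u. c * f u) \<in> word_nabla n \<mu>"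
proof -
  have "wdeg ` {u. c * f u \<noteq> 0} \<subseteq> wdeg ` {u. f u \<noteq> 0}" by auto
  moreover have "(\<lambda>u. c * f u) \<in> word_functionals n m" if f: "f \<in> word_functionals n m" for m
    unfolding word_functionals_def mem_Collect_eq
    by (intro conjI allI ballI impI)
      (simp_all only: word_functionalsD[OF f] algebra_simps simp_thms mult_zero_right mult_zero_left)
  ultimately show ?thesis using f unfolding word_nabla_def by (auto intro: finite_subset)
qed

lemma word_nabla_act:
  assumes g: "g \<in> word_nabla n \<mu>" and x: "x \<in> sl n" shows "word_act x s g \<in> word_nabla n \<mu>"
proof -
  have "(+) s ` wdeg ` {u. word_act x s g u \<noteq> 0} \<subseteq> wdeg ` {u. g u \<noteq> 0}"
  proof
    fix d assume "d \<in> (+) s ` wdeg ` {u. word_act x s g u \<noteq> 0}"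
    then obtain u where "g ((x, s) # u) \<noteq> 0" "d = s + wdeg u" by (auto simp: word_act_def)
    then show "d \<in> wdeg ` {u. g u \<noteq> 0}" by (intro image_eqI[of _ _ "(x, s) # u"]) (auto simp: wdeg_def)
  qed
  moreover have "finite (wdeg ` {u. g u \<noteq> 0})" using g unfolding word_nabla_def by blast
  ultimately have "finite ((+) s ` wdeg ` {u. word_act x s g u \<noteq> 0})" by (rule finite_subset)
  then have "finite (wdeg ` {u. word_act x s g u \<noteq> 0})" by (rule finite_imageD) simp
  then show ?thesis using g word_act_functional[OF _ x] by (auto simp: word_nabla_def)
qed

section \<open>The relations of a global Weyl module\<close>

context
  fixes n :: nat and m :: weight and r :: int
begin

abbreviation "FW \<equiv> free_word_module n r"
abbreviation "RS \<equiv> relation_submodule n m r"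
abbreviation "pc p \<equiv> Cvec (Poly_Mapping.lookup p)"

lemma FW_simps:
  "carrier FW = {f. Poly_Mapping.keys f \<subseteq> words n}" "\<zero>\<^bsub>FW\<^esub> = 0" "(\<oplus>\<^bsub>FW\<^esub>) = (+)" "c \<odot>\<^bsub>FW\<^esub> p = Poly_Mapping.map ((*) c) p"
  "act FW x s p = pre x s p"
  by (simp_all add: free_word_module_def pre_def)

lemma FW_emb: "emb FW pc"
  unfolding emb_def FW_simps
proof (intro conjI ballI allI)
  show "inj_on pc {f. Poly_Mapping.keys f \<subseteq> words n}"
    by (rule inj_onI) (auto simp: cvec_eq_iff Cvec_inverse intro: poly_mapping_eqI)
  show "(0 :: current_word \<Rightarrow>\<^sub>0 complex) \<in> {f. Poly_Mapping.keys f \<subseteq> words n}" by simp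
  show "pc 0 = 0" by (simp add: cvec_eq_iff Cvec_inverse)
  fix p :: "current_word \<Rightarrow>\<^sub>0 complex" assume p: "p \<in> {f. Poly_Mapping.keys f \<subseteq> words n}"
  show "Poly_Mapping.map ((*) c) p \<in> {f. Poly_Mapping.keys f \<subseteq> words n}" for c
    using p keys_scale[of c p] by blast
  show "pc (Poly_Mapping.map ((*) c) p) = sc c (pc p)" for c
    by (simp add: cvec_eq_iff Cvec_inverse lookup_scale)
  fix q :: "current_word \<Rightarrow>\<^sub>0 complex" assume q: "q \<in> {f. Poly_Mapping.keys f \<subseteq> words n}"
  show "p + q \<in> {f. Poly_Mapping.keys f \<subseteq> words n}" using p q keys_add[of p q] by blast
  show "pc (p + q) = pc p + pc q" by (simp add: cvec_eq_iff Cvec_inverse lookup_add)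
qed

lemma FW_act: "x \<in> sl n \<Longrightarrow> p \<in> carrier FW \<Longrightarrow> pre x s p \<in> carrier FW"
  using pre_keys[of x s p] unfolding FW_simps by fastforce

lemma FW_single: "u \<in> words n \<Longrightarrow> Poly_Mapping.single u c \<in> carrier FW"
  by (simp add: FW_simps)

definition weyl_family :: "(current_word \<Rightarrow>\<^sub>0 complex) set set" where
  "weyl_family = {K. VectorSpace.subspace (class_ring :: complex ring) K FW \<and>
     (\<forall>x\<in>sl n. \<forall>s. \<forall>f\<in>K. act FW x s f \<in> K) \<and> weyl_relations n m \<subseteq> K}"

lemma RS_Inter: "RS = \<Inter> weyl_family"
  by (simp add: relation_submodule_def weyl_family_def)

text \<open>The common kernel of all word functionals is one of the submodules intersected in
  \<open>relation_submodule\<close>. Hence word functionals descend to the global Weyl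
  module.\<close>

lemma functional_kernel:
  "{p \<in> carrier FW. \<forall>g\<in>word_functionals n m. pev g p = 0} \<in> weyl_family" (is "?K \<in> _")
proof -
  have "vs.subspace (pc ` ?K)"
  proof (rule vs.subspaceI)
    have "0 \<in> ?K" by (simp add: FW_simps pev_zero)
    then show "0 \<in> pc ` ?K" by (rule image_eqI[rotated]) (simp add: embD(3)[OF FW_emb, unfolded FW_simps(2)])
    fix y z assume "y \<in> pc ` ?K" "z \<in> pc ` ?K"
    then obtain p q where pq: "p \<in> ?K" "q \<in> ?K" "y = pc p" "z = pc q" by blast
    then have "p + q \<in> ?K" using embD(4)[OF FW_emb, of p q] by (simp add: FW_simps pev_add)
    then show "y + z \<in> pc ` ?K" by (rule image_eqI[rotated]) (use embD(5)[OF FW_emb, of p q] pq in \<open>simp add: FW_simps(3)\<close>)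
  next
    fix c y assume "y \<in> pc ` ?K"
    then obtain p where p: "p \<in> ?K" "y = pc p" by blast
    then have "Poly_Mapping.map ((*) c) p \<in> ?K" using embD(6)[OF FW_emb, of p c] by (simp add: FW_simps pev_scale)
    then show "sc c y \<in> pc ` ?K" by (rule image_eqI[rotated]) (use embD(7)[OF FW_emb, of p c] p in \<open>simp add: FW_simps(4)\<close>)
  qed
  then have "VectorSpace.subspace (class_ring :: complex ring) ?K FW"
    using emb_subspace_iff[OF FW_emb] by blast
  moreover have "act FW x s p \<in> ?K" if "x \<in> sl n" "p \<in> ?K" for x s p
    using that FW_act[of x p s] word_act_functional by (simp add: FW_simps(5) pev_pre)
  moreover have "p \<in> ?K" if "p \<in> weyl_relations n m" for p
  proof -
    have car: "p - q \<in> carrier FW" if "p \<in> carrier FW" "q \<in> carrier FW" for p q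
      using that keys_diff[of p q] unfolding FW_simps by blast
    have e0: "[] \<in> words n" by simp
    note D = word_functionalsD' and car' = car embD(4)[OF FW_emb, unfolded FW_simps(3)] FW_single
    show ?thesis
      using that unfolding weyl_relations_def Let_def Un_iff
    proof (elim disjE)
      assume "p \<in> {Poly_Mapping.single ((x + y, s) # u) 1 - Poly_Mapping.single ((x, s) # u) 1 - Poly_Mapping.single ((y, s) # u) 1 | x y s u.
        x \<in> sl n \<and> y \<in> sl n \<and> u \<in> words n}"
      then obtain x y s u where p: "p = Poly_Mapping.single ((x + y, s) # u) 1 - Poly_Mapping.single ((x, s) # u) 1 - Poly_Mapping.single ((y, s) # u) 1"
        "x \<in> sl n" "y \<in> sl n" "u \<in> words n" by blast
      show ?thesis unfolding p(1) mem_Collect_eq pev_diff pev_single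
      proof (intro conjI ballI car' )
        show "(x + y, s) # u \<in> words n" "(x, s) # u \<in> words n" "(y, s) # u \<in> words n" using p sl_add by auto
      next
        fix g assume "g \<in> word_functionals n m"
        from D(1)[OF this p(4,2,3), where s = s]
        show "1 * g ((x + y, s) # u) - 1 * g ((x, s) # u) - 1 * g ((y, s) # u) = 0" by simp
      qed
    next
      assume "p \<in> {Poly_Mapping.single ((c \<cdot>\<^sub>m x, s) # u) 1 - Poly_Mapping.single ((x, s) # u) c | c x s u. x \<in> sl n \<and> u \<in> words n}"
      then obtain c x s u where p: "p = Poly_Mapping.single ((c \<cdot>\<^sub>m x, s) # u) 1 - Poly_Mapping.single ((x, s) # u) c"
        "x \<in> sl n" "u \<in> words n" by blast
      show ?thesis unfolding p(1) mem_Collect_eq pev_diff pev_single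
      proof (intro conjI ballI car')
        show "(c \<cdot>\<^sub>m x, s) # u \<in> words n" "(x, s) # u \<in> words n" using p sl_smult by auto
      next
        fix g assume "g \<in> word_functionals n m"
        from D(2)[OF this p(3,2), where s = s and c = c]
        show "1 * g ((c \<cdot>\<^sub>m x, s) # u) - c * g ((x, s) # u) = 0" by simp
      qed
    next
      assume "p \<in> {Poly_Mapping.single ((bracket x y, r + s) # u) 1 - Poly_Mapping.single ((x, r) # (y, s) # u) 1 +
        Poly_Mapping.single ((y, s) # (x, r) # u) 1 | x y r s u. x \<in> sl n \<and> y \<in> sl n \<and> u \<in> words n}"
      then obtain x y r s u where p: "p = Poly_Mapping.single ((bracket x y, r + s) # u) 1 - Poly_Mapping.single ((x, r) # (y, s) # u) 1 +
        Poly_Mapping.single ((y, s) # (x, r) # u) 1" "x \<in> sl n" "y \<in> sl n" "u \<in> words n" by blast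
      show ?thesis unfolding p(1) mem_Collect_eq pev_diff pev_single pev_add
      proof (intro conjI ballI car')
        show "(bracket x y, r + s) # u \<in> words n" "(x, r) # (y, s) # u \<in> words n" "(y, s) # (x, r) # u \<in> words n"
          using p bracket_sl by auto
      next
        fix g assume "g \<in> word_functionals n m"
        from D(3)[OF this p(4,2,3), where s = s and r = r]
        show "1 * g ((bracket x y, r + s) # u) - 1 * g ((x, r) # (y, s) # u) + 1 * g ((y, s) # (x, r) # u) = 0" by simp
      qed
    next
      assume "p \<in> {Poly_Mapping.single [(x, s)] 1 | x s. x \<in> n_pos n}"
      then obtain x s where p: "p = Poly_Mapping.single [(x, s)] 1" "x \<in> n_pos n" by blast
      show ?thesis unfolding p(1) mem_Collect_eq pev_single
      proof (intro conjI ballI FW_single)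
        show "[(x, s)] \<in> words n" using n_pos_upper[OF p(2)] by simp
      next
        fix g assume "g \<in> word_functionals n m"
        from D(4)[OF this p(2), where s = s]
        show "1 * g [(x, s)] = 0" by simp
      qed
    next
      assume "p \<in> {Poly_Mapping.single (replicate (k + 1) (x_neg n i, 0)) 1 | i k. i \<in> {1..n} \<and> m (coroot n i) = of_nat k}"
      then obtain i k where p: "p = Poly_Mapping.single (replicate (k + 1) (x_neg n i, 0)) 1" "i \<in> {1..n}" "m (coroot n i) = of_nat k" by blast
      show ?thesis unfolding p(1) mem_Collect_eq pev_single
      proof (intro conjI ballI FW_single)
        show "replicate (k + 1) (x_neg n i, 0) \<in> words n" using x_neg_sl[OF p(2)] by (auto simp: lists_eq_set)
        fix g assume "g \<in> word_functionals n m"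
        then show "1 * g (replicate (k + 1) (x_neg n i, 0)) = 0" using word_functionalsD(6)[of g n m "[]" i k] e0 p(2,3) by (simp del: One_nat_def)
      qed
    next
      assume "p \<in> {Poly_Mapping.single [(h, 0)] 1 - Poly_Mapping.single [] (m h) | h. h \<in> cartan n}"
      then obtain h where p: "p = Poly_Mapping.single [(h, 0)] 1 - Poly_Mapping.single [] (m h)" "h \<in> cartan n" by blast
      show ?thesis unfolding p(1) mem_Collect_eq pev_single pev_diff
      proof (intro conjI ballI car')
        show "[(h, 0)] \<in> words n" using cartan_sl[OF p(2)] by simp
      next
        fix g assume "g \<in> word_functionals n m"
        from D(5)[OF this p(2)]
        show "1 * g [(h, 0)] - m h * g [] = 0" by simp
      qed simp_all
    qed
  qed
  ultimately show ?thesis unfolding weyl_family_def by blast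
qed

lemma RS_functional: "p \<in> RS \<Longrightarrow> p \<in> carrier FW \<and> (\<forall>g\<in>word_functionals n m. pev g p = 0)"
  using functional_kernel unfolding RS_Inter by blast

lemma RS_sub: "RS \<subseteq> carrier FW"
  using RS_functional by blast

text \<open>Images under an injection commute with intersections of subsets of the carrier; the
  family is not empty by \<open>functional_kernel\<close>.\<close>

lemma RS_subspace: "vs.subspace (pc ` RS)"
proof -
  have K: "K \<subseteq> carrier FW" "vs.subspace (pc ` K)" if "K \<in> weyl_family" for K
    using that emb_subspace_iff[OF FW_emb] unfolding weyl_family_def by blast+
  obtain K0 where K0: "K0 \<in> weyl_family" using functional_kernel by blast
  have "pc ` RS = (\<Inter>K\<in>weyl_family. pc ` K)"
  proof
    show "(\<Inter>K\<in>weyl_family. pc ` K) \<subseteq> pc ` RS"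
    proof
      fix y assume y: "y \<in> (\<Inter>K\<in>weyl_family. pc ` K)"
      then obtain p where p: "p \<in> K0" "y = pc p" using K0 by blast
      have "p \<in> K" if k: "K \<in> weyl_family" for K
      proof -
        obtain q where q: "q \<in> K" "y = pc q" using y k by blast
        then have "p = q" using embD(1)[OF FW_emb] p K(1)[OF k] K(1)[OF K0] by blast
        then show ?thesis using q by simp
      qed
      then show "y \<in> pc ` RS" unfolding RS_Inter using p(2) by blast
    qed
  qed (auto simp: RS_Inter)
  then show ?thesis using K(2) by (auto intro: vs.subspace_Inter)
qed

lemma RS_act: "x \<in> sl n \<Longrightarrow> p \<in> RS \<Longrightarrow> pre x s p \<in> RS"
  unfolding RS_Inter weyl_family_def FW_simps(5) by blast

lemma RS_relations: "weyl_relations n m \<subseteq> RS"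
  unfolding RS_Inter weyl_family_def by blast

text \<open>Each type of relation has at most three terms, so one statement serves all of them;
  shorter relations are padded with zero coefficients. Prefixing letters is the module
  action.\<close>

lemma RS_prefix:
  assumes "Poly_Mapping.single a \<alpha> + Poly_Mapping.single b \<beta> + Poly_Mapping.single c \<gamma> \<in> RS" and "w \<in> words n"
  shows "Poly_Mapping.single (w @ a) \<alpha> + Poly_Mapping.single (w @ b) \<beta> + Poly_Mapping.single (w @ c) \<gamma> \<in> RS"
  using assms(2)
proof (induction w rule: list.induct)
  case (Cons l w)
  obtain x s where l: "l = (x, s)" by (cases l)
  then have x: "x \<in> sl n" "w \<in> words n" using Cons.prems by auto
  show ?case using RS_act[OF x(1) Cons.IH[OF x(2)], of s] unfolding pre_add pre_single l by simp
qed (use assms(1) in simp)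

end

context
  fixes n :: nat and m :: weight and r :: int
begin

abbreviation "GW \<equiv> global_weyl n m r"
abbreviation "cs p \<equiv> RS n m r +>\<^bsub>FW n r\<^esub> p"
abbreviation "DW \<equiv> dual_gmod GW"
abbreviation "finite_functionals \<equiv> {g \<in> word_functionals n m. finite (wdeg ` {u. g u \<noteq> 0})}"

interpretation Q: emb_quotient "FW n r" "\<lambda>p. Cvec (Poly_Mapping.lookup p)" "RS n m r"
  by (rule emb_quotient.intro[OF FW_emb RS_sub RS_subspace])

lemma FW_car: "p \<in> carrier (FW n r) \<longleftrightarrow> Poly_Mapping.keys p \<subseteq> words n"
  by (simp add: FW_simps)

lemma GW_carrier: "carrier GW = cs ` carrier (FW n r)"
  unfolding global_weyl_def by (rule Q.quotient_carrier)

lemma GW_in: "p \<in> carrier (FW n r) \<Longrightarrow> cs p \<in> carrier GW"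
  unfolding GW_carrier by blast

lemma cs_eq:
  assumes p: "p \<in> carrier (FW n r)" and q: "q \<in> carrier (FW n r)"
  shows "cs p = cs q \<longleftrightarrow> p - q \<in> RS n m r"
proof -
  have "Cvec (Poly_Mapping.lookup p) - Cvec (Poly_Mapping.lookup q) = Cvec (Poly_Mapping.lookup h) \<longleftrightarrow> p - q = h" for h :: "current_word \<Rightarrow>\<^sub>0 complex"
    by (auto simp: cvec_eq_iff Cvec_inverse lookup_minus[symmetric] poly_mapping_eq_iff fun_eq_iff)
  then show ?thesis unfolding Q.coset_eq[OF p q] image_iff by simp
qed

lemma cs_pev:
  assumes g: "g \<in> word_functionals n m" and p: "p \<in> carrier (FW n r)" and q: "q \<in> carrier (FW n r)" and eq: "cs p = cs q"
  shows "pev g p = pev g q"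
proof -
  have "pev g (p - q) = 0" using RS_functional eq g unfolding cs_eq[OF p q] by blast
  then show ?thesis by (simp add: pev_diff)
qed

lemma cs_add: "p \<in> carrier (FW n r) \<Longrightarrow> q \<in> carrier (FW n r) \<Longrightarrow> cs p \<oplus>\<^bsub>GW\<^esub> cs q = cs (p + q)"
  using Q.quotient_add[of p q] by (simp add: global_weyl_def FW_simps)

lemma cs_smult: "p \<in> carrier (FW n r) \<Longrightarrow> c \<odot>\<^bsub>GW\<^esub> cs p = cs (Poly_Mapping.map ((*) c) p)"
  using Q.quotient_smult[of p c] by (simp add: global_weyl_def FW_simps)

lemma cs_act:
  assumes x: "x \<in> sl n" and p: "p \<in> carrier (FW n r)"
  shows "act GW x s (cs p) = cs (pre x s p)"
proof -
  have "act (quotient_gmod (FW n r) (RS n m r)) x s (cs p) = cs (act (FW n r) x s p)"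
  proof (rule Q.quotient_act[OF p])
    show c: "act (FW n r) x s q \<in> carrier (FW n r)" if "q \<in> carrier (FW n r)" for q
      using FW_act[OF x that] by (simp only: FW_simps(5))
    fix q assume q: "q \<in> carrier (FW n r)"
      and d: "Cvec (Poly_Mapping.lookup q) - Cvec (Poly_Mapping.lookup p) \<in> (\<lambda>p. Cvec (Poly_Mapping.lookup p)) ` RS n m r"
    have "q - p \<in> RS n m r" using d Q.coset_eq[OF q p] cs_eq[OF q p] by blast
    then have "pre x s (q - p) \<in> RS n m r" by (rule RS_act[OF x])
    moreover have "pre x s q = pre x s (q - p) + pre x s p" unfolding pre_add[symmetric] by simp
    ultimately have "pre x s q - pre x s p \<in> RS n m r" by simp
    then have "cs (pre x s q) = cs (pre x s p)" using cs_eq[OF FW_act[OF x q] FW_act[OF x p]] by blast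
    then have "cs (act (FW n r) x s q) = cs (act (FW n r) x s p)" by (simp only: FW_simps(5))
    then show "Cvec (Poly_Mapping.lookup (act (FW n r) x s q)) - Cvec (Poly_Mapping.lookup (act (FW n r) x s p)) \<in> (\<lambda>p. Cvec (Poly_Mapping.lookup p)) ` RS n m r"
      by (rule iffD1[OF Q.coset_eq[OF c[OF q] c[OF p]]])
  qed
  then show ?thesis by (simp only: global_weyl_def FW_simps(5))
qed

lemma GW_grd: "grd GW d = cs ` {p. \<forall>u\<in>Poly_Mapping.keys p. u \<in> words n \<and> d = r + int (wdeg u)}"
  unfolding global_weyl_def Q.quotient_grd by (simp add: free_word_module_def wdeg_def)

text \<open>Any representative will do, because \<open>RS\<close> lies in the kernel of every word
  functional.\<close>

definition word_to_dual :: "(current_word \<Rightarrow> complex) \<Rightarrow> nabla_carrier" where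
  "word_to_dual g = (\<lambda>C\<in>carrier GW. pev g (SOME p. p \<in> carrier (FW n r) \<and> C = cs p))"

definition dual_to_word :: "nabla_carrier \<Rightarrow> current_word \<Rightarrow> complex" where
  "dual_to_word f u = (if u \<in> words n then f (cs (Poly_Mapping.single u 1)) else 0)"

lemma word_to_dual_cs:
  assumes g: "g \<in> word_functionals n m" and p: "p \<in> carrier (FW n r)"
  shows "word_to_dual g (cs p) = pev g p"
proof -
  let ?q = "SOME q. q \<in> carrier (FW n r) \<and> cs p = cs q"
  have "?q \<in> carrier (FW n r) \<and> cs p = cs ?q" by (rule someI[of _ p]) (simp add: p)
  then have "pev g ?q = pev g p" using cs_pev[OF g p, of ?q] by metis
  then show ?thesis using GW_in[OF p] by (simp add: word_to_dual_def)
qed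

lemma DW_carrier: "carrier DW = {f \<in> extensional (carrier GW).
    (\<forall>v\<in>carrier GW. \<forall>w\<in>carrier GW. f (v \<oplus>\<^bsub>GW\<^esub> w) = f v + f w) \<and> (\<forall>c. \<forall>v\<in>carrier GW. f (c \<odot>\<^bsub>GW\<^esub> v) = c * f v) \<and>
    finite {d. \<exists>v\<in>grd GW d. f v \<noteq> 0}}"
  by (simp add: dual_gmod_def Let_def)

lemma word_to_dual_in:
  assumes g: "g \<in> finite_functionals"
  shows "word_to_dual g \<in> carrier DW"
proof -
  have gw: "g \<in> word_functionals n m" using g by blast
  note E = word_to_dual_cs[OF gw]
  have sc: "Poly_Mapping.map ((*) c) p \<in> carrier (FW n r)" if "p \<in> carrier (FW n r)" for c p
    using that keys_scale[of c p] by (auto simp: FW_car)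
  have ad: "p + q \<in> carrier (FW n r)" if "p \<in> carrier (FW n r)" "q \<in> carrier (FW n r)" for p q
    using that keys_add[of p q] by (auto simp: FW_car)
  have "{d. \<exists>v\<in>grd GW d. word_to_dual g v \<noteq> 0} \<subseteq> (\<lambda>k. r + int k) ` wdeg ` {u. g u \<noteq> 0}"
  proof
    fix d assume "d \<in> {d. \<exists>v\<in>grd GW d. word_to_dual g v \<noteq> 0}"
    then obtain p where p: "\<forall>u\<in>Poly_Mapping.keys p. u \<in> words n \<and> d = r + int (wdeg u)" "word_to_dual g (cs p) \<noteq> 0"
      unfolding GW_grd by blast
    then have "p \<in> carrier (FW n r)" by (auto simp: FW_car)
    then have "pev g p \<noteq> 0" using p(2) E by simp
    then obtain u where "u \<in> Poly_Mapping.keys p" "g u \<noteq> 0"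
      unfolding pev_def by (metis (no_types, lifting) mult_eq_0_iff sum.neutral)
    then show "d \<in> (\<lambda>k. r + int k) ` wdeg ` {u. g u \<noteq> 0}" using p(1) by blast
  qed
  moreover have "finite ((\<lambda>k. r + int k) ` wdeg ` {u. g u \<noteq> 0})" using g by blast
  ultimately have "finite {d. \<exists>v\<in>grd GW d. word_to_dual g v \<noteq> 0}" by (rule finite_subset)
  moreover have "word_to_dual g (v \<oplus>\<^bsub>GW\<^esub> w) = word_to_dual g v + word_to_dual g w" if "v \<in> carrier GW" "w \<in> carrier GW" for v w
    using that ad unfolding GW_carrier by (auto simp: cs_add E pev_add)
  moreover have "word_to_dual g (c \<odot>\<^bsub>GW\<^esub> v) = c * word_to_dual g v" if "v \<in> carrier GW" for c v
    using that sc unfolding GW_carrier by (auto simp: cs_smult E pev_scale)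
  ultimately show ?thesis unfolding DW_carrier by (simp add: word_to_dual_def)
qed

lemma dual_linear:
  assumes f: "f \<in> carrier DW"
  shows "p \<in> carrier (FW n r) \<Longrightarrow> q \<in> carrier (FW n r) \<Longrightarrow> f (cs (p + q)) = f (cs p) + f (cs q)"
    and "p \<in> carrier (FW n r) \<Longrightarrow> f (cs (Poly_Mapping.map ((*) c) p)) = c * f (cs p)"
    and "f (cs 0) = 0"
proof -
  show ad: "f (cs (p + q)) = f (cs p) + f (cs q)" if "p \<in> carrier (FW n r)" "q \<in> carrier (FW n r)" for p q
  proof -
    have "f (cs p \<oplus>\<^bsub>GW\<^esub> cs q) = f (cs p) + f (cs q)" using f GW_in[OF that(1)] GW_in[OF that(2)] unfolding DW_carrier by blast
    then show ?thesis by (simp only: cs_add[OF that])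
  qed
  show "f (cs (Poly_Mapping.map ((*) c) p)) = c * f (cs p)" if "p \<in> carrier (FW n r)" for p
  proof -
    have "f (c \<odot>\<^bsub>GW\<^esub> cs p) = c * f (cs p)" using f GW_in[OF that] unfolding DW_carrier by blast
    then show ?thesis by (simp only: cs_smult[OF that])
  qed
  show "f (cs 0) = 0" using ad[of 0 0] by (simp add: FW_car)
qed

lemma dual_single:
  assumes f: "f \<in> carrier DW" and u: "u \<in> words n"
  shows "f (cs (Poly_Mapping.single u c)) = c * dual_to_word f u"
proof -
  have "Poly_Mapping.single u c = Poly_Mapping.map ((*) c) (Poly_Mapping.single u 1)"
    by (rule poly_mapping_eqI) (simp add: lookup_scale lookup_single when_def)
  then show ?thesis using dual_linear(2)[OF f, of "Poly_Mapping.single u 1" c] u by (simp add: FW_car dual_to_word_def)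
qed

lemma dual_pev:
  assumes f: "f \<in> carrier DW" and p: "p \<in> carrier (FW n r)"
  shows "f (cs p) = pev (dual_to_word f) p"
proof -
  have "f (cs (\<Sum>u\<in>T. Poly_Mapping.single u (a u))) = (\<Sum>u\<in>T. a u * dual_to_word f u) \<and> (\<Sum>u\<in>T. Poly_Mapping.single u (a u)) \<in> carrier (FW n r)"
    if "finite T" "T \<subseteq> words n" for T a
    using that
  proof (induction T)
    case empty
    then show ?case using dual_linear(3)[OF f] by (simp add: FW_car)
  next
    case (insert u T)
    then have u: "u \<in> words n" and su: "Poly_Mapping.single u (a u) \<in> carrier (FW n r)" by (auto simp: FW_car)
    let ?R = "\<Sum>u\<in>T. Poly_Mapping.single u (a u)"
    have R: "?R \<in> carrier (FW n r)" "f (cs ?R) = (\<Sum>u\<in>T. a u * dual_to_word f u)" using insert by auto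
    have "Poly_Mapping.single u (a u) + ?R \<in> carrier (FW n r)" using R(1) su keys_add[of "Poly_Mapping.single u (a u)" ?R] unfolding FW_car by blast
    moreover have "f (cs (Poly_Mapping.single u (a u) + ?R)) = a u * dual_to_word f u + f (cs ?R)"
      using dual_linear(1)[OF f su R(1)] dual_single[OF f u] by simp
    ultimately show ?case using insert(1,2) R(2) by simp
  qed
  from this[of "Poly_Mapping.keys p" "Poly_Mapping.lookup p"]
  have "f (cs (\<Sum>u\<in>Poly_Mapping.keys p. Poly_Mapping.single u (Poly_Mapping.lookup p u))) = pev (dual_to_word f) p"
    using p by (simp add: FW_car pev_def)
  moreover have "(\<Sum>u\<in>Poly_Mapping.keys p. Poly_Mapping.single u (Poly_Mapping.lookup p u)) = p"
    by (rule poly_mapping_eqI) (simp add: lookup_sum lookup_single when_def in_keys_iff)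
  ultimately show ?thesis by simp
qed

lemma dual_relation:
  assumes f: "f \<in> carrier DW"
    and R: "Poly_Mapping.single a \<alpha> + Poly_Mapping.single b \<beta> + Poly_Mapping.single c \<gamma> \<in> RS n m r"
    and w: "w \<in> words n" and abc: "a \<in> words n" "b \<in> words n" "c \<in> words n"
  shows "\<alpha> * dual_to_word f (w @ a) + \<beta> * dual_to_word f (w @ b) + \<gamma> * dual_to_word f (w @ c) = 0"
proof -
  let ?p = "Poly_Mapping.single (w @ a) \<alpha> + Poly_Mapping.single (w @ b) \<beta> + Poly_Mapping.single (w @ c) \<gamma>"
  have p: "?p \<in> RS n m r" by (rule RS_prefix[OF R w])
  then have pc: "?p \<in> carrier (FW n r)" using RS_sub by blast
  have "cs ?p = cs 0" using cs_eq[OF pc, of 0] p by (simp add: FW_car)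
  then have "f (cs ?p) = 0" using dual_linear(3)[OF f] by simp
  then show ?thesis unfolding dual_pev[OF f pc] by (simp add: pev_add pev_single)
qed

text \<open>Each condition on word functionals is the vanishing of a linear functional on a prefixed
  relation; finiteness of degrees transfers because the word \<open>u\<close> sits in degree
  \<open>r + int (wdeg u)\<close>.\<close>

lemma dual_to_word_functional:
  assumes f: "f \<in> carrier DW"
  shows "dual_to_word f \<in> finite_functionals"
proof -
  let ?g = "dual_to_word f" and ?e = "\<lambda>u. Poly_Mapping.single u (1 :: complex)"
  note rel = subsetD[OF RS_relations, unfolded weyl_relations_def Let_def]
  note R = dual_relation[OF f]
  have e0: "[] \<in> words n" by simp
  have wf: "?g \<in> word_functionals n m"
    unfolding word_functionals_def mem_Collect_eq
  proof (intro conjI allI ballI impI)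
    fix w u x y s assume h: "w \<in> words n" "u \<in> words n" "x \<in> sl n" "y \<in> sl n"
    have "?e ((x + y, s) # u) - ?e ((x, s) # u) - ?e ((y, s) # u) \<in> RS n m r" by (rule rel) (use h in blast)
    then have "Poly_Mapping.single ((x + y, s) # u) 1 + Poly_Mapping.single ((x, s) # u) (- 1) + Poly_Mapping.single ((y, s) # u) (- 1) \<in> RS n m r"
      by (simp add: single_uminus)
    from R[OF this h(1)] show "?g (w @ (x + y, s) # u) = ?g (w @ (x, s) # u) + ?g (w @ (y, s) # u)"
      using h sl_add by (simp add: algebra_simps)
  next
    fix w u c x s assume h: "w \<in> words n" "u \<in> words n" "x \<in> sl n"
    have "?e ((c \<cdot>\<^sub>m x, s) # u) - Poly_Mapping.single ((x, s) # u) c \<in> RS n m r" by (rule rel) (use h in blast)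
    then have "Poly_Mapping.single ((c \<cdot>\<^sub>m x, s) # u) 1 + Poly_Mapping.single ((x, s) # u) (- c) + Poly_Mapping.single [] 0 \<in> RS n m r"
      by (simp add: single_uminus)
    from R[OF this h(1)] show "?g (w @ (c \<cdot>\<^sub>m x, s) # u) = c * ?g (w @ (x, s) # u)"
      using h sl_smult by (simp add: algebra_simps)
  next
    fix w u x y a s assume h: "w \<in> words n" "u \<in> words n" "x \<in> sl n" "y \<in> sl n"
    have "?e ((bracket x y, a + s) # u) - ?e ((x, a) # (y, s) # u) + ?e ((y, s) # (x, a) # u) \<in> RS n m r" by (rule rel) (use h in blast)
    then have "Poly_Mapping.single ((bracket x y, a + s) # u) 1 + Poly_Mapping.single ((x, a) # (y, s) # u) (- 1) + Poly_Mapping.single ((y, s) # (x, a) # u) 1 \<in> RS n m r"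
      by (simp add: single_uminus)
    from R[OF this h(1)] show "?g (w @ (bracket x y, a + s) # u) = ?g (w @ (x, a) # (y, s) # u) - ?g (w @ (y, s) # (x, a) # u)"
      using h bracket_sl by (simp add: algebra_simps)
  next
    fix w x s assume h: "w \<in> words n" "x \<in> n_pos n"
    have "?e [(x, s)] \<in> RS n m r" by (rule rel) (use h in blast)
    then have "Poly_Mapping.single [(x, s)] 1 + Poly_Mapping.single [] 0 + Poly_Mapping.single [] 0 \<in> RS n m r" by simp
    from R[OF this h(1)] show "?g (w @ [(x, s)]) = 0" using n_pos_upper[OF h(2)] by simp
  next
    fix w i k assume h: "w \<in> words n" "i \<in> {1..n}" "m (coroot n i) = of_nat k"
    have "?e (replicate (k + 1) (x_neg n i, 0)) \<in> RS n m r" by (rule rel) (use h in blast)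
    then have "Poly_Mapping.single (replicate (k + 1) (x_neg n i, 0)) 1 + Poly_Mapping.single [] 0 + Poly_Mapping.single [] 0 \<in> RS n m r" by simp
    moreover have "replicate (k + 1) (x_neg n i, 0) \<in> words n" using x_neg_sl[OF h(2)] by (auto simp: lists_eq_set)
    ultimately show "?g (w @ replicate (k + 1) (x_neg n i, 0)) = 0" using R[OF _ h(1) _ e0 e0] by fastforce
  next
    fix w h assume h: "w \<in> words n" "h \<in> cartan n"
    have "?e [(h, 0)] - Poly_Mapping.single [] (m h) \<in> RS n m r" by (rule rel) (use h in blast)
    then have "Poly_Mapping.single [(h, 0)] 1 + Poly_Mapping.single [] (- m h) + Poly_Mapping.single [] 0 \<in> RS n m r"
      by (simp add: single_uminus)
    from R[OF this h(1)] show "?g (w @ [(h, 0)]) = m h * ?g w"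
      using cartan_sl[OF h(2)] by (simp add: algebra_simps)
  qed (simp add: dual_to_word_def)
  have "(\<lambda>k. r + int k) ` wdeg ` {u. ?g u \<noteq> 0} \<subseteq> {d. \<exists>v\<in>grd GW d. f v \<noteq> 0}"
  proof safe
    fix u assume "?g u \<noteq> 0"
    then have u: "u \<in> words n" "f (cs (?e u)) \<noteq> 0" by (auto simp: dual_to_word_def split: if_splits)
    then have "cs (?e u) \<in> grd GW (r + int (wdeg u))" unfolding GW_grd by (intro imageI) simp
    then show "\<exists>v\<in>grd GW (r + int (wdeg u)). f v \<noteq> 0" using u(2) by blast
  qed
  moreover have "finite {d. \<exists>v\<in>grd GW d. f v \<noteq> 0}" using f unfolding DW_carrier by blast
  ultimately have "finite ((\<lambda>k. r + int k) ` wdeg ` {u. ?g u \<noteq> 0})" by (rule finite_subset)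
  then have "finite (wdeg ` {u. ?g u \<noteq> 0})" by (rule finite_imageD) (simp add: inj_on_def)
  then show ?thesis using wf by blast
qed

text \<open>Closure of the dual under an operation and the formula for the result follow together,
  once the values on representatives are known. All operations below are treated this way.\<close>

lemma dual_eqI:
  assumes h: "h \<in> extensional (carrier GW)" and g: "g \<in> finite_functionals"
    and eq: "\<And>p. p \<in> carrier (FW n r) \<Longrightarrow> h (cs p) = pev g p"
  shows "h \<in> carrier DW \<and> dual_to_word h = g"
proof -
  have gw: "g \<in> word_functionals n m" using g by blast
  have "h = word_to_dual g"
  proof (rule extensionalityI[OF h])
    show "word_to_dual g \<in> extensional (carrier GW)" by (simp add: word_to_dual_def)
    fix C assume "C \<in> carrier GW"
    then obtain p where "p \<in> carrier (FW n r)" "C = cs p" unfolding GW_carrier by blast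
    then show "h C = word_to_dual g C" using eq word_to_dual_cs[OF gw] by simp
  qed
  then have "h \<in> carrier DW" using word_to_dual_in[OF g] by simp
  moreover have "dual_to_word h u = g u" for u
    using eq[of "Poly_Mapping.single u 1"] word_functionalsD(1)[OF gw, of u]
    by (auto simp: dual_to_word_def FW_car pev_single)
  ultimately show ?thesis by auto
qed

lemma dual_ext: "f \<in> carrier DW \<Longrightarrow> f \<in> extensional (carrier GW)"
  unfolding DW_carrier by blast

lemma dual_inj:
  assumes "f \<in> carrier DW" "f' \<in> carrier DW" "dual_to_word f = dual_to_word f'" shows "f = f'"
proof (rule extensionalityI[OF dual_ext[OF assms(1)] dual_ext[OF assms(2)]])
  fix C assume "C \<in> carrier GW"
  then obtain p where p: "p \<in> carrier (FW n r)" "C = cs p" unfolding GW_carrier by blast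
  show "f C = f' C" unfolding p(2) using dual_pev[OF assms(1) p(1)] dual_pev[OF assms(2) p(1)] assms(3) by simp
qed

lemma dual_surj:
  assumes g: "g \<in> finite_functionals" shows "\<exists>f\<in>carrier DW. dual_to_word f = g"
  using dual_eqI[OF _ g, of "word_to_dual g"] word_to_dual_cs[of g] g
  by (intro bexI[of _ "word_to_dual g"]) (auto simp: word_to_dual_def)

lemma dual_add:
  assumes f: "f \<in> carrier DW" and f': "f' \<in> carrier DW"
    and g: "(\<lambda>u. dual_to_word f u + dual_to_word f' u) \<in> finite_functionals"
  shows "f \<oplus>\<^bsub>DW\<^esub> f' \<in> carrier DW \<and> dual_to_word (f \<oplus>\<^bsub>DW\<^esub> f') = (\<lambda>u. dual_to_word f u + dual_to_word f' u)"
proof (rule dual_eqI[OF _ g])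
  have eq: "f \<oplus>\<^bsub>DW\<^esub> f' = (\<lambda>v\<in>carrier GW. f v + f' v)" by (simp add: dual_gmod_def Let_def)
  show "f \<oplus>\<^bsub>DW\<^esub> f' \<in> extensional (carrier GW)" unfolding eq by simp
  fix p assume p: "p \<in> carrier (FW n r)"
  show "(f \<oplus>\<^bsub>DW\<^esub> f') (cs p) = pev (\<lambda>u. dual_to_word f u + dual_to_word f' u) p"
    unfolding eq using GW_in[OF p] by (simp add: pev_fun dual_pev[OF f p] dual_pev[OF f' p])
qed

lemma dual_smult:
  assumes f: "f \<in> carrier DW" and g: "(\<lambda>u. c * dual_to_word f u) \<in> finite_functionals"
  shows "c \<odot>\<^bsub>DW\<^esub> f \<in> carrier DW \<and> dual_to_word (c \<odot>\<^bsub>DW\<^esub> f) = (\<lambda>u. c * dual_to_word f u)"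
proof (rule dual_eqI[OF _ g])
  have eq: "c \<odot>\<^bsub>DW\<^esub> f = (\<lambda>v\<in>carrier GW. c * f v)" by (simp add: dual_gmod_def Let_def)
  show "c \<odot>\<^bsub>DW\<^esub> f \<in> extensional (carrier GW)" unfolding eq by simp
  fix p assume p: "p \<in> carrier (FW n r)"
  show "(c \<odot>\<^bsub>DW\<^esub> f) (cs p) = pev (\<lambda>u. c * dual_to_word f u) p"
    unfolding eq using GW_in[OF p] by (simp add: pev_fun dual_pev[OF f p])
qed

lemma dual_zero:
  assumes g: "zf \<in> finite_functionals"
  shows "\<zero>\<^bsub>DW\<^esub> \<in> carrier DW \<and> dual_to_word \<zero>\<^bsub>DW\<^esub> = zf"
proof (rule dual_eqI[OF _ g])
  have eq: "\<zero>\<^bsub>DW\<^esub> = (\<lambda>v\<in>carrier GW. 0)" by (simp add: dual_gmod_def Let_def)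
  show "\<zero>\<^bsub>DW\<^esub> \<in> extensional (carrier GW)" unfolding eq by simp
  fix p assume p: "p \<in> carrier (FW n r)"
  show "\<zero>\<^bsub>DW\<^esub> (cs p) = pev zf p" unfolding eq using GW_in[OF p] by (simp add: pev_def)
qed

lemma dual_act:
  assumes x: "x \<in> sl n" and f: "f \<in> carrier DW" and g: "word_act x s (dual_to_word f) \<in> finite_functionals"
  shows "act DW x s f \<in> carrier DW \<and> dual_to_word (act DW x s f) = word_act x s (dual_to_word f)"
proof (rule dual_eqI[OF _ g])
  have eq: "act DW x s f = (\<lambda>v\<in>carrier GW. - f (act GW x s v))" by (simp add: dual_gmod_def Let_def)
  show "act DW x s f \<in> extensional (carrier GW)" unfolding eq by simp
  fix p assume p: "p \<in> carrier (FW n r)"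
  show "act DW x s f (cs p) = pev (word_act x s (dual_to_word f)) p"
    unfolding eq using GW_in[OF p] by (simp add: cs_act[OF x p] dual_pev[OF f FW_act[OF x p]] pev_pre)
qed

text \<open>Degree \<open>d\<close> of the dual pairs with degree \<open>- d\<close>, and the word
  \<open>u\<close> has degree \<open>r + int (wdeg u)\<close>. For \<open>nabla\<close> the
  generator has degree \<open>- r\<close>, which yields the condition
  \<open>int (wdeg u) = r - d\<close>.\<close>

lemma dual_grd:
  assumes f: "f \<in> carrier DW"
  shows "f \<in> grd DW d \<longleftrightarrow> (\<forall>u. dual_to_word f u \<noteq> 0 \<longrightarrow> int (wdeg u) = - r - d)"
proof -
  have eq: "f \<in> grd DW d \<longleftrightarrow> (\<forall>e. e \<noteq> - d \<longrightarrow> (\<forall>v\<in>grd GW e. f v = 0))"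
    using f by (simp add: dual_gmod_def Let_def)
  show ?thesis
  proof
    assume h: "f \<in> grd DW d"
    show "\<forall>u. dual_to_word f u \<noteq> 0 \<longrightarrow> int (wdeg u) = - r - d"
    proof (intro allI impI, rule ccontr)
      fix u assume u: "dual_to_word f u \<noteq> 0" "int (wdeg u) \<noteq> - r - d"
      then have uw: "u \<in> words n" "f (cs (Poly_Mapping.single u 1)) \<noteq> 0" by (auto simp: dual_to_word_def split: if_splits)
      then have "cs (Poly_Mapping.single u 1) \<in> grd GW (r + int (wdeg u))" unfolding GW_grd by (intro imageI) simp
      moreover have "r + int (wdeg u) \<noteq> - d" using u(2) by simp
      ultimately show False using h uw(2) unfolding eq by blast
    qed
  next
    assume h: "\<forall>u. dual_to_word f u \<noteq> 0 \<longrightarrow> int (wdeg u) = - r - d"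
    show "f \<in> grd DW d"
      unfolding eq
    proof (intro allI impI ballI)
      fix e v assume e: "e \<noteq> - d" and "v \<in> grd GW e"
      then obtain p where p: "\<forall>u\<in>Poly_Mapping.keys p. u \<in> words n \<and> e = r + int (wdeg u)" "v = cs p" unfolding GW_grd by blast
      then have pF: "p \<in> carrier (FW n r)" by (auto simp: FW_car)
      have "dual_to_word f u = 0" if "u \<in> Poly_Mapping.keys p" for u using h p(1) that e by fastforce
      then show "f v = 0" unfolding p(2) dual_pev[OF f pF] pev_def by simp
    qed
  qed
qed

end

text \<open>The values of a functional on the words applied to the generator.\<close>
definition nabla_word :: "nat \<Rightarrow> weight \<Rightarrow> int \<Rightarrow> nabla_carrier \<Rightarrow> current_word \<Rightarrow> complex" where
  "nabla_word n \<mu> r = dual_to_word n (\<lambda>h. - longest_element n \<mu> h) (- r)"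

lemma word_nabla_eq: "word_nabla n \<mu> = finite_functionals n (\<lambda>h. - longest_element n \<mu> h)"
  unfolding word_nabla_def by blast

lemma nabla_word_in: "f \<in> carrier (nabla n \<mu> r) \<Longrightarrow> nabla_word n \<mu> r f \<in> word_nabla n \<mu>"
  unfolding nabla_def nabla_word_def word_nabla_eq by (rule dual_to_word_functional)

lemma nabla_word_inj:
  "f \<in> carrier (nabla n \<mu> r) \<Longrightarrow> f' \<in> carrier (nabla n \<mu> r) \<Longrightarrow> nabla_word n \<mu> r f = nabla_word n \<mu> r f' \<Longrightarrow> f = f'"
  unfolding nabla_def nabla_word_def by (rule dual_inj)

lemma nabla_word_surj: "g \<in> word_nabla n \<mu> \<Longrightarrow> \<exists>f\<in>carrier (nabla n \<mu> r). nabla_word n \<mu> r f = g"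
  unfolding nabla_def nabla_word_def word_nabla_eq by (rule dual_surj)

lemma nabla_word_add:
  assumes "f \<in> carrier (nabla n \<mu> r)" "f' \<in> carrier (nabla n \<mu> r)"
  shows "f \<oplus>\<^bsub>nabla n \<mu> r\<^esub> f' \<in> carrier (nabla n \<mu> r) \<and>
    nabla_word n \<mu> r (f \<oplus>\<^bsub>nabla n \<mu> r\<^esub> f') = (\<lambda>u. nabla_word n \<mu> r f u + nabla_word n \<mu> r f' u)"
  using dual_add[OF assms[unfolded nabla_def] word_nabla_add[OF nabla_word_in[OF assms(1)] nabla_word_in[OF assms(2)], unfolded word_nabla_eq nabla_word_def]]
  unfolding nabla_def nabla_word_def .

lemma nabla_word_smult:
  assumes "f \<in> carrier (nabla n \<mu> r)"
  shows "c \<odot>\<^bsub>nabla n \<mu> r\<^esub> f \<in> carrier (nabla n \<mu> r) \<and>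
    nabla_word n \<mu> r (c \<odot>\<^bsub>nabla n \<mu> r\<^esub> f) = (\<lambda>u. c * nabla_word n \<mu> r f u)"
  using dual_smult[OF assms[unfolded nabla_def] word_nabla_scale[OF nabla_word_in[OF assms], unfolded word_nabla_eq nabla_word_def]]
  unfolding nabla_def nabla_word_def .

lemma nabla_word_zero: "\<zero>\<^bsub>nabla n \<mu> r\<^esub> \<in> carrier (nabla n \<mu> r) \<and> nabla_word n \<mu> r \<zero>\<^bsub>nabla n \<mu> r\<^esub> = zf"
  using dual_zero[OF zf_nabla[unfolded word_nabla_eq]] unfolding nabla_def nabla_word_def .

lemma nabla_word_act:
  assumes "x \<in> sl n" "f \<in> carrier (nabla n \<mu> r)"
  shows "act (nabla n \<mu> r) x s f \<in> carrier (nabla n \<mu> r) \<and>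
    nabla_word n \<mu> r (act (nabla n \<mu> r) x s f) = word_act x s (nabla_word n \<mu> r f)"
  using dual_act[OF assms(1) assms(2)[unfolded nabla_def] word_nabla_act[OF nabla_word_in[OF assms(2)] assms(1), unfolded word_nabla_eq nabla_word_def]]
  unfolding nabla_def nabla_word_def .

lemma nabla_word_grd:
  assumes "f \<in> carrier (nabla n \<mu> r)"
  shows "f \<in> grd (nabla n \<mu> r) d \<longleftrightarrow> (\<forall>u. nabla_word n \<mu> r f u \<noteq> 0 \<longrightarrow> int (wdeg u) = r - d)"
  using dual_grd[OF assms[unfolded nabla_def], of d] unfolding nabla_def nabla_word_def by simp

lemma nabla_word_eq_zero:
  "f \<in> carrier (nabla n \<mu> r) \<Longrightarrow> f = \<zero>\<^bsub>nabla n \<mu> r\<^esub> \<longleftrightarrow> nabla_word n \<mu> r f = zf"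
  using nabla_word_inj[of f n \<mu> r "\<zero>\<^bsub>nabla n \<mu> r\<^esub>"] nabla_word_zero[of n \<mu> r] by auto

section \<open>Direct sums of dual global Weyl modules\<close>

context
  fixes n :: nat and J :: "(weight \<times> int \<times> nat) set"
begin

abbreviation "NS \<equiv> nabla_sum n J"
abbreviation "nab t \<equiv> nabla n (fst t) (fst (snd t))"

definition sum_word :: "(weight \<times> int \<times> nat \<Rightarrow> nabla_carrier) \<Rightarrow> weight \<times> int \<times> nat \<Rightarrow> current_word \<Rightarrow> complex" where
  "sum_word F t = (if t \<in> J then nabla_word n (fst t) (fst (snd t)) (F t) else zf)"

lemma NS_simps:
  "carrier NS = {f \<in> (\<Pi>\<^sub>E t\<in>J. carrier (nab t)). finite {t \<in> J. f t \<noteq> \<zero>\<^bsub>nab t\<^esub>}}"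
  "\<zero>\<^bsub>NS\<^esub> = (\<lambda>t\<in>J. \<zero>\<^bsub>nab t\<^esub>)" "F \<oplus>\<^bsub>NS\<^esub> F' = (\<lambda>t\<in>J. F t \<oplus>\<^bsub>nab t\<^esub> F' t)"
  "c \<odot>\<^bsub>NS\<^esub> F = (\<lambda>t\<in>J. c \<odot>\<^bsub>nab t\<^esub> F t)" "act NS x s F = (\<lambda>t\<in>J. act (nab t) x s (F t))"
  "grd NS d = {f \<in> carrier NS. \<forall>t\<in>J. f t \<in> grd (nab t) d}"
  by (simp_all add: nabla_sum_def direct_sum_gmod_def Let_def split_def)

lemma NS_carrier_iff:
  "F \<in> carrier NS \<longleftrightarrow> F \<in> extensional J \<and> (\<forall>t\<in>J. F t \<in> carrier (nab t)) \<and> finite {t. sum_word F t \<noteq> zf}"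
proof (cases "F \<in> extensional J \<and> (\<forall>t\<in>J. F t \<in> carrier (nab t))")
  case True
  have "{t \<in> J. F t \<noteq> \<zero>\<^bsub>nab t\<^esub>} = {t. sum_word F t \<noteq> zf}"
    using True nabla_word_eq_zero nabla_word_zero by (auto simp: sum_word_def)
  then show ?thesis using True unfolding NS_simps(1) by (auto simp: PiE_def Pi_def)
next
  case False
  then show ?thesis unfolding NS_simps(1) by (auto simp: PiE_def Pi_def)
qed

lemma NS_at: "F \<in> carrier NS \<Longrightarrow> t \<in> J \<Longrightarrow> F t \<in> carrier (nab t)"
  unfolding NS_carrier_iff by blast

lemma sum_word_in: "F \<in> carrier NS \<Longrightarrow> sum_word F \<in> word_sum n J fst"
  unfolding word_sum_def NS_carrier_iff using nabla_word_in by (auto simp: sum_word_def)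

lemma sum_word_inj:
  assumes F: "F \<in> carrier NS" and F': "F' \<in> carrier NS" and eq: "sum_word F = sum_word F'"
  shows "F = F'"
proof (rule extensionalityI[of _ J])
  show "F \<in> extensional J" "F' \<in> extensional J" using F F' unfolding NS_carrier_iff by blast+
  fix t assume t: "t \<in> J"
  have "nabla_word n (fst t) (fst (snd t)) (F t) = nabla_word n (fst t) (fst (snd t)) (F' t)"
    using fun_cong[OF eq, of t] t by (simp add: sum_word_def)
  then show "F t = F' t" by (rule nabla_word_inj[OF NS_at[OF F t] NS_at[OF F' t]])
qed

lemma sum_word_surj:
  assumes g: "g \<in> word_sum n J fst" shows "\<exists>F\<in>carrier NS. sum_word F = g"
proof -
  have "\<exists>f. t \<in> J \<longrightarrow> f \<in> carrier (nab t) \<and> nabla_word n (fst t) (fst (snd t)) f = g t" for t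
    using nabla_word_surj[of "g t" n "fst t" "fst (snd t)"] g unfolding word_sum_def by blast
  then obtain F0 where F0: "\<And>t. t \<in> J \<Longrightarrow> F0 t \<in> carrier (nab t) \<and> nabla_word n (fst t) (fst (snd t)) (F0 t) = g t"
    by metis
  let ?F = "\<lambda>t\<in>J. F0 t"
  have eq: "sum_word ?F = g" using F0 g by (auto simp: sum_word_def word_sum_def)
  moreover have "?F \<in> carrier NS" unfolding NS_carrier_iff eq using F0 g by (auto simp: word_sum_def)
  ultimately show ?thesis by blast
qed

lemma NS_memI:
  assumes H: "H \<in> extensional J" "\<And>t. t \<in> J \<Longrightarrow> H t \<in> carrier (nab t)"
    and z: "finite {t. sum_word H t \<noteq> zf}"
  shows "H \<in> carrier NS"
  unfolding NS_carrier_iff using assms by blast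

lemma sum_word_add:
  assumes F: "F \<in> carrier NS" and F': "F' \<in> carrier NS"
  shows "F \<oplus>\<^bsub>NS\<^esub> F' \<in> carrier NS" and "sum_word (F \<oplus>\<^bsub>NS\<^esub> F') t u = sum_word F t u + sum_word F' t u"
proof -
  note a = nabla_word_add[OF NS_at[OF F] NS_at[OF F']]
  show eq: "sum_word (F \<oplus>\<^bsub>NS\<^esub> F') t u = sum_word F t u + sum_word F' t u" for t u
    using a[of t] by (simp add: sum_word_def NS_simps)
  have "{t. sum_word (F \<oplus>\<^bsub>NS\<^esub> F') t \<noteq> zf} \<subseteq> {t. sum_word F t \<noteq> zf} \<union> {t. sum_word F' t \<noteq> zf}"
    by (auto simp: fun_eq_iff eq)
  then have "finite {t. sum_word (F \<oplus>\<^bsub>NS\<^esub> F') t \<noteq> zf}"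
    using F F' unfolding NS_carrier_iff by (meson finite_UnI finite_subset)
  then show "F \<oplus>\<^bsub>NS\<^esub> F' \<in> carrier NS"
    by (intro NS_memI) (use a in \<open>auto simp: NS_simps\<close>)
qed

lemma sum_word_smult:
  assumes F: "F \<in> carrier NS"
  shows "c \<odot>\<^bsub>NS\<^esub> F \<in> carrier NS" and "sum_word (c \<odot>\<^bsub>NS\<^esub> F) t u = c * sum_word F t u"
proof -
  note a = nabla_word_smult[OF NS_at[OF F]]
  show eq: "sum_word (c \<odot>\<^bsub>NS\<^esub> F) t u = c * sum_word F t u" for t u
    using a[of t c] by (simp add: sum_word_def NS_simps)
  have "{t. sum_word (c \<odot>\<^bsub>NS\<^esub> F) t \<noteq> zf} \<subseteq> {t. sum_word F t \<noteq> zf}"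
    by (auto simp: fun_eq_iff eq)
  then have "finite {t. sum_word (c \<odot>\<^bsub>NS\<^esub> F) t \<noteq> zf}"
    using F unfolding NS_carrier_iff by (meson finite_subset)
  then show "c \<odot>\<^bsub>NS\<^esub> F \<in> carrier NS"
    by (intro NS_memI) (use a in \<open>auto simp: NS_simps\<close>)
qed

lemma sum_word_act:
  assumes x: "x \<in> sl n" and F: "F \<in> carrier NS"
  shows "act NS x s F \<in> carrier NS" and "sum_word (act NS x s F) t u = - sum_word F t ((x, s) # u)"
proof -
  note a = nabla_word_act[OF x NS_at[OF F]]
  show eq: "sum_word (act NS x s F) t u = - sum_word F t ((x, s) # u)" for t u
    using a[of t s] by (simp add: sum_word_def NS_simps word_act_def)
  have "{t. sum_word (act NS x s F) t \<noteq> zf} \<subseteq> {t. sum_word F t \<noteq> zf}"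
    by (auto simp: fun_eq_iff eq)
  then have "finite {t. sum_word (act NS x s F) t \<noteq> zf}"
    using F unfolding NS_carrier_iff by (meson finite_subset)
  then show "act NS x s F \<in> carrier NS"
    by (intro NS_memI) (use a in \<open>auto simp: NS_simps\<close>)
qed

lemma sum_word_zero: shows "\<zero>\<^bsub>NS\<^esub> \<in> carrier NS" and "sum_word \<zero>\<^bsub>NS\<^esub> = (\<lambda>_. zf)"
proof -
  show eq: "sum_word \<zero>\<^bsub>NS\<^esub> = (\<lambda>_. zf)" using nabla_word_zero by (auto simp: sum_word_def NS_simps)
  show "\<zero>\<^bsub>NS\<^esub> \<in> carrier NS" unfolding NS_carrier_iff eq using nabla_word_zero by (auto simp: NS_simps)
qed

lemma sum_word_grd:
  assumes F: "F \<in> carrier NS"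
  shows "F \<in> grd NS d \<longleftrightarrow> (\<forall>t u. sum_word F t u \<noteq> 0 \<longrightarrow> int (wdeg u) = fst (snd t) - d)"
  using nabla_word_grd[OF NS_at[OF F]] F unfolding NS_simps(6) by (auto simp: sum_word_def)

text \<open>Summand and word are merged into one argument, so that the whole direct sum lies in a
  single function space.\<close>

definition sum_emb :: "(weight \<times> int \<times> nat \<Rightarrow> nabla_carrier) \<Rightarrow> ((weight \<times> int \<times> nat) \<times> current_word) cvec" where
  "sum_emb F = Cvec (\<lambda>(t, u). sum_word F t u)"

lemma ev_sum_emb: "ev (sum_emb F) (t, u) = sum_word F t u"
  by (simp add: sum_emb_def Cvec_inverse)

lemma sum_emb_emb: "emb NS sum_emb"
  unfolding emb_def
proof (intro conjI ballI allI)
  show "inj_on sum_emb (carrier NS)"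
  proof (rule inj_onI)
    fix F F' assume F: "F \<in> carrier NS" "F' \<in> carrier NS" and eq: "sum_emb F = sum_emb F'"
    have "sum_word F t u = sum_word F' t u" for t u using ev_sum_emb[of F t u] ev_sum_emb[of F' t u] eq by simp
    then show "F = F'" by (intro sum_word_inj F ext)
  qed
qed (simp_all add: cvec_eq_iff ev_sum_emb sum_word_zero sum_word_add sum_word_smult)

end

section \<open>Embedded modules\<close>

lemma emb_minus:
  assumes e: "emb V \<iota>" and v: "v \<in> carrier V" and w: "w \<in> carrier V"
  shows "v \<ominus>\<^bsub>V\<^esub> w \<in> carrier V" and "\<iota> (v \<ominus>\<^bsub>V\<^esub> w) = \<iota> v - \<iota> w"
proof -
  interpret V: vectorspace "class_ring :: complex ring" V by (rule emb_vectorspace[OF e])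
  have m: "\<ominus>\<^bsub>V\<^esub> w \<in> carrier V" using w by simp
  have "w \<oplus>\<^bsub>V\<^esub> (\<ominus>\<^bsub>V\<^esub> w) = \<zero>\<^bsub>V\<^esub>" using w by (rule V.r_neg)
  then have "\<iota> w + \<iota> (\<ominus>\<^bsub>V\<^esub> w) = 0" using embD(5)[OF e w m] embD(3)[OF e] by simp
  then have "\<iota> (\<ominus>\<^bsub>V\<^esub> w) = - \<iota> w" by (simp add: eq_neg_iff_add_eq_0 add.commute)
  then show "\<iota> (v \<ominus>\<^bsub>V\<^esub> w) = \<iota> v - \<iota> w" using embD(5)[OF e v m] by (simp add: a_minus_def)
  show "v \<ominus>\<^bsub>V\<^esub> w \<in> carrier V" using embD(4)[OF e v m] by (simp add: a_minus_def)
qed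

lemma emb_grading:
  assumes e: "emb V \<iota>" and G: "\<And>d. H d \<subseteq> carrier V"
    and f: "\<And>d. f d \<in> H d" "finite {d. f d \<noteq> \<zero>\<^bsub>V\<^esub>}" and D: "finite D" "{d. f d \<noteq> \<zero>\<^bsub>V\<^esub>} \<subseteq> D"
  shows "\<iota> (\<Oplus>\<^bsub>V\<^esub>d\<in>{d. f d \<noteq> \<zero>\<^bsub>V\<^esub>}. f d) = (\<Sum>d\<in>D. \<iota> (f d))"
proof -
  have "\<iota> (\<Oplus>\<^bsub>V\<^esub>d\<in>{d. f d \<noteq> \<zero>\<^bsub>V\<^esub>}. f d) = (\<Sum>d\<in>{d. f d \<noteq> \<zero>\<^bsub>V\<^esub>}. \<iota> (f d))"
    by (rule conjunct2[OF emb_finsum[OF e f(2)]]) (use f(1) G in blast)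
  also have "\<dots> = (\<Sum>d\<in>D. \<iota> (f d))"
    by (rule sum.mono_neutral_left[OF D]) (use embD(3)[OF e] in auto)
  finally show ?thesis .
qed

locale embedded_module =
  fixes n :: nat and M :: "'v gmod" and \<iota> :: "'v \<Rightarrow> 'x cvec"
  assumes cat: "category_I n M" and e: "emb M \<iota>"
begin

abbreviation "\<kappa> \<equiv> inv_into (carrier M) \<iota>"
definition "MS = \<iota> ` carrier M"
definition "MA x s y = \<iota> (act M x s (\<kappa> y))"
definition "MG d = \<iota> ` grd M d"

interpretation C: category_I n M by (rule cat)

lemma kappa: "v \<in> carrier M \<Longrightarrow> \<kappa> (\<iota> v) = v"
  using e by (simp add: emb_def)

lemma MA: "v \<in> carrier M \<Longrightarrow> MA x s (\<iota> v) = \<iota> (act M x s v)"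
  by (simp add: MA_def kappa)

lemma act_in: "x \<in> sl n \<Longrightarrow> v \<in> carrier M \<Longrightarrow> act M x s v \<in> carrier M"
  by (rule C.act_closed)

lemma grd_sub: "grd M d \<subseteq> carrier M" and MG_sub: "vs.subspace (MG d)"
  using C.grd_subspace[of d] emb_subspace_iff[OF e] unfolding MG_def by blast+

lemma MG_iff: "v \<in> carrier M \<Longrightarrow> \<iota> v \<in> MG d \<longleftrightarrow> v \<in> grd M d"
  unfolding MG_def using grd_sub embD(1)[OF e] by blast

text \<open>Independence is the uniqueness of the homogeneous decomposition of the zero vector: a
  vanishing sum is pulled back to a second such decomposition.\<close>

lemma MG_ind:
  assumes D: "finite D" and f: "\<And>d. d \<in> D \<Longrightarrow> f d \<in> MG d" and s: "(\<Sum>d\<in>D. f d) = 0" and d: "d \<in> D"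
  shows "f d = 0"
proof -
  define g where "g d = (if d \<in> D then \<kappa> (f d) else \<zero>\<^bsub>M\<^esub>)" for d
  have z: "\<zero>\<^bsub>M\<^esub> \<in> grd M d" for d
    using MG_iff[OF embD(2)[OF e], of d] vs.subspace_0[OF MG_sub[of d]] embD(3)[OF e] by simp
  have g: "g d \<in> grd M d" "d \<in> D \<Longrightarrow> \<iota> (g d) = f d" for d
  proof -
    have "g d \<in> grd M d \<and> \<iota> (g d) = f d" if dD: "d \<in> D"
    proof -
      obtain v where v: "v \<in> grd M d" "f d = \<iota> v" using f[OF dD] unfolding MG_def by blast
      then have "v \<in> carrier M" using grd_sub by blast
      then have "\<kappa> (f d) = v" using kappa v(2) by simp
      then show ?thesis using v dD by (simp add: g_def)
    qed
    then show "g d \<in> grd M d" "d \<in> D \<Longrightarrow> \<iota> (g d) = f d" using z by (auto simp: g_def)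
  qed
  have gs: "{d. g d \<noteq> \<zero>\<^bsub>M\<^esub>} \<subseteq> D" by (auto simp: g_def)
  then have gf: "finite {d. g d \<noteq> \<zero>\<^bsub>M\<^esub>}" using D by (rule finite_subset)
  have "\<iota> (\<Oplus>\<^bsub>M\<^esub>d\<in>{d. g d \<noteq> \<zero>\<^bsub>M\<^esub>}. g d) = (\<Sum>d\<in>D. \<iota> (g d))"
    by (rule emb_grading[OF e grd_sub g(1) gf D gs])
  also have "\<dots> = \<iota> \<zero>\<^bsub>M\<^esub>" using s g(2) embD(3)[OF e] by simp
  finally have sum0: "\<zero>\<^bsub>M\<^esub> = (\<Oplus>\<^bsub>M\<^esub>d\<in>{d. g d \<noteq> \<zero>\<^bsub>M\<^esub>}. g d)"
    using embD(1)[OF e _ embD(2)[OF e]] emb_finsum[OF e gf, of g] g(1) grd_sub by (metis subsetD)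
  let ?P = "\<lambda>f. (\<forall>d. f d \<in> grd M d) \<and> finite {d. f d \<noteq> \<zero>\<^bsub>M\<^esub>} \<and> \<zero>\<^bsub>M\<^esub> = (\<Oplus>\<^bsub>M\<^esub>d\<in>{d. f d \<noteq> \<zero>\<^bsub>M\<^esub>}. f d)"
  have ex: "\<exists>!f. ?P f" by (rule C.grd_decomposition[OF embD(2)[OF e]])
  have Pg: "?P g" using g(1) gf sum0 by blast
  have Pz: "?P (\<lambda>_. \<zero>\<^bsub>M\<^esub>)" using z by simp
  have "g = (\<lambda>_. \<zero>\<^bsub>M\<^esub>)"
    using the1_equality[where P = ?P, OF ex Pg] the1_equality[where P = ?P, OF ex Pz] by (rule box_equals[OF refl])
  then show ?thesis using g(2)[OF d] embD(3)[OF e] by simp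
qed

lemma rep: "current_rep n MS MA MG"
proof
  show S: "vs.subspace MS" unfolding MS_def by (rule emb_subspace[OF e])
  fix x s assume x: "x \<in> sl n"
  show "endo MS (MA x s)"
    unfolding endo_def MS_def
  proof (intro conjI ballI allI)
    fix y assume "y \<in> \<iota> ` carrier M"
    then obtain v where v: "v \<in> carrier M" "y = \<iota> v" by blast
    show "MA x s y \<in> \<iota> ` carrier M" unfolding v(2) MA[OF v(1)] by (intro imageI act_in x v)
    show "MA x s (sc c y) = sc c (MA x s y)" for c
    proof -
      have "MA x s (sc c y) = \<iota> (act M x s (c \<odot>\<^bsub>M\<^esub> v))"
        unfolding v(2) embD(7)[OF e v(1), symmetric] by (rule MA[OF embD(6)[OF e v(1)]])
      also have "\<dots> = sc c (MA x s y)"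
        unfolding v(2) MA[OF v(1)] C.act_smult_right[OF x v(1)] by (rule embD(7)[OF e act_in[OF x v(1)]])
      finally show ?thesis .
    qed
    fix z assume "z \<in> \<iota> ` carrier M"
    then obtain w where w: "w \<in> carrier M" "z = \<iota> w" by blast
    have "MA x s (y + z) = \<iota> (act M x s (v \<oplus>\<^bsub>M\<^esub> w))"
      unfolding v(2) w(2) embD(5)[OF e v(1) w(1), symmetric] by (rule MA[OF embD(4)[OF e v(1) w(1)]])
    also have "\<dots> = MA x s y + MA x s z"
      unfolding v(2) w(2) MA[OF v(1)] MA[OF w(1)] C.act_add_right[OF x v(1) w(1)]
      by (rule embD(5)[OF e act_in[OF x v(1)] act_in[OF x w(1)]])
    finally show "MA x s (y + z) = MA x s y + MA x s z" .
  qed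
next
  fix x y v s assume xy: "x \<in> sl n" "y \<in> sl n" and "v \<in> MS"
  then obtain w where w: "w \<in> carrier M" "v = \<iota> w" unfolding MS_def by blast
  show "MA (x + y) s v = MA x s v + MA y s v"
    unfolding w(2) MA[OF w(1)] C.act_add_left[OF xy w(1)] by (rule embD(5)[OF e act_in[OF xy(1) w(1)] act_in[OF xy(2) w(1)]])
next
  fix x v c s assume x: "x \<in> sl n" and "v \<in> MS"
  then obtain w where w: "w \<in> carrier M" "v = \<iota> w" unfolding MS_def by blast
  show "MA (c \<cdot>\<^sub>m x) s v = sc c (MA x s v)"
    unfolding w(2) MA[OF w(1)] C.act_smult_left[OF x w(1)] by (rule embD(7)[OF e act_in[OF x w(1)]])
next
  fix x y v r s assume xy: "x \<in> sl n" "y \<in> sl n" and "v \<in> MS"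
  then obtain w where w: "w \<in> carrier M" "v = \<iota> w" unfolding MS_def by blast
  show "MA (bracket x y) (r + s) v = MA x r (MA y s v) - MA y s (MA x r v)"
    unfolding w(2) MA[OF w(1)] MA[OF act_in[OF xy(1) w(1)]] MA[OF act_in[OF xy(2) w(1)]] C.act_bracket[OF xy w(1)]
    by (rule emb_minus(2)[OF e act_in[OF xy(1) act_in[OF xy(2) w(1)]] act_in[OF xy(2) act_in[OF xy(1) w(1)]]])
next
  show "vs.subspace (MG d)" for d by (rule MG_sub)
  show "MG d \<subseteq> MS" for d unfolding MG_def MS_def by (intro image_mono grd_sub)
  fix x v d s assume x: "x \<in> sl n" and "v \<in> MG d"
  then obtain w where w: "w \<in> grd M d" "v = \<iota> w" unfolding MG_def by blast
  then have "w \<in> carrier M" using grd_sub by blast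
  then show "MA x s v \<in> MG (d + int s)" unfolding w(2) MG_def by (simp add: MA C.act_grd[OF x w(1)])
next
  show "\<exists>B. finite B \<and> MG d \<subseteq> vs.span B" for d
    using C.grd_fin_dim[of d] emb_fin_dim_update[OF e grd_sub[of d]] MG_sub[of d] unfolding MG_def by blast
qed (rule MG_ind)

sublocale R: current_rep n MS MA MG by (rule rep)

lemma restrict_emb:
  assumes N: "N \<subseteq> carrier M" "vs.subspace (\<iota> ` N)" shows "emb (restrict_gmod M N) \<iota>"
  by (rule emb_carrier_update[OF e N]) (simp_all add: restrict_gmod_def)

lemma restrict_simps [simp]:
  "carrier (restrict_gmod M N) = N" "(\<oplus>\<^bsub>restrict_gmod M N\<^esub>) = (\<oplus>\<^bsub>M\<^esub>)" "(\<odot>\<^bsub>restrict_gmod M N\<^esub>) = (\<odot>\<^bsub>M\<^esub>)"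
  "\<zero>\<^bsub>restrict_gmod M N\<^esub> = \<zero>\<^bsub>M\<^esub>" "act (restrict_gmod M N) = act M" "grd (restrict_gmod M N) d = grd M d \<inter> N"
  by (simp_all add: restrict_gmod_def)

lemma MG_int: "N \<subseteq> carrier M \<Longrightarrow> MG d \<inter> \<iota> ` N = \<iota> ` (grd M d \<inter> N)"
  using MG_iff by blast

lemma restrict_subspace:
  assumes N: "N \<subseteq> carrier M" and v: "vectorspace (class_ring :: complex ring) (restrict_gmod M N)"
  shows "vs.subspace (\<iota> ` N)"
proof -
  interpret V: vectorspace "class_ring :: complex ring" "restrict_gmod M N" by (rule v)
  have "VectorSpace.subspace (class_ring :: complex ring) N M"
  proof (intro VectorSpace.subspace.intro submodule.intro N emb_vectorspace[OF e])
    show "Module.module (class_ring :: complex ring) M" by (rule vectorspace.axioms(1)[OF emb_vectorspace[OF e]])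
    show "v \<oplus>\<^bsub>M\<^esub> w \<in> N" if "v \<in> N" "w \<in> N" for v w using V.a_closed[of v w] that by simp
    show "\<zero>\<^bsub>M\<^esub> \<in> N" using V.zero_closed by simp
    show "c \<odot>\<^bsub>M\<^esub> v \<in> N" if "c \<in> carrier (class_ring :: complex ring)" "v \<in> N" for c v
      using V.smult_closed[of c v] that by simp
  qed
  then show ?thesis using emb_subspace_iff[OF e] by blast
qed

lemma restrict_grading:
  assumes N: "N \<subseteq> carrier M" "vs.subspace (\<iota> ` N)" and f: "\<And>d. f d \<in> grd M d \<inter> N"
    and D: "finite D" "{d. f d \<noteq> \<zero>\<^bsub>M\<^esub>} \<subseteq> D"
  shows "\<iota> (\<Oplus>\<^bsub>restrict_gmod M N\<^esub>d\<in>{d. f d \<noteq> \<zero>\<^bsub>M\<^esub>}. f d) = (\<Sum>d\<in>D. \<iota> (f d))"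
proof -
  have "finite {d. f d \<noteq> \<zero>\<^bsub>restrict_gmod M N\<^esub>}" "{d. f d \<noteq> \<zero>\<^bsub>restrict_gmod M N\<^esub>} \<subseteq> D"
    using finite_subset[OF D(2,1)] D(2) by simp_all
  from emb_grading[OF restrict_emb[OF N] _ f this(1) D(1) this(2)] show ?thesis by simp
qed

lemma graded_submodule_gsub:
  assumes g: "graded_submodule n N M"
  shows "R.gsub (\<iota> ` N)"
proof -
  have N: "N \<subseteq> carrier M" and c: "category_I n (restrict_gmod M N)" using g unfolding graded_submodule_def by blast+
  interpret V: category_I n "restrict_gmod M N" by (rule c)
  have s: "vs.subspace (\<iota> ` N)" by (rule restrict_subspace[OF N V.vectorspace_axioms])
  note eN = restrict_emb[OF N s]
  show ?thesis
    unfolding R.gsub_def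
  proof (intro conjI s ballI allI)
    show "\<iota> ` N \<subseteq> MS" unfolding MS_def using N by blast
    fix x t y assume x: "x \<in> sl n" and "y \<in> \<iota> ` N"
    then obtain v where v: "v \<in> N" "y = \<iota> v" by blast
    then have vM: "v \<in> carrier M" using N by blast
    show "MA x t y \<in> \<iota> ` N" unfolding v(2) MA[OF vM] using V.act_closed[OF x, of v t] v(1) by simp
  next
    show "\<iota> ` N \<subseteq> vs.span (\<Union>d. MG d \<inter> \<iota> ` N)"
    proof
      fix y assume "y \<in> \<iota> ` N"
      then obtain v where v: "v \<in> N" "y = \<iota> v" by blast
      then obtain f where f: "\<forall>d. f d \<in> grd M d \<inter> N" "finite {d. f d \<noteq> \<zero>\<^bsub>M\<^esub>}"
        "v = (\<Oplus>\<^bsub>restrict_gmod M N\<^esub>d\<in>{d. f d \<noteq> \<zero>\<^bsub>M\<^esub>}. f d)"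
        using V.grd_decomposition[of v] by auto
      have fd: "f d \<in> grd M d \<inter> N" for d using f(1) by blast
      have "y = (\<Sum>d\<in>{d. f d \<noteq> \<zero>\<^bsub>M\<^esub>}. \<iota> (f d))"
        unfolding v(2) by (subst f(3)) (rule restrict_grading[OF N s fd f(2) order_refl])
      also have "\<dots> \<in> vs.span (\<Union>d. MG d \<inter> \<iota> ` N)"
        by (intro vs.span_sum vs.span_base) (use fd in \<open>auto simp: MG_def\<close>)
      finally show "y \<in> vs.span (\<Union>d. MG d \<inter> \<iota> ` N)" .
    qed
  qed
qed

text \<open>The decomposition axiom comes from the spanning condition in \<open>gsub\<close>, its
  uniqueness from \<open>MG_ind\<close>, and finite dimensions are inherited.\<close>

lemma gsub_graded_submodule:
  assumes N: "N \<subseteq> carrier M" and g: "R.gsub (\<iota> ` N)"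
  shows "graded_submodule n N M"
proof -
  have s: "vs.subspace (\<iota> ` N)" by (rule R.gsub_subspace[OF g])
  let ?V = "restrict_gmod M N"
  note eN = restrict_emb[OF N s]
  interpret V: vectorspace "class_ring :: complex ring" ?V by (rule emb_vectorspace[OF eN])
  have in_N: "v \<in> N" if "v \<in> carrier M" "\<iota> v \<in> \<iota> ` N" for v using that N embD(1)[OF e] by blast
  have aN: "act M x t v \<in> N" if "x \<in> sl n" "v \<in> N" for x t v
  proof (rule in_N)
    have vM: "v \<in> carrier M" using N that(2) by blast
    show "act M x t v \<in> carrier M" by (rule act_in[OF that(1) vM])
    show "\<iota> (act M x t v) \<in> \<iota> ` N" using R.gsub_A[OF g that(1) imageI[OF that(2)], of t] MA[OF vM] by simp
  qed
  have gs: "vs.subspace (\<iota> ` (grd M d \<inter> N))" for d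
    unfolding MG_int[OF N, symmetric] by (rule vs.subspace_inter[OF MG_sub s])
  have cm: "current_module n ?V"
  proof (intro current_module.intro V.vectorspace_axioms current_module_axioms.intro)
    fix x y v w r t c assume x: "x \<in> sl n" and v: "v \<in> carrier ?V"
    have vN: "v \<in> N" and vM: "v \<in> carrier M" using v N by auto
    show "act ?V x t v \<in> carrier ?V" using aN[OF x vN] by simp
    show "act ?V x t (c \<odot>\<^bsub>?V\<^esub> v) = c \<odot>\<^bsub>?V\<^esub> act ?V x t v" using C.act_smult_right[OF x vM] by simp
    show "act ?V (c \<cdot>\<^sub>m x) t v = c \<odot>\<^bsub>?V\<^esub> act ?V x t v" using C.act_smult_left[OF x vM] by simp
    show "act ?V x t (v \<oplus>\<^bsub>?V\<^esub> w) = act ?V x t v \<oplus>\<^bsub>?V\<^esub> act ?V x t w" if "w \<in> carrier ?V"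
      using C.act_add_right[OF x vM, of w] N that by auto
    assume y: "y \<in> sl n"
    show "act ?V (x + y) t v = act ?V x t v \<oplus>\<^bsub>?V\<^esub> act ?V y t v" using C.act_add_left[OF x y vM] by simp
    let ?a = "act M x r (act M y t v)" and ?b = "act M y t (act M x r v)"
    have ab: "?a \<in> N" "?b \<in> N" by (intro aN x y vN)+
    then have abM: "?a \<in> carrier M" "?b \<in> carrier M" using N by blast+
    have mN: "?a \<ominus>\<^bsub>?V\<^esub> ?b \<in> N" using emb_minus(1)[OF eN, of ?a ?b] ab by simp
    \<comment> \<open>Additive inverses are computed within the respective structure, so the two
      differences have to be compared through \<open>\<iota>\<close>.\<close>
    have "?a \<ominus>\<^bsub>?V\<^esub> ?b = ?a \<ominus>\<^bsub>M\<^esub> ?b"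
    proof (rule embD(1)[OF e])
      show "?a \<ominus>\<^bsub>?V\<^esub> ?b \<in> carrier M" using mN N by blast
      show "?a \<ominus>\<^bsub>M\<^esub> ?b \<in> carrier M" by (rule emb_minus(1)[OF e abM])
      show "\<iota> (?a \<ominus>\<^bsub>?V\<^esub> ?b) = \<iota> (?a \<ominus>\<^bsub>M\<^esub> ?b)"
        using emb_minus(2)[OF eN, of ?a ?b] emb_minus(2)[OF e abM] ab by simp
    qed
    then show "act ?V (bracket x y) (r + t) v = act ?V x r (act ?V y t v) \<ominus>\<^bsub>?V\<^esub> act ?V y t (act ?V x r v)"
      using C.act_bracket[OF x y vM, of r t] by simp
  qed
  have dec: "\<exists>!f. (\<forall>d. f d \<in> grd ?V d) \<and> finite {d. f d \<noteq> \<zero>\<^bsub>?V\<^esub>} \<and> v = (\<Oplus>\<^bsub>?V\<^esub>d\<in>{d. f d \<noteq> \<zero>\<^bsub>?V\<^esub>}. f d)"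
    if v: "v \<in> carrier ?V" for v
  proof -
    have uniq: "f d = g d" if f: "\<forall>d. f d \<in> grd M d \<inter> N" "finite {d. f d \<noteq> \<zero>\<^bsub>M\<^esub>}" "v = (\<Oplus>\<^bsub>?V\<^esub>d\<in>{d. f d \<noteq> \<zero>\<^bsub>M\<^esub>}. f d)"
      and g: "\<forall>d. g d \<in> grd M d \<inter> N" "finite {d. g d \<noteq> \<zero>\<^bsub>M\<^esub>}" "v = (\<Oplus>\<^bsub>?V\<^esub>d\<in>{d. g d \<noteq> \<zero>\<^bsub>M\<^esub>}. g d)" for f g d
    proof -
      let ?D = "insert d ({d. f d \<noteq> \<zero>\<^bsub>M\<^esub>} \<union> {d. g d \<noteq> \<zero>\<^bsub>M\<^esub>})"
      have D: "finite ?D" using f(2) g(2) by simp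
      have fd: "f d \<in> grd M d \<inter> N" and gd: "g d \<in> grd M d \<inter> N" for d using f(1) g(1) by blast+
      have "\<iota> v = (\<Sum>d\<in>?D. \<iota> (f d))"
        by (subst f(3)) (rule restrict_grading[OF N s fd D], blast)
      moreover have "\<iota> v = (\<Sum>d\<in>?D. \<iota> (g d))"
        by (subst g(3)) (rule restrict_grading[OF N s gd D], blast)
      ultimately have s0: "(\<Sum>d\<in>?D. \<iota> (f d) - \<iota> (g d)) = 0" by (simp only: sum_subtractf) simp
      have "\<iota> (f d) - \<iota> (g d) \<in> MG d" for d
        using vs.subspace_diff[OF MG_sub[of d], of "\<iota> (f d)" "\<iota> (g d)"] fd[of d] gd[of d] by (auto simp: MG_def)
      then have "\<iota> (f d) - \<iota> (g d) = 0" using MG_ind[OF D _ s0, of d] by blast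
      moreover have "f d \<in> carrier M" "g d \<in> carrier M" using fd[of d] gd[of d] N by blast+
      ultimately show "f d = g d" using embD(1)[OF e] by simp
    qed
    have "\<iota> v \<in> vs.span (\<Union>d\<in>UNIV. \<iota> ` (grd M d \<inter> N))"
      using R.gsub_graded[OF g] v unfolding MG_int[OF N] by auto
    from span_UN_form[OF gs this] obtain f D
      where fD: "finite D" "\<forall>d\<in>D. f d \<in> \<iota> ` (grd M d \<inter> N)" "\<iota> v = (\<Sum>d\<in>D. f d)" by blast
    define h where "h d = (if d \<in> D then \<kappa> (f d) else \<zero>\<^bsub>M\<^esub>)" for d
    have z: "\<zero>\<^bsub>M\<^esub> \<in> grd M d \<inter> N" for d
    proof -
      have "\<iota> \<zero>\<^bsub>M\<^esub> \<in> MG d" "\<iota> \<zero>\<^bsub>M\<^esub> \<in> \<iota> ` N" unfolding embD(3)[OF e] by (rule vs.subspace_0[OF MG_sub], rule vs.subspace_0[OF s])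
      then show ?thesis using MG_iff[OF embD(2)[OF e]] in_N[OF embD(2)[OF e]] by blast
    qed
    have h: "h d \<in> grd M d \<inter> N \<and> (d \<in> D \<longrightarrow> \<iota> (h d) = f d)" for d
    proof (cases "d \<in> D")
      case True
      then obtain w where w: "w \<in> grd M d \<inter> N" "f d = \<iota> w" using fD(2) by blast
      then have "\<kappa> (f d) = w" using kappa N by auto
      then show ?thesis using True w by (simp add: h_def)
    qed (simp add: h_def z[simplified])
    have hs: "{d. h d \<noteq> \<zero>\<^bsub>M\<^esub>} \<subseteq> D" by (auto simp: h_def)
    then have hf: "finite {d. h d \<noteq> \<zero>\<^bsub>M\<^esub>}" using fD(1) by (rule finite_subset)
    have hd: "h d \<in> grd M d \<inter> N" for d using h by blast
    have "\<iota> (\<Oplus>\<^bsub>?V\<^esub>d\<in>{d. h d \<noteq> \<zero>\<^bsub>M\<^esub>}. h d) = (\<Sum>d\<in>D. \<iota> (h d))"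
      by (rule restrict_grading[OF N s hd fD(1) hs])
    also have "\<dots> = \<iota> v" using fD(3) h by simp
    finally have "v = (\<Oplus>\<^bsub>?V\<^esub>d\<in>{d. h d \<noteq> \<zero>\<^bsub>M\<^esub>}. h d)"
      using embD(1)[OF eN v] emb_finsum[OF eN hf, of h] hd by simp
    then show ?thesis
      using uniq hd hf by (intro ex1I[of _ h]) (auto intro!: ext)
  qed
  have "graded_current_module n ?V"
  proof (intro graded_current_module.intro cm graded_current_module_axioms.intro dec)
    show "VectorSpace.subspace (class_ring :: complex ring) (grd ?V d) ?V" for d
      using emb_subspace_iff[OF eN, of "grd ?V d"] gs by simp
    show "act ?V x t v \<in> grd ?V (d + int t)" if "x \<in> sl n" "v \<in> grd ?V d" for x v d t
      using that aN C.act_grd by simp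
  qed
  moreover have "category_I_axioms ?V"
  proof
    fix d
    have "\<iota> ` (grd M d \<inter> N) \<subseteq> MG d" unfolding MG_def by blast
    then have "\<exists>B. finite B \<and> \<iota> ` (grd M d \<inter> N) \<subseteq> vs.span B" using R.G_fin[of d] by (meson order_trans)
    then show "vectorspace.fin_dim (class_ring :: complex ring) (?V\<lparr>carrier := grd ?V d\<rparr>)"
      using emb_fin_dim_update[OF eN, of "grd ?V d"] gs by simp
  qed
  ultimately show ?thesis unfolding graded_submodule_def using N category_I.intro by blast
qed

lemma weights_wts:
  assumes N: "N \<subseteq> carrier M"
  shows "weights n (restrict_gmod M N) = R.wts (\<iota> ` N)"
proof -
  have "v \<noteq> \<zero>\<^bsub>M\<^esub> \<longleftrightarrow> \<iota> v \<noteq> 0" if "v \<in> N" for v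
    using that N embD(1)[OF e, of v "\<zero>\<^bsub>M\<^esub>"] embD(2,3)[OF e] by auto
  moreover have "act M h 0 v = \<mu> h \<odot>\<^bsub>M\<^esub> v \<longleftrightarrow> MA h 0 (\<iota> v) = sc (\<mu> h) (\<iota> v)" if h: "h \<in> cartan n" and vN: "v \<in> N" for h v \<mu>
  proof -
    have v: "v \<in> carrier M" using N vN by blast
    show ?thesis unfolding MA[OF v] embD(7)[OF e v, symmetric]
      using embD(1)[OF e act_in[OF cartan_sl[OF h] v] embD(6)[OF e v]] by metis
  qed
  ultimately show ?thesis unfolding weights_def R.wts_def R.weight_vector_def by simp
qed

end

section \<open>Presentations and isomorphisms with direct sums\<close>

context current_rep
begin

lemma pres_lin:
  assumes X: "gsub X" and \<phi>: "pres X N J w r \<phi>" and v: "v \<in> X"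
  shows "v' \<in> X \<Longrightarrow> \<phi> (v + v') t u = \<phi> v t u + \<phi> v' t u"
    and "\<phi> (sc c v) t u = c * \<phi> v t u"
    and "x \<in> sl n \<Longrightarrow> \<phi> (A x s v) t u = - \<phi> v t ((x, s) # u)"
    and "v \<in> G d \<Longrightarrow> \<phi> v t u \<noteq> 0 \<Longrightarrow> int (wdeg u) = r t - d"
proof -
  have out: "\<phi> y t = zf" if "y \<in> X" "t \<notin> J" for y by (rule pres_zero[OF \<phi> that])
  note h = presD(1)[OF \<phi>]
  have sX: "sc c v \<in> X" by (rule vs.subspace_scale[OF gsub_subspace[OF X] v])
  show "\<phi> (v + v') t u = \<phi> v t u + \<phi> v' t u" if v': "v' \<in> X"
  proof (cases "t \<in> J")
    case True then show ?thesis by (rule nhomD(2)[OF h v v'])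
  next
    case False
    then show ?thesis using out[OF vs.subspace_add[OF gsub_subspace[OF X] v v']] out[OF v] out[OF v'] by simp
  qed
  show "\<phi> (sc c v) t u = c * \<phi> v t u"
  proof (cases "t \<in> J")
    case True then show ?thesis by (rule nhomD(3)[OF h v])
  next
    case False then show ?thesis using out[OF sX] out[OF v] by simp
  qed
  show "\<phi> (A x s v) t u = - \<phi> v t ((x, s) # u)" if x: "x \<in> sl n"
  proof (cases "t \<in> J")
    case True then show ?thesis by (rule nhomD(4)[OF h x v])
  next
    case False then show ?thesis using out[OF gsub_A[OF X x v]] out[OF v] by simp
  qed
  show "int (wdeg u) = r t - d" if "v \<in> G d" "\<phi> v t u \<noteq> 0"
    using nhomD(5)[OF h v that] out[OF v] that(2) by (cases "t \<in> J") auto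
qed

lemma pres_ker:
  assumes X: "gsub X" and \<phi>: "pres X N J w r \<phi>" and v: "v \<in> X" "v' \<in> X"
  shows "\<phi> v = \<phi> v' \<longleftrightarrow> v - v' \<in> N"
proof -
  have s: "v - v' \<in> X" by (rule vs.subspace_diff[OF gsub_subspace[OF X] v])
  have "\<phi> v t u = \<phi> (v - v') t u + \<phi> v' t u" for t u using pres_lin(1)[OF X \<phi> s v(2)] by simp
  then have "\<phi> v = \<phi> v' \<longleftrightarrow> \<phi> (v - v') = (\<lambda>_. zf)" by (auto simp: fun_eq_iff)
  then show ?thesis using presD(3)[OF \<phi> s] by simp
qed

end

context embedded_module
begin

context
  fixes X N :: "'v set" and J :: "(weight \<times> int \<times> nat) set"
  assumes XM: "X \<subseteq> carrier M" and X: "R.gsub (\<iota> ` X)" and NX: "N \<subseteq> X" and N: "R.gsub (\<iota> ` N)"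
begin

abbreviation "QX \<equiv> quotient_gmod (restrict_gmod M X) N"

interpretation Q: emb_quotient "restrict_gmod M X" \<iota> N
  using restrict_emb[OF XM R.gsub_subspace[OF X]] NX R.gsub_subspace[OF N] by (intro emb_quotient.intro) auto

abbreviation "cx v \<equiv> N +>\<^bsub>restrict_gmod M X\<^esub> v"

lemma X_add: "v \<in> X \<Longrightarrow> w \<in> X \<Longrightarrow> v \<oplus>\<^bsub>M\<^esub> w \<in> X" "v \<in> X \<Longrightarrow> c \<odot>\<^bsub>M\<^esub> v \<in> X"
  using embD(4,6)[OF Q.e] by simp_all

lemma X_act:
  assumes x: "x \<in> sl n" and v: "v \<in> X" shows "act M x s v \<in> X"
proof -
  have vM: "v \<in> carrier M" using XM v by blast
  have "\<iota> (act M x s v) \<in> \<iota> ` X" using R.gsub_A[OF X x imageI[OF v], of s] unfolding MA[OF vM] .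
  then show ?thesis using embD(1)[OF e act_in[OF x vM]] XM by blast
qed

lemma QX_carrier: "carrier QX = cx ` X"
  using Q.quotient_carrier by simp

lemma QX_add: "v \<in> X \<Longrightarrow> w \<in> X \<Longrightarrow> cx v \<oplus>\<^bsub>QX\<^esub> cx w = cx (v \<oplus>\<^bsub>M\<^esub> w)"
  and QX_smult: "v \<in> X \<Longrightarrow> c \<odot>\<^bsub>QX\<^esub> cx v = cx (c \<odot>\<^bsub>M\<^esub> v)"
  and QX_zero: "\<zero>\<^bsub>QX\<^esub> = cx \<zero>\<^bsub>M\<^esub>"
  and QX_grd: "grd QX d = cx ` (grd M d \<inter> X)"
  using Q.quotient_add[of v w] Q.quotient_smult[of v c] Q.quotient_zero Q.quotient_grd[of d] by simp_all

lemma QX_eq: "v \<in> X \<Longrightarrow> w \<in> X \<Longrightarrow> cx v = cx w \<longleftrightarrow> \<iota> v - \<iota> w \<in> \<iota> ` N"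
  using Q.coset_eq[of v w] by simp

lemma QX_act:
  assumes x: "x \<in> sl n" and v: "v \<in> X" shows "act QX x s (cx v) = cx (act M x s v)"
proof -
  have "act QX x s (cx v) = cx (act (restrict_gmod M X) x s v)"
  proof (rule Q.quotient_act)
    show "v \<in> carrier (restrict_gmod M X)" using v by simp
    fix w assume w: "w \<in> carrier (restrict_gmod M X)"
    then show "act (restrict_gmod M X) x s w \<in> carrier (restrict_gmod M X)" using X_act[OF x] by simp
    have vw: "v \<in> carrier M" "w \<in> carrier M" using XM v w by auto
    assume "\<iota> w - \<iota> v \<in> \<iota> ` N"
    then have "MA x s (\<iota> w - \<iota> v) \<in> \<iota> ` N" by (rule R.gsub_A[OF N x])
    moreover have "MA x s (\<iota> w) = MA x s (\<iota> w - \<iota> v) + MA x s (\<iota> v)"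
    proof -
      have "\<iota> v \<in> MS" "\<iota> w \<in> MS" using vw by (auto simp: MS_def)
      then show ?thesis using R.A_add[OF x vs.subspace_diff[OF R.S_sub], of "\<iota> w" "\<iota> v" "\<iota> v" s] by simp
    qed
    ultimately show "\<iota> (act (restrict_gmod M X) x s w) - \<iota> (act (restrict_gmod M X) x s v) \<in> \<iota> ` N"
      using MA[OF vw(1)] MA[OF vw(2)] by simp
  qed
  then show ?thesis by simp
qed

lemma iso_imp_pres:
  assumes "gmod_iso n QX (nabla_sum n J)"
  shows "\<exists>\<phi>. R.pres (\<iota> ` X) (\<iota> ` N) J fst (\<lambda>t. fst (snd t)) \<phi>"
proof -
  obtain \<theta> where \<theta>: "degree0_hom n QX (nabla_sum n J) \<theta>" "bij_betw \<theta> (carrier QX) (carrier (nabla_sum n J))"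
    using assms unfolding gmod_iso_def by blast
  have "linear_map (class_ring :: complex ring) QX (nabla_sum n J) \<theta>" using \<theta>(1) unfolding degree0_hom_def by blast
  then have hom: "\<theta> \<in> LinearCombinations.module_hom (class_ring :: complex ring) QX (nabla_sum n J)"
    unfolding linear_map_def mod_hom_def mod_hom_axioms_def by blast
  have tin: "\<theta> (cx v) \<in> carrier (nabla_sum n J)" if "v \<in> X" for v
    using \<theta>(2) that unfolding bij_betw_def QX_carrier by blast
  define f where "f v = sum_word n J (\<theta> (cx v))" for v
  have cin: "cx v \<in> carrier QX" if "v \<in> X" for v unfolding QX_carrier using that by blast
  have f_add: "f (v \<oplus>\<^bsub>M\<^esub> w) t u = f v t u + f w t u" if "v \<in> X" "w \<in> X" for v w t u
  proof -
    have "\<theta> (cx (v \<oplus>\<^bsub>M\<^esub> w)) = \<theta> (cx v) \<oplus>\<^bsub>nabla_sum n J\<^esub> \<theta> (cx w)"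
      using hom cin[OF that(1)] cin[OF that(2)] unfolding LinearCombinations.module_hom_def QX_add[OF that, symmetric] by blast
    then show ?thesis unfolding f_def using sum_word_add(2)[OF tin[OF that(1)] tin[OF that(2)]] by simp
  qed
  have f_sc: "f (c \<odot>\<^bsub>M\<^esub> v) t u = c * f v t u" if "v \<in> X" for v c t u
  proof -
    have "\<theta> (cx (c \<odot>\<^bsub>M\<^esub> v)) = c \<odot>\<^bsub>nabla_sum n J\<^esub> \<theta> (cx v)"
      using hom cin[OF that] unfolding LinearCombinations.module_hom_def QX_smult[OF that, symmetric] by simp
    then show ?thesis unfolding f_def using sum_word_smult(2)[OF tin[OF that]] by simp
  qed
  have f_act: "f (act M x s v) t u = - f v t ((x, s) # u)" if "x \<in> sl n" "v \<in> X" for x s v t u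
  proof -
    have "\<theta> (cx (act M x s v)) = act (nabla_sum n J) x s (\<theta> (cx v))"
      using \<theta>(1) cin[OF that(2)] that(1) unfolding degree0_hom_def QX_act[OF that, symmetric] by blast
    then show ?thesis unfolding f_def using sum_word_act(2)[OF that(1) tin[OF that(2)]] by simp
  qed
  have f_deg: "int (wdeg u) = fst (snd t) - d" if "v \<in> grd M d \<inter> X" "f v t u \<noteq> 0" for v d t u
  proof -
    have "cx v \<in> grd QX d" unfolding QX_grd using that(1) by blast
    then have "\<theta> (cx v) \<in> grd (nabla_sum n J) d" using \<theta>(1) unfolding degree0_hom_def by blast
    then show ?thesis using sum_word_grd[OF tin, of v d] that unfolding f_def by blast
  qed
  have f_in: "f v \<in> word_sum n J fst" if "v \<in> X" for v unfolding f_def by (rule sum_word_in[OF tin[OF that]])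
  have zX: "\<zero>\<^bsub>M\<^esub> \<in> X" using embD(2)[OF Q.e] by simp
  have f_zero: "f \<zero>\<^bsub>M\<^esub> = (\<lambda>_. zf)"
  proof (intro ext)
    fix t u
    have "\<zero>\<^bsub>M\<^esub> \<oplus>\<^bsub>M\<^esub> \<zero>\<^bsub>M\<^esub> = \<zero>\<^bsub>M\<^esub>"
      using embD(4,5)[OF e embD(2)[OF e] embD(2)[OF e]] embD(2,3)[OF e] by (intro embD(1)[OF e]) auto
    then show "f \<zero>\<^bsub>M\<^esub> t u = 0" using f_add[OF zX zX, of t u] by simp
  qed
  have f_ker: "f v = (\<lambda>_. zf) \<longleftrightarrow> \<iota> v \<in> \<iota> ` N" if v: "v \<in> X" for v
  proof -
    have "f v = (\<lambda>_. zf) \<longleftrightarrow> \<theta> (cx v) = \<theta> (cx \<zero>\<^bsub>M\<^esub>)"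
      using sum_word_inj[OF tin[OF v] tin[OF zX]] f_zero unfolding f_def by metis
    also have "\<dots> \<longleftrightarrow> cx v = cx \<zero>\<^bsub>M\<^esub>"
      by (rule inj_on_eq_iff[OF bij_betw_imp_inj_on[OF \<theta>(2)] cin[OF v] cin[OF zX]])
    also have "\<dots> \<longleftrightarrow> \<iota> v \<in> \<iota> ` N" using QX_eq[OF v zX] embD(3)[OF e] by simp
    finally show ?thesis .
  qed
  have kX: "\<kappa> (\<iota> v) = v" if "v \<in> X" for v using kappa that XM by blast
  define \<phi> where "\<phi> y = f (\<kappa> y)" for y
  have \<phi>: "\<phi> (\<iota> v) = f v" if "v \<in> X" for v unfolding \<phi>_def kX[OF that] ..
  have i_add: "\<iota> v + \<iota> w = \<iota> (v \<oplus>\<^bsub>M\<^esub> w)" "sc c (\<iota> v) = \<iota> (c \<odot>\<^bsub>M\<^esub> v)" if "v \<in> X" "w \<in> X" for v w c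
    by (rule embD(5)[OF e subsetD[OF XM that(1)] subsetD[OF XM that(2)], symmetric])
      (rule embD(7)[OF e subsetD[OF XM that(1)], symmetric])
  have "R.pres (\<iota> ` X) (\<iota> ` N) J fst (\<lambda>t. fst (snd t)) \<phi>"
    unfolding R.pres_def
  proof (intro conjI ballI)
    fix t assume t: "t \<in> J"
    show "R.nhom (\<iota> ` X) (longest_element n (fst t)) (fst (snd t)) (\<lambda>v. \<phi> v t)"
      unfolding R.nhom_def
    proof (intro conjI ballI allI impI)
      fix y assume "y \<in> \<iota> ` X"
      then obtain v where v: "v \<in> X" "y = \<iota> v" by blast
      show "\<phi> y t \<in> word_functionals n (\<lambda>h. - longest_element n (fst t) h)"
        using f_in[OF v(1)] t unfolding v(2) \<phi>[OF v(1)] word_sum_def word_nabla_def by blast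
      show "\<phi> (sc c y) t u = c * \<phi> y t u" for c u
        unfolding v(2) i_add(2)[OF v(1) v(1)] \<phi>[OF v(1)] \<phi>[OF X_add(2)[OF v(1)]] by (rule f_sc[OF v(1)])
      show "\<phi> (MA x s y) t u = - \<phi> y t ((x, s) # u)" if x: "x \<in> sl n" for x s u
        unfolding v(2) MA[OF subsetD[OF XM v(1)]] \<phi>[OF v(1)] \<phi>[OF X_act[OF x v(1)]] by (rule f_act[OF x v(1)])
      fix z assume "z \<in> \<iota> ` X"
      then obtain w where w: "w \<in> X" "z = \<iota> w" by blast
      show "\<phi> (y + z) t u = \<phi> y t u + \<phi> z t u" for u
        unfolding v(2) w(2) i_add(1)[OF v(1) w(1)] \<phi>[OF v(1)] \<phi>[OF w(1)] \<phi>[OF X_add(1)[OF v(1) w(1)]] by (rule f_add[OF v(1) w(1)])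
    next
      fix d y u assume "y \<in> \<iota> ` X \<inter> MG d" and ne: "\<phi> y t u \<noteq> 0"
      then obtain v where v: "v \<in> X" "y = \<iota> v" "\<iota> v \<in> MG d" by blast
      then have "v \<in> grd M d \<inter> X" using MG_iff XM by blast
      then show "int (wdeg u) = fst (snd t) - d" using f_deg ne unfolding v(2) \<phi>[OF v(1)] by blast
    qed
  next
    fix y assume "y \<in> \<iota> ` X"
    then obtain v where v: "v \<in> X" "y = \<iota> v" by blast
    show "\<phi> y \<in> word_sum n J fst" unfolding v(2) \<phi>[OF v(1)] by (rule f_in[OF v(1)])
    show "\<phi> y = (\<lambda>_. zf) \<longleftrightarrow> y \<in> \<iota> ` N" unfolding v(2) \<phi>[OF v(1)] by (rule f_ker[OF v(1)])
  next
    fix g assume "g \<in> word_sum n J fst"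
    then obtain F where F: "F \<in> carrier (nabla_sum n J)" "sum_word n J F = g" using sum_word_surj by blast
    then have "F \<in> \<theta> ` carrier QX" using bij_betw_imp_surj_on[OF \<theta>(2)] by simp
    then obtain v where v: "v \<in> X" "\<theta> (cx v) = F" unfolding QX_carrier by blast
    then have "\<phi> (\<iota> v) = g" unfolding \<phi>[OF v(1)] f_def using F(2) by simp
    then show "\<exists>y\<in>\<iota> ` X. \<phi> y = g" using v(1) by blast
  qed
  then show ?thesis by blast
qed

lemma pres_imp_iso:
  assumes \<phi>: "R.pres (\<iota> ` X) (\<iota> ` N) J fst (\<lambda>t. fst (snd t)) \<phi>"
  shows "gmod_iso n QX (nabla_sum n J)"
proof -
  \<comment> \<open>The presentation read as a map on cosets, through an arbitrary representative;
    independence of the choice is \<open>pres_ker\<close>.\<close>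
  define a :: "'v set \<Rightarrow> ((weight \<times> int \<times> nat) \<times> current_word) cvec"
    where "a C = Cvec (\<lambda>(t, u). \<phi> (\<iota> (SOME v. v \<in> X \<and> C = cx v)) t u)" for C
  have a: "ev (a (cx v)) (t, u) = \<phi> (\<iota> v) t u" if v: "v \<in> X" for v t u
  proof -
    let ?w = "SOME w. w \<in> X \<and> cx v = cx w"
    have w: "?w \<in> X \<and> cx v = cx ?w" by (rule someI[of _ v]) (simp add: v)
    then have "\<iota> v - \<iota> ?w \<in> \<iota> ` N" using QX_eq[OF v, of ?w] by blast
    then have "\<phi> (\<iota> v) = \<phi> (\<iota> ?w)" using R.pres_ker[OF X \<phi> imageI[OF v] imageI, of ?w] w by blast
    then show ?thesis by (simp add: a_def Cvec_inverse)
  qed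
  note lin = R.pres_lin[OF X \<phi> imageI]
  have zX: "\<zero>\<^bsub>M\<^esub> \<in> X" using embD(2)[OF Q.e] by simp
  have cin: "cx v \<in> carrier QX" if "v \<in> X" for v unfolding QX_carrier using that by blast
  have eqI: "y = z" if "\<And>t u. ev y (t, u) = ev z (t, u)" for y z :: "((weight \<times> int \<times> nat) \<times> current_word) cvec"
    using that by (auto simp: cvec_eq_iff)
  show ?thesis
  \<comment> \<open>\<open>T\<close> is the coinduced action written on functions of a summand and a
    word; both sides realise it.\<close>
  proof (rule emb_iso[where a = a and b = "sum_emb n J" and T = "\<lambda>x s y. Cvec (\<lambda>(t, u). - ev y (t, (x, s) # u))"])
    show "emb (nabla_sum n J) (sum_emb n J)" by (rule sum_emb_emb)
    show "emb QX a"
      unfolding emb_def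
    proof (intro conjI ballI allI)
      show "inj_on a (carrier QX)"
      proof (rule inj_onI)
        fix C D assume "C \<in> carrier QX" "D \<in> carrier QX" and eq: "a C = a D"
        then obtain v w where v: "v \<in> X" "C = cx v" and w: "w \<in> X" "D = cx w" unfolding QX_carrier by blast
        have "\<phi> (\<iota> v) t u = \<phi> (\<iota> w) t u" for t u using a[OF v(1), of t u] a[OF w(1), of t u] eq v(2) w(2) by simp
        then have "\<phi> (\<iota> v) = \<phi> (\<iota> w)" by blast
        then show "C = D" unfolding v(2) w(2) QX_eq[OF v(1) w(1)] R.pres_ker[OF X \<phi> imageI[OF v(1)] imageI[OF w(1)]] .
      qed
      show "\<zero>\<^bsub>QX\<^esub> \<in> carrier QX" unfolding QX_zero by (rule cin[OF zX])
      show "a \<zero>\<^bsub>QX\<^esub> = 0"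
      proof (rule eqI)
        fix t u
        show "ev (a \<zero>\<^bsub>QX\<^esub>) (t, u) = ev 0 (t, u)"
          unfolding QX_zero a[OF zX] using lin(2)[OF zX, of 0 t u] embD(3)[OF e] by simp
      qed
      fix C assume "C \<in> carrier QX"
      then obtain v where v: "v \<in> X" "C = cx v" unfolding QX_carrier by blast
      have vM: "v \<in> carrier M" using XM v(1) by blast
      show "c \<odot>\<^bsub>QX\<^esub> C \<in> carrier QX" for c unfolding v(2) QX_smult[OF v(1)] by (rule cin[OF X_add(2)[OF v(1)]])
      show "a (c \<odot>\<^bsub>QX\<^esub> C) = sc c (a C)" for c
        by (rule eqI) (simp add: v(2) QX_smult[OF v(1)] a[OF v(1)] a[OF X_add(2)[OF v(1)]] embD(7)[OF e vM] lin(2)[OF v(1)])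
      fix D assume "D \<in> carrier QX"
      then obtain w where w: "w \<in> X" "D = cx w" unfolding QX_carrier by blast
      have wM: "w \<in> carrier M" using XM w(1) by blast
      show "C \<oplus>\<^bsub>QX\<^esub> D \<in> carrier QX" unfolding v(2) w(2) QX_add[OF v(1) w(1)] by (rule cin[OF X_add(1)[OF v(1) w(1)]])
      show "a (C \<oplus>\<^bsub>QX\<^esub> D) = a C + a D"
        by (rule eqI) (simp add: v(2) w(2) QX_add[OF v(1) w(1)] a[OF v(1)] a[OF w(1)] a[OF X_add(1)[OF v(1) w(1)]]
          embD(5)[OF e vM wM] lin(1)[OF v(1) imageI[OF w(1)]])
    qed
    show "a ` carrier QX = sum_emb n J ` carrier (nabla_sum n J)"
    proof (intro equalityI subsetI)
      fix y assume "y \<in> a ` carrier QX"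
      then obtain v where v: "v \<in> X" "y = a (cx v)" unfolding QX_carrier by blast
      obtain F where F: "F \<in> carrier (nabla_sum n J)" "sum_word n J F = \<phi> (\<iota> v)"
        using sum_word_surj[OF R.presD(2)[OF \<phi> imageI[OF v(1)]]] by blast
      have "y = sum_emb n J F" unfolding v(2) by (rule eqI) (simp add: a[OF v(1)] ev_sum_emb F(2))
      then show "y \<in> sum_emb n J ` carrier (nabla_sum n J)" using F(1) by blast
    next
      fix y assume "y \<in> sum_emb n J ` carrier (nabla_sum n J)"
      then obtain F where F: "F \<in> carrier (nabla_sum n J)" "y = sum_emb n J F" by blast
      obtain v where v: "v \<in> X" "\<phi> (\<iota> v) = sum_word n J F" using R.presD(4)[OF \<phi> sum_word_in[OF F(1)]] by blast
      have "y = a (cx v)" unfolding F(2) by (rule eqI) (simp add: a[OF v(1)] ev_sum_emb v(2))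
      then show "y \<in> a ` carrier QX" using cin[OF v(1)] by blast
    qed
    fix x s assume x: "x \<in> sl n"
    show "act QX x s C \<in> carrier QX \<and> a (act QX x s C) = Cvec (\<lambda>(t, u). - ev (a C) (t, (x, s) # u))" if C: "C \<in> carrier QX" for C
    proof -
      obtain v where v: "v \<in> X" "C = cx v" using C unfolding QX_carrier by blast
      have vM: "v \<in> carrier M" using XM v(1) by blast
      show ?thesis
        unfolding v(2) QX_act[OF x v(1)]
        by (intro conjI cin X_act x v(1) eqI)
          (simp add: Cvec_inverse a[OF v(1)] a[OF X_act[OF x v(1)]] lin(3)[OF v(1) x, unfolded MA[OF vM]])
    qed
    show "act (nabla_sum n J) x s F \<in> carrier (nabla_sum n J) \<and>
        sum_emb n J (act (nabla_sum n J) x s F) = Cvec (\<lambda>(t, u). - ev (sum_emb n J F) (t, (x, s) # u))"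
      if F: "F \<in> carrier (nabla_sum n J)" for F
      by (intro conjI sum_word_act(1)[OF x F] eqI) (simp add: Cvec_inverse ev_sum_emb sum_word_act(2)[OF x F])
  next
    show "grd QX d \<subseteq> carrier QX" for d unfolding QX_grd QX_carrier by blast
    fix d C F assume "C \<in> grd QX d" and F: "F \<in> carrier (nabla_sum n J)" and eq: "sum_emb n J F = a C"
    then obtain v where v: "v \<in> grd M d" "v \<in> X" "C = cx v" unfolding QX_grd by blast
    have "sum_word n J F t u = \<phi> (\<iota> v) t u" for t u using ev_sum_emb[of n J F t u] a[OF v(2), of t u] eq v(3) by simp
    moreover have "\<iota> v \<in> MG d" using v(1) by (auto simp: MG_def)
    ultimately show "F \<in> grd (nabla_sum n J) d"
      using lin(4)[OF v(2), of d] unfolding sum_word_grd[OF F] by simp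
  qed
qed

lemma iso_iff_pres:
  "gmod_iso n QX (nabla_sum n J) \<longleftrightarrow> (\<exists>\<phi>. R.pres (\<iota> ` X) (\<iota> ` N) J fst (\<lambda>t. fst (snd t)) \<phi>)"
  using iso_imp_pres pres_imp_iso by blast

end

end

section \<open>The canonical filtration\<close>

lemma (in current_rep) gsub_no_weights: "gsub Y \<Longrightarrow> wts Y \<subseteq> {} \<Longrightarrow> Y = {0}"
  using wts_span[of Y "{}"] vs.subspace_0[OF gsub_subspace, of Y] by auto

lemma (in current_rep) Nm_mono:
  assumes X: "gsub X" and C: "C \<subseteq> D" shows "Nm C X \<subseteq> Nm D X"
  using Nm_wts[OF X, of C] C by (intro Nm_max Nm_gsub Nm_sub X) blast

lemma (in current_rep) pres_refl: "gsub X \<Longrightarrow> pres X X {} w r (\<lambda>_ _. zf)"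
  using vs.subspace_0[OF gsub_subspace, of X] by (auto simp: pres_def word_sum_def)

text \<open>A filtration asks for numbered copies, the canonical condition for an arbitrary index
  set. For fixed weight and shift the indices are finite in number and are renumbered by an initial
  segment.\<close>

lemma (in current_rep) pres_multiplicities:
  assumes X: "gsub X" and \<phi>: "pres X N J fst (\<lambda>t. fst (snd t)) \<phi>" and J: "J \<subseteq> D \<times> UNIV \<times> UNIV"
  shows "\<exists>m :: weight \<Rightarrow> int \<Rightarrow> nat. \<exists>\<phi>'. pres X N {(\<mu>, d, j). \<mu> \<in> D \<and> j < m \<mu> d} fst (\<lambda>t. fst (snd t)) \<phi>'"
proof -
  \<comment> \<open>Summands that happen to be zero are dropped first, as they could occur infinitely often.\<close>
  define J' where "J' = {t \<in> J. word_nabla n (fst t) \<noteq> {zf}}"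
  have \<phi>J: "pres X N J' fst (\<lambda>t. fst (snd t)) \<phi>" unfolding J'_def by (rule pres_drop_zero[OF \<phi>])
  define B where "B \<mu> d = {t \<in> J'. fst t = \<mu> \<and> fst (snd t) = d}" for \<mu> :: weight and d :: int
  have fin: "finite (B \<mu> d)" for \<mu> d
  proof (cases "word_nabla n \<mu> = {zf}")
    case True
    then have "B \<mu> d = {}" unfolding B_def J'_def by auto
    then show ?thesis by simp
  next
    case False
    show ?thesis unfolding B_def by (rule multiplicity_finite[OF X \<phi>J False])
  qed
  define m where "m \<mu> d = card (B \<mu> d)" for \<mu> d
  have "\<exists>h. bij_betw h (B \<mu> d) {..<m \<mu> d}" for \<mu> d
    using ex_bij_betw_finite_nat[OF fin] unfolding m_def atLeast0LessThan by blast
  then obtain h where h: "\<And>\<mu> d. bij_betw (h \<mu> d) (B \<mu> d) {..<m \<mu> d}" by metis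
  define \<rho> where "\<rho> t = (fst t, fst (snd t), h (fst t) (fst (snd t)) t)" for t
  have inB: "t \<in> B (fst t) (fst (snd t))" if "t \<in> J'" for t using that by (simp add: B_def)
  have inj: "inj_on \<rho> J'"
  proof (rule inj_onI)
    fix t t' assume t: "t \<in> J'" "t' \<in> J'" and eq: "\<rho> t = \<rho> t'"
    then have e12: "fst t = fst t'" "fst (snd t) = fst (snd t')" by (simp_all add: \<rho>_def)
    have e3: "h (fst t) (fst (snd t)) t = h (fst t) (fst (snd t)) t'"
      using eq unfolding \<rho>_def prod.inject e12 by blast
    show "t = t'"
      using inj_onD[OF bij_betw_imp_inj_on[OF h] e3 inB[OF t(1)]] inB[OF t(2)] unfolding e12 by blast
  qed
  have "\<rho> ` J' = {(\<mu>, d, j). \<mu> \<in> D \<and> j < m \<mu> d}"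
  proof (intro equalityI subsetI)
    fix y assume "y \<in> \<rho> ` J'"
    then obtain t where t: "t \<in> J'" "y = \<rho> t" by blast
    then have "h (fst t) (fst (snd t)) t < m (fst t) (fst (snd t))" using bij_betwE[OF h] inB[OF t(1)] by blast
    moreover have "fst t \<in> D" using t(1) J unfolding J'_def by auto
    ultimately show "y \<in> {(\<mu>, d, j). \<mu> \<in> D \<and> j < m \<mu> d}" unfolding t(2) \<rho>_def by simp
  next
    fix y assume "y \<in> {(\<mu>, d, j). \<mu> \<in> D \<and> j < m \<mu> d}"
    then obtain \<mu> d j where y: "y = (\<mu>, d, j)" "j < m \<mu> d" by blast
    then have "j \<in> h \<mu> d ` B \<mu> d" using bij_betw_imp_surj_on[OF h] by blast
    then obtain t where t: "t \<in> B \<mu> d" "j = h \<mu> d t" by blast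
    then have "y = \<rho> t" "t \<in> J'" using y(1) by (auto simp: B_def \<rho>_def)
    then show "y \<in> \<rho> ` J'" by blast
  qed
  moreover have "\<exists>\<phi>'. pres X N (\<rho> ` J') fst (\<lambda>t. fst (snd t)) \<phi>'"
    by (rule pres_reindex[OF \<phi>J inj]) (simp_all add: \<rho>_def)
  ultimately show ?thesis by auto
qed

locale bounded_module = embedded_module n M \<iota> + enumerated n lam
  for n :: nat and M :: "'v gmod" and \<iota> :: "'v \<Rightarrow> 'x cvec" and lam +
  assumes bdd: "category_I_bdd n M"
begin

sublocale E: enumerated_rep n MS MA MG lam ..

lemma restrict_self: "restrict_gmod M (carrier M) = M"
proof -
  have "(\<lambda>d. grd M d \<inter> carrier M) = grd M" using grd_sub by blast
  then show ?thesis by (simp add: restrict_gmod_def)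
qed

lemma MS_gsub: "R.gsub MS"
proof -
  have "graded_submodule n (carrier M) M" by (simp add: graded_submodule_def restrict_self cat)
  then show ?thesis by (rule graded_submodule_gsub[of "carrier M", folded MS_def])
qed

lemma weights_MS: "weights n M = R.wts MS"
  using weights_wts[OF order_refl] unfolding restrict_self MS_def .

lemma cells_Suc: "(\<Union>r\<le>s. saturated_cell n (lam r)) = cells (Suc s)"
  by (simp add: cells_def lessThan_Suc_atMost)

text \<open>Shifted by one: \<open>canon s\<close> is the canonical submodule with index \<open>s - 1\<close>, and \<open>canon 0\<close> is zero.\<close>
definition "canon s = {v \<in> carrier M. \<iota> v \<in> R.Nm (cells s) MS}"

lemma canon_sub: "canon s \<subseteq> carrier M"
  by (auto simp: canon_def)

lemma canon_image: "\<iota> ` canon s = R.Nm (cells s) MS"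
  using R.Nm_sub[OF MS_gsub, of "cells s"] unfolding canon_def MS_def by blast

lemma canon_gsub: "R.gsub (\<iota> ` canon s)"
  unfolding canon_image by (rule R.Nm_gsub[OF MS_gsub])

lemma canon_mono: "s \<le> t \<Longrightarrow> canon s \<subseteq> canon t"
  using R.Nm_mono[OF MS_gsub cells_mono] unfolding canon_def by blast

lemma canon_0: "canon 0 = {\<zero>\<^bsub>M\<^esub>}"
proof -
  have "R.Nm (cells 0) MS = {0}"
    using R.Nm_wts[OF MS_gsub, of "cells 0"] by (intro R.gsub_no_weights R.Nm_gsub MS_gsub) (simp add: cells_def)
  then have "canon 0 = {v \<in> carrier M. \<iota> v = \<iota> \<zero>\<^bsub>M\<^esub>}" unfolding canon_def embD(3)[OF e] by simp
  also have "\<dots> = {\<zero>\<^bsub>M\<^esub>}"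
  proof (intro equalityI subsetI)
    fix v assume "v \<in> {v \<in> carrier M. \<iota> v = \<iota> \<zero>\<^bsub>M\<^esub>}"
    then have "v = \<zero>\<^bsub>M\<^esub>" by (intro embD(1)[OF e _ embD(2)[OF e]]) simp_all
    then show "v \<in> {\<zero>\<^bsub>M\<^esub>}" by simp
  qed (simp add: embD(2)[OF e])
  finally show ?thesis .
qed

text \<open>Graded submodules of \<open>M\<close> correspond to \<open>gsub\<close> sets of
  functions, with the same weights; so the largest one is \<open>Nm\<close> and the description
  operator picks it.\<close>

lemma canonical_submodule_eq: "canonical_submodule n lam M s = canon (Suc s)"
proof -
  let ?P = "\<lambda>N. graded_submodule n N M \<and> weights n (restrict_gmod M N) \<subseteq> (\<Union>r\<le>s. saturated_cell n (lam r))"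
  have P: "?P N \<longleftrightarrow> N \<subseteq> carrier M \<and> R.gsub (\<iota> ` N) \<and> R.wts (\<iota> ` N) \<subseteq> cells (Suc s)" for N
  proof (cases "N \<subseteq> carrier M")
    case True
    have "graded_submodule n N M \<longleftrightarrow> R.gsub (\<iota> ` N)"
      by (rule iffI[OF graded_submodule_gsub gsub_graded_submodule[OF True]])
    then show ?thesis unfolding weights_wts[OF True] cells_Suc by (simp only: True simp_thms)
  qed (auto simp: graded_submodule_def)
  have Pc: "?P (canon (Suc s))"
    unfolding P canon_image by (intro conjI canon_sub R.Nm_gsub[OF MS_gsub] R.Nm_wts[OF MS_gsub])
  have max: "N \<subseteq> canon (Suc s)" if "?P N" for N
  proof -
    have N: "N \<subseteq> carrier M" "R.gsub (\<iota> ` N)" "R.wts (\<iota> ` N) \<subseteq> cells (Suc s)" using that unfolding P by blast+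
    have "\<iota> ` N \<subseteq> MS" unfolding MS_def using N(1) by blast
    then have "\<iota> ` N \<subseteq> R.Nm (cells (Suc s)) MS" by (rule R.Nm_max[OF N(2) _ N(3)])
    then show ?thesis using N(1) unfolding canon_def by blast
  qed
  show ?thesis
    unfolding canonical_submodule_def Let_def
    by (rule the_equality) (use Pc max in \<open>blast, blast\<close>)
qed

abbreviation "K \<equiv> canonical_length n lam M"

text \<open>Boundedness and integrality of the weights provide some number of cells that suffices,
  so the least index in \<open>canonical_length\<close> is attained.\<close>

lemma wts_K: "R.wts MS \<subseteq> cells (Suc K)"
proof -
  obtain F where F: "finite F" "F \<subseteq> dominant_weights n" "R.wts MS \<subseteq> (\<Union>\<mu>\<in>F. conv_hull (weyl_orbit n \<mu>))"
    using bdd unfolding category_I_bdd_def weights_MS by blast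
  obtain k where "R.wts MS \<subseteq> cells k" using finite_cells[OF F R.wts_integral[OF MS_gsub]] by blast
  then have "R.wts MS \<subseteq> cells (Suc k)" using cells_mono[of k "Suc k"] by auto
  then show ?thesis
    unfolding canonical_length_def weights_MS cells_Suc by (rule LeastI[where P = "\<lambda>k. R.wts MS \<subseteq> cells (Suc k)"])
qed

lemma canon_K: "canon (Suc K) = carrier M"
  unfolding canon_def R.Nm_eq[OF MS_gsub wts_K] by (auto simp: MS_def)

lemma canon_quotient:
  "(if s = 0 then {\<zero>\<^bsub>M\<^esub>} else canonical_submodule n lam M (s - 1)) = canon s"
  by (cases s) (simp_all add: canon_0 canonical_submodule_eq)

lemma canonical_iff:
  "canonical_is_nabla_filtration n lam M \<longleftrightarrow> (\<forall>s\<le>K. \<exists>J :: (weight \<times> int \<times> nat) set. J \<subseteq> dominant_weights n \<times> UNIV \<times> UNIV \<and>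
     (\<exists>\<phi>. R.pres (\<iota> ` canon (Suc s)) (\<iota> ` canon s) J fst (\<lambda>t. fst (snd t)) \<phi>))"
  unfolding canonical_is_nabla_filtration_def canon_quotient
  unfolding canonical_submodule_eq iso_iff_pres[OF canon_sub canon_gsub canon_mono[OF le_SucI[OF order_refl]] canon_gsub]
  by (rule refl)

lemma filtration_imp_canonical:
  assumes "has_nabla_filtration n M"
  shows "canonical_is_nabla_filtration n lam M"
proof -
  let ?J = "\<lambda>m :: weight \<Rightarrow> int \<Rightarrow> nat. {(\<mu>, r, j). \<mu> \<in> dominant_weights n \<and> j < m \<mu> r}"
  obtain F where F: "F 0 = {\<zero>\<^bsub>M\<^esub>}" "\<And>k. graded_submodule n (F k) M" "\<And>k. F k \<subseteq> F (Suc k)" "(\<Union>k. F k) = carrier M"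
    and iso: "\<And>k. \<exists>m. gmod_iso n (quotient_gmod (restrict_gmod M (F (Suc k))) (F k)) (nabla_sum n (?J m))"
    using assms unfolding has_nabla_filtration_def by blast
  have "\<forall>k. \<exists>m. gmod_iso n (quotient_gmod (restrict_gmod M (F (Suc k))) (F k)) (nabla_sum n (?J m))"
    by (rule allI, rule iso)
  from choice[OF this] obtain m
    where m: "\<forall>k. gmod_iso n (quotient_gmod (restrict_gmod M (F (Suc k))) (F k)) (nabla_sum n (?J (m k)))" by (rule exE)
  have Fg: "R.gsub (\<iota> ` F k)" and FM: "F k \<subseteq> carrier M" for k
    using graded_submodule_gsub[OF F(2)] F(2) unfolding graded_submodule_def by blast+
  have "\<forall>k. \<exists>\<phi>. R.pres (\<iota> ` F (Suc k)) (\<iota> ` F k) (?J (m k)) fst (\<lambda>t. fst (snd t)) \<phi>"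
    by (rule allI, rule iso_imp_pres[OF FM Fg F(3) Fg], rule m[rule_format])
  from choice[OF this] obtain \<phi>
    where "\<forall>k. R.pres (\<iota> ` F (Suc k)) (\<iota> ` F k) (?J (m k)) fst (\<lambda>t. fst (snd t)) (\<phi> k)" by (rule exE)
  note \<phi> = this[rule_format]
  have chain: "\<iota> ` F k \<subseteq> \<iota> ` F (Suc k)" for k using F(3) by blast
  have union: "(\<Union>k. \<iota> ` F k) = MS" unfolding MS_def F(4)[symmetric] by blast
  have start: "\<iota> ` F 0 = {0}" unfolding F(1) using embD(3)[OF e] by simp
  have dom: "fst t \<in> dominant_weights n" if "t \<in> ?J (m k)" for k t using that by auto
  show ?thesis
    unfolding canonical_iff
  proof (intro allI impI)
    fix s assume "s \<le> K"
    then have s: "s < Suc K" by simp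
    have "\<exists>\<Phi>. \<exists>I :: (nat \<times> weight \<times> int \<times> nat) set. (\<forall>i\<in>I. fst (snd i) = lam s) \<and>
        R.pres (R.Nm (cells (Suc s)) MS) (R.Nm (cells s) MS) I (\<lambda>i. lam s) (\<lambda>i. fst (snd (snd i))) \<Phi>"
      by (rule E.canonical_presentations[OF MS_gsub wts_K Fg chain union start \<phi> dom s])
    then obtain \<Phi> and I :: "(nat \<times> weight \<times> int \<times> nat) set"
      where h: "(\<forall>i\<in>I. fst (snd i) = lam s) \<and>
        R.pres (R.Nm (cells (Suc s)) MS) (R.Nm (cells s) MS) I (\<lambda>i. lam s) (\<lambda>i. fst (snd (snd i))) \<Phi>" by (elim exE)
    note I = conjunct1[OF h] and \<Phi> = conjunct2[OF h]
    \<comment> \<open>Merge the step of the filtration and the copy number into one copy number.\<close>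
    define \<rho> where "\<rho> i = (lam s, fst (snd (snd i)), prod_encode (fst i, snd (snd (snd i))))" for i :: "nat \<times> weight \<times> int \<times> nat"
    have "inj_on \<rho> I"
    proof (rule inj_onI)
      fix i i' assume "i \<in> I" "i' \<in> I" and eq: "\<rho> i = \<rho> i'"
      then have "fst (snd i) = fst (snd i')" using I by simp
      then show "i = i'" using eq by (simp add: \<rho>_def prod_encode_eq prod_eq_iff)
    qed
    from R.pres_reindex[OF \<Phi> this, of fst "\<lambda>t. fst (snd t)"]
    have ex: "\<exists>\<phi>. R.pres (R.Nm (cells (Suc s)) MS) (R.Nm (cells s) MS) (\<rho> ` I) fst (\<lambda>t. fst (snd t)) \<phi>"
      by (simp add: \<rho>_def)
    have "\<rho> ` I \<subseteq> dominant_weights n \<times> UNIV \<times> UNIV"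
      using lam_dominant[of s] by (intro image_subsetI) (simp add: \<rho>_def)
    then show "\<exists>J :: (weight \<times> int \<times> nat) set. J \<subseteq> dominant_weights n \<times> UNIV \<times> UNIV \<and>
        (\<exists>\<phi>. R.pres (\<iota> ` canon (Suc s)) (\<iota> ` canon s) J fst (\<lambda>t. fst (snd t)) \<phi>)"
      unfolding canon_image using ex by blast
  qed
qed

lemma canonical_imp_filtration:
  assumes "canonical_is_nabla_filtration n lam M"
  shows "has_nabla_filtration n M"
  unfolding has_nabla_filtration_def
\<comment> \<open>The canonical filtration, preceded by zero, is continued by the constant
  \<open>carrier M\<close> to an infinite chain.\<close>
proof (intro exI[of _ "\<lambda>k. canon (min k (Suc K))"] conjI allI)
  show "canon (min 0 (Suc K)) = {\<zero>\<^bsub>M\<^esub>}" using canon_0 by simp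
  show "graded_submodule n (canon (min k (Suc K))) M" for k
    by (rule gsub_graded_submodule[OF canon_sub canon_gsub])
  show mono: "canon (min k (Suc K)) \<subseteq> canon (min (Suc k) (Suc K))" for k by (rule canon_mono) simp
  show "(\<Union>k. canon (min k (Suc K))) = carrier M"
  proof
    show "carrier M \<subseteq> (\<Union>k. canon (min k (Suc K)))"
      using canon_K by (intro order_trans[OF _ UN_upper[of "Suc K"]]) simp_all
  qed (use canon_sub in blast)
  fix k
  have "\<exists>m :: weight \<Rightarrow> int \<Rightarrow> nat. \<exists>\<phi>. R.pres (\<iota> ` canon (min (Suc k) (Suc K))) (\<iota> ` canon (min k (Suc K)))
    {(\<mu>, r, j). \<mu> \<in> dominant_weights n \<and> j < m \<mu> r} fst (\<lambda>t. fst (snd t)) \<phi>"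
  proof (cases "k \<le> K")
    case True
    from assms[unfolded canonical_iff, rule_format, OF True] obtain J :: "(weight \<times> int \<times> nat) set"
      where J: "J \<subseteq> dominant_weights n \<times> UNIV \<times> UNIV \<and>
        (\<exists>\<phi>. R.pres (\<iota> ` canon (Suc k)) (\<iota> ` canon k) J fst (\<lambda>t. fst (snd t)) \<phi>)" by (rule exE)
    from conjunct2[OF J] obtain \<phi> where \<phi>: "R.pres (\<iota> ` canon (Suc k)) (\<iota> ` canon k) J fst (\<lambda>t. fst (snd t)) \<phi>" by (rule exE)
    have mm: "min (Suc k) (Suc K) = Suc k" "min k (Suc K) = k" using True by simp_all
    show ?thesis unfolding mm by (rule R.pres_multiplicities[OF canon_gsub \<phi> conjunct1[OF J]])
  next
    case False
    then have mm: "min (Suc k) (Suc K) = Suc K" "min k (Suc K) = Suc K" by simp_all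
    \<comment> \<open>From here on the quotients are zero: all multiplicities are 0 and the index
      set is empty.\<close>
    have "{(\<mu>, r, j). \<mu> \<in> dominant_weights n \<and> j < (0 :: nat)} = ({} :: (weight \<times> int \<times> nat) set)" by auto
    then show ?thesis
      unfolding mm using R.pres_refl[OF canon_gsub, of "Suc K" fst "\<lambda>t. fst (snd t)"]
      by (intro exI[of _ "\<lambda>_ _. 0"] exI[of _ "\<lambda>_ _. zf"]) (simp only:)
  qed
  then show "\<exists>m. gmod_iso n (quotient_gmod (restrict_gmod M (canon (min (Suc k) (Suc K)))) (canon (min k (Suc K))))
      (nabla_sum n {(\<mu>, r, j). \<mu> \<in> dominant_weights n \<and> j < m \<mu> r})"
    unfolding iso_iff_pres[OF canon_sub canon_gsub mono canon_gsub] .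
qed

end

theorem proposition3p11:
  fixes n :: nat and lam :: "nat \<Rightarrow> weight" and M :: "'v gmod"
  assumes "1 \<le> n"
    and "dominant_enumeration n lam"
    and "category_I_bdd n M"
  shows "has_nabla_filtration n M \<longleftrightarrow> canonical_is_nabla_filtration n lam M"
proof -
  have cat: "category_I n M" using assms(3) unfolding category_I_bdd_def by blast
  then have "vectorspace (class_ring :: complex ring) M"
    unfolding category_I_def graded_current_module_def current_module_def by blast
  \<comment> \<open>Functions on the carrier type itself form a large enough target space.\<close>
  then obtain \<iota> :: "'v \<Rightarrow> 'v cvec" where \<iota>: "emb M \<iota>" using emb_exists by blast
  interpret bounded_module n M \<iota> lam
    by (intro bounded_module.intro embedded_module.intro enumerated.intro bounded_module_axioms.intro cat \<iota> assms(2,3))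
  show ?thesis using filtration_imp_canonical canonical_imp_filtration by blast
qed

end
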